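(* Let $M$ be a smooth manifold of dimension $2n$ endowed with a generalized metric $E$ of signature $(n,n)$, and let $D'$, $D''$ be metric connections on $E'=E$ and $E''=E^\perp$, respectively. Then the generalized almost paracomplex structures $\mathcal{K}_2,\mathcal{K}_3,\mathcal{K}_4$ on the generalized reflector space $\mathcal{G}(E)$ of $(M,E)$ defined by means of $D=D'\oplus D''$ are never integrable.
   Context: **Linear notions.** A metric is a nondegenerate symmetric bilinear form. A bilinear form $\varphi$ on a vector space $T$ also denotes the map $T\to T^*$, $\varphi(X)(Y)=\varphi(X,Y)$. On $T\oplus T^*$ put $\langle X+\alpha,Y+\beta\rangle=\frac12[\alpha(Y)+\beta(X)]$. A generalized paracomplex structure on $T$ is an endomorphism $K$ of $T\oplus T^*$ with $K^2=Id$ and $\langle KA,B\rangle+\langle A,KB\rangle=0$. **Generalized metrics.** A generalized metric of signature $(n,n)$ on $M$, $\dim M=2n$, is a subbundle $E\subset TM\oplus T^*M$ of rank $2n$ on which $\langle\cdot,\cdot\rangle$ has signature $(n,n)$ and with $E_p\cap T^*_pM=\{0\}$ for all $p$. Then $E=\{X+g(X)+\Theta(X):X\in TM\}$ for a unique metric $g$ of signature $(n,n)$ and a unique $2$-form $\Theta$ on $M$. Put $E'=E$, $E''=E^{\perp}$ (orthogonal complement for $\langle\cdot,\cdot\rangle$), $g'=\langle\cdot,\cdot\rangle|E'$, $g''=-\langle\cdot,\cdot\rangle|E''$. A generalized paracomplex structure $K$ on $T_pM$ is compatible with $E_p$ if $KE_p\subset E_p$; then $K$ preserves $E'_p$ and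 $E''_p$. **Generalized reflector space.** $\pi:\mathcal G=\mathcal G(E)\to M$ is the bundle whose fibre at $p$ consists of all generalized paracomplex structures on $T_pM$ compatible with $E_p$. Let $A(E')$, $A(E'')$ be the bundles of $g'$-, resp. $g''$-skew-symmetric endomorphisms; via $K\mapsto(K|E',K|E'')$, $\mathcal G$ is a subbundle of $A(E')\oplus A(E'')$. Given connections $D'$ on $E'$ with $D'g'=0$ and $D''$ on $E''$ with $D''g''=0$, let $D=D'\oplus D''$ on $TM\oplus T^*M$; the induced connection on $A(E')\oplus A(E'')$ is also denoted by $D$. Its horizontal spaces at points of $\mathcal G$ are tangent to $\mathcal G$, so $T\mathcal G=\mathcal V\oplus\mathcal H$ (vertical and horizontal). Elements of $\mathcal H_K^*$, $\mathcal V_K^*$ are considered as $1$-forms on $T_K\mathcal G$ vanishing on $\mathcal V_K$, resp. $\mathcal H_K$. For $A=X+\alpha\in T_pM\oplus T_p^*M$, $p=\pi(K)$, let $A^h_K=X^h_K+\alpha^h_K$, where $X^h_K\in\mathcal H_K$ is the horizontal lift and $\alpha^h_K\in\mathcal H_K^*$ satisfies $\alpha^h_K(Y^h_K)=\alpha(Y)$. **The structures $\mathcal K_\varepsilon$.** The space $\mathcal V_K$ consists of the $\langle\cdot,\cdot\rangle$-skew-symmetric endomorphisms $V$ of $T_pM\oplus T_p^*M$ preserving $E'_p$ and $E''_p$ and anticommuting with $K$; write $V=(V',V'')=(V|E',V|E'')$, $K'=K|E'$, $K''=K|E''$. Define on $\mathcal V_K$: $\mathcal P_1(V',V'')=(K'V',K''V'')$,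 $\mathcal P_2(V',V'')=(K'V',-K''V'')$, $\mathcal P_3=-\mathcal P_2$, $\mathcal P_4=-\mathcal P_1$. For $\varepsilon=1,\dots,4$, $\mathcal K_\varepsilon$ is the endomorphism of $T\mathcal G\oplus T^*\mathcal G$ with $\mathcal K_\varepsilon A^h_K=(KA)^h_K$, $\mathcal K_\varepsilon V=\mathcal P_\varepsilon V$ for $V\in\mathcal V_K$, and $\mathcal K_\varepsilon\varphi=-\varphi\circ\mathcal P_\varepsilon$ for $\varphi\in\mathcal V_K^*$. **Integrability.** A generalized almost paracomplex structure $\mathcal K$ on a manifold $N$ (an endomorphism of $TN\oplus T^*N$, skew for $\langle\cdot,\cdot\rangle$, with square $Id$) is integrable if $[\mathcal E,\mathcal F]+[\mathcal K\mathcal E,\mathcal K\mathcal F]-\mathcal K[\mathcal K\mathcal E,\mathcal F]-\mathcal K[\mathcal E,\mathcal K\mathcal F]=0$ for all sections $\mathcal E,\mathcal F$ of $TN\oplus T^*N$, where $[X+\alpha,Y+\beta]=[X,Y]+\mathcal L_X\beta-\mathcal L_Y\alpha-\frac12d(\imath_X\beta-\imath_Y\alpha)$ is the Courant bracket.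
   Formalization: The theorem assumes n ≥ 2 and M non-empty. For n = 1 the vertical spaces vanish and the structures are integrable (for instance on flat R^2 with Θ = 0 and flat D', D''), and n = 0 is trivial, so the printed claim fails for n ≤ 1. *)

theory Defs
  imports "HOL-Analysis.Analysis" "HOL-Library.Function_Algebras"
begin

section \<open>Real-valued functions as vectors\<close>

instantiation "fun" :: (type, real_vector) real_vector
begin

definition scaleR_fun :: "real \<Rightarrow> ('a \<Rightarrow> 'b) \<Rightarrow> 'a \<Rightarrow> 'b"
  where "scaleR_fun r f = (\<lambda>x. r *\<^sub>R f x)"

instance
  by standard (simp_all add: scaleR_fun_def plus_fun_def fun_eq_iff algebra_simps)

end

text \<open>Linearity on a subspace, for maps that are only meaningful on that subspace.\<close>

definition linear_upon :: "'v::real_vector set \<Rightarrow> ('v \<Rightarrow> 'w::real_vector) \<Rightarrow> bool"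
  where "linear_upon S f \<longleftrightarrow>
    (\<forall>u\<in>S. \<forall>w\<in>S. \<forall>a b. f (a *\<^sub>R u + b *\<^sub>R w) = a *\<^sub>R f u + b *\<^sub>R f w)"

text \<open>Endomorphisms of a subspace \<open>S\<close>, normalised to be \<open>0\<close> off \<open>S\<close> so that
  equality of functions is equality of endomorphisms.\<close>

definition endos :: "'v::real_vector set \<Rightarrow> ('v \<Rightarrow> 'v) set"
  where "endos S = {L. linear_upon S L \<and> L ` S \<subseteq> S \<and> (\<forall>A. A \<notin> S \<longrightarrow> L A = 0)}"

text \<open>The form \<open>b\<close> is nondegenerate of signature \<open>(k, l)\<close> on \<open>S\<close>, \<open>dim S = k + l\<close>.\<close>

definition has_signature :: "('v::real_vector \<Rightarrow> 'v \<Rightarrow> real) \<Rightarrow> 'v set \<Rightarrow> nat \<Rightarrow> nat \<Rightarrow> bool"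
  where "has_signature b S k l \<longleftrightarrow>
    (\<exists>e::nat \<Rightarrow> 'v. span (e ` {..<k + l}) = S \<and>
       (\<forall>i<k + l. \<forall>j<k + l. b (e i) (e j) = (if i \<noteq> j then 0 else if i < k then 1 else - 1)))"


section \<open>Smooth functions, tangent vectors, covectors\<close>

primrec Ck_on :: "nat \<Rightarrow> 'a::real_normed_vector set \<Rightarrow> ('a \<Rightarrow> 'b::real_normed_vector) \<Rightarrow> bool"
  where
    "Ck_on 0 S f \<longleftrightarrow> continuous_on S f"
  | "Ck_on (Suc k) S f \<longleftrightarrow> (\<forall>x\<in>S. f differentiable (at x)) \<and>
       (\<forall>v. Ck_on k S (\<lambda>x. frechet_derivative f (at x) v))"

text \<open>Only used for open subsets \<open>S\<close> of Euclidean spaces.\<close>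

definition smooth_on :: "'a::real_normed_vector set \<Rightarrow> ('a \<Rightarrow> 'b::real_normed_vector) \<Rightarrow> bool"
  where "smooth_on S f \<longleftrightarrow> (\<forall>k. Ck_on k S f)"

type_synonym ('a, 'e) chart = "'a set \<times> ('a \<Rightarrow> 'e)"

text \<open>A smooth manifold is a Hausdorff second countable space with a smooth atlas; its points
  form the whole type \<open>'p\<close>, its dimension is \<open>CARD('n)\<close>.\<close>

definition smooth_atlas ::
  "('p::{t2_space, second_countable_topology}, real ^ 'n) chart set \<Rightarrow> bool"
  where "smooth_atlas \<A> \<longleftrightarrow>
    (\<Union>(U, \<phi>)\<in>\<A>. U) = UNIV \<and>
    (\<forall>(U, \<phi>)\<in>\<A>. open U \<and> open (\<phi> ` U) \<and> homeomorphism U (\<phi> ` U) \<phi> (inv_into U \<phi>)) \<and>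
    (\<forall>(U, \<phi>)\<in>\<A>. \<forall>(V, \<psi>)\<in>\<A>. smooth_on (\<phi> ` (U \<inter> V)) (\<psi> \<circ> inv_into U \<phi>))"

text \<open>The functions that are smooth near \<open>x\<close> on a submanifold \<open>N\<close> of a manifold with the given
  charts: near \<open>x\<close>, and on \<open>N\<close>, they are smooth functions of the ambient coordinates.
  For \<open>N = UNIV\<close> this is smoothness on the manifold itself. Membership of \<open>f\<close> depends only on
  the values of \<open>f\<close> on \<open>N\<close> near \<open>x\<close>.\<close>

definition smooth_near ::
  "('a, 'e::real_normed_vector) chart set \<Rightarrow> 'a set \<Rightarrow> 'a \<Rightarrow> ('a \<Rightarrow> real) set"
  where "smooth_near \<C> N x = {f. \<exists>(U, \<phi>)\<in>\<C>. x \<in> U \<and>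
    (\<exists>W h. open W \<and> \<phi> x \<in> W \<and> smooth_on W h \<and> (\<forall>y\<in>N \<inter> U. \<phi> y \<in> W \<longrightarrow> f y = h (\<phi> y)))}"

text \<open>From here to the Courant bracket, a manifold is given by its set of points \<open>N\<close> and the map
  \<open>C\<close> sending a point \<open>x\<close> to the algebra \<open>C x\<close> of functions smooth near \<open>x\<close>. Tangent vectors are
  the derivations at \<open>x\<close> of this algebra. They depend only on germs at \<open>x\<close>: if \<open>f = g\<close> on \<open>N\<close> near
  \<open>x\<close>, then \<open>f - g = (f - g) \<chi>\<close> where \<open>\<chi>\<close> is \<open>0\<close> on \<open>N\<close> near \<open>x\<close> and \<open>1\<close> elsewhere, so \<open>\<chi> \<in> C x\<close> and
  the Leibniz rule gives the same value on \<open>f\<close> and \<open>g\<close>.\<close>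

type_synonym 'a tvec = "('a \<Rightarrow> real) \<Rightarrow> real"
type_synonym 'a covec = "'a tvec \<Rightarrow> real"
type_synonym 'a gvec = "'a tvec \<times> 'a covec"

definition tangent :: "('a \<Rightarrow> ('a \<Rightarrow> real) set) \<Rightarrow> 'a \<Rightarrow> 'a tvec set"
  where "tangent C x = {v.
    linear_upon (C x) v \<and>
    (\<forall>f\<in>C x. \<forall>g\<in>C x. v (\<lambda>y. f y * g y) = v f * g x + f x * v g) \<and>
    (\<forall>f. f \<notin> C x \<longrightarrow> v f = 0)}"

definition cotangent :: "('a \<Rightarrow> ('a \<Rightarrow> real) set) \<Rightarrow> 'a \<Rightarrow> 'a covec set"
  where "cotangent C x = {\<alpha>.
    linear_upon (tangent C x) \<alpha> \<and> (\<forall>v. v \<notin> tangent C x \<longrightarrow> \<alpha> v = 0)}"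

definition gtangent :: "('a \<Rightarrow> ('a \<Rightarrow> real) set) \<Rightarrow> 'a \<Rightarrow> 'a gvec set"
  where "gtangent C x = tangent C x \<times> cotangent C x"

definition pair :: "'a gvec \<Rightarrow> 'a gvec \<Rightarrow> real"
  where "pair A B = (snd A (fst B) + snd B (fst A)) / 2"


section \<open>Sections, the Courant bracket, integrability\<close>

text \<open>Sections are defined at all points of \<open>N\<close> but are required to be smooth only near \<open>x\<close>.
  Every smooth local section arises so, after extension by \<open>0\<close>.\<close>

definition vfield_at :: "('a \<Rightarrow> ('a \<Rightarrow> real) set) \<Rightarrow> 'a set \<Rightarrow> 'a \<Rightarrow> ('a \<Rightarrow> 'a tvec) \<Rightarrow> bool"
  where "vfield_at C N x X \<longleftrightarrow>
    (\<forall>y\<in>N. X y \<in> tangent C y) \<and> (\<forall>f\<in>C x. (\<lambda>y. X y f) \<in> C x)"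

definition oneform_at :: "('a \<Rightarrow> ('a \<Rightarrow> real) set) \<Rightarrow> 'a set \<Rightarrow> 'a \<Rightarrow> ('a \<Rightarrow> 'a covec) \<Rightarrow> bool"
  where "oneform_at C N x \<omega> \<longleftrightarrow>
    (\<forall>y\<in>N. \<omega> y \<in> cotangent C y) \<and> (\<forall>X. vfield_at C N x X \<longrightarrow> (\<lambda>y. \<omega> y (X y)) \<in> C x)"

definition gsection_at :: "('a \<Rightarrow> ('a \<Rightarrow> real) set) \<Rightarrow> 'a set \<Rightarrow> 'a \<Rightarrow> ('a \<Rightarrow> 'a gvec) \<Rightarrow> bool"
  where "gsection_at C N x \<E> \<longleftrightarrow>
    vfield_at C N x (\<lambda>y. fst (\<E> y)) \<and> oneform_at C N x (\<lambda>y. snd (\<E> y))"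

definition gsection :: "('a \<Rightarrow> ('a \<Rightarrow> real) set) \<Rightarrow> 'a set \<Rightarrow> ('a \<Rightarrow> 'a gvec) \<Rightarrow> bool"
  where "gsection C N \<E> \<longleftrightarrow> (\<forall>x\<in>N. gsection_at C N x \<E>)"

definition lie_bracket ::
  "('a \<Rightarrow> ('a \<Rightarrow> real) set) \<Rightarrow> ('a \<Rightarrow> 'a tvec) \<Rightarrow> ('a \<Rightarrow> 'a tvec) \<Rightarrow> 'a \<Rightarrow> 'a tvec"
  where "lie_bracket C X Y x =
    (\<lambda>f. if f \<in> C x then X x (\<lambda>y. Y y f) - Y x (\<lambda>y. X y f) else 0)"

definition diff_fun :: "('a \<Rightarrow> ('a \<Rightarrow> real) set) \<Rightarrow> ('a \<Rightarrow> real) \<Rightarrow> 'a \<Rightarrow> 'a covec"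
  where "diff_fun C u x = (\<lambda>v. if v \<in> tangent C x then v u else 0)"

text \<open>\<open>(L\<^sub>X \<beta>)(Y) = X (\<beta>(Y)) - \<beta>([X, Y])\<close>, whose value at \<open>x\<close> depends only on \<open>Y\<close> at \<open>x\<close>.\<close>

definition lie_form ::
  "('a \<Rightarrow> ('a \<Rightarrow> real) set) \<Rightarrow> 'a set \<Rightarrow> ('a \<Rightarrow> 'a tvec) \<Rightarrow> ('a \<Rightarrow> 'a covec) \<Rightarrow> 'a \<Rightarrow> 'a covec"
  where "lie_form C N X \<beta> x = (\<lambda>v. if v \<in> tangent C x
    then (THE c. \<forall>Y. vfield_at C N x Y \<and> Y x = v \<longrightarrow>
            c = X x (\<lambda>y. \<beta> y (Y y)) - \<beta> x (lie_bracket C X Y x))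
    else 0)"

definition courant ::
  "('a \<Rightarrow> ('a \<Rightarrow> real) set) \<Rightarrow> 'a set \<Rightarrow> ('a \<Rightarrow> 'a gvec) \<Rightarrow> ('a \<Rightarrow> 'a gvec) \<Rightarrow> 'a \<Rightarrow> 'a gvec"
  where "courant C N \<E> \<F> x =
    (let X = (\<lambda>y. fst (\<E> y)); \<alpha> = (\<lambda>y. snd (\<E> y)); Y = (\<lambda>y. fst (\<F> y)); \<beta> = (\<lambda>y. snd (\<F> y)) in
      (lie_bracket C X Y x,
       lie_form C N X \<beta> x - lie_form C N Y \<alpha> x
         - (1 / 2) *\<^sub>R diff_fun C (\<lambda>y. \<beta> y (X y) - \<alpha> y (Y y)) x))"

definition integrable_gpc ::
  "('a \<Rightarrow> ('a \<Rightarrow> real) set) \<Rightarrow> 'a set \<Rightarrow> ('a \<Rightarrow> 'a gvec \<Rightarrow> 'a gvec) \<Rightarrow> bool"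
  where "integrable_gpc C N \<K> \<longleftrightarrow>
    (\<forall>\<E> \<F>. gsection C N \<E> \<longrightarrow> gsection C N \<F> \<longrightarrow> (\<forall>x\<in>N.
       courant C N \<E> \<F> x + courant C N (\<lambda>y. \<K> y (\<E> y)) (\<lambda>y. \<K> y (\<F> y)) x
       - \<K> x (courant C N (\<lambda>y. \<K> y (\<E> y)) \<F> x)
       - \<K> x (courant C N \<E> (\<lambda>y. \<K> y (\<F> y)) x) = 0))"


section \<open>Generalized metrics and metric connections\<close>

abbreviation cinf :: "('p, real ^ 'n) chart set \<Rightarrow> 'p \<Rightarrow> ('p \<Rightarrow> real) set"
  where "cinf \<A> \<equiv> smooth_near \<A> UNIV"

abbreviation TM :: "('p, real ^ 'n) chart set \<Rightarrow> 'p \<Rightarrow> 'p tvec set"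
  where "TM \<A> \<equiv> tangent (cinf \<A>)"

abbreviation GTM :: "('p, real ^ 'n) chart set \<Rightarrow> 'p \<Rightarrow> 'p gvec set"
  where "GTM \<A> \<equiv> gtangent (cinf \<A>)"

definition bsection_at ::
  "('p, real ^ 'n) chart set \<Rightarrow> ('p \<Rightarrow> 'p gvec set) \<Rightarrow> 'p \<Rightarrow> ('p \<Rightarrow> 'p gvec) \<Rightarrow> bool"
  where "bsection_at \<A> F p s \<longleftrightarrow> (\<forall>q. s q \<in> F q) \<and> gsection_at (cinf \<A>) UNIV p s"

text \<open>As the rank is constant, local sections that form a basis at \<open>p\<close> form a local frame near \<open>p\<close>.\<close>

definition gsubbundle :: "('p, real ^ 'n) chart set \<Rightarrow> nat \<Rightarrow> ('p \<Rightarrow> 'p gvec set) \<Rightarrow> bool"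
  where "gsubbundle \<A> r F \<longleftrightarrow> (\<forall>p.
    F p \<subseteq> GTM \<A> p \<and> subspace (F p) \<and> dim (F p) = r \<and>
    (\<exists>s::nat \<Rightarrow> 'p \<Rightarrow> 'p gvec.
       (\<forall>i<r. bsection_at \<A> F p (s i)) \<and> span ((\<lambda>i. s i p) ` {..<r}) = F p))"

definition gen_metric :: "('p, real ^ 'n) chart set \<Rightarrow> nat \<Rightarrow> ('p \<Rightarrow> 'p gvec set) \<Rightarrow> bool"
  where "gen_metric \<A> n E \<longleftrightarrow>
    gsubbundle \<A> (2 * n) E \<and>
    (\<forall>p. has_signature pair (E p) n n) \<and>
    (\<forall>p. E p \<inter> ({0} \<times> cotangent (cinf \<A>) p) = {0})"

definition orth ::
  "('p, real ^ 'n) chart set \<Rightarrow> ('p \<Rightarrow> 'p gvec set) \<Rightarrow> 'p \<Rightarrow> 'p gvec set"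
  where "orth \<A> E p = {B \<in> GTM \<A> p. \<forall>A\<in>E p. pair A B = 0}"

text \<open>\<open>D p X s\<close> is \<open>(D\<^sub>X s)(p)\<close> for \<open>X \<in> T\<^sub>p M\<close> and a section \<open>s\<close> of \<open>F\<close> that is smooth near \<open>p\<close>. The
  operator acts on local sections, to which a covariant derivative of global sections extends
  uniquely. Where \<open>D p X s\<close> has no meaning it is set to \<open>0\<close>.\<close>

type_synonym 'p connection = "'p \<Rightarrow> 'p tvec \<Rightarrow> ('p \<Rightarrow> 'p gvec) \<Rightarrow> 'p gvec"

definition is_connection ::
  "('p, real ^ 'n) chart set \<Rightarrow> ('p \<Rightarrow> 'p gvec set) \<Rightarrow> 'p connection \<Rightarrow> bool"
  where "is_connection \<A> F D \<longleftrightarrow>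
    (\<forall>p X s. X \<in> TM \<A> p \<and> bsection_at \<A> F p s \<longrightarrow> D p X s \<in> F p) \<and>
    (\<forall>p X s. \<not> (X \<in> TM \<A> p \<and> bsection_at \<A> F p s) \<longrightarrow> D p X s = 0) \<and>
    (\<forall>p s. bsection_at \<A> F p s \<longrightarrow> linear_upon (TM \<A> p) (\<lambda>X. D p X s)) \<and>
    (\<forall>p. \<forall>X\<in>TM \<A> p. \<forall>s t. bsection_at \<A> F p s \<and> bsection_at \<A> F p t \<longrightarrow>
       D p X (\<lambda>q. s q + t q) = D p X s + D p X t) \<and>
    (\<forall>p. \<forall>X\<in>TM \<A> p. \<forall>f\<in>cinf \<A> p. \<forall>s. bsection_at \<A> F p s \<longrightarrow>
       D p X (\<lambda>q. f q *\<^sub>R s q) = X f *\<^sub>R s p + f p *\<^sub>R D p X s) \<and>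
    (\<forall>p X s. vfield_at (cinf \<A>) UNIV p X \<and> bsection_at \<A> F p s \<longrightarrow>
       bsection_at \<A> F p (\<lambda>q. D q (X q) s))"

definition metric_connection ::
  "('p, real ^ 'n) chart set \<Rightarrow> ('p \<Rightarrow> 'p gvec set) \<Rightarrow> ('p gvec \<Rightarrow> 'p gvec \<Rightarrow> real)
    \<Rightarrow> 'p connection \<Rightarrow> bool"
  where "metric_connection \<A> F g D \<longleftrightarrow>
    is_connection \<A> F D \<and>
    (\<forall>p. \<forall>X\<in>TM \<A> p. \<forall>s t. bsection_at \<A> F p s \<and> bsection_at \<A> F p t \<longrightarrow>
       X (\<lambda>q. g (s q) (t q)) = g (D p X s) (t p) + g (s p) (D p X t))"

text \<open>The \<open>E\<close>-component of a generalized vector in \<open>TM \<oplus> T\<^sup>*M = E \<oplus> E\<^sup>\<bottom>\<close>, and \<open>D' \<oplus> D''\<close>.\<close>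

definition proj_E ::
  "('p, real ^ 'n) chart set \<Rightarrow> ('p \<Rightarrow> 'p gvec set) \<Rightarrow> 'p \<Rightarrow> 'p gvec \<Rightarrow> 'p gvec"
  where "proj_E \<A> E p A =
    (if A \<in> GTM \<A> p then THE B. B \<in> E p \<and> A - B \<in> orth \<A> E p else 0)"

definition sum_connection ::
  "('p, real ^ 'n) chart set \<Rightarrow> ('p \<Rightarrow> 'p gvec set) \<Rightarrow> 'p connection \<Rightarrow> 'p connection
    \<Rightarrow> 'p connection"
  where "sum_connection \<A> E D' D'' p X s =
    D' p X (\<lambda>q. proj_E \<A> E q (s q)) + D'' p X (\<lambda>q. s q - proj_E \<A> E q (s q))"


section \<open>The generalized reflector space\<close>

definition paracomplex :: "('p, real ^ 'n) chart set \<Rightarrow> 'p \<Rightarrow> ('p gvec \<Rightarrow> 'p gvec) set"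
  where "paracomplex \<A> p = {K \<in> endos (GTM \<A> p).
    (\<forall>A\<in>GTM \<A> p. K (K A) = A) \<and>
    (\<forall>A\<in>GTM \<A> p. \<forall>B\<in>GTM \<A> p. pair (K A) B + pair A (K B) = 0)}"

type_synonym 'p gpoint = "'p \<times> ('p gvec \<Rightarrow> 'p gvec)"

definition reflector_space ::
  "('p, real ^ 'n) chart set \<Rightarrow> ('p \<Rightarrow> 'p gvec set) \<Rightarrow> 'p gpoint set"
  where "reflector_space \<A> E = {(p, K). K \<in> paracomplex \<A> p \<and> K ` E p \<subseteq> E p}"

text \<open>The fibre of \<open>A(E') \<oplus> A(E'')\<close>: a pair of skew endomorphisms of \<open>E'\<close> and \<open>E''\<close> is the same as a
  skew endomorphism of \<open>TM \<oplus> T\<^sup>*M\<close> preserving \<open>E'\<close> and \<open>E''\<close>.\<close>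

definition skew_fibre ::
  "('p, real ^ 'n) chart set \<Rightarrow> ('p \<Rightarrow> 'p gvec set) \<Rightarrow> 'p \<Rightarrow> ('p gvec \<Rightarrow> 'p gvec) set"
  where "skew_fibre \<A> E p = {L \<in> endos (GTM \<A> p).
    (\<forall>A\<in>GTM \<A> p. \<forall>B\<in>GTM \<A> p. pair (L A) B + pair A (L B) = 0) \<and>
    L ` E p \<subseteq> E p \<and> L ` orth \<A> E p \<subseteq> orth \<A> E p}"

definition skew_bundle :: "('p, real ^ 'n) chart set \<Rightarrow> ('p \<Rightarrow> 'p gvec set) \<Rightarrow> 'p gpoint set"
  where "skew_bundle \<A> E = {(p, L). L \<in> skew_fibre \<A> E p}"

text \<open>The coordinate frame \<open>\<partial>/\<partial>x\<^sub>i\<close>, \<open>dx\<^sub>i\<close> of \<open>TM \<oplus> T\<^sup>*M\<close> over a chart.\<close>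

definition coord_frame ::
  "('p, real ^ 'n) chart set \<Rightarrow> ('p, real ^ 'n) chart \<Rightarrow> 'p \<Rightarrow> 'n + 'n \<Rightarrow> 'p gvec"
  where "coord_frame \<A> = (\<lambda>(U, \<phi>) q a. case a of
      Inl i \<Rightarrow> (\<lambda>f. if f \<in> cinf \<A> q
                 then frechet_derivative (f \<circ> inv_into U \<phi>) (at (\<phi> q)) (axis i 1) else 0, 0)
    | Inr i \<Rightarrow> (0, \<lambda>v. if v \<in> TM \<A> q then v (\<lambda>r. \<phi> r $ i) else 0))"

text \<open>Charts of the total space of \<open>End(TM \<oplus> T\<^sup>*M)\<close>. Since \<open>pair\<close> is nondegenerate, the numbers
  \<open>pair (L e\<^sub>a) e\<^sub>b\<close>, for the coordinate frame \<open>e\<close>, are linear coordinates of the endomorphism \<open>L\<close>.\<close>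

definition end_charts ::
  "('p, real ^ 'n) chart set
    \<Rightarrow> ('p gpoint, (real ^ 'n) \<times> (real ^ ('n + 'n) ^ ('n + 'n))) chart set"
  where "end_charts \<A> = (\<lambda>(U, \<phi>).
    ({(q, L). q \<in> U},
     \<lambda>(q, L). (\<phi> q, \<chi> a b. pair (L (coord_frame \<A> (U, \<phi>) q a)) (coord_frame \<A> (U, \<phi>) q b)))) ` \<A>"

text \<open>Smooth functions on the submanifolds \<open>\<G>(E) \<subseteq> A(E') \<oplus> A(E'')\<close> of \<open>End(TM \<oplus> T\<^sup>*M)\<close>.\<close>

abbreviation cinf_G ::
  "('p, real ^ 'n) chart set \<Rightarrow> ('p \<Rightarrow> 'p gvec set) \<Rightarrow> 'p gpoint \<Rightarrow> ('p gpoint \<Rightarrow> real) set"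
  where "cinf_G \<A> E \<equiv> smooth_near (end_charts \<A>) (reflector_space \<A> E)"

abbreviation cinf_A ::
  "('p, real ^ 'n) chart set \<Rightarrow> ('p \<Rightarrow> 'p gvec set) \<Rightarrow> 'p gpoint \<Rightarrow> ('p gpoint \<Rightarrow> real) set"
  where "cinf_A \<A> E \<equiv> smooth_near (end_charts \<A>) (skew_bundle \<A> E)"


section \<open>Vertical and horizontal spaces\<close>

definition vert ::
  "('p, real ^ 'n) chart set \<Rightarrow> ('p \<Rightarrow> 'p gvec set) \<Rightarrow> 'p gpoint \<Rightarrow> ('p gvec \<Rightarrow> 'p gvec) set"
  where "vert \<A> E = (\<lambda>(p, K). {V \<in> skew_fibre \<A> E p. \<forall>A\<in>GTM \<A> p. V (K A) = - K (V A)})"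

text \<open>A tangent vector of \<open>\<G>(E)\<close> is determined by its values on functions smooth on
  \<open>A(E') \<oplus> A(E'')\<close>. The one given by \<open>V \<in> vert\<close> is the velocity of \<open>t \<mapsto> K + t V\<close>.\<close>

definition vert_vec ::
  "('p, real ^ 'n) chart set \<Rightarrow> ('p \<Rightarrow> 'p gvec set) \<Rightarrow> 'p gpoint \<Rightarrow> ('p gvec \<Rightarrow> 'p gvec)
    \<Rightarrow> 'p gpoint tvec"
  where "vert_vec \<A> E x V = (THE v. v \<in> tangent (cinf_G \<A> E) x \<and>
    (\<forall>f\<in>cinf_A \<A> E x. v f = deriv (\<lambda>t. f (fst x, snd x + t *\<^sub>R V)) 0))"

definition skew_section_at ::
  "('p, real ^ 'n) chart set \<Rightarrow> ('p \<Rightarrow> 'p gvec set) \<Rightarrow> 'p \<Rightarrow> ('p \<Rightarrow> 'p gvec \<Rightarrow> 'p gvec) \<Rightarrow> bool"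
  where "skew_section_at \<A> E p s \<longleftrightarrow> (\<forall>q. s q \<in> skew_fibre \<A> E q) \<and>
    (\<forall>A. gsection_at (cinf \<A>) UNIV p A \<longrightarrow> gsection_at (cinf \<A>) UNIV p (\<lambda>q. s q (A q)))"

text \<open>\<open>D s = 0\<close> at \<open>p\<close> for the connection \<open>(D\<^sub>X s) A = D\<^sub>X (s A) - s (D\<^sub>X A)\<close> induced on endomorphisms.\<close>

definition parallel_at ::
  "('p, real ^ 'n) chart set \<Rightarrow> 'p connection \<Rightarrow> 'p \<Rightarrow> ('p \<Rightarrow> 'p gvec \<Rightarrow> 'p gvec) \<Rightarrow> bool"
  where "parallel_at \<A> D p s \<longleftrightarrow> (\<forall>X\<in>TM \<A> p. \<forall>A. gsection_at (cinf \<A>) UNIV p A \<longrightarrow>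
    D p X (\<lambda>q. s q (A q)) - s p (D p X A) = 0)"

text \<open>The horizontal lift of \<open>X\<close> to \<open>K\<close> is \<open>s\<^sub>* X\<close> for any section \<open>s\<close> of \<open>A(E') \<oplus> A(E'')\<close> with
  \<open>s p = K\<close> and \<open>D s = 0\<close> at \<open>p\<close>; it is tangent to \<open>\<G>(E)\<close>.\<close>

definition hlift ::
  "('p, real ^ 'n) chart set \<Rightarrow> ('p \<Rightarrow> 'p gvec set) \<Rightarrow> 'p connection \<Rightarrow> 'p gpoint \<Rightarrow> 'p tvec
    \<Rightarrow> 'p gpoint tvec"
  where "hlift \<A> E D x X = (THE v. v \<in> tangent (cinf_G \<A> E) x \<and>
    (\<exists>s. skew_section_at \<A> E (fst x) s \<and> s (fst x) = snd x \<and> parallel_at \<A> D (fst x) s \<and>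
       (\<forall>f\<in>cinf_A \<A> E x. v f = X (\<lambda>q. f (q, s q)))))"

definition vert_space ::
  "('p, real ^ 'n) chart set \<Rightarrow> ('p \<Rightarrow> 'p gvec set) \<Rightarrow> 'p gpoint \<Rightarrow> 'p gpoint tvec set"
  where "vert_space \<A> E x = vert_vec \<A> E x ` vert \<A> E x"

definition hor_space ::
  "('p, real ^ 'n) chart set \<Rightarrow> ('p \<Rightarrow> 'p gvec set) \<Rightarrow> 'p connection \<Rightarrow> 'p gpoint
    \<Rightarrow> 'p gpoint tvec set"
  where "hor_space \<A> E D x = hlift \<A> E D x ` TM \<A> (fst x)"

definition vert_dual ::
  "('p, real ^ 'n) chart set \<Rightarrow> ('p \<Rightarrow> 'p gvec set) \<Rightarrow> 'p connection \<Rightarrow> 'p gpoint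
    \<Rightarrow> 'p gpoint covec set"
  where "vert_dual \<A> E D x =
    {\<phi> \<in> cotangent (cinf_G \<A> E) x. \<forall>h\<in>hor_space \<A> E D x. \<phi> h = 0}"

definition hor_dual ::
  "('p, real ^ 'n) chart set \<Rightarrow> ('p \<Rightarrow> 'p gvec set) \<Rightarrow> 'p gpoint \<Rightarrow> 'p gpoint covec set"
  where "hor_dual \<A> E x =
    {\<omega> \<in> cotangent (cinf_G \<A> E) x. \<forall>v\<in>vert_space \<A> E x. \<omega> v = 0}"

definition hlift_form ::
  "('p, real ^ 'n) chart set \<Rightarrow> ('p \<Rightarrow> 'p gvec set) \<Rightarrow> 'p connection \<Rightarrow> 'p gpoint \<Rightarrow> 'p covec
    \<Rightarrow> 'p gpoint covec"
  where "hlift_form \<A> E D x \<alpha> = (THE \<omega>. \<omega> \<in> hor_dual \<A> E x \<and>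
    (\<forall>Y\<in>TM \<A> (fst x). \<omega> (hlift \<A> E D x Y) = \<alpha> Y))"

definition ghlift ::
  "('p, real ^ 'n) chart set \<Rightarrow> ('p \<Rightarrow> 'p gvec set) \<Rightarrow> 'p connection \<Rightarrow> 'p gpoint \<Rightarrow> 'p gvec
    \<Rightarrow> 'p gpoint gvec"
  where "ghlift \<A> E D x A = (hlift \<A> E D x (fst A), hlift_form \<A> E D x (snd A))"


section \<open>The generalized almost paracomplex structures on the reflector space\<close>

definition vert_P ::
  "('p, real ^ 'n) chart set \<Rightarrow> ('p \<Rightarrow> 'p gvec set) \<Rightarrow> nat \<Rightarrow> 'p gpoint
    \<Rightarrow> ('p gvec \<Rightarrow> 'p gvec) \<Rightarrow> ('p gvec \<Rightarrow> 'p gvec)"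
  where "vert_P \<A> E \<epsilon> = (\<lambda>(p, K) V.
    (let V' = (\<lambda>A. V (proj_E \<A> E p A)); V'' = (\<lambda>A. V (A - proj_E \<A> E p A));
         P1 = (\<lambda>A. K (V' A) + K (V'' A));
         P2 = (\<lambda>A. K (V' A) - K (V'' A))
     in if \<epsilon> = 1 then P1 else if \<epsilon> = 2 then P2 else if \<epsilon> = 3 then - P2 else - P1))"

text \<open>\<open>\<phi> \<circ> \<P>\<^sub>\<epsilon>\<close> for \<open>\<phi> \<in> \<V>\<^sup>*\<close>, again as a form on the tangent space vanishing on \<open>\<H>\<close>.\<close>

definition vert_form_P ::
  "('p, real ^ 'n) chart set \<Rightarrow> ('p \<Rightarrow> 'p gvec set) \<Rightarrow> 'p connection \<Rightarrow> nat \<Rightarrow> 'p gpoint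
    \<Rightarrow> 'p gpoint covec \<Rightarrow> 'p gpoint covec"
  where "vert_form_P \<A> E D \<epsilon> x \<phi> = (THE \<psi>. \<psi> \<in> vert_dual \<A> E D x \<and>
    (\<forall>V\<in>vert \<A> E x. \<psi> (vert_vec \<A> E x V) = \<phi> (vert_vec \<A> E x (vert_P \<A> E \<epsilon> x V))))"

text \<open>Every element of the generalized tangent space at \<open>x = (p, K)\<close> is uniquely of the form
  \<open>A\<^sup>h + V + \<phi>\<close>, and \<open>\<K>\<^sub>\<epsilon>\<close> sends it to \<open>(K A)\<^sup>h + \<P>\<^sub>\<epsilon> V - \<phi> \<circ> \<P>\<^sub>\<epsilon>\<close>. The index \<open>\<epsilon>\<close> ranges over \<open>1, ..., 4\<close>.\<close>

definition gpc_structure ::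
  "('p, real ^ 'n) chart set \<Rightarrow> ('p \<Rightarrow> 'p gvec set) \<Rightarrow> 'p connection \<Rightarrow> nat \<Rightarrow> 'p gpoint
    \<Rightarrow> 'p gpoint gvec \<Rightarrow> 'p gpoint gvec"
  where "gpc_structure \<A> E D \<epsilon> x \<Xi> = (THE \<Psi>.
    \<exists>A\<in>GTM \<A> (fst x). \<exists>V\<in>vert \<A> E x. \<exists>\<phi>\<in>vert_dual \<A> E D x.
      \<Xi> = ghlift \<A> E D x A + (vert_vec \<A> E x V, \<phi>) \<and>
      \<Psi> = ghlift \<A> E D x (snd x A)
           + (vert_vec \<A> E x (vert_P \<A> E \<epsilon> x V), - vert_form_P \<A> E D \<epsilon> x \<phi>))"

end

theory Submission
  imports Defs
begin

text \<open>
  Let \<open>\<K>\<close> be one of \<open>\<K>\<^sub>2, \<K>\<^sub>3, \<K>\<^sub>4\<close>. If \<open>\<K> \<E> = \<E>\<close> and \<open>\<K> \<F> = \<F>\<close>, then integrability says that the Courant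
  bracket \<open>[\<E>, \<F>]\<close> is again fixed by \<open>\<K>\<close>. So it suffices to find two sections fixed by \<open>\<K>\<close> whose
  bracket is not.

  The structure \<open>\<P>\<^sub>\<epsilon>\<close> is \<open>V \<mapsto> - K V\<close> on the endomorphisms of \<open>E''\<close> for \<open>\<epsilon> = 2\<close>, and on those of \<open>E'\<close> for
  \<open>\<epsilon> = 3, 4\<close>; this sign is what fails for \<open>\<K>\<^sub>1\<close>. In that block take members \<open>e\<^sub>i, e\<^sub>j\<close> of a local
  orthonormal frame, put \<open>w\<^sub>k = e\<^sub>k - K e\<^sub>k\<close>, and let \<open>V = w\<^sub>i \<and> w\<^sub>j\<close>. Since \<open>K w\<^sub>k = - w\<^sub>k\<close>, this is a vertical
  field with \<open>K V = - V\<close>, hence fixed by \<open>\<P>\<^sub>\<epsilon>\<close> (lemma \<open>vert_P_eigen_vert\<close>). It is nonzero for suitable \<open>i\<close>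
  and \<open>j\<close> because the eigenspaces of \<open>K\<close> in the block have dimension \<open>n \<ge> 2\<close>. The second section is
  \<open>A\<^sup>h\<close> for \<open>A = e\<^sub>i + K e\<^sub>i\<close>, which satisfies \<open>K A = A\<close>. The point of the fibre enters \<open>A\<close> through \<open>K e\<^sub>i\<close>,
  whose derivative along \<open>V\<close> is \<open>V e\<^sub>i\<close>, so \<open>[V, A\<^sup>h] = (V e\<^sub>i)\<^sup>h\<close> up to a vertical vector (lemma
  \<open>bracket_eq\<close>). Now \<open>K (V e\<^sub>i) = - V e\<^sub>i\<close>. If the bracket were fixed by \<open>\<K>\<close>, the tangent part of \<open>V e\<^sub>i\<close> would
  vanish; but \<open>V e\<^sub>i \<noteq> 0\<close> lies in \<open>E'\<close> or \<open>E''\<close>, and both meet \<open>T\<^sup>*M\<close> only in \<open>0\<close>. The sections are made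
  global by a cut-off function on \<open>M\<close>; as it only multiplies the bracket and adds vertical terms, it is
  harmless.

  Before this computation can be made, the spaces in it must be identified, since tangent vectors are
  derivations and the lifts are given by descriptions. Hadamard's lemma shows that a derivation is a
  directional derivative (lemma \<open>tangent_eq_derivative\<close>). A Gram-Schmidt argument gives local
  orthonormal frames of \<open>TM \<oplus> T\<^sup>*M\<close> adapted to \<open>E \<oplus> E\<^sup>\<bottom>\<close> (lemma \<open>framed_chart_exists\<close>). In such a frame \<open>\<G>\<close> is
  the product of an open set with a fixed set of matrices, and its tangent vectors are the pairs of a
  vector of \<open>\<real>\<^sup>2\<^sup>n\<close> and a vertical endomorphism (lemmas \<open>admissible_vert\<close> and \<open>tangent_G_cases\<close>). The
  horizontal lift of \<open>X\<close> is then the pair of \<open>X\<close> and \<open>K \<omega>(X) - \<omega>(X) K\<close>, where \<open>\<omega>\<close> is the connection form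
  (lemma \<open>hlift_eq\<close>), and horizontal forms are pullbacks from \<open>M\<close> (lemma \<open>hlift_form_eq\<close>).
\<close>

section \<open>Calculus of smooth maps\<close>

lemma Ck_on_Suc_imp: "Ck_on (Suc k) S f \<Longrightarrow> Ck_on k S f"
proof (induction k arbitrary: f)
  case 0
  then show ?case
    by (simp add: continuous_at_imp_continuous_on differentiable_imp_continuous_within)
next
  case (Suc k)
  then show ?case by (metis Ck_on.simps(2))
qed

lemma Ck_on_subset: "Ck_on k S f \<Longrightarrow> T \<subseteq> S \<Longrightarrow> Ck_on k T f"
  by (induction k arbitrary: f) (auto intro: continuous_on_subset)

lemma Ck_on_cong:
  assumes "open S" "\<And>x. x \<in> S \<Longrightarrow> f x = g x"
  shows "Ck_on k S f \<longleftrightarrow> Ck_on k S g"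
proof -
  have "Ck_on k S f \<Longrightarrow> Ck_on k S g" if "\<And>x. x \<in> S \<Longrightarrow> f x = g x" for f g :: "'a \<Rightarrow> 'b"
    using that
  proof (induction k arbitrary: f g)
    case 0
    then show ?case by (metis Ck_on.simps(1) continuous_on_cong)
  next
    case (Suc k)
    have d: "(g has_derivative frechet_derivative f (at x)) (at x)" if "x \<in> S" for x
      using Suc.prems that assms(1)
      by (metis Ck_on.simps(2) frechet_derivative_works has_derivative_transform_within_open)
    then have e: "frechet_derivative f (at x) v = frechet_derivative g (at x) v" if "x \<in> S" for x v
      using frechet_derivative_at that by fastforce
    show ?case
      using Suc.prems d Suc.IH[OF _ e] by (auto simp: differentiable_def)
  qed
  then show ?thesis using assms(2) by (metis (full_types))
qed

lemma Ck_on_SucI: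
  assumes "open S" "\<And>x. x \<in> S \<Longrightarrow> (f has_derivative f' x) (at x)" "\<And>v. Ck_on k S (\<lambda>x. f' x v)"
  shows "Ck_on (Suc k) S f"
proof -
  have "f' x v = frechet_derivative f (at x) v" if "x \<in> S" for x v
    using assms(2)[OF that] frechet_derivative_at by fastforce
  then have "Ck_on k S (\<lambda>x. frechet_derivative f (at x) v)" for v
    using assms(3)[of v] Ck_on_cong[OF assms(1), of "\<lambda>x. f' x v" "\<lambda>x. frechet_derivative f (at x) v"]
    by auto
  with assms(2) show ?thesis by (auto simp: differentiable_def)
qed

lemma Ck_on_SucD:
  assumes "Ck_on (Suc k) S f" "x \<in> S"
  shows "(f has_derivative frechet_derivative f (at x)) (at x)"
  using assms by (simp flip: frechet_derivative_works)

lemma Ck_on_const: "open S \<Longrightarrow> Ck_on k S (\<lambda>x. c)"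
  by (induction k arbitrary: c) (auto intro: Ck_on_SucI[where f' = "\<lambda>_ _. 0"])

lemma Ck_on_add:
  "open S \<Longrightarrow> Ck_on k S f \<Longrightarrow> Ck_on k S g \<Longrightarrow> Ck_on k S (\<lambda>x. f x + g x)"
proof (induction k arbitrary: f g)
  case (Suc k)
  show ?case
    by (rule Ck_on_SucI[OF Suc.prems(1),
          where f' = "\<lambda>x v. frechet_derivative f (at x) v + frechet_derivative g (at x) v"])
      (use Suc.prems in \<open>auto intro!: has_derivative_add Ck_on_SucD[where k = k] Suc.IH simp: \<close>)
qed (auto intro: continuous_intros)

lemma Ck_on_sum:
  "open S \<Longrightarrow> (\<And>i. i \<in> I \<Longrightarrow> Ck_on k S (f i)) \<Longrightarrow> Ck_on k S (\<lambda>x. \<Sum>i\<in>I. f i x)"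
  by (induction I rule: infinite_finite_induct) (auto intro: Ck_on_add Ck_on_const)

lemma Ck_on_bilinear:
  assumes "bounded_bilinear P"
  shows "open S \<Longrightarrow> Ck_on k S f \<Longrightarrow> Ck_on k S g \<Longrightarrow> Ck_on k S (\<lambda>x. P (f x) (g x))"
proof (induction k arbitrary: f g)
  case 0
  then show ?case using bounded_bilinear.continuous_on[OF assms] by auto
next
  case (Suc k)
  show ?case
  proof (rule Ck_on_SucI[OF Suc.prems(1)])
    show "((\<lambda>x. P (f x) (g x)) has_derivative
      (\<lambda>v. P (f x) (frechet_derivative g (at x) v) + P (frechet_derivative f (at x) v) (g x))) (at x)"
      if "x \<in> S" for x
      using bounded_bilinear.FDERIV[OF assms Ck_on_SucD[OF Suc.prems(2) that] Ck_on_SucD[OF Suc.prems(3) that]] .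
    show "Ck_on k S (\<lambda>x. P (f x) (frechet_derivative g (at x) v)
        + P (frechet_derivative f (at x) v) (g x))" for v
      using Suc.prems by (intro Ck_on_add Suc.IH Ck_on_Suc_imp[OF Suc.prems(2)]
          Ck_on_Suc_imp[OF Suc.prems(3)]) auto
  qed
qed

lemmas Ck_on_mult = Ck_on_bilinear[OF bounded_bilinear_mult]
lemmas Ck_on_scaleR = Ck_on_bilinear[OF bounded_bilinear_scaleR]
lemmas Ck_on_inner = Ck_on_bilinear[OF bounded_bilinear_inner]

lemma Ck_on_bounded_linear: "open S \<Longrightarrow> bounded_linear L \<Longrightarrow> Ck_on k S L"
proof (cases k)
  case (Suc l)
  assume "open S" "bounded_linear L"
  then have "Ck_on (Suc l) S L"
    by (intro Ck_on_SucI[where f' = "\<lambda>x. L"] bounded_linear_imp_has_derivative Ck_on_const)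
  with Suc show ?thesis by simp
qed (auto intro: linear_continuous_on)

text \<open>The chain rule expresses the derivative of \<open>g \<circ> f\<close> by products of derivatives of \<open>f\<close> with partial
  derivatives of \<open>g\<close> along \<open>f\<close>, to which the induction hypothesis applies; the finite basis of the middle
  space is what makes these products expressible.\<close>

lemma Ck_on_compose:
  fixes f :: "'a::real_normed_vector \<Rightarrow> 'b::euclidean_space"
  assumes "open S" "open T" "f ` S \<subseteq> T"
  shows "Ck_on k S f \<Longrightarrow> Ck_on k T g \<Longrightarrow> Ck_on k S (\<lambda>x. g (f x))"
proof (induction k arbitrary: g)
  case 0
  then show ?case using assms(3) by (auto intro: continuous_on_compose2)
next
  case (Suc k)
  let ?D = "\<lambda>x v. \<Sum>b\<in>Basis. (frechet_derivative f (at x) v \<bullet> b) *\<^sub>R frechet_derivative g (at (f x)) b"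
  show ?case
  proof (rule Ck_on_SucI[OF assms(1), where f' = ?D])
    fix x assume x: "x \<in> S"
    then have fx: "f x \<in> T" using assms by auto
    have lin: "linear (frechet_derivative g (at (f x)))"
      using has_derivative_linear Ck_on_SucD[OF Suc.prems(2) fx] by blast
    have "((\<lambda>x. g (f x)) has_derivative
      (\<lambda>v. frechet_derivative g (at (f x)) (frechet_derivative f (at x) v))) (at x)"
      using diff_chain_at[OF Ck_on_SucD[OF Suc.prems(1) x] Ck_on_SucD[OF Suc.prems(2) fx]]
      by (simp add: o_def)
    moreover have "frechet_derivative g (at (f x)) (frechet_derivative f (at x) v) = ?D x v" for v
      using lin by (subst euclidean_representation[symmetric])
        (simp add: linear_sum linear_cmul)
    ultimately show "((\<lambda>x. g (f x)) has_derivative ?D x) (at x)" by simp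
  next
    fix v
    show "Ck_on k S (\<lambda>x. ?D x v)"
    proof (intro Ck_on_sum Ck_on_scaleR Ck_on_inner Ck_on_const assms(1))
      show "Ck_on k S (\<lambda>x. frechet_derivative f (at x) v)" using Suc.prems by auto
      show "Ck_on k S (\<lambda>x. frechet_derivative g (at (f x)) b)" for b
        by (rule Suc.IH[OF Ck_on_Suc_imp[OF Suc.prems(1)]]) (use Suc.prems in auto)
    qed
  qed
qed

lemma smooth_on_subset: "smooth_on S f \<Longrightarrow> T \<subseteq> S \<Longrightarrow> smooth_on T f"
  unfolding smooth_on_def using Ck_on_subset by blast

lemma smooth_on_const: "open S \<Longrightarrow> smooth_on S (\<lambda>x. c)"
  unfolding smooth_on_def using Ck_on_const by blast

lemma smooth_on_add:
  "open S \<Longrightarrow> smooth_on S f \<Longrightarrow> smooth_on S g \<Longrightarrow> smooth_on S (\<lambda>x. f x + g x)"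
  unfolding smooth_on_def by (auto intro: Ck_on_add)

lemma smooth_on_sum:
  "open S \<Longrightarrow> (\<And>i. i \<in> I \<Longrightarrow> smooth_on S (f i)) \<Longrightarrow> smooth_on S (\<lambda>x. \<Sum>i\<in>I. f i x)"
  unfolding smooth_on_def by (auto intro: Ck_on_sum)

lemma smooth_on_mult:
  fixes f g :: "'a::real_normed_vector \<Rightarrow> real"
  shows "open S \<Longrightarrow> smooth_on S f \<Longrightarrow> smooth_on S g \<Longrightarrow> smooth_on S (\<lambda>x. f x * g x)"
  unfolding smooth_on_def by (auto intro: Ck_on_mult)

lemma smooth_on_scaleR:
  "open S \<Longrightarrow> smooth_on S f \<Longrightarrow> smooth_on S g \<Longrightarrow> smooth_on S (\<lambda>x. f x *\<^sub>R g x)"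
  unfolding smooth_on_def by (auto intro: Ck_on_scaleR)

lemma smooth_on_inner:
  "open S \<Longrightarrow> smooth_on S f \<Longrightarrow> smooth_on S g \<Longrightarrow> smooth_on S (\<lambda>x. f x \<bullet> g x)"
  unfolding smooth_on_def by (auto intro: Ck_on_inner)

lemma smooth_on_bounded_linear: "open S \<Longrightarrow> bounded_linear L \<Longrightarrow> smooth_on S L"
  unfolding smooth_on_def by (auto intro: Ck_on_bounded_linear)

lemma smooth_on_compose:
  fixes f :: "'a::real_normed_vector \<Rightarrow> 'b::euclidean_space"
  assumes "open S" "open T" "f ` S \<subseteq> T" "smooth_on S f" "smooth_on T g"
  shows "smooth_on S (\<lambda>x. g (f x))"
  using assms unfolding smooth_on_def by (auto intro: Ck_on_compose)

lemma smooth_on_compose_linear: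
  fixes f :: "'a::real_normed_vector \<Rightarrow> 'b::euclidean_space"
  assumes "open S" "smooth_on S f" "bounded_linear g"
  shows "smooth_on S (\<lambda>x. g (f x))"
  using smooth_on_compose[of S UNIV f g] assms smooth_on_bounded_linear by auto

lemma smooth_on_has_derivative:
  "smooth_on S f \<Longrightarrow> x \<in> S \<Longrightarrow> (f has_derivative frechet_derivative f (at x)) (at x)"
  unfolding smooth_on_def by (metis Ck_on_SucD)

lemma smooth_on_linear_derivative:
  "smooth_on S f \<Longrightarrow> x \<in> S \<Longrightarrow> linear (frechet_derivative f (at x))"
  using has_derivative_linear[OF smooth_on_has_derivative] .

lemma smooth_on_frechet: "smooth_on S f \<Longrightarrow> smooth_on S (\<lambda>x. frechet_derivative f (at x) v)"
  unfolding smooth_on_def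
proof
  fix k assume "\<forall>k. Ck_on k S f"
  then have "Ck_on (Suc k) S f" by blast
  then show "Ck_on k S (\<lambda>x. frechet_derivative f (at x) v)" by simp
qed

lemma smooth_on_continuous: "smooth_on S f \<Longrightarrow> continuous_on S f"
  unfolding smooth_on_def by (metis Ck_on.simps(1))

lemma smooth_on_inverse_sqrt: "smooth_on {0::real<..} (\<lambda>x. 1 / sqrt x)"
  unfolding smooth_on_def
proof
  fix k show "Ck_on k {0::real<..} (\<lambda>x. 1 / sqrt x)"
  proof (induction k)
    case 0
    then show ?case by (auto intro!: continuous_intros)
  next
    case (Suc k)
    show ?case
    proof (rule Ck_on_SucI)
      fix x :: real assume "x \<in> {0<..}"
      then have x: "x > 0" by simp
      have "DERIV (\<lambda>x. 1 / sqrt x) x :> - (1/2) * ((1 / sqrt x) * ((1 / sqrt x) * (1 / sqrt x)))"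
        using x by (auto intro!: derivative_eq_intros simp: field_simps)
      then show "((\<lambda>x. 1 / sqrt x) has_derivative
          (\<lambda>v. - (1/2) * ((1 / sqrt x) * ((1 / sqrt x) * (1 / sqrt x))) * v)) (at x)"
        unfolding has_field_derivative_def .
    qed (simp, intro Ck_on_mult[where f = "\<lambda>x. _ * _"] Ck_on_mult[where g = "\<lambda>x. _ * _"]  Ck_on_mult Ck_on_const Suc open_greaterThan)
  qed
qed

text \<open>The case \<open>m = 0\<close> is the classical function that is flat at \<open>0\<close>. The powers \<open>x ^ m\<close> are there because the
  derivative of each member is a linear combination of two later members, so smoothness of the whole
  family is one induction.\<close>

definition flat_exp :: "nat \<Rightarrow> real \<Rightarrow> real"
  where "flat_exp m x = (if x > 0 then exp (- (1 / x)) / x ^ m else 0)"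

lemma flat_exp_tendsto_0: "(flat_exp m \<longlongrightarrow> 0) (at 0)"
proof -
  have "((\<lambda>x. (inverse x) ^ m / exp (inverse x)) \<longlongrightarrow> (0::real)) (at_right 0)"
    using filterlim_compose[OF tendsto_power_div_exp_0 filterlim_inverse_at_top_right] .
  moreover have "eventually (\<lambda>x. (inverse x) ^ m / exp (inverse x) = flat_exp m x) (at_right 0)"
    by (auto simp: flat_exp_def eventually_at_filter exp_minus field_simps)
  ultimately have r: "(flat_exp m \<longlongrightarrow> 0) (at_right 0)" using Lim_transform_eventually by blast
  have "eventually (\<lambda>x. 0 = flat_exp m x) (at_left 0)"
    by (auto simp: flat_exp_def eventually_at_filter)
  then have "(flat_exp m \<longlongrightarrow> 0) (at_left 0)" by (rule Lim_transform_eventually[OF tendsto_const])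
  with r show ?thesis by (simp add: filterlim_split_at)
qed

lemma flat_exp_has_derivative:
  "DERIV (flat_exp m) x :> flat_exp (m + 2) x - real m * flat_exp (m + 1) x"
proof -
  consider "x > 0" | "x < 0" | "x = 0" by linarith
  then show ?thesis
  proof cases
    case 1
    have "DERIV (\<lambda>x. exp (- (1 / x)) / x ^ m) x :> flat_exp (m + 2) x - real m * flat_exp (m + 1) x"
    proof (cases m)
      case 0
      with 1 show ?thesis
        by (auto intro!: derivative_eq_intros simp: flat_exp_def field_simps power2_eq_square)
    next
      case (Suc l)
      have "l = 0" if "x ^ l \<noteq> x * x ^ (l - Suc 0)"
        using that by (cases l) auto
      with 1 Suc show ?thesis
        by (auto intro!: derivative_eq_intros simp: flat_exp_def field_simps power2_eq_square)
    qed
    then show ?thesis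
      by (rule has_field_derivative_transform_within_open[where S = "{0<..}"])
        (use 1 in \<open>auto simp: flat_exp_def\<close>)
  next
    case 2
    have "DERIV (\<lambda>x. 0) x :> flat_exp (m + 2) x - real m * flat_exp (m + 1) x"
      using 2 by (simp add: flat_exp_def)
    then show ?thesis
      by (rule has_field_derivative_transform_within_open[where S = "{..<0}"])
        (use 2 in \<open>auto simp: flat_exp_def\<close>)
  next
    case 3
    have "eventually (\<lambda>h. flat_exp (m + 1) h = (flat_exp m (0 + h) - flat_exp m 0) / h) (at 0)"
      by (auto simp: flat_exp_def eventually_at_filter)
    then have "((\<lambda>h. (flat_exp m (0 + h) - flat_exp m 0) / h) \<longlongrightarrow> 0) (at 0)"
      by (rule Lim_transform_eventually[OF flat_exp_tendsto_0])
    with 3 show ?thesis by (simp add: DERIV_def flat_exp_def)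
  qed
qed

lemma smooth_on_flat_exp: "smooth_on UNIV (flat_exp m)"
  unfolding smooth_on_def
proof
  fix k show "Ck_on k UNIV (flat_exp m)"
  proof (induction k arbitrary: m)
    case 0
    then show ?case
      by (simp add: continuous_at_imp_continuous_on DERIV_isCont[OF flat_exp_has_derivative])
  next
    case (Suc k)
    show ?case
    proof (rule Ck_on_SucI)
      show "(flat_exp m has_derivative
          (\<lambda>v. (flat_exp (m + 2) x + (- real m) * flat_exp (m + 1) x) * v)) (at x)" for x
        using flat_exp_has_derivative[of m x] by (simp add: has_field_derivative_def)
    qed (simp, intro Ck_on_mult Ck_on_add Ck_on_const Suc open_UNIV)
  qed
qed


text \<open>Differentiation under the integral sign reproduces an integral of the same kind with \<open>m\<close> raised by \<open>1\<close>;
  this is why the factor \<open>t ^ m\<close> is carried along.\<close>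

lemma smooth_on_segment_integral:
  fixes F :: "'a::euclidean_space \<Rightarrow> real"
  assumes S: "open S" "convex S" "z0 \<in> S"
  shows "smooth_on S F \<Longrightarrow> smooth_on S (\<lambda>z. integral {0..1} (\<lambda>t. t ^ m * F (z0 + t *\<^sub>R (z - z0))))"
proof -
  have seg: "z0 + t *\<^sub>R (z - z0) \<in> S" if "z \<in> S" "0 \<le> t" "t \<le> 1" for z t
    using convexD_alt[OF S(2) S(3) that(1) that(2,3)] by (simp add: algebra_simps)
  {
    fix m :: nat and F :: "'a \<Rightarrow> real" assume F: "smooth_on S F"
    let ?fx = "\<lambda>z t. (\<Sum>b\<in>Basis. (t ^ Suc m * frechet_derivative F (at (z0 + t *\<^sub>R (z - z0))) b)
      *\<^sub>R blinfun_inner_left b) :: 'a \<Rightarrow>\<^sub>L real"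
    have cont: "continuous_on (S \<times> cbox 0 1) (\<lambda>x. G (z0 + snd x *\<^sub>R (fst x - z0)))"
      if "continuous_on S G" for G :: "'a \<Rightarrow> real"
      by (rule continuous_on_compose2[OF that]) (auto intro!: continuous_intros seg)
    have cont1: "continuous_on (cbox 0 1) (\<lambda>t. t ^ m * G (z0 + t *\<^sub>R (z - z0)))"
      if "continuous_on S G" "z \<in> S" for G :: "'a \<Rightarrow> real" and z m
      by (intro continuous_intros continuous_on_compose2[OF that(1)]) (auto intro!: that seg)
    have cfd: "continuous_on S (\<lambda>x. frechet_derivative F (at x) b)" for b
      by (rule smooth_on_continuous[OF smooth_on_frechet[OF F]])
    have d: "((\<lambda>z. integral (cbox 0 1) (\<lambda>t. t ^ m * F (z0 + t *\<^sub>R (z - z0)))) has_derivative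
        blinfun_apply (integral (cbox 0 1) (?fx z))) (at z within S)" if z: "z \<in> S" for z
    proof (rule leibniz_rule[OF _ _ _ z S(2)])
      fix z t assume zt: "z \<in> S" "t \<in> cbox 0 (1::real)"
      let ?w = "z0 + t *\<^sub>R (z - z0)"
      have w: "?w \<in> S" using zt seg by auto
      note FD = smooth_on_has_derivative[OF F w]
      have "((\<lambda>z. t ^ m * F (z0 + t *\<^sub>R (z - z0))) has_derivative
        (\<lambda>v. t ^ m * frechet_derivative F (at ?w) (t *\<^sub>R v))) (at z within S)"
        by (rule has_derivative_mult_right, rule has_derivative_compose[where f = "\<lambda>z. z0 + t *\<^sub>R (z - z0)" and g = F, OF _ FD])
          (auto intro!: derivative_eq_intros)
      moreover have "t ^ m * frechet_derivative F (at ?w) (t *\<^sub>R v) = ?fx z t v" for v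
      proof -
        have "frechet_derivative F (at ?w) (t *\<^sub>R v) = t * frechet_derivative F (at ?w) (\<Sum>b\<in>Basis. (v \<bullet> b) *\<^sub>R b)"
          using has_derivative_linear[OF FD] by (simp add: linear_cmul euclidean_representation)
        also have "\<dots> = t * (\<Sum>b\<in>Basis. (v \<bullet> b) * frechet_derivative F (at ?w) b)"
          using has_derivative_linear[OF FD] by (simp add: linear_sum linear_cmul)
        finally show ?thesis
          by (simp add: blinfun.sum_left blinfun.scaleR_left sum_distrib_left algebra_simps)
      qed
      ultimately show "((\<lambda>z. t ^ m * F (z0 + t *\<^sub>R (z - z0))) has_derivative ?fx z t) (at z within S)"
        by simp
    next
      fix z assume "z \<in> S"
      then show "(\<lambda>t. t ^ m * F (z0 + t *\<^sub>R (z - z0))) integrable_on cbox 0 1"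
        by (intro integrable_continuous cont1 smooth_on_continuous[OF F])
    next
      show "continuous_on (S \<times> cbox 0 1) (\<lambda>(z, t). ?fx z t)"
        unfolding split_beta by (intro continuous_intros cont cfd)
    qed
    have "((\<lambda>z. integral {0..1} (\<lambda>t. t ^ m * F (z0 + t *\<^sub>R (z - z0)))) has_derivative
        (\<lambda>v. \<Sum>b\<in>Basis. (v \<bullet> b) * integral {0..1} (\<lambda>t. t ^ Suc m *
          frechet_derivative F (at (z0 + t *\<^sub>R (z - z0))) b))) (at z)" if z: "z \<in> S" for z
    proof -
      have i: "(\<lambda>t. t ^ Suc m * frechet_derivative F (at (z0 + t *\<^sub>R (z - z0))) b) integrable_on cbox 0 1" for b
        by (intro integrable_continuous cont1 cfd z)
      have "?fx z integrable_on cbox 0 1"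
        by (intro integrable_sum integrable_on_scaleR_left i) auto
      then have "blinfun_apply (integral (cbox 0 1) (?fx z)) v
        = integral (cbox 0 1) (\<lambda>t. ?fx z t v)" for v
        using blinfun_apply_integral by blast
      also have "\<And>v. integral (cbox 0 1) (\<lambda>t. ?fx z t v) = integral (cbox 0 1)
        (\<lambda>t. \<Sum>b\<in>Basis. (v \<bullet> b) * (t ^ Suc m * frechet_derivative F (at (z0 + t *\<^sub>R (z - z0))) b))"
        by (simp add: blinfun.sum_left blinfun.scaleR_left algebra_simps)
      also have "\<And>v. integral (cbox 0 1)
        (\<lambda>t. \<Sum>b\<in>Basis. (v \<bullet> b) * (t ^ Suc m * frechet_derivative F (at (z0 + t *\<^sub>R (z - z0))) b))
        = (\<Sum>b\<in>Basis. (v \<bullet> b) * integral (cbox 0 1) (\<lambda>t. t ^ Suc m *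
          frechet_derivative F (at (z0 + t *\<^sub>R (z - z0))) b))"
        using i by (subst integral_sum) (auto intro!: integrable_on_mult_right)
      finally show ?thesis using d[OF z] S(1) z at_within_open[of z S]
        by (metis (no_types, lifting) cbox_interval ext)
    qed
  } note D = this
  assume "smooth_on S F"
  then have "Ck_on k S (\<lambda>z. integral {0..1} (\<lambda>t. t ^ m * F (z0 + t *\<^sub>R (z - z0))))" for k
  proof (induction k arbitrary: m F)
    case 0
    show ?case unfolding Ck_on.simps
      by (intro continuous_at_imp_continuous_on ballI has_derivative_continuous[OF D[OF 0]])
  next
    case (Suc k)
    show ?case
      by (rule Ck_on_SucI[OF S(1)], erule D[OF Suc.prems],
        intro Ck_on_sum Ck_on_mult Ck_on_const S(1) Suc.IH smooth_on_frechet Suc.prems)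
  qed
  then show ?thesis by (simp add: smooth_on_def)
qed

text \<open>Hadamard's lemma: the difference \<open>h z - h z0\<close> is the integral of the derivative of \<open>h\<close> along the
  segment from \<open>z0\<close> to \<open>z\<close>, and the coefficients are the averaged partial derivatives.\<close>

lemma smooth_on_first_order_expansion:
  fixes h :: "'a::euclidean_space \<Rightarrow> real"
  assumes S: "open S" "convex S" "z0 \<in> S" and h: "smooth_on S h"
  obtains g where "\<And>b. smooth_on S (g b)" "\<And>b. g b z0 = frechet_derivative h (at z0) b"
    "\<And>z. z \<in> S \<Longrightarrow> h z = h z0 + (\<Sum>b\<in>Basis. ((z - z0) \<bullet> b) * g b z)"
proof
  let ?g = "\<lambda>b z. integral {0..1} (\<lambda>t. t ^ 0 * frechet_derivative h (at (z0 + t *\<^sub>R (z - z0))) b)"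
  show "smooth_on S (?g b)" for b
    by (intro smooth_on_segment_integral S smooth_on_frechet h)
  show "?g b z0 = frechet_derivative h (at z0) b" for b by simp
  fix z assume z: "z \<in> S"
  have seg: "z0 + t *\<^sub>R (z - z0) \<in> S" if "0 \<le> t" "t \<le> 1" for t
    using convexD_alt[OF S(2) S(3) z that] by (simp add: algebra_simps)
  let ?f = "\<lambda>t. \<Sum>b\<in>Basis. ((z - z0) \<bullet> b) * (t ^ 0 * frechet_derivative h (at (z0 + t *\<^sub>R (z - z0))) b)"
  have "(?f has_integral h (z0 + 1 *\<^sub>R (z - z0)) - h (z0 + 0 *\<^sub>R (z - z0))) {0..1}"
  proof (rule fundamental_theorem_of_calculus)
    fix t :: real assume t: "t \<in> {0..1}"
    let ?w = "z0 + t *\<^sub>R (z - z0)"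
    have w: "?w \<in> S" using t seg by auto
    note D = smooth_on_has_derivative[OF h w]
    have "((\<lambda>t. h (z0 + t *\<^sub>R (z - z0))) has_derivative
      (\<lambda>s. frechet_derivative h (at ?w) (s *\<^sub>R (z - z0)))) (at t within {0..1})"
      by (rule has_derivative_compose[where f = "\<lambda>t. z0 + t *\<^sub>R (z - z0)" and g = h, OF _ D]) (auto intro!: derivative_eq_intros)
    moreover have "frechet_derivative h (at ?w) (s *\<^sub>R (z - z0)) = s * ?f t" for s
    proof -
      have "frechet_derivative h (at ?w) (s *\<^sub>R (z - z0))
        = s * frechet_derivative h (at ?w) (\<Sum>b\<in>Basis. ((z - z0) \<bullet> b) *\<^sub>R b)"
        using has_derivative_linear[OF D] by (simp only: linear_cmul euclidean_representation) simp
      then show ?thesis using has_derivative_linear[OF D] by (simp add: linear_sum linear_cmul)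
    qed
    ultimately show "((\<lambda>t. h (z0 + t *\<^sub>R (z - z0))) has_vector_derivative ?f t) (at t within {0..1})"
      by (simp add: has_vector_derivative_def)
  qed simp
  moreover have "(\<lambda>t. t ^ 0 * frechet_derivative h (at (z0 + t *\<^sub>R (z - z0))) b) integrable_on {0..1}" for b
    by (intro integrable_continuous_interval continuous_intros
        continuous_on_compose2[OF smooth_on_continuous[OF smooth_on_frechet[OF h]]])
      (auto intro!: seg)
  then have "(?f has_integral (\<Sum>b\<in>Basis. ((z - z0) \<bullet> b) * ?g b z)) {0..1}"
    by (intro has_integral_sum has_integral_mult_right integrable_integral) auto
  ultimately have "h (z0 + 1 *\<^sub>R (z - z0)) - h (z0 + 0 *\<^sub>R (z - z0))
    = (\<Sum>b\<in>Basis. ((z - z0) \<bullet> b) * ?g b z)"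
    by (rule has_integral_unique)
  then show "h z = h z0 + (\<Sum>b\<in>Basis. ((z - z0) \<bullet> b) * ?g b z)" by simp
qed

section \<open>Smooth functions and tangent vectors in one chart\<close>

text \<open>A subset \<open>N\<close> of a manifold seen through one ambient chart \<open>\<phi>\<close>: \<open>M\<close> in itself, or a subset of the
  endomorphism bundle. The smooth structure of \<open>N\<close> consists of the restrictions of smooth functions.\<close>

locale smooth_chart =
  fixes C :: "'a \<Rightarrow> ('a \<Rightarrow> real) set" and N U :: "'a set" and \<phi> :: "'a \<Rightarrow> 'e::euclidean_space"
  assumes C_eq: "\<And>x. x \<in> N \<Longrightarrow> x \<in> U \<Longrightarrow> C x = smooth_near {(U, \<phi>)} N x"
begin

definition near :: "'a \<Rightarrow> ('a \<Rightarrow> bool) \<Rightarrow> bool"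
  where "near x P \<longleftrightarrow> (\<exists>W. open W \<and> \<phi> x \<in> W \<and> (\<forall>y\<in>N \<inter> U. \<phi> y \<in> W \<longrightarrow> P y))"

definition local_rep :: "'a \<Rightarrow> ('a \<Rightarrow> real) \<Rightarrow> ('e \<Rightarrow> real) \<Rightarrow> 'e set \<Rightarrow> bool"
  where "local_rep x f h W \<longleftrightarrow>
    open W \<and> \<phi> x \<in> W \<and> smooth_on W h \<and> (\<forall>y\<in>N \<inter> U. \<phi> y \<in> W \<longrightarrow> f y = h (\<phi> y))"

lemma mem_C_iff: "x \<in> N \<Longrightarrow> x \<in> U \<Longrightarrow> f \<in> C x \<longleftrightarrow> (\<exists>h W. local_rep x f h W)"
  by (auto simp: C_eq smooth_near_def local_rep_def)

lemma nearI: "open W \<Longrightarrow> \<phi> x \<in> W \<Longrightarrow> (\<And>y. y \<in> N \<Longrightarrow> y \<in> U \<Longrightarrow> \<phi> y \<in> W \<Longrightarrow> P y) \<Longrightarrow> near x P"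
  unfolding near_def by blast

lemma near_mono: "near x P \<Longrightarrow> (\<And>y. y \<in> N \<Longrightarrow> y \<in> U \<Longrightarrow> P y \<Longrightarrow> Q y) \<Longrightarrow> near x Q"
  unfolding near_def by blast

lemma near_conj: "near x P \<Longrightarrow> near x Q \<Longrightarrow> near x (\<lambda>y. P y \<and> Q y)"
  unfolding near_def by (meson IntD1 IntD2 IntI open_Int)

lemma near_all: "(\<And>y. y \<in> N \<Longrightarrow> y \<in> U \<Longrightarrow> P y) \<Longrightarrow> near x P"
  unfolding near_def by (rule exI[of _ UNIV]) auto

lemma near_refl: "near x P \<Longrightarrow> x \<in> N \<Longrightarrow> x \<in> U \<Longrightarrow> P x"
  unfolding near_def by blast

lemma near_finite: "finite I \<Longrightarrow> (\<And>i. i \<in> I \<Longrightarrow> near x (P i)) \<Longrightarrow> near x (\<lambda>y. \<forall>i\<in>I. P i y)"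
  by (induction I rule: finite_induct) (auto intro: near_all near_conj)

lemma C_cong:
  assumes "x \<in> N" "x \<in> U" "near x (\<lambda>y. f y = g y)"
  shows "f \<in> C x \<longleftrightarrow> g \<in> C x"
proof -
  have "g \<in> C x" if nr: "near x (\<lambda>y. f y = g y)" and f: "f \<in> C x" for f g
  proof -
    obtain h W where r: "local_rep x f h W" using f mem_C_iff[OF assms(1,2)] by blast
    obtain V where V: "open V" "\<phi> x \<in> V" "\<forall>y\<in>N \<inter> U. \<phi> y \<in> V \<longrightarrow> f y = g y"
      using nr unfolding near_def by blast
    have "local_rep x g h (W \<inter> V)"
      using r V unfolding local_rep_def by (auto intro: smooth_on_subset)
    then show ?thesis using mem_C_iff[OF assms(1,2)] by blast
  qed
  moreover have "near x (\<lambda>y. g y = f y)" using assms(3) by (rule near_mono) simp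
  ultimately show ?thesis using assms by blast
qed

context fixes x assumes x: "x \<in> N" "x \<in> U"
begin

lemma C_smooth_coord: "open W \<Longrightarrow> \<phi> x \<in> W \<Longrightarrow> smooth_on W h \<Longrightarrow> (\<lambda>y. h (\<phi> y)) \<in> C x"
  using x by (auto simp: mem_C_iff local_rep_def)

lemma C_coord: "(\<lambda>y. \<phi> y \<bullet> b) \<in> C x"
  by (rule C_smooth_coord[of UNIV]) (auto intro: smooth_on_bounded_linear bounded_linear_inner_left)

lemma C_const: "(\<lambda>y. c) \<in> C x"
  by (rule C_smooth_coord[of UNIV]) (auto intro: smooth_on_const)

lemma C_binop:
  assumes "\<And>S (f :: 'e \<Rightarrow> real) g. open S \<Longrightarrow> smooth_on S f \<Longrightarrow> smooth_on S g \<Longrightarrow> smooth_on S (\<lambda>x. F (f x) (g x))"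
    and "f \<in> C x" "g \<in> C x"
  shows "(\<lambda>y. F (f y) (g y)) \<in> C x"
proof -
  obtain h W h' W' where r: "local_rep x f h W" "local_rep x g h' W'"
    using assms(2,3) mem_C_iff[OF x] by blast
  then have "local_rep x (\<lambda>y. F (f y) (g y)) (\<lambda>z. F (h z) (h' z)) (W \<inter> W')"
    unfolding local_rep_def
    by (auto intro!: assms(1) intro: smooth_on_subset)
  then show ?thesis using mem_C_iff[OF x] by blast
qed

lemma C_add: "f \<in> C x \<Longrightarrow> g \<in> C x \<Longrightarrow> (\<lambda>y. f y + g y) \<in> C x"
  by (rule C_binop) (auto intro: smooth_on_add)

lemma C_mult: "f \<in> C x \<Longrightarrow> g \<in> C x \<Longrightarrow> (\<lambda>y. f y * g y) \<in> C x"
  by (rule C_binop) (auto intro: smooth_on_mult)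

lemma C_diff: "f \<in> C x \<Longrightarrow> g \<in> C x \<Longrightarrow> (\<lambda>y. f y - g y) \<in> C x"
  using C_add[of f "\<lambda>y. (-1) * g y"] C_mult[OF C_const, of g "-1"] by simp

lemma C_sum: "(\<And>i. i \<in> I \<Longrightarrow> f i \<in> C x) \<Longrightarrow> (\<lambda>y. \<Sum>i\<in>I. f i y) \<in> C x"
  by (induction I rule: infinite_finite_induct) (auto intro: C_const C_add)

lemma C_compose:
  assumes "f \<in> C x" "open T" "f x \<in> T" "smooth_on T g"
  shows "(\<lambda>y. g (f y)) \<in> C x"
proof -
  obtain h W where r: "local_rep x f h W" using assms(1) mem_C_iff[OF x] by blast
  let ?W = "{w \<in> W. h w \<in> T}"
  have o: "open ?W"
    using r assms(2) smooth_on_continuous[of W h] continuous_on_open_vimage[of W h]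
    by (auto simp: local_rep_def vimage_def Int_def conj_commute Collect_conj_eq[symmetric])
  have "smooth_on ?W (\<lambda>z. g (h z))"
    by (rule smooth_on_compose[OF o assms(2)])
      (use r assms(4) in \<open>auto simp: local_rep_def intro: smooth_on_subset\<close>)
  then have "local_rep x (\<lambda>y. g (f y)) (\<lambda>z. g (h z)) ?W"
    using r x assms(3) o unfolding local_rep_def by auto
  then show ?thesis using mem_C_iff[OF x] by blast
qed

lemma near_value:
  assumes "f \<in> C x" "open T" "f x \<in> T"
  shows "near x (\<lambda>y. f y \<in> T)"
proof -
  obtain h W where r: "local_rep x f h W" using assms(1) mem_C_iff[OF x] by blast
  have "open {w \<in> W. h w \<in> T}"
    using r assms(2) smooth_on_continuous[of W h] continuous_on_open_vimage[of W h]
    by (auto simp: local_rep_def vimage_def Int_def conj_commute Collect_conj_eq[symmetric])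
  then show ?thesis
    by (rule nearI) (use r x assms(3) in \<open>auto simp: local_rep_def\<close>)
qed

lemma near_mem_C: "f \<in> C x \<Longrightarrow> near x (\<lambda>y. f \<in> C y)"
proof -
  assume "f \<in> C x"
  then obtain h W where r: "local_rep x f h W" using mem_C_iff[OF x] by blast
  then have "near x (\<lambda>y. local_rep y f h W)"
    by (intro nearI[of W]) (auto simp: local_rep_def)
  then show ?thesis by (rule near_mono) (use mem_C_iff in metis)
qed

text \<open>A derivation sees only germs: the indicator function of the points away from \<open>x\<close> is
  smooth near \<open>x\<close>, and multiplies \<open>f - g\<close> to itself if \<open>f = g\<close> near \<open>x\<close>.\<close>

lemma tangent_near_cong:
  assumes v: "v \<in> tangent C x" and nr: "near x (\<lambda>y. f y = g y)"
  shows "v f = v g"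
proof (cases "f \<in> C x")
  case False
  then show ?thesis using v C_cong[OF x nr] by (simp add: tangent_def)
next
  case True
  then have g: "g \<in> C x" using C_cong[OF x nr] by simp
  have lin: "v (\<lambda>y. a * p y + b * q y) = a * v p + b * v q" if "p \<in> C x" "q \<in> C x" for a b p q
    using v that by (force simp: tangent_def linear_upon_def scaleR_fun_def plus_fun_def)
  obtain W where W: "open W" "\<phi> x \<in> W" "\<forall>y\<in>N \<inter> U. \<phi> y \<in> W \<longrightarrow> f y = g y"
    using nr unfolding near_def by blast
  define \<theta> :: "'a \<Rightarrow> real" where "\<theta> y = (if y \<in> N \<inter> U \<and> \<phi> y \<in> W then 0 else 1)" for y
  define d where "d y = 1 * f y + (-1) * g y" for y
  have d: "d \<in> C x" unfolding d_def using True g by (intro C_add C_mult C_const)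
  have "near x (\<lambda>y. \<theta> y = 0)" using W by (intro nearI[of W]) (auto simp: \<theta>_def)
  then have \<theta>: "\<theta> \<in> C x" using C_cong[OF x, of \<theta> "\<lambda>y. 0"] C_const by blast
  have "(\<lambda>y. d y * \<theta> y) = d" using W by (auto simp: d_def \<theta>_def)
  moreover have "v (\<lambda>y. d y * \<theta> y) = v d * \<theta> x + d x * v \<theta>"
    using v d \<theta> by (auto simp: tangent_def)
  moreover have "\<theta> x = 0" "d x = 0" using x W by (auto simp: \<theta>_def d_def)
  ultimately have "v d = 0" by simp
  moreover have "v d = 1 * v f + (-1) * v g" unfolding d_def by (rule lin[OF True g])
  ultimately show ?thesis by simp
qed

context fixes v assumes v: "v \<in> tangent C x"
begin

lemma tangent_lin: "p \<in> C x \<Longrightarrow> q \<in> C x \<Longrightarrow> v (\<lambda>y. a * p y + b * q y) = a * v p + b * v q"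
  using v by (force simp: tangent_def linear_upon_def scaleR_fun_def plus_fun_def)

lemma tangent_mult: "p \<in> C x \<Longrightarrow> q \<in> C x \<Longrightarrow> v (\<lambda>y. p y * q y) = v p * q x + p x * v q"
  using v by (auto simp: tangent_def)

lemma tangent_add: "p \<in> C x \<Longrightarrow> q \<in> C x \<Longrightarrow> v (\<lambda>y. p y + q y) = v p + v q"
  using tangent_lin[of p q 1 1] by simp

lemma tangent_diff: "p \<in> C x \<Longrightarrow> q \<in> C x \<Longrightarrow> v (\<lambda>y. p y - q y) = v p - v q"
  using tangent_lin[of p q 1 "-1"] by simp

lemma tangent_const: "v (\<lambda>y. c) = 0"
proof -
  have "v (\<lambda>y. 1 * 1) = v (\<lambda>y. 1) * 1 + 1 * v (\<lambda>y. 1)"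
    by (rule tangent_mult[OF C_const C_const])
  then have "v (\<lambda>y. 1) = 0" by simp
  then show ?thesis using tangent_lin[OF C_const[of 1] C_const[of 1], of c 0] by simp
qed

lemma tangent_cmult: "q \<in> C x \<Longrightarrow> v (\<lambda>y. c * q y) = c * v q"
  using tangent_mult[OF C_const[of c], of q] by (simp add: tangent_const)

lemma tangent_sum:
  "(\<And>i. i \<in> I \<Longrightarrow> f i \<in> C x) \<Longrightarrow> v (\<lambda>y. \<Sum>i\<in>I. f i y) = (\<Sum>i\<in>I. v (f i))"
  by (induction I rule: infinite_finite_induct) (auto simp: tangent_const tangent_add C_sum)

lemma tangent_outside: "f \<notin> C x \<Longrightarrow> v f = 0"
  using v by (simp add: tangent_def)

end

lemma tangent_lincomb:
  assumes "v \<in> tangent C x" "w \<in> tangent C x"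
  shows "a *\<^sub>R v + b *\<^sub>R w \<in> tangent C x"
  using assms unfolding tangent_def linear_upon_def
  by (auto simp: scaleR_fun_def plus_fun_def algebra_simps)

end

lemma subspace_tangent: "x \<in> N \<Longrightarrow> x \<in> U \<Longrightarrow> subspace (tangent C x)"
  unfolding subspace_def
  using tangent_lincomb[of x _ _ 1 1] tangent_lincomb[of x _ _ _ 0]
  by (auto simp: tangent_def linear_upon_def scaleR_fun_def zero_fun_def)

definition velocity :: "'a tvec \<Rightarrow> 'e"
  where "velocity v = (\<Sum>b\<in>Basis. v (\<lambda>y. \<phi> y \<bullet> b) *\<^sub>R b)"

lemma velocity_inner: "b \<in> Basis \<Longrightarrow> velocity v \<bullet> b = v (\<lambda>y. \<phi> y \<bullet> b)"
  by (simp add: velocity_def)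

text \<open>By Hadamard's lemma a derivation is the directional derivative along its velocity.\<close>

lemma tangent_eq_derivative:
  assumes x: "x \<in> N" "x \<in> U" and v: "v \<in> tangent C x" and r: "local_rep x f h W"
  shows "v f = frechet_derivative h (at (\<phi> x)) (velocity v)"
proof -
  obtain e where e: "e > 0" "ball (\<phi> x) e \<subseteq> W"
    using r unfolding local_rep_def by (meson openE)
  let ?B = "ball (\<phi> x) e"
  have hB: "smooth_on ?B h" using r e by (auto simp: local_rep_def intro: smooth_on_subset)
  have "\<phi> x \<in> ?B" using e by simp
  then obtain g where g: "\<And>b. smooth_on ?B (g b)" "\<And>b. g b (\<phi> x) = frechet_derivative h (at (\<phi> x)) b"
      "\<And>z. z \<in> ?B \<Longrightarrow> h z = h (\<phi> x) + (\<Sum>b\<in>Basis. ((z - \<phi> x) \<bullet> b) * g b z)"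
    using smooth_on_first_order_expansion[OF open_ball convex_ball _ hB] by metis
  have gC: "(\<lambda>y. g b (\<phi> y)) \<in> C x" for b
    using e by (intro C_smooth_coord[OF x, of ?B] g) auto
  have cC: "(\<lambda>y. \<phi> y \<bullet> b - \<phi> x \<bullet> b) \<in> C x" for b
    by (intro C_diff[OF x] C_coord[OF x] C_const[OF x])
  have "near x (\<lambda>y. f y = h (\<phi> x) + (\<Sum>b\<in>Basis. (\<phi> y \<bullet> b - \<phi> x \<bullet> b) * g b (\<phi> y)))"
  proof (rule nearI[of ?B])
    fix y assume y: "y \<in> N" "y \<in> U" "\<phi> y \<in> ?B"
    then have "f y = h (\<phi> y)" using r e by (auto simp: local_rep_def)
    then show "f y = h (\<phi> x) + (\<Sum>b\<in>Basis. (\<phi> y \<bullet> b - \<phi> x \<bullet> b) * g b (\<phi> y))"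
      using g(3)[OF y(3)] by (simp add: inner_diff_left)
  qed (use e in auto)
  then have "v f = v (\<lambda>y. h (\<phi> x) + (\<Sum>b\<in>Basis. (\<phi> y \<bullet> b - \<phi> x \<bullet> b) * g b (\<phi> y)))"
    by (rule tangent_near_cong[OF x v])
  also have "\<dots> = (\<Sum>b\<in>Basis. v (\<lambda>y. (\<phi> y \<bullet> b - \<phi> x \<bullet> b) * g b (\<phi> y)))"
    using gC cC by (simp add: tangent_add[OF x v] tangent_const[OF x v] tangent_sum[OF x v]
        C_const[OF x] C_sum[OF x] C_mult[OF x])
  also have "\<dots> = (\<Sum>b\<in>Basis. v (\<lambda>y. \<phi> y \<bullet> b) * frechet_derivative h (at (\<phi> x)) b)"
    using gC cC by (simp add: tangent_mult[OF x v] tangent_diff[OF x v] tangent_const[OF x v]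
        C_coord[OF x] C_const[OF x] g(2))
  also have "\<dots> = frechet_derivative h (at (\<phi> x)) (velocity v)"
  proof -
    have "linear (frechet_derivative h (at (\<phi> x)))"
      using r smooth_on_linear_derivative[of W h "\<phi> x"] by (auto simp: local_rep_def)
    then show ?thesis by (simp add: velocity_def linear_sum linear_cmul)
  qed
  finally show ?thesis .
qed

lemma tangent_eqI:
  assumes x: "x \<in> N" "x \<in> U" and v: "v \<in> tangent C x" "w \<in> tangent C x" and "velocity v = velocity w"
  shows "v = w"
proof
  fix f show "v f = w f"
    using tangent_eq_derivative[OF x] assms mem_C_iff[OF x] tangent_outside[OF x]
    by (cases "f \<in> C x") metis+
qed

text \<open>The directions in which the derivative of a smooth ambient function depends only on its restriction to
  \<open>N\<close>: the tangent space of \<open>N\<close> at \<open>x\<close> in coordinates.\<close>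

definition admissible :: "'a \<Rightarrow> 'e set"
  where "admissible x =
    {w. \<forall>h W. local_rep x (\<lambda>y. 0) h W \<longrightarrow> frechet_derivative h (at (\<phi> x)) w = 0}"

definition dvec :: "'a \<Rightarrow> 'e \<Rightarrow> 'a tvec"
  where "dvec x w f = (if f \<in> C x
    then frechet_derivative (SOME h. \<exists>W. local_rep x f h W) (at (\<phi> x)) w else 0)"

text \<open>If the straight line through \<open>\<phi> x\<close> in direction \<open>w\<close> stays in the image of \<open>N\<close>, then a function vanishing on
  \<open>N\<close> vanishes along it. The tangent spaces of \<open>\<G>\<close> are spanned by directions of this kind.\<close>

lemma admissible_line:
  assumes "eventually (\<lambda>t. \<phi> x + t *\<^sub>R w \<in> \<phi> ` (N \<inter> U)) (at 0)"
  shows "w \<in> admissible x"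
  unfolding admissible_def
proof (intro CollectI allI impI)
  fix h W assume r: "local_rep x (\<lambda>y. 0) h W"
  then have D: "(h has_derivative frechet_derivative h (at (\<phi> x + 0 *\<^sub>R w))) (at (\<phi> x + 0 *\<^sub>R w))"
    by (auto simp: local_rep_def intro: smooth_on_has_derivative)
  have *: "((\<lambda>t. h (\<phi> x + t *\<^sub>R w)) has_derivative (\<lambda>t. frechet_derivative h (at (\<phi> x + 0 *\<^sub>R w)) (t *\<^sub>R w))) (at 0)"
    by (rule has_derivative_compose[where f = "\<lambda>t. \<phi> x + t *\<^sub>R w" and g = h, OF _ D])
      (auto intro!: derivative_eq_intros)
  have "((\<lambda>t. \<phi> x + t *\<^sub>R w) \<longlongrightarrow> \<phi> x + 0 *\<^sub>R w) (at 0)" by (intro tendsto_intros)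
  then have "eventually (\<lambda>t. \<phi> x + t *\<^sub>R w \<in> W) (at 0)"
    using r by (auto simp: local_rep_def elim!: topological_tendstoD)
  with assms have e0: "eventually (\<lambda>t. 0 = h (\<phi> x + t *\<^sub>R w)) (at 0)"
    by eventually_elim (use r in \<open>auto simp: local_rep_def\<close>)
  have "h (\<phi> x) = 0"
  proof -
    have "((\<lambda>t. h (\<phi> x + t *\<^sub>R w)) \<longlongrightarrow> h (\<phi> x + 0 *\<^sub>R w)) (at 0)"
      using has_derivative_continuous[OF *] by (simp add: isCont_def)
    moreover have "((\<lambda>t. h (\<phi> x + t *\<^sub>R w)) \<longlongrightarrow> 0) (at 0)"
      by (rule Lim_transform_eventually[OF tendsto_const e0])
    ultimately show ?thesis using tendsto_unique[of "at (0::real)"] by fastforce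
  qed
  then have "((\<lambda>t. 0) has_derivative (\<lambda>t. frechet_derivative h (at (\<phi> x + 0 *\<^sub>R w)) (t *\<^sub>R w))) (at 0)"
    by (intro has_derivative_transform_eventually[OF *] eventually_mono[OF e0]) auto
  then have "(\<lambda>t. frechet_derivative h (at (\<phi> x + 0 *\<^sub>R w)) (t *\<^sub>R w)) = (\<lambda>t::real. 0)"
    using has_derivative_unique has_derivative_const by blast
  from fun_cong[OF this, of 1] show "frechet_derivative h (at (\<phi> x)) w = 0" by simp
qed

context fixes x assumes x: "x \<in> N" "x \<in> U"
begin

lemma frechet_rep_diff:
  assumes "local_rep x f h W" "local_rep x g k V"
  shows "local_rep x (\<lambda>y. a * f y + b * g y) (\<lambda>z. a * h z + b * k z) (W \<inter> V)"
    and "frechet_derivative (\<lambda>z. a * h z + b * k z) (at (\<phi> x)) w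
      = a * frechet_derivative h (at (\<phi> x)) w + b * frechet_derivative k (at (\<phi> x)) w"
proof -
  show "local_rep x (\<lambda>y. a * f y + b * g y) (\<lambda>z. a * h z + b * k z) (W \<inter> V)"
    using assms unfolding local_rep_def
    by (auto intro!: smooth_on_add smooth_on_mult smooth_on_const intro: smooth_on_subset)
  have "((\<lambda>z. a * h z + b * k z) has_derivative (\<lambda>w. a * frechet_derivative h (at (\<phi> x)) w
      + b * frechet_derivative k (at (\<phi> x)) w)) (at (\<phi> x))"
    using assms by (intro has_derivative_add has_derivative_mult_right smooth_on_has_derivative)
      (auto simp: local_rep_def)
  from frechet_derivative_at[OF this]
  show "frechet_derivative (\<lambda>z. a * h z + b * k z) (at (\<phi> x)) w
      = a * frechet_derivative h (at (\<phi> x)) w + b * frechet_derivative k (at (\<phi> x)) w"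
    by metis
qed

lemma dvec_rep:
  assumes w: "w \<in> admissible x" and r: "local_rep x f h W"
  shows "dvec x w f = frechet_derivative h (at (\<phi> x)) w"
proof -
  define k where "k = (SOME h. \<exists>W. local_rep x f h W)"
  have "\<exists>W. local_rep x f k W" unfolding k_def by (rule someI[of _ h]) (use r in blast)
  then obtain V where s: "local_rep x f k V" by blast
  have "frechet_derivative (\<lambda>z. 1 * h z + (-1) * k z) (at (\<phi> x)) w = 0"
    using frechet_rep_diff(1)[OF r s, of 1 "-1"] w unfolding admissible_def by auto
  then have "frechet_derivative h (at (\<phi> x)) w = frechet_derivative k (at (\<phi> x)) w"
    using frechet_rep_diff(2)[OF r s, of 1 "-1"] by simp
  moreover have "f \<in> C x" using r mem_C_iff[OF x] by blast
  ultimately show ?thesis by (simp add: dvec_def k_def)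
qed

lemma dvec_tangent:
  assumes w: "w \<in> admissible x"
  shows "dvec x w \<in> tangent C x"
  unfolding tangent_def linear_upon_def
proof (intro CollectI conjI ballI allI impI)
  fix f g a b assume "f \<in> C x" "g \<in> C x"
  then obtain h W k V where r: "local_rep x f h W" "local_rep x g k V" using mem_C_iff[OF x] by blast
  have "(a *\<^sub>R f + b *\<^sub>R g) = (\<lambda>y. a * f y + b * g y)" by (auto simp: scaleR_fun_def plus_fun_def)
  then show "dvec x w (a *\<^sub>R f + b *\<^sub>R g) = a *\<^sub>R dvec x w f + b *\<^sub>R dvec x w g"
    using dvec_rep[OF w frechet_rep_diff(1)[OF r, of a b]] dvec_rep[OF w r(1)] dvec_rep[OF w r(2)]
      frechet_rep_diff(2)[OF r, of a b w] by simp
  have "local_rep x (\<lambda>y. f y * g y) (\<lambda>z. h z * k z) (W \<inter> V)"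
    using r unfolding local_rep_def by (auto intro!: smooth_on_mult intro: smooth_on_subset)
  note m = dvec_rep[OF w this]
  have "((\<lambda>z. h z * k z) has_derivative (\<lambda>w. h (\<phi> x) * frechet_derivative k (at (\<phi> x)) w
      + frechet_derivative h (at (\<phi> x)) w * k (\<phi> x))) (at (\<phi> x))"
    using r by (intro has_derivative_mult smooth_on_has_derivative) (auto simp: local_rep_def)
  from frechet_derivative_at[OF this, symmetric]
  show "dvec x w (\<lambda>y. f y * g y) = dvec x w f * g x + f x * dvec x w g"
    using m dvec_rep[OF w r(1)] dvec_rep[OF w r(2)] r x by (simp add: local_rep_def)
next
  fix f assume "f \<notin> C x" then show "dvec x w f = 0" by (simp add: dvec_def)
qed

lemma dvec_coord: "w \<in> admissible x \<Longrightarrow> dvec x w (\<lambda>y. \<phi> y \<bullet> b) = w \<bullet> b"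
proof -
  assume w: "w \<in> admissible x"
  have bl: "bounded_linear (\<lambda>z. z \<bullet> b)" by (rule bounded_linear_inner_left)
  have "local_rep x (\<lambda>y. \<phi> y \<bullet> b) (\<lambda>z. z \<bullet> b) UNIV"
    unfolding local_rep_def using smooth_on_bounded_linear[OF open_UNIV bl] by auto
  from dvec_rep[OF w this] show ?thesis
    using frechet_derivative_at[OF bounded_linear_imp_has_derivative[OF bl]] by metis
qed

lemma velocity_dvec: "w \<in> admissible x \<Longrightarrow> velocity (dvec x w) = w"
  by (simp add: velocity_def dvec_coord euclidean_representation)

lemma velocity_admissible: "v \<in> tangent C x \<Longrightarrow> velocity v \<in> admissible x"
  unfolding admissible_def using tangent_eq_derivative[OF x] tangent_const[OF x] by fastforce

lemma dvec_velocity: "v \<in> tangent C x \<Longrightarrow> dvec x (velocity v) = v"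
  by (rule tangent_eqI[OF x]) (auto intro: dvec_tangent velocity_admissible velocity_dvec)

lemma admissible_lincomb:
  assumes "v \<in> admissible x" "w \<in> admissible x"
  shows "a *\<^sub>R v + b *\<^sub>R w \<in> admissible x"
  unfolding admissible_def
proof (intro CollectI allI impI)
  fix h W assume r: "local_rep x (\<lambda>y. 0) h W"
  then have "linear (frechet_derivative h (at (\<phi> x)))"
    using smooth_on_linear_derivative[of W h "\<phi> x"] by (auto simp: local_rep_def)
  moreover have "frechet_derivative h (at (\<phi> x)) v = 0" "frechet_derivative h (at (\<phi> x)) w = 0"
    using assms r unfolding admissible_def by blast+
  ultimately show "frechet_derivative h (at (\<phi> x)) (a *\<^sub>R v + b *\<^sub>R w) = 0"
    by (simp add: linear_add linear_cmul)
qed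

text \<open>Smoothness need only be tested on the coordinate functions, because a derivation acts on any other
  function by the chain rule.\<close>

lemma vfield_atI:
  assumes "\<And>y. y \<in> N \<Longrightarrow> X y \<in> tangent C y"
    and "\<And>b. b \<in> Basis \<Longrightarrow> (\<lambda>y. X y (\<lambda>z. \<phi> z \<bullet> b)) \<in> C x"
  shows "vfield_at C N x X"
  unfolding vfield_at_def
proof (intro conjI ballI assms(1))
  fix f assume "f \<in> C x"
  then obtain h W where r: "local_rep x f h W" using mem_C_iff[OF x] by blast
  let ?F = "\<lambda>y. \<Sum>b\<in>Basis. X y (\<lambda>z. \<phi> z \<bullet> b) * frechet_derivative h (at (\<phi> y)) b"
  have "near x (\<lambda>y. X y f = ?F y)"
  proof (rule nearI[of W])
    fix y assume y: "y \<in> N" "y \<in> U" "\<phi> y \<in> W"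
    then have ry: "local_rep y f h W" using r by (auto simp: local_rep_def)
    have "linear (frechet_derivative h (at (\<phi> y)))"
      using r y smooth_on_linear_derivative[of W h "\<phi> y"] by (auto simp: local_rep_def)
    then show "X y f = ?F y"
      using tangent_eq_derivative[OF y(1,2) assms(1)[OF y(1)] ry]
      by (simp add: velocity_def linear_sum linear_cmul)
  qed (use r in \<open>auto simp: local_rep_def\<close>)
  moreover have "?F \<in> C x"
    by (intro C_sum[OF x] C_mult[OF x] assms(2) C_smooth_coord[OF x, of W] smooth_on_frechet)
      (use r in \<open>auto simp: local_rep_def\<close>)
  ultimately show "(\<lambda>y. X y f) \<in> C x"
    using C_cong[OF x, of "\<lambda>y. X y f" ?F] by simp
qed

lemma lie_bracket_tangent:
  assumes X: "vfield_at C N x X" and Y: "vfield_at C N x Y"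
  shows "lie_bracket C X Y x \<in> tangent C x"
  unfolding tangent_def linear_upon_def
proof (intro CollectI conjI ballI allI impI)
  have Xx: "X x \<in> tangent C x" and Yx: "Y x \<in> tangent C x"
    using X Y x by (auto simp: vfield_at_def)
  have XC: "(\<lambda>y. X y f) \<in> C x" and YC: "(\<lambda>y. Y y f) \<in> C x" if "f \<in> C x" for f
    using X Y that by (auto simp: vfield_at_def)
  fix f g a b assume fg: "f \<in> C x" "g \<in> C x"
  have nf: "near x (\<lambda>y. f \<in> C y)" "near x (\<lambda>y. g \<in> C y)" using near_mem_C[OF x] fg by auto
  {
    fix Z Z' assume Z: "vfield_at C N x Z" and Z': "vfield_at C N x Z'"
    have Zx: "Z x \<in> tangent C x" using Z x by (auto simp: vfield_at_def)
    have ZC: "(\<lambda>y. Z' y f) \<in> C x" "(\<lambda>y. Z' y g) \<in> C x" using Z' fg by (auto simp: vfield_at_def)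
    have "near x (\<lambda>y. Z' y (\<lambda>y. a * f y + b * g y) = a * Z' y f + b * Z' y g)"
      using near_conj[OF nf] by (rule near_mono) (use Z' tangent_lin in \<open>auto simp: vfield_at_def\<close>)
    from tangent_near_cong[OF x Zx this]
    have 1: "Z x (\<lambda>y. Z' y (\<lambda>y. a * f y + b * g y)) = a * Z x (\<lambda>y. Z' y f) + b * Z x (\<lambda>y. Z' y g)"
      using tangent_lin[OF x Zx ZC] by simp
    have "near x (\<lambda>y. Z' y (\<lambda>y. f y * g y) = Z' y f * g y + f y * Z' y g)"
      using near_conj[OF nf] by (rule near_mono) (use Z' tangent_mult in \<open>auto simp: vfield_at_def\<close>)
    from tangent_near_cong[OF x Zx this]
    have 2: "Z x (\<lambda>y. Z' y (\<lambda>y. f y * g y)) = Z x (\<lambda>y. Z' y f) * g x + Z' x f * Z x g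
        + (Z x f * Z' x g + f x * Z x (\<lambda>y. Z' y g))"
      using ZC fg by (simp add: tangent_add[OF x Zx] tangent_mult[OF x Zx] C_mult[OF x])
    note 1 2
  } note Z = this
  have "(a *\<^sub>R f + b *\<^sub>R g) = (\<lambda>y. a * f y + b * g y)" by (auto simp: scaleR_fun_def plus_fun_def)
  then show "lie_bracket C X Y x (a *\<^sub>R f + b *\<^sub>R g) = a *\<^sub>R lie_bracket C X Y x f + b *\<^sub>R lie_bracket C X Y x g"
    using Z(1)[OF X Y] Z(1)[OF Y X] fg C_add[OF x C_mult[OF x C_const[OF x]] C_mult[OF x C_const[OF x]]]
    by (simp add: lie_bracket_def algebra_simps)
  show "lie_bracket C X Y x (\<lambda>y. f y * g y) = lie_bracket C X Y x f * g x + f x * lie_bracket C X Y x g"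
    using Z(2)[OF X Y] Z(2)[OF Y X] fg C_mult[OF x] by (simp add: lie_bracket_def algebra_simps)
next
  fix f assume "f \<notin> C x" then show "lie_bracket C X Y x f = 0" by (simp add: lie_bracket_def)
qed

text \<open>The Leibniz rule for \<open>L\<^sub>X\<close>, together with \<open>L\<^sub>X dg = d(X g)\<close>. The vector \<open>v\<close> is extended to a field because
  the Lie derivative of a form is defined by its values on fields.\<close>

lemma lie_form_eq:
  assumes X: "vfield_at C N x X"
    and \<alpha>: "near x (\<lambda>y. \<forall>v\<in>tangent C y. \<alpha> y v = (\<Sum>i\<in>I. a i y * v (g i)))"
    and ag: "\<And>i. i \<in> I \<Longrightarrow> a i \<in> C x" "\<And>i. i \<in> I \<Longrightarrow> g i \<in> C x"
    and v: "v \<in> tangent C x" and ex: "\<exists>Y. vfield_at C N x Y \<and> Y x = v"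
  shows "lie_form C N X \<alpha> x v = (\<Sum>i\<in>I. X x (a i) * v (g i) + a i x * v (\<lambda>y. X y (g i)))"
    (is "_ = ?R")
proof -
  have "X x (\<lambda>y. \<alpha> y (Y y)) - \<alpha> x (lie_bracket C X Y x) = ?R"
    if Y: "vfield_at C N x Y" "Y x = v" for Y
  proof -
    have Xx: "X x \<in> tangent C x" using X x by (auto simp: vfield_at_def)
    have YC: "(\<lambda>y. Y y f) \<in> C x" if "f \<in> C x" for f using Y that by (auto simp: vfield_at_def)
    have "near x (\<lambda>y. \<alpha> y (Y y) = (\<Sum>i\<in>I. a i y * Y y (g i)))"
      using \<alpha> by (rule near_mono) (use Y in \<open>auto simp: vfield_at_def\<close>)
    then have "X x (\<lambda>y. \<alpha> y (Y y)) = X x (\<lambda>y. \<Sum>i\<in>I. a i y * Y y (g i))"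
      by (rule tangent_near_cong[OF x Xx])
    also have "\<dots> = (\<Sum>i\<in>I. X x (a i) * v (g i) + a i x * X x (\<lambda>y. Y y (g i)))"
      using Y(2) by (simp add: tangent_sum[OF x Xx] tangent_mult[OF x Xx] C_mult[OF x] ag YC)
    finally have 1: "X x (\<lambda>y. \<alpha> y (Y y)) = (\<Sum>i\<in>I. X x (a i) * v (g i) + a i x * X x (\<lambda>y. Y y (g i)))" .
    have 2: "\<alpha> x (lie_bracket C X Y x) = (\<Sum>i\<in>I. a i x * lie_bracket C X Y x (g i))"
      using near_refl[OF \<alpha> x] lie_bracket_tangent[OF X Y(1)] by blast
    show ?thesis unfolding 1 2 sum_subtractf[symmetric]
      using ag Y(2) by (intro sum.cong) (auto simp: lie_bracket_def algebra_simps)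
  qed
  then have "(THE c. \<forall>Y. vfield_at C N x Y \<and> Y x = v \<longrightarrow>
      c = X x (\<lambda>y. \<alpha> y (Y y)) - \<alpha> x (lie_bracket C X Y x)) = ?R"
    using ex by (intro the_equality) auto
  then show ?thesis using v by (simp add: lie_form_def)
qed

text \<open>The bracket involves only first derivatives at \<open>x\<close>, hence only germs. This allows sections to be
  compared on the chart where they are computed.\<close>

lemma courant_near_cong:
  assumes "near x (\<lambda>y. E y = E' y)" "near x (\<lambda>y. F y = F' y)"
    and "fst (E x) \<in> tangent C x" "fst (F x) \<in> tangent C x"
  shows "courant C N E F x = courant C N E' F' x"
proof -
  have x0: "E x = E' x" "F x = F' x" using near_refl[OF assms(1) x] near_refl[OF assms(2) x] by auto
  have lie: "lie_bracket C X Y x = lie_bracket C X' Y' x"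
    if "near x (\<lambda>y. X y = X' y)" "near x (\<lambda>y. Y y = Y' y)" "X x \<in> tangent C x" "Y x \<in> tangent C x"
    for X X' Y Y'
  proof
    fix f
    have "X x = X' x" "Y x = Y' x" using near_refl[OF that(1) x] near_refl[OF that(2) x] by auto
    moreover have "X x (\<lambda>y. Y y f) = X x (\<lambda>y. Y' y f)"
      by (rule tangent_near_cong[OF x that(3)], rule near_mono[OF that(2)]) simp
    moreover have "Y x (\<lambda>y. X y f) = Y x (\<lambda>y. X' y f)"
      by (rule tangent_near_cong[OF x that(4)], rule near_mono[OF that(1)]) simp
    ultimately show "lie_bracket C X Y x f = lie_bracket C X' Y' x f"
      by (simp add: lie_bracket_def)
  qed
  have form: "lie_form C N X \<alpha> x = lie_form C N X' \<alpha>' x"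
    if nr: "near x (\<lambda>y. X y = X' y)" "near x (\<lambda>y. \<alpha> y = \<alpha>' y)" "X x \<in> tangent C x"
    for X X' \<alpha> \<alpha>'
  proof -
    have "X x = X' x" "\<alpha> x = \<alpha>' x" using near_refl[OF nr(1) x] near_refl[OF nr(2) x] by auto
    moreover have "X x (\<lambda>y. \<alpha> y (Y y)) = X x (\<lambda>y. \<alpha>' y (Y y))" for Y
      by (rule tangent_near_cong[OF x nr(3)], rule near_mono[OF nr(2)]) simp
    moreover have "lie_bracket C X Y x = lie_bracket C X' Y x" if "vfield_at C N x Y" for Y
    proof (rule lie[OF nr(1)])
      show "near x (\<lambda>y. Y y = Y y)" by (rule near_all) simp
    qed (use that x nr(3) in \<open>auto simp: vfield_at_def\<close>)
    ultimately have "(c = X x (\<lambda>y. \<alpha> y (Y y)) - \<alpha> x (lie_bracket C X Y x)) \<longleftrightarrow>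
      (c = X' x (\<lambda>y. \<alpha>' y (Y y)) - \<alpha>' x (lie_bracket C X' Y x))" if "vfield_at C N x Y" for c Y
      using that by simp
    then show ?thesis unfolding lie_form_def by (intro ext if_cong refl arg_cong[where f = The]) blast
  qed
  have d: "diff_fun C u x = diff_fun C u' x" if "near x (\<lambda>y. u y = u' y)" for u u'
    unfolding diff_fun_def using tangent_near_cong[OF x _ that] by auto
  have nE: "near x (\<lambda>y. fst (E y) = fst (E' y))" "near x (\<lambda>y. snd (E y) = snd (E' y))"
    and nF: "near x (\<lambda>y. fst (F y) = fst (F' y))" "near x (\<lambda>y. snd (F y) = snd (F' y))"
    by (rule near_mono[OF assms(1)] near_mono[OF assms(2)]; simp)+
  have "near x (\<lambda>y. snd (F y) (fst (E y)) - snd (E y) (fst (F y))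
      = snd (F' y) (fst (E' y)) - snd (E' y) (fst (F' y)))"
    using near_conj[OF assms(1,2)] by (rule near_mono) simp
  with lie[OF nE(1) nF(1) assms(3,4)] form[OF nE(1) nF(2) assms(3)] form[OF nF(1) nE(2) assms(4)]
  show ?thesis unfolding courant_def Let_def using d by (auto simp del: One_nat_def)
qed

end

end

section \<open>The base manifold in a chart\<close>

lemma smooth_near_chart_change:
  fixes \<phi> :: "'a \<Rightarrow> 'e::euclidean_space" and \<psi> :: "'a \<Rightarrow> 'f::euclidean_space"
  assumes W: "open W" "\<phi> x \<in> W" "smooth_on W \<tau>"
    and t: "\<And>y. y \<in> N \<Longrightarrow> y \<in> U \<Longrightarrow> \<phi> y \<in> W \<Longrightarrow> y \<in> V \<and> \<psi> y = \<tau> (\<phi> y)"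
    and x: "x \<in> N" "x \<in> U"
    and f: "f \<in> smooth_near {(V, \<psi>)} N x"
  shows "f \<in> smooth_near {(U, \<phi>)} N x"
proof -
  obtain S h where S: "open S" "\<psi> x \<in> S" "smooth_on S h" "\<And>y. y \<in> N \<inter> V \<Longrightarrow> \<psi> y \<in> S \<Longrightarrow> f y = h (\<psi> y)"
    using f by (auto simp: smooth_near_def)
  let ?W = "{w \<in> W. \<tau> w \<in> S}"
  have o: "open ?W"
    using W S(1) smooth_on_continuous[of W \<tau>] continuous_on_open_vimage[of W \<tau>]
    by (auto simp: vimage_def Int_def conj_commute Collect_conj_eq[symmetric])
  have "smooth_on ?W (\<lambda>z. h (\<tau> z))"
    by (rule smooth_on_compose[OF o S(1)]) (use W S in \<open>auto intro: smooth_on_subset\<close>)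
  moreover have "\<phi> x \<in> ?W" using W x t[OF x] S by auto
  moreover have "\<forall>y\<in>N \<inter> U. \<phi> y \<in> ?W \<longrightarrow> f y = h (\<tau> (\<phi> y))" using t S(4) by auto
  ultimately show ?thesis using x o unfolding smooth_near_def by blast
qed

text \<open>Smoothness with respect to a family of charts can be tested in any one further chart compatible with
  the family, in particular in one that does not belong to it.\<close>

lemma smooth_near_eq_single:
  assumes x: "x \<in> N" "x \<in> U"
    and ex: "\<exists>(V, \<psi>)\<in>\<C>. x \<in> V"
    and fwd: "\<And>V \<psi> f. (V, \<psi>) \<in> \<C> \<Longrightarrow> x \<in> V \<Longrightarrow> f \<in> smooth_near {(V, \<psi>)} N x \<Longrightarrow> f \<in> smooth_near {(U, \<phi>)} N x"
    and bck: "\<And>V \<psi> f. (V, \<psi>) \<in> \<C> \<Longrightarrow> x \<in> V \<Longrightarrow> f \<in> smooth_near {(U, \<phi>)} N x \<Longrightarrow> f \<in> smooth_near {(V, \<psi>)} N x"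
  shows "smooth_near \<C> N x = smooth_near {(U, \<phi>)} N x"
proof -
  have un: "f \<in> smooth_near \<C> N x \<longleftrightarrow> (\<exists>(V, \<psi>)\<in>\<C>. x \<in> V \<and> f \<in> smooth_near {(V, \<psi>)} N x)" for f
    unfolding smooth_near_def by auto
  show ?thesis
  proof (intro equalityI subsetI)
    fix f assume "f \<in> smooth_near \<C> N x"
    then show "f \<in> smooth_near {(U, \<phi>)} N x" using un fwd by blast
  next
    fix f assume "f \<in> smooth_near {(U, \<phi>)} N x"
    then show "f \<in> smooth_near \<C> N x" using un ex bck by blast
  qed
qed

lemma pair_commute: "pair A B = pair B A"
  by (simp add: pair_def)

lemma pair_lin_left:
  assumes "A \<in> gtangent C x" "B \<in> gtangent C x" "X \<in> gtangent C x"
  shows "pair (a *\<^sub>R A + b *\<^sub>R B) X = a * pair A X + b * pair B X"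
  using assms by (auto simp: pair_def gtangent_def cotangent_def linear_upon_def
      scaleR_fun_def plus_fun_def field_simps)

context smooth_chart
begin

lemma subspace_cotangent: "subspace (cotangent C x)"
  unfolding subspace_def cotangent_def linear_upon_def
  by (auto simp: scaleR_fun_def plus_fun_def zero_fun_def algebra_simps)

lemma subspace_gtangent: "x \<in> N \<Longrightarrow> x \<in> U \<Longrightarrow> subspace (gtangent C x)"
  using subspace_tangent[of x] subspace_cotangent[of x]
  unfolding gtangent_def subspace_def by (auto simp: zero_prod_def)

lemma cotangent_lin:
  assumes x: "x \<in> N" "x \<in> U" and \<alpha>: "\<alpha> \<in> cotangent C x"
  shows "(\<And>i. i \<in> I \<Longrightarrow> v i \<in> tangent C x) \<Longrightarrow> \<alpha> (\<Sum>i\<in>I. c i *\<^sub>R v i) = (\<Sum>i\<in>I. c i * \<alpha> (v i))"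
proof (induction I rule: infinite_finite_induct)
  have lin: "\<alpha> (a *\<^sub>R u + b *\<^sub>R w) = a * \<alpha> u + b * \<alpha> w" if "u \<in> tangent C x" "w \<in> tangent C x" for a b u w
    using \<alpha> that by (auto simp: cotangent_def linear_upon_def)
  have z: "\<alpha> 0 = 0" using lin[of 0 0 0 0] subspace_0[OF subspace_tangent[OF x]] by simp
  {
    case (infinite A)
    show ?case unfolding sum.infinite[OF infinite(1)] by (rule z)
  next
    case empty
    show ?case unfolding sum.empty by (rule z)
  next
    case (insert i F)
    have "(\<Sum>i\<in>F. c i *\<^sub>R v i) \<in> tangent C x"
      using insert.prems by (intro subspace_sum subspace_scale subspace_tangent[OF x]) auto
    note l = lin[OF insert.prems[OF insertI1] this, of "c i" 1, unfolded scaleR_one mult_1]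
    show ?case unfolding sum.insert[OF insert(1,2)] l using insert.IH insert.prems by simp
  }
qed

lemma cotangent_zero: "x \<in> N \<Longrightarrow> x \<in> U \<Longrightarrow> \<alpha> \<in> cotangent C x \<Longrightarrow> \<alpha> 0 = 0"
  using cotangent_lin[of x \<alpha> "{}" "\<lambda>_. 0"] by simp

lemma pair_zero_left: "x \<in> N \<Longrightarrow> x \<in> U \<Longrightarrow> X \<in> gtangent C x \<Longrightarrow> pair 0 X = 0"
  using pair_lin_left[of 0 C x 0 X 0 0] subspace_0[OF subspace_gtangent] by auto

lemma pair_sum_left:
  assumes x: "x \<in> N" "x \<in> U" and X: "X \<in> gtangent C x"
  shows "(\<And>i. i \<in> I \<Longrightarrow> A i \<in> gtangent C x) \<Longrightarrow> pair (\<Sum>i\<in>I. c i *\<^sub>R A i) X = (\<Sum>i\<in>I. c i * pair (A i) X)"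
proof (induction I rule: infinite_finite_induct)
  case (insert i F)
  then show ?case
    using pair_lin_left[of "A i" C x "\<Sum>i\<in>F. c i *\<^sub>R A i" X "c i" 1] subspace_gtangent[OF x] X
    by (simp add: subspace_sum subspace_scale)
qed (auto simp: pair_zero_left[OF x X])

lemma pair_sum_right:
  assumes x: "x \<in> N" "x \<in> U" and X: "X \<in> gtangent C x"
  shows "(\<And>i. i \<in> I \<Longrightarrow> A i \<in> gtangent C x) \<Longrightarrow> pair X (\<Sum>i\<in>I. c i *\<^sub>R A i) = (\<Sum>i\<in>I. c i * pair X (A i))"
  unfolding pair_commute[of X] by (rule pair_sum_left[OF x X])

lemma pair_diff_left:
  assumes "A \<in> gtangent C x" "B \<in> gtangent C x" "X \<in> gtangent C x"
  shows "pair (A - B) X = pair A X - pair B X"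
  using pair_lin_left[OF assms, of 1 "-1"] by simp

lemma pair_add_left:
  assumes "A \<in> gtangent C x" "B \<in> gtangent C x" "X \<in> gtangent C x"
  shows "pair (A + B) X = pair A X + pair B X"
  using pair_lin_left[OF assms, of 1 1] by simp

lemma pair_scale_left:
  assumes "A \<in> gtangent C x" "X \<in> gtangent C x"
  shows "pair (a *\<^sub>R A) X = a * pair A X"
  using pair_lin_left[OF assms(1,1,2), of a 0] by simp

end

locale manifold_chart =
  fixes \<A> :: "('p::{t2_space, second_countable_topology}, real ^ 'n) chart set"
    and U :: "'p set" and \<phi> :: "'p \<Rightarrow> real ^ 'n"
  assumes atlas: "smooth_atlas \<A>" and chart: "(U, \<phi>) \<in> \<A>"
begin

lemma chartD: "(V, \<psi>) \<in> \<A> \<Longrightarrow> open V" "(V, \<psi>) \<in> \<A> \<Longrightarrow> open (\<psi> ` V)"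
  "(V, \<psi>) \<in> \<A> \<Longrightarrow> homeomorphism V (\<psi> ` V) \<psi> (inv_into V \<psi>)"
  using atlas by (auto simp: smooth_atlas_def)

lemma open_U: "open U" and open_image: "open (\<phi> ` U)"
  and homeo: "homeomorphism U (\<phi> ` U) \<phi> (inv_into U \<phi>)"
  using chartD chart by auto

lemma chart_cover: "\<exists>(V, \<psi>)\<in>\<A>. p \<in> V"
proof -
  have "p \<in> (\<Union>(V, \<psi>)\<in>\<A>. V)" using atlas by (simp add: smooth_atlas_def)
  then show ?thesis by auto
qed

lemma chart_inv: "y \<in> U \<Longrightarrow> inv_into U \<phi> (\<phi> y) = y" "z \<in> \<phi> ` U \<Longrightarrow> \<phi> (inv_into U \<phi> z) = z"
  using homeo by (auto simp: homeomorphism_def)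

lemma open_chart_image:
  assumes "(V, \<psi>) \<in> \<A>" "open S" "S \<subseteq> V" shows "open (\<psi> ` S)"
proof -
  have "openin (top_of_set (\<psi> ` V)) (\<psi> ` S)"
    using homeomorphism_imp_open_map[OF chartD(3)[OF assms(1)]] assms by (simp add: openin_open_eq chartD)
  then show ?thesis using chartD(2)[OF assms(1)] openin_open_trans by blast
qed

lemma smooth_transition:
  "(V, \<psi>) \<in> \<A> \<Longrightarrow> (V', \<psi>') \<in> \<A> \<Longrightarrow> smooth_on (\<psi> ` (V \<inter> V')) (\<psi>' \<circ> inv_into V \<psi>)"
  using atlas unfolding smooth_atlas_def by blast

lemma atlas_change:
  assumes "(V, \<psi>) \<in> \<A>" "(V', \<psi>') \<in> \<A>" "x \<in> V" "x \<in> V'" "f \<in> smooth_near {(V', \<psi>')} UNIV x"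
  shows "f \<in> smooth_near {(V, \<psi>)} UNIV x"
proof (rule smooth_near_chart_change[where W = "\<psi> ` (V \<inter> V')" and \<tau> = "\<psi>' \<circ> inv_into V \<psi>"])
  show "open (\<psi> ` (V \<inter> V'))" using assms by (intro open_chart_image) (auto intro: chartD)
  have "inj_on \<psi> V" using chartD(3)[OF assms(1)] by (auto simp: homeomorphism_def intro: inj_on_inverseI)
  then show "y \<in> V' \<and> \<psi>' y = (\<psi>' \<circ> inv_into V \<psi>) (\<psi> y)" if "y \<in> V" "\<psi> y \<in> \<psi> ` (V \<inter> V')" for y
    using that by (auto simp: inj_on_def)
qed (use assms smooth_transition in auto)

sublocale base: smooth_chart "cinf \<A>" UNIV U \<phi>
  by standard (rule smooth_near_eq_single; use chart_cover atlas_change chart in blast)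

lemma near_iff: "q \<in> U \<Longrightarrow> base.near q P \<longleftrightarrow> (\<exists>S. open S \<and> q \<in> S \<and> S \<subseteq> U \<and> (\<forall>y\<in>S. P y))"
proof
  assume q: "q \<in> U" and "base.near q P"
  then obtain W where W: "open W" "\<phi> q \<in> W" "\<And>y. y \<in> U \<Longrightarrow> \<phi> y \<in> W \<Longrightarrow> P y"
    unfolding base.near_def by auto
  have "continuous_on U \<phi>" using homeo by (simp add: homeomorphism_def)
  then have "open (\<phi> -` W \<inter> U)" using continuous_on_open_vimage[OF open_U] W by blast
  then show "\<exists>S. open S \<and> q \<in> S \<and> S \<subseteq> U \<and> (\<forall>y\<in>S. P y)"
    using W q by (intro exI[of _ "\<phi> -` W \<inter> U"]) auto
next
  assume q: "q \<in> U" and "\<exists>S. open S \<and> q \<in> S \<and> S \<subseteq> U \<and> (\<forall>y\<in>S. P y)"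
  then obtain S where S: "open S" "q \<in> S" "S \<subseteq> U" "\<And>y. y \<in> S \<Longrightarrow> P y" by auto
  show "base.near q P"
  proof (rule base.nearI[OF open_chart_image[OF chart S(1,3)]])
    show "\<phi> q \<in> \<phi> ` S" using S by auto
    fix y assume "y \<in> U" "\<phi> y \<in> \<phi> ` S"
    then have "y \<in> S" using S(3) chart_inv(1) by (metis imageE subsetD)
    then show "P y" by (rule S(4))
  qed
qed

lemma admissible_base: "q \<in> U \<Longrightarrow> w \<in> base.admissible q"
proof (rule base.admissible_line)
  assume q: "q \<in> U"
  have "((\<lambda>t. \<phi> q + t *\<^sub>R w) \<longlongrightarrow> \<phi> q + 0 *\<^sub>R w) (at 0)" by (intro tendsto_intros)
  then show "eventually (\<lambda>t. \<phi> q + t *\<^sub>R w \<in> \<phi> ` (UNIV \<inter> U)) (at 0)"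
    using open_image q by (auto elim!: topological_tendstoD)
qed

abbreviation coordf :: "'n \<Rightarrow> 'p \<Rightarrow> real" where "coordf i \<equiv> \<lambda>y. \<phi> y $ i"

text \<open>The coordinate frame is cut off outside the chart domain, since a section must be given at every point
  of \<open>M\<close>.\<close>

definition frame :: "'p \<Rightarrow> 'n + 'n \<Rightarrow> 'p gvec"
  where "frame q a = (if q \<in> U then coord_frame \<A> (U, \<phi>) q a else 0)"

abbreviation coord_vec :: "'p \<Rightarrow> 'n \<Rightarrow> 'p tvec" where "coord_vec q i \<equiv> fst (frame q (Inl i))"

lemma coordf_mem: "q \<in> U \<Longrightarrow> coordf i \<in> cinf \<A> q"
  using base.C_coord[of q "axis i 1"] by (simp add: inner_axis)

lemma coord_vec_eq: "q \<in> U \<Longrightarrow> coord_vec q i = base.dvec q (axis i 1)"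
proof
  fix f assume q: "q \<in> U"
  show "coord_vec q i f = base.dvec q (axis i 1) f"
  proof (cases "f \<in> cinf \<A> q")
    case True
    then obtain h W where r: "base.local_rep q f h W" using base.mem_C_iff q by auto
    have "(h has_derivative frechet_derivative h (at (\<phi> q))) (at (\<phi> q))"
      using r by (auto simp: base.local_rep_def intro: smooth_on_has_derivative)
    then have "((f \<circ> inv_into U \<phi>) has_derivative frechet_derivative h (at (\<phi> q))) (at (\<phi> q))"
      by (rule has_derivative_transform_within_open[where s = "W \<inter> \<phi> ` U"])
        (use r q open_image in \<open>auto simp: base.local_rep_def chart_inv\<close>)
    then have "frechet_derivative (f \<circ> inv_into U \<phi>) (at (\<phi> q)) = frechet_derivative h (at (\<phi> q))"
      using frechet_derivative_at by metis
    then show ?thesis using True q base.dvec_rep[OF _ _ admissible_base[OF q] r]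
      by (simp add: frame_def coord_frame_def)
  qed (simp add: frame_def coord_frame_def base.dvec_def q)
qed

lemma coord_vec_coordf: "q \<in> U \<Longrightarrow> coord_vec q i (coordf j) = (if i = j then 1 else 0)"
  using base.dvec_coord[of q "axis i 1" "axis j 1", unfolded inner_axis_axis] admissible_base[of q]
  by (simp add: coord_vec_eq inner_axis)

lemma zero_GTM: "0 \<in> GTM \<A> q"
  by (auto simp: gtangent_def tangent_def cotangent_def linear_upon_def zero_prod_def)

lemma coord_vec_TM: "q \<in> U \<Longrightarrow> coord_vec q i \<in> TM \<A> q"
  by (simp add: coord_vec_eq base.dvec_tangent admissible_base)

lemma TM_expand:
  assumes q: "q \<in> U" and v: "v \<in> TM \<A> q"
  shows "v = (\<Sum>i\<in>UNIV. v (coordf i) *\<^sub>R coord_vec q i)"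
proof (rule base.tangent_eqI[OF _ q v])
  show t: "(\<Sum>i\<in>UNIV. v (coordf i) *\<^sub>R coord_vec q i) \<in> TM \<A> q"
    using base.subspace_tangent[of q] q by (auto intro!: subspace_sum subspace_scale coord_vec_TM)
  have ap: "(\<Sum>i\<in>I. g i) f = (\<Sum>i\<in>I. g i f)" if "finite I" for I and g :: "'n \<Rightarrow> 'p tvec" and f
    using that by (induction I rule: finite_induct) (auto simp: zero_fun_def plus_fun_def)
  have "(\<Sum>i\<in>UNIV. v (coordf i) *\<^sub>R coord_vec q i) (coordf j) = v (coordf j)" for j
    by (simp add: ap scaleR_fun_def coord_vec_coordf[OF q] if_distrib cong: if_cong)
  then show "base.velocity v = base.velocity (\<Sum>i\<in>UNIV. v (coordf i) *\<^sub>R coord_vec q i)"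
    unfolding base.velocity_def by (intro sum.cong) (auto simp: Basis_vec_def inner_axis)
qed auto

lemma frame_GTM: "frame q a \<in> GTM \<A> q"
proof (cases "q \<in> U")
  case q: True
  show ?thesis
  proof (cases a)
    case (Inl i)
    then have "frame q a = (coord_vec q i, 0)" using q by (simp add: frame_def coord_frame_def)
    then show ?thesis using coord_vec_TM[OF q] subspace_0[OF base.subspace_cotangent]
      by (simp add: gtangent_def)
  next
    case (Inr i)
    have "snd (frame q a) \<in> cotangent (cinf \<A>) q" "fst (frame q a) = 0"
      using Inr q subspace_add[OF base.subspace_tangent[OF UNIV_I q]]
        subspace_scale[OF base.subspace_tangent[OF UNIV_I q]]
      by (auto simp: frame_def coord_frame_def cotangent_def linear_upon_def scaleR_fun_def plus_fun_def)
    then show ?thesis using subspace_0[OF base.subspace_tangent[OF UNIV_I q]]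
      by (simp add: gtangent_def mem_Times_iff)
  qed
qed (simp add: frame_def zero_GTM)

text \<open>The components of a generalized vector in the coordinate frame.\<close>

definition crd :: "'p \<Rightarrow> 'p gvec \<Rightarrow> 'n + 'n \<Rightarrow> real"
  where "crd q A a = (case a of Inl i \<Rightarrow> fst A (coordf i) | Inr i \<Rightarrow> snd A (coord_vec q i))"

lemma snd_frame_Inr: "q \<in> U \<Longrightarrow> v \<in> TM \<A> q \<Longrightarrow> snd (frame q (Inr i)) v = v (coordf i)"
  by (simp add: frame_def coord_frame_def)

lemma snd_frame_Inl: "snd (frame q (Inl i)) = 0"
  by (simp add: frame_def coord_frame_def)

lemma fst_frame_Inr: "fst (frame q (Inr i)) = 0"
  by (simp add: frame_def coord_frame_def)

lemma cotangent_expand: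
  assumes q: "q \<in> U" and \<alpha>: "\<alpha> \<in> cotangent (cinf \<A>) q" and v: "v \<in> TM \<A> q"
  shows "\<alpha> v = (\<Sum>i\<in>UNIV. v (coordf i) * \<alpha> (coord_vec q i))"
  using base.cotangent_lin[OF UNIV_I q \<alpha>, of UNIV "coord_vec q" "\<lambda>i. v (coordf i)"] TM_expand[OF q v] coord_vec_TM[OF q]
  by simp

lemma fst_sum_apply: "finite I \<Longrightarrow> fst (\<Sum>i\<in>I. A i) f = (\<Sum>i\<in>I. fst (A i) f)"
  for A :: "'i \<Rightarrow> 'q gvec"
  by (induction I rule: finite_induct) (auto simp: zero_fun_def plus_fun_def)

lemma snd_sum_apply: "finite I \<Longrightarrow> snd (\<Sum>i\<in>I. A i) f = (\<Sum>i\<in>I. snd (A i) f)"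
  for A :: "'i \<Rightarrow> 'q gvec"
  by (induction I rule: finite_induct) (auto simp: zero_fun_def plus_fun_def)

lemma GTM_expand:
  assumes q: "q \<in> U" and A: "A \<in> GTM \<A> q"
  shows "A = (\<Sum>a\<in>UNIV. crd q A a *\<^sub>R frame q a)"
proof -
  have t: "fst A \<in> TM \<A> q" "snd A \<in> cotangent (cinf \<A>) q" using A by (auto simp: gtangent_def)
  have un: "(\<Sum>a\<in>(UNIV :: ('n + 'n) set). g a) = (\<Sum>i\<in>UNIV. g (Inl i)) + (\<Sum>i\<in>UNIV. g (Inr i))"
    for g :: "'n + 'n \<Rightarrow> 'p gvec"
    by (simp add: UNIV_Plus_UNIV[symmetric] sum.Plus del: UNIV_Plus_UNIV)
  have "fst A f = fst (\<Sum>a\<in>UNIV. crd q A a *\<^sub>R frame q a) f" for f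
    unfolding un using fun_cong[OF TM_expand[OF q t(1)], of f]
    by (simp add: fst_sum fst_frame_Inr crd_def)
  moreover have "snd A v = snd (\<Sum>a\<in>UNIV. crd q A a *\<^sub>R frame q a) v" for v
  proof (cases "v \<in> TM \<A> q")
    case True
    have 0: "snd (frame q (Inl i)) v = 0" for i by (simp add: snd_frame_Inl)
    have "snd (\<Sum>a\<in>UNIV. crd q A a *\<^sub>R frame q a) v
      = (\<Sum>i\<in>UNIV. snd (crd q A (Inl i) *\<^sub>R frame q (Inl i)) v) + (\<Sum>i\<in>UNIV. snd (crd q A (Inr i) *\<^sub>R frame q (Inr i)) v)"
      unfolding un snd_add plus_fun_def by (simp only: snd_sum_apply[OF finite])
    also have "\<dots> = (\<Sum>i\<in>UNIV. snd A (coord_vec q i) * v (coordf i))"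
      by (simp only: snd_scaleR scaleR_fun_def 0 snd_frame_Inr[OF q True]) (simp add: crd_def)
    also have "\<dots> = snd A v"
      unfolding cotangent_expand[OF q t(2) True] by (simp only: mult.commute)
    finally show ?thesis by (rule sym)
  next
    case False
    then have "snd (frame q a) v = 0" for a using frame_GTM[of q a] by (auto simp: gtangent_def cotangent_def)
    moreover have "snd A v = 0" using False t(2) by (auto simp: cotangent_def)
    ultimately show ?thesis by (simp add: snd_sum_apply scaleR_fun_def)
  qed
  ultimately show ?thesis by (intro prod_eqI ext)
qed

lemma pair_crd:
  assumes q: "q \<in> U" and A: "A \<in> GTM \<A> q" "B \<in> GTM \<A> q"
  shows "pair A B = (\<Sum>i\<in>UNIV. (crd q B (Inl i) * crd q A (Inr i) + crd q A (Inl i) * crd q B (Inr i)) / 2)"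
  using A cotangent_expand[OF q, of "snd A" "fst B"] cotangent_expand[OF q, of "snd B" "fst A"]
  by (auto simp: gtangent_def pair_def crd_def sum.distrib sum_divide_distrib add_divide_distrib)

lemma GTM_span: "q \<in> U \<Longrightarrow> GTM \<A> q = span (range (frame q))"
proof (intro equalityI subsetI)
  fix A assume q: "q \<in> U" and "A \<in> GTM \<A> q"
  then show "A \<in> span (range (frame q))"
    using GTM_expand[OF q, of A] by (metis (no_types, lifting) rangeI span_base span_scale span_sum)
next
  fix A assume "q \<in> U" "A \<in> span (range (frame q))"
  then show "A \<in> GTM \<A> q"
    using span_minimal[OF _ base.subspace_gtangent, of "range (frame q)" q] frame_GTM by blast
qed

abbreviation gsec :: "'p \<Rightarrow> ('p \<Rightarrow> 'p gvec) \<Rightarrow> bool"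
  where "gsec \<equiv> gsection_at (cinf \<A>) UNIV"

lemma vfield_coord_vec: "q \<in> U \<Longrightarrow> vfield_at (cinf \<A>) UNIV q (\<lambda>y. coord_vec y i)"
proof (rule base.vfield_atI)
  fix b :: "real ^ 'n" assume q: "q \<in> U" and "b \<in> Basis"
  then obtain j where j: "b = axis j 1" by (auto simp: Basis_vec_def)
  have "base.near q (\<lambda>y. coord_vec y i (\<lambda>z. \<phi> z \<bullet> b) = (if i = j then 1 else 0))"
    by (rule base.near_all) (simp add: j inner_axis coord_vec_coordf)
  then show "(\<lambda>y. coord_vec y i (\<lambda>z. \<phi> z \<bullet> b)) \<in> cinf \<A> q"
    using base.C_cong[OF UNIV_I q, of "\<lambda>y. coord_vec y i (\<lambda>z. \<phi> z \<bullet> b)" "\<lambda>y. if i = j then 1 else 0"]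
      base.C_const[OF UNIV_I q] by simp
qed (use frame_GTM in \<open>auto simp: gtangent_def mem_Times_iff\<close>)

text \<open>The components of a smooth section are smooth by definition of smooth fields and forms applied to the
  coordinate functions and coordinate fields; the converse is \<open>vfield_atI\<close> and the expansion of a form in
  the \<open>dx\<^sub>i\<close>.\<close>

lemma gsec_iff:
  assumes q: "q \<in> U"
  shows "gsec q s \<longleftrightarrow> (\<forall>y. s y \<in> GTM \<A> y) \<and> (\<forall>a. (\<lambda>y. crd y (s y) a) \<in> cinf \<A> q)"
proof (intro iffI conjI allI)
  assume s: "gsec q s"
  show "s y \<in> GTM \<A> y" for y
    using s by (auto simp: gsection_at_def vfield_at_def oneform_at_def gtangent_def mem_Times_iff)
  show "(\<lambda>y. crd y (s y) a) \<in> cinf \<A> q" for a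
  proof (cases a)
    case (Inl i)
    then show ?thesis using s coordf_mem[OF q] by (simp add: crd_def gsection_at_def vfield_at_def)
  next
    case (Inr i)
    then show ?thesis using s vfield_coord_vec[OF q] by (simp add: crd_def gsection_at_def oneform_at_def)
  qed
next
  assume s: "(\<forall>y. s y \<in> GTM \<A> y) \<and> (\<forall>a. (\<lambda>y. crd y (s y) a) \<in> cinf \<A> q)"
  then have t: "fst (s y) \<in> TM \<A> y" "snd (s y) \<in> cotangent (cinf \<A>) y" for y
    by (auto simp: gtangent_def mem_Times_iff)
  have "vfield_at (cinf \<A>) UNIV q (\<lambda>y. fst (s y))"
  proof (rule base.vfield_atI[OF UNIV_I q t(1)])
    fix b :: "real ^ 'n" assume "b \<in> Basis"
    then obtain j where j: "b = axis j 1" by (auto simp: Basis_vec_def)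
    then show "(\<lambda>y. fst (s y) (\<lambda>z. \<phi> z \<bullet> b)) \<in> cinf \<A> q"
      using conjunct2[OF s, rule_format, of "Inl j"] by (simp add: inner_axis crd_def)
  qed
  moreover have "oneform_at (cinf \<A>) UNIV q (\<lambda>y. snd (s y))"
    unfolding oneform_at_def
  proof (intro conjI allI ballI impI t)
    fix X assume X: "vfield_at (cinf \<A>) UNIV q X"
    let ?F = "\<lambda>y. \<Sum>i\<in>UNIV. X y (coordf i) * crd y (s y) (Inr i)"
    have "base.near q (\<lambda>y. snd (s y) (X y) = ?F y)"
      by (rule base.near_all) (use X cotangent_expand t(2) in \<open>auto simp: vfield_at_def crd_def\<close>)
    moreover have "?F \<in> cinf \<A> q"
      using X coordf_mem[OF q] s by (intro base.C_sum base.C_mult q) (auto simp: vfield_at_def)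
    ultimately show "(\<lambda>y. snd (s y) (X y)) \<in> cinf \<A> q"
      using base.C_cong[OF UNIV_I q, of "\<lambda>y. snd (s y) (X y)" ?F] by simp
  qed
  ultimately show "gsec q s" by (simp add: gsection_at_def)
qed

lemma gsec_GTM: "q \<in> U \<Longrightarrow> gsec q s \<Longrightarrow> s y \<in> GTM \<A> y"
  by (simp add: gsec_iff)

lemma gsec_frame: "q \<in> U \<Longrightarrow> gsec q (\<lambda>y. frame y a)"
proof -
  assume q: "q \<in> U"
  have "(\<lambda>y. crd y (frame y a) b) \<in> cinf \<A> q" for b
  proof -
    have "base.near q (\<lambda>y. crd y (frame y a) b = (if a = b then 1 else 0))"
      by (rule base.near_all)
        (cases a; cases b; simp add: crd_def coord_vec_coordf snd_frame_Inr coord_vec_TM fst_frame_Inr snd_frame_Inl; auto)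
    then show ?thesis
      using base.C_cong[OF UNIV_I q, of "\<lambda>y. crd y (frame y a) b" "\<lambda>y. if a = b then 1 else 0"]
        base.C_const[OF UNIV_I q] by simp
  qed
  then show ?thesis using gsec_iff[OF q] frame_GTM by blast
qed

lemma crd_lin: "crd q (a *\<^sub>R A + b *\<^sub>R B) c = a * crd q A c + b * crd q B c"
  by (cases c) (auto simp: crd_def scaleR_fun_def plus_fun_def)

lemma GTM_any_subspace: "subspace (GTM \<A> y)"
proof -
  obtain V \<psi> where "(V, \<psi>) \<in> \<A>" "y \<in> V" using chart_cover by blast
  then interpret c: manifold_chart \<A> V \<psi> using atlas by unfold_locales
  show ?thesis using c.base.subspace_gtangent \<open>y \<in> V\<close> by simp
qed

lemma gsec_lincomb:
  assumes q: "q \<in> U" and "f \<in> cinf \<A> q" "g \<in> cinf \<A> q" "gsec q s" "gsec q t"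
  shows "gsec q (\<lambda>y. f y *\<^sub>R s y + g y *\<^sub>R t y)"
  using assms(2-) unfolding gsec_iff[OF q] crd_lin
  by (auto intro!: base.C_add base.C_mult q subspace_add subspace_scale GTM_any_subspace)

lemma gsec_zero: "q \<in> U \<Longrightarrow> gsec q (\<lambda>y. 0)"
  using gsec_lincomb[of q "\<lambda>y. 0" "\<lambda>y. 0" "\<lambda>y. frame y undefined" "\<lambda>y. frame y undefined"]
    base.C_const[of q 0] gsec_frame by simp

lemma gsec_scale: "q \<in> U \<Longrightarrow> f \<in> cinf \<A> q \<Longrightarrow> gsec q s \<Longrightarrow> gsec q (\<lambda>y. f y *\<^sub>R s y)"
  using gsec_lincomb[of q f "\<lambda>y. 0" s s] base.C_const[of q 0] by simp

lemma gsec_sum: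
  "q \<in> U \<Longrightarrow> (\<And>i. i \<in> I \<Longrightarrow> f i \<in> cinf \<A> q) \<Longrightarrow> (\<And>i. i \<in> I \<Longrightarrow> gsec q (s i))
    \<Longrightarrow> gsec q (\<lambda>y. \<Sum>i\<in>I. f i y *\<^sub>R s i y)"
proof (induction I rule: infinite_finite_induct)
  case (insert i F)
  then have "gsec q (\<lambda>y. f i y *\<^sub>R s i y + 1 *\<^sub>R (\<Sum>i\<in>F. f i y *\<^sub>R s i y))"
    by (intro gsec_lincomb base.C_const) auto
  then show ?case using insert by simp
qed (auto intro: gsec_zero)

lemma gsec_diff: "q \<in> U \<Longrightarrow> gsec q s \<Longrightarrow> gsec q t \<Longrightarrow> gsec q (\<lambda>y. s y - t y)"
  using gsec_lincomb[of q "\<lambda>y. 1" "\<lambda>y. -1" s t] base.C_const[of q] by simp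

lemma gsec_cong:
  assumes q: "q \<in> U" and s: "gsec q s" and t: "\<And>y. t y \<in> GTM \<A> y" and n: "base.near q (\<lambda>y. s y = t y)"
  shows "gsec q t"
  unfolding gsec_iff[OF q]
proof (intro conjI allI t)
  fix a
  have "base.near q (\<lambda>y. crd y (t y) a = crd y (s y) a)" using n by (rule base.near_mono) simp
  then show "(\<lambda>y. crd y (t y) a) \<in> cinf \<A> q"
    using base.C_cong[OF UNIV_I q, of "\<lambda>y. crd y (t y) a" "\<lambda>y. crd y (s y) a"] s gsec_iff[OF q] by simp
qed

lemma near_gsec: "q \<in> U \<Longrightarrow> gsec q s \<Longrightarrow> base.near q (\<lambda>y. gsec y s)"
proof -
  assume q: "q \<in> U" and s: "gsec q s"
  have "base.near q (\<lambda>y. \<forall>a\<in>UNIV. (\<lambda>y. crd y (s y) a) \<in> cinf \<A> y)"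
    using s q by (intro base.near_finite base.near_mem_C) (auto simp: gsec_iff)
  then show ?thesis by (rule base.near_mono) (use s q in \<open>auto simp: gsec_iff\<close>)
qed

lemma pair_smooth:
  assumes q: "q \<in> U" and s: "gsec q s" "gsec q t"
  shows "(\<lambda>y. pair (s y) (t y)) \<in> cinf \<A> q"
proof -
  let ?F = "\<lambda>y. \<Sum>i\<in>UNIV. (crd y (t y) (Inl i) * crd y (s y) (Inr i)
    + crd y (s y) (Inl i) * crd y (t y) (Inr i)) * (1/2)"
  have "base.near q (\<lambda>y. pair (s y) (t y) = ?F y)"
    by (rule base.near_all) (use s q in \<open>simp add: pair_crd gsec_GTM[OF q]\<close>)
  moreover have "?F \<in> cinf \<A> q"
    using s q by (intro base.C_sum base.C_mult base.C_add base.C_const) (auto simp: gsec_iff)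
  ultimately show ?thesis using base.C_cong[OF UNIV_I q, of "\<lambda>y. pair (s y) (t y)" ?F] by simp
qed

end

section \<open>Orthonormal frames adapted to a generalized metric\<close>

lemma span_image_sum:
  assumes "finite I" "x \<in> span (f ` I)"
  obtains c where "x = (\<Sum>i\<in>I. c i *\<^sub>R f i)"
proof -
  let ?S = "{x. \<exists>c. x = (\<Sum>i\<in>I. c i *\<^sub>R f i)}"
  have "subspace ?S" unfolding subspace_def
  proof (intro conjI ballI allI)
    show "0 \<in> ?S" by (auto intro!: exI[of _ "\<lambda>_. 0"])
    fix x y c assume "x \<in> ?S"
    then obtain a where a: "x = (\<Sum>i\<in>I. a i *\<^sub>R f i)" by blast
    then have "c *\<^sub>R x = (\<Sum>i\<in>I. (c * a i) *\<^sub>R f i)" by (simp add: scaleR_sum_right)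
    then show "c *\<^sub>R x \<in> ?S" by (intro CollectI exI)
    assume "y \<in> ?S"
    then obtain b where b: "y = (\<Sum>i\<in>I. b i *\<^sub>R f i)" by blast
    have "x + y = (\<Sum>i\<in>I. (a i + b i) *\<^sub>R f i)" unfolding a b by (simp add: sum.distrib scaleR_add_left)
    then show "x + y \<in> ?S" by (intro CollectI exI)
  qed
  moreover have "f ` I \<subseteq> ?S"
  proof safe
    fix i assume "i \<in> I"
    then show "\<exists>c. f i = (\<Sum>j\<in>I. c j *\<^sub>R f j)"
      using assms(1) by (intro exI[of _ "\<lambda>j. if j = i then 1 else 0"])
        (simp add: if_distrib[of "\<lambda>c. c *\<^sub>R _"] cong: if_cong)
  qed
  ultimately show ?thesis using span_minimal assms(2) that by blast
qed

lemma independent_imageI: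
  assumes "finite I" "inj_on g I" "\<forall>c. (\<Sum>i\<in>I. c i *\<^sub>R g i) = 0 \<longrightarrow> (\<forall>i\<in>I. c i = 0)"
  shows "independent (g ` I)"
proof (rule independent_if_scalars_zero)
  fix f x assume "(\<Sum>x\<in>g ` I. f x *\<^sub>R x) = 0" "x \<in> g ` I"
  then show "f x = 0"
    using assms(3)[rule_format, of "\<lambda>i. f (g i)"] by (auto simp: sum.reindex[OF assms(2)])
qed (use assms(1) in simp)

context manifold_chart
begin

definition orthonormal :: "'i set \<Rightarrow> ('i \<Rightarrow> real) \<Rightarrow> 'p \<Rightarrow> ('i \<Rightarrow> 'p gvec) \<Rightarrow> bool"
  where "orthonormal I \<eta> q e \<longleftrightarrow> (\<forall>i\<in>I. e i \<in> GTM \<A> q) \<and>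
    (\<forall>i\<in>I. \<forall>j\<in>I. pair (e i) (e j) = (if i = j then \<eta> i else 0))"

lemma orthonormal_expand:
  assumes q: "q \<in> U" and I: "finite I" and e: "orthonormal I \<eta> q e"
    and \<eta>: "\<And>i. i \<in> I \<Longrightarrow> \<eta> i * \<eta> i = 1" and A: "A \<in> span (e ` I)"
  shows "A = (\<Sum>i\<in>I. (\<eta> i * pair A (e i)) *\<^sub>R e i)"
proof -
  have eG: "e i \<in> GTM \<A> q" if "i \<in> I" for i using e that by (auto simp: orthonormal_def)
  obtain c where c: "A = (\<Sum>i\<in>I. c i *\<^sub>R e i)" using span_image_sum[OF I A] .
  have "pair A (e i) = c i * \<eta> i" if i: "i \<in> I" for i
  proof -
    have "pair A (e i) = (\<Sum>j\<in>I. c j * pair (e j) (e i))"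
      unfolding c by (rule base.pair_sum_left[OF UNIV_I q eG[OF i] eG])
    also have "\<dots> = (\<Sum>j\<in>I. if j = i then c i * \<eta> i else 0)"
      using e i by (intro sum.cong) (auto simp: orthonormal_def)
    finally show ?thesis using I i by simp
  qed
  then have "(\<Sum>i\<in>I. (\<eta> i * pair A (e i)) *\<^sub>R e i) = (\<Sum>i\<in>I. c i *\<^sub>R e i)"
    using \<eta> by (intro sum.cong refl) (simp add: mult.commute mult.left_commute)
  then show ?thesis using c by simp
qed

lemma orthonormal_independent:
  assumes q: "q \<in> U" and I: "finite I" and e: "orthonormal I \<eta> q e"
    and \<eta>: "\<And>i. i \<in> I \<Longrightarrow> \<eta> i * \<eta> i = 1"
  shows "inj_on e I" "independent (e ` I)"
proof -
  have eG: "e i \<in> GTM \<A> q" if "i \<in> I" for i using e that by (auto simp: orthonormal_def)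
  show inj: "inj_on e I"
  proof (rule inj_onI, rule ccontr)
    fix i j assume ij: "i \<in> I" "j \<in> I" "e i = e j" "i \<noteq> j"
    have "pair (e i) (e j) = 0" using e ij(1,2,4) unfolding orthonormal_def by (metis (full_types))
    moreover have "pair (e i) (e i) = \<eta> i" using e ij(1) unfolding orthonormal_def by (metis (full_types))
    ultimately show False using ij \<eta>[of i] by simp
  qed
  show "independent (e ` I)"
  proof (rule independent_if_scalars_zero)
    fix f x assume s: "(\<Sum>x\<in>e ` I. f x *\<^sub>R x) = 0" and "x \<in> e ` I"
    then obtain i where i: "i \<in> I" "x = e i" by auto
    have "0 = pair (\<Sum>j\<in>I. f (e j) *\<^sub>R e j) (e i)"
      using s by (simp add: sum.reindex[OF inj] base.pair_zero_left[OF UNIV_I q eG[OF i(1)]])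
    also have "\<dots> = (\<Sum>j\<in>I. f (e j) * pair (e j) (e i))"
      by (rule base.pair_sum_left[OF UNIV_I q eG[OF i(1)] eG])
    also have "\<dots> = (\<Sum>j\<in>I. if j = i then f (e i) * \<eta> i else 0)"
      using e i by (intro sum.cong) (auto simp: orthonormal_def)
    finally have "f (e i) * \<eta> i = 0" using I i by simp
    then show "f x = 0" using \<eta>[OF i(1)] i(2) by auto
  qed (use I in auto)
qed

text \<open>Counting dimensions without a dimension function: one more independent vector would contradict the
  exchange bound.\<close>

lemma independent_spans:
  assumes "subspace S" "S \<subseteq> span T" "finite T" "B \<subseteq> S" "independent B" "card T \<le> card B"
  shows "span B = S"
proof (rule equalityI)
  show "span B \<subseteq> S" using assms by (simp add: span_minimal)
  show "S \<subseteq> span B"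
  proof
    fix x assume x: "x \<in> S"
    show "x \<in> span B"
    proof (rule ccontr)
      assume n: "x \<notin> span B"
      then have "independent (insert x B)" using assms by (simp add: independent_insertI)
      then have "finite (insert x B) \<and> card (insert x B) \<le> card T"
        using independent_span_bound[OF assms(3)] assms x by (metis insert_subset order_trans)
      moreover have "x \<notin> B" using n span_base by blast
      ultimately show False using assms(6) by auto
    qed
  qed
qed

lemma orthonormal_spans:
  assumes q: "q \<in> U" and I: "finite I" and e: "orthonormal I \<eta> q e"
    and \<eta>: "\<And>i. i \<in> I \<Longrightarrow> \<eta> i * \<eta> i = 1"
    and S: "subspace S" "S \<subseteq> span T" "finite T" "e ` I \<subseteq> S" "card T \<le> card I"
  shows "span (e ` I) = S"
  using orthonormal_independent[OF q I e \<eta>] S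
  by (intro independent_spans[of S T]) (auto simp: card_image)

text \<open>The form is indefinite, but the given sections are orthonormal at \<open>p\<close>. So near \<open>p\<close> the vectors to be
  normalised have square close to their sign, and no null vector occurs.\<close>

lemma Gram_Schmidt_sections:
  fixes s :: "nat \<Rightarrow> 'p \<Rightarrow> 'p gvec"
  assumes p: "p \<in> U" and s: "\<And>a. a < m \<Longrightarrow> gsec p (s a)"
    and on: "orthonormal {..<m} \<eta> p (\<lambda>a. s a p)" and \<eta>: "\<And>a. \<eta> a * \<eta> a = 1"
  shows "\<exists>e. (\<forall>a<m. gsec p (e a) \<and> e a p = s a p \<and> (\<forall>q. e a q \<in> span ((\<lambda>b. s b q) ` {..a}))) \<and>
    base.near p (\<lambda>q. orthonormal {..<m} \<eta> q (\<lambda>a. e a q))"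
  using s on
proof (induction m)
  case 0
  then show ?case by (auto simp: orthonormal_def intro: base.near_all)
next
  case (Suc m)
  have on: "orthonormal {..<m} \<eta> p (\<lambda>a. s a p)" and sm_on: "pair (s m p) (s m p) = \<eta> m"
      "\<And>a. a < m \<Longrightarrow> pair (s m p) (s a p) = 0"
    using Suc.prems(2) unfolding orthonormal_def by auto
  have s': "\<And>a. a < m \<Longrightarrow> gsec p (s a)" using Suc.prems(1) by simp
  obtain e where e: "\<And>a. a < m \<Longrightarrow> gsec p (e a)" "\<And>a. a < m \<Longrightarrow> e a p = s a p"
      "\<And>a q. a < m \<Longrightarrow> e a q \<in> span ((\<lambda>b. s b q) ` {..a})"
      "base.near p (\<lambda>q. orthonormal {..<m} \<eta> q (\<lambda>a. e a q))"
    using Suc.IH[OF s' on] by blast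
  have sm: "gsec p (s m)" using Suc.prems(1) by simp
  define R where "R q = s m q - (\<Sum>b<m. (\<eta> b * pair (s m q) (e b q)) *\<^sub>R e b q)" for q
  \<comment> \<open>\<open>r = 1\<close> at \<open>p\<close>, so it stays positive nearby and the square root below is smooth there.\<close>
  define r where "r q = \<eta> m * pair (R q) (R q)" for q
  define e' where "e' = e(m := \<lambda>q. (1 / sqrt (r q)) *\<^sub>R R q)"
  have R: "gsec p R" unfolding R_def
    using e(1) sm by (intro gsec_diff gsec_sum p base.C_mult base.C_const pair_smooth) auto
  have Rp: "R p = s m p" unfolding R_def using e(2) sm_on(2) by simp
  have rC: "r \<in> cinf \<A> p" unfolding r_def by (intro base.C_mult base.C_const pair_smooth R p UNIV_I)
  have rp: "r p = 1" unfolding r_def Rp sm_on(1) by (rule \<eta>)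
  have cf: "(\<lambda>q. 1 / sqrt (r q)) \<in> cinf \<A> p"
    using rp by (intro base.C_compose[OF UNIV_I p rC _ _ smooth_on_inverse_sqrt]) auto
  have near_r: "base.near p (\<lambda>q. r q \<in> {0<..})"
    by (rule base.near_value[OF UNIV_I p rC]) (auto simp: rp)
  have "base.near p (\<lambda>q. orthonormal {..<Suc m} \<eta> q (\<lambda>a. e' a q))"
    using base.near_conj[OF e(4) near_r]
  proof (rule base.near_mono)
    fix q assume q: "q \<in> U" and h: "orthonormal {..<m} \<eta> q (\<lambda>a. e a q) \<and> r q \<in> {0<..}"
    have G: "e b q \<in> GTM \<A> q" if "b < m" for b using h that by (auto simp: orthonormal_def)
    have RG: "R q \<in> GTM \<A> q" "s m q \<in> GTM \<A> q" using gsec_GTM[OF p] R sm by auto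
    have Re: "pair (R q) (e c q) = 0" if c: "c < m" for c
    proof -
      have "pair (R q) (e c q) = pair (s m q) (e c q) - (\<Sum>b<m. (\<eta> b * pair (s m q) (e b q)) * pair (e b q) (e c q))"
        unfolding R_def using G c
        by (subst base.pair_diff_left[OF RG(2) _ G[OF c]])
          (auto intro!: subspace_sum subspace_scale GTM_any_subspace base.pair_sum_left[OF UNIV_I q])
      also have "(\<Sum>b<m. (\<eta> b * pair (s m q) (e b q)) * pair (e b q) (e c q))
        = (\<Sum>b<m. if b = c then pair (s m q) (e c q) else 0)"
        using h c \<eta>[of c] by (intro sum.cong refl) (auto simp: orthonormal_def mult.commute mult.left_commute)
      finally show ?thesis using c by simp
    qed
    have RR: "pair ((1 / sqrt (r q)) *\<^sub>R R q) ((1 / sqrt (r q)) *\<^sub>R R q) = \<eta> m"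
    proof -
      have "pair ((1 / sqrt (r q)) *\<^sub>R R q) ((1 / sqrt (r q)) *\<^sub>R R q)
          = (1 / sqrt (r q)) * ((1 / sqrt (r q)) * pair (R q) (R q))"
        using base.pair_scale_left[OF RG(1)] RG(1) subspace_scale[OF GTM_any_subspace]
        by (metis pair_commute)
      also have "\<dots> = pair (R q) (R q) / r q" using h by (simp add: field_simps)
      also have "pair (R q) (R q) = \<eta> m * r q"
        unfolding r_def using \<eta>[of m] by (simp flip: mult.assoc)
      finally show ?thesis using h by simp
    qed
    have eR: "pair ((1 / sqrt (r q)) *\<^sub>R R q) (e c q) = 0" "pair (e c q) ((1 / sqrt (r q)) *\<^sub>R R q) = 0" if "c < m" for c
      using base.pair_scale_left[OF RG(1) G[OF that]] Re[OF that] by (simp_all add: pair_commute)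
    show "orthonormal {..<Suc m} \<eta> q (\<lambda>a. e' a q)"
      unfolding orthonormal_def e'_def
      using h RG(1) RR eR G by (auto simp: orthonormal_def less_Suc_eq intro: subspace_scale[OF GTM_any_subspace])
  qed
  moreover have "gsec p (e' a) \<and> e' a p = s a p \<and> (\<forall>q. e' a q \<in> span ((\<lambda>b. s b q) ` {..a}))"
    if "a < Suc m" for a
  proof (cases "a = m")
    case True
    have "R q \<in> span ((\<lambda>b. s b q) ` {..m})" for q
      unfolding R_def
    proof (intro span_diff span_sum span_scale)
      fix b assume "b \<in> {..<m}"
      then show "e b q \<in> span ((\<lambda>b. s b q) ` {..m})"
        using e(3)[of b q] subsetD[OF span_mono[OF image_mono[of "{..b}" "{..m}" "\<lambda>b. s b q"]]] by auto
    qed (auto intro: span_base)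
    then show ?thesis
      using True gsec_scale[OF p cf R] Rp rp by (simp add: e'_def span_scale)
  next
    case False
    then show ?thesis using that e by (simp add: e'_def)
  qed
  ultimately show ?case by blast
qed

end

locale gmetric_chart = manifold_chart \<A> U \<phi>
  for \<A> :: "('p::{t2_space, second_countable_topology}, real ^ 'n) chart set" and U \<phi> +
  fixes n :: nat and E :: "'p \<Rightarrow> 'p gvec set"
  assumes dim: "CARD('n) = 2 * n" and metric: "gen_metric \<A> n E"
begin

lemma E_GTM: "E q \<subseteq> GTM \<A> q" and E_subspace: "subspace (E q)" and E_dim: "real_vector.dim (E q) = 2 * n"
  and E_sections: "\<exists>s::nat \<Rightarrow> 'p \<Rightarrow> 'p gvec. (\<forall>i<2 * n. bsection_at \<A> E q (s i)) \<and>
       span ((\<lambda>i. s i q) ` {..<2 * n}) = E q"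
  and E_signature: "has_signature pair (E q) n n"
  using metric unfolding gen_metric_def gsubbundle_def by auto

lemma E_no_forms: "A \<in> E q \<Longrightarrow> fst A = 0 \<Longrightarrow> A = 0"
proof -
  assume A: "A \<in> E q" "fst A = 0"
  then have "snd A \<in> cotangent (cinf \<A>) q" using E_GTM[of q] unfolding gtangent_def by (cases A) auto
  then have "A \<in> E q \<inter> ({0} \<times> cotangent (cinf \<A>) q)" using A by (cases A) auto
  then show ?thesis using metric unfolding gen_metric_def by blast
qed

lemma E_finite_span: "\<exists>T. finite T \<and> E q \<subseteq> span T \<and> card T \<le> 2 * n"
proof -
  obtain s :: "nat \<Rightarrow> 'p \<Rightarrow> 'p gvec" where "span ((\<lambda>i. s i q) ` {..<2 * n}) = E q"
    using E_sections by blast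
  then show ?thesis
    using card_image_le[of "{..<2 * n}" "\<lambda>i. s i q"] by (intro exI[of _ "(\<lambda>i. s i q) ` {..<2 * n}"]) auto
qed

text \<open>The signs of an adapted basis with \<open>4 n\<close> members: the first \<open>2 n\<close> span \<open>E\<close>, of signature \<open>(n, n)\<close>, and the
  others span \<open>E\<^sup>\<bottom>\<close>, where the signs are opposite.\<close>

definition bsign :: "nat \<Rightarrow> real"
  where "bsign k = (if k < n then 1 else if k < 2 * n then - 1 else if k < 3 * n then - 1 else 1)"

lemma bsign_square: "bsign k * bsign k = 1"
  by (simp add: bsign_def)

text \<open>The projection of \<open>E\<close> to \<open>TM\<close> is injective because \<open>E\<close> contains no covectors, and both spaces have
  dimension \<open>2 n\<close>.\<close>

lemma E_onto_TM:
  assumes q: "q \<in> U" and Y: "Y \<in> TM \<A> q"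
  shows "\<exists>B. B \<in> E q \<and> fst B = Y"
proof -
  obtain e :: "nat \<Rightarrow> 'p gvec" where sp: "span (e ` {..<n + n}) = E q"
    and on: "\<And>i j. i < n + n \<Longrightarrow> j < n + n \<Longrightarrow> pair (e i) (e j) = (if i \<noteq> j then 0 else if i < n then 1 else - 1)"
    using E_signature[of q] unfolding has_signature_def by auto
  have eE: "e i \<in> E q" if "i < 2 * n" for i using sp that span_base[of "e i" "e ` {..<n + n}"] by auto
  have eG: "e i \<in> GTM \<A> q" if "i < 2 * n" for i using eE[OF that] E_GTM by blast
  have one: "orthonormal {..<2 * n} bsign q e"
    unfolding orthonormal_def using eG on by (auto simp: bsign_def)
  note ind = orthonormal_independent[OF q finite_lessThan one bsign_square]
  have fin: "(\<lambda>i. fst (e i)) ` {..<2 * n} \<subseteq> TM \<A> q" using eG by (auto simp: gtangent_def mem_Times_iff)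
  have lin0: "\<forall>i<2 * n. c i = 0" if z: "(\<Sum>i<2 * n. c i *\<^sub>R fst (e i)) = 0" for c
  proof -
    have "(\<Sum>i<2 * n. c i *\<^sub>R e i) \<in> E q" using eE by (intro subspace_sum subspace_scale E_subspace) auto
    moreover have "fst (\<Sum>i<2 * n. c i *\<^sub>R e i) = 0" using z by (simp add: fst_sum)
    ultimately have 0: "(\<Sum>i<2 * n. c i *\<^sub>R e i) = 0" by (rule E_no_forms)
    show ?thesis
    proof (intro allI impI)
      fix j assume j: "j < 2 * n"
      have "0 = (\<Sum>i<2 * n. c i * pair (e i) (e j))"
        using base.pair_sum_left[OF UNIV_I q eG[OF j], of "{..<2 * n}" e c] eG 0
          base.pair_zero_left[OF UNIV_I q eG[OF j]] by simp
      also have "\<dots> = (\<Sum>i<2 * n. if i = j then c j * bsign j else 0)"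
        using one j by (intro sum.cong) (auto simp: orthonormal_def)
      finally show "c j = 0" using j bsign_square[of j] by auto
    qed
  qed
  have inj: "inj_on (\<lambda>i. fst (e i)) {..<2 * n}"
  proof (rule inj_onI, rule ccontr)
    fix i j assume ij: "i \<in> {..<2 * n}" "j \<in> {..<2 * n}" "fst (e i) = fst (e j)" "i \<noteq> j"
    have "e i - e j \<in> E q" using ij eE by (intro subspace_diff E_subspace) auto
    then have "e i = e j" using E_no_forms[of "e i - e j" q] ij(3) by simp
    then show False using ind(1) ij by (auto simp: inj_on_def)
  qed
  have "independent ((\<lambda>i. fst (e i)) ` {..<2 * n})"
    using lin0 by (intro independent_imageI inj) auto
  moreover have "TM \<A> q \<subseteq> span (range (coord_vec q))"
  proof
    fix v assume v: "v \<in> TM \<A> q"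
    have "(\<Sum>i\<in>UNIV. v (coordf i) *\<^sub>R coord_vec q i) \<in> span (range (coord_vec q))"
      by (intro span_sum span_scale span_base) auto
    then show "v \<in> span (range (coord_vec q))"
      by (rule back_subst[where P = "\<lambda>w. w \<in> span (range (coord_vec q))", OF _ TM_expand[OF q v, symmetric]])
  qed
  moreover have "card (range (coord_vec q)) \<le> card ((\<lambda>i. fst (e i)) ` {..<2 * n})"
    using card_image_le[of UNIV "coord_vec q"] dim by (simp add: card_image[OF inj])
  ultimately have spT: "span ((\<lambda>i. fst (e i)) ` {..<2 * n}) = TM \<A> q"
    using fin by (intro independent_spans[of _ "range (coord_vec q)"] base.subspace_tangent q) auto
  obtain c where "Y = (\<Sum>i\<in>{..<2 * n}. c i *\<^sub>R fst (e i))"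
    using span_image_sum[OF finite_lessThan] Y spT by metis
  then have "(\<Sum>i<2 * n. c i *\<^sub>R e i) \<in> E q \<and> fst (\<Sum>i<2 * n. c i *\<^sub>R e i) = Y"
    using eE by (auto simp: fst_sum intro!: subspace_sum subspace_scale E_subspace)
  then show ?thesis by blast
qed

text \<open>For \<open>A \<in> E\<close> there is a unique \<open>B \<in> E\<^sup>\<bottom>\<close> with the same tangent part, and this map is an
  anti-isometry. It turns an orthonormal basis of \<open>E\<close> into one of \<open>E\<^sup>\<bottom>\<close>.\<close>

lemma adapted_basis:
  assumes q: "q \<in> U"
  obtains b where "orthonormal {..<4 * n} bsign q b" "\<And>k. k < 2 * n \<Longrightarrow> b k \<in> E q"
proof -
  obtain e :: "nat \<Rightarrow> 'p gvec" where sp: "span (e ` {..<n + n}) = E q"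
    and on: "\<And>i j. i < n + n \<Longrightarrow> j < n + n \<Longrightarrow> pair (e i) (e j) = (if i \<noteq> j then 0 else if i < n then 1 else - 1)"
    using E_signature[of q] unfolding has_signature_def by auto
  have eE: "e i \<in> E q" if "i < 2 * n" for i using sp that span_base[of "e i" "e ` {..<n + n}"] by auto
  have eG: "e i \<in> GTM \<A> q" if "i < 2 * n" for i using eE[OF that] E_GTM by blast
  have one: "orthonormal {..<2 * n} bsign q e"
    unfolding orthonormal_def using eG on by (auto simp: bsign_def)
  define j where "j Y = (SOME B. B \<in> E q \<and> fst B = Y)" for Y
  have j: "j Y \<in> E q" "fst (j Y) = Y" if Y: "Y \<in> TM \<A> q" for Y
    using someI_ex[OF E_onto_TM[OF q Y]] by (auto simp: j_def)
  have E_inj: "A = B" if "A \<in> E q" "B \<in> E q" "fst A = fst B" for A B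
    using E_no_forms[of "A - B" q] subspace_diff[OF E_subspace that(1,2)] that(3) by simp
  define \<gamma> where "\<gamma> A Y = (if Y \<in> TM \<A> q then 2 * pair A (j Y) else 0)" for A Y
  have \<gamma>: "\<gamma> A \<in> cotangent (cinf \<A>) q" if A: "A \<in> GTM \<A> q" for A
    unfolding cotangent_def linear_upon_def
  proof (intro CollectI conjI ballI allI impI)
    fix u w a b assume u: "u \<in> TM \<A> q" and w: "w \<in> TM \<A> q"
    have t: "a *\<^sub>R u + b *\<^sub>R w \<in> TM \<A> q" using u w by (rule base.tangent_lincomb[OF UNIV_I q])
    have "j (a *\<^sub>R u + b *\<^sub>R w) = a *\<^sub>R j u + b *\<^sub>R j w"
      using j u w t by (intro E_inj subspace_add subspace_scale E_subspace) auto
    moreover have "pair A (a *\<^sub>R j u + b *\<^sub>R j w) = a * pair A (j u) + b * pair A (j w)"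
      unfolding pair_commute[of A] by (rule pair_lin_left[OF _ _ A])
        (use j(1)[OF u] j(1)[OF w] E_GTM[of q] in \<open>auto\<close>)
    ultimately show "\<gamma> A (a *\<^sub>R u + b *\<^sub>R w) = a *\<^sub>R \<gamma> A u + b *\<^sub>R \<gamma> A w"
      using u w t by (simp add: \<gamma>_def distrib_left)
  qed (simp add: \<gamma>_def)
  define f where "f i = e i - (0, \<gamma> (e i))" for i
  have \<gamma>G: "(0, \<gamma> (e i)) \<in> GTM \<A> q" if "i < 2 * n" for i
    using \<gamma>[OF eG[OF that]] subspace_0[OF base.subspace_tangent[OF UNIV_I q]] by (simp add: gtangent_def)
  have fG: "f i \<in> GTM \<A> q" if "i < 2 * n" for i
    unfolding f_def using that eG \<gamma>G by (intro subspace_diff GTM_any_subspace) auto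
  have pg: "pair (0, \<gamma> (e i)) C = \<gamma> (e i) (fst C) / 2" if "i < 2 * n" "C \<in> GTM \<A> q" for i C
    using that base.cotangent_zero[OF UNIV_I q, of "snd C"] by (auto simp: pair_def gtangent_def)
  have fE: "pair (f i) C = 0" if "i < 2 * n" "C \<in> E q" for i C
  proof -
    have C: "C \<in> GTM \<A> q" using that(2) E_GTM by blast
    then have "fst C \<in> TM \<A> q" by (simp add: gtangent_def mem_Times_iff)
    note C = C this
    have "j (fst C) = C" using j[OF C(2)] that(2) E_inj by blast
    then have "pair (0, \<gamma> (e i)) C = pair (e i) C"
      using pg[OF that(1) C(1)] C(2) by (simp add: \<gamma>_def)
    then show ?thesis
      unfolding f_def using base.pair_diff_left[OF eG[OF that(1)] \<gamma>G[OF that(1)] C(1)] by simp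
  qed
  have ff: "pair (f i) (f k) = - pair (e i) (e k)" if ik: "i < 2 * n" "k < 2 * n" for i k
  proof -
    have t: "fst (e i) \<in> TM \<A> q" using eG[OF ik(1)] by (auto simp: gtangent_def mem_Times_iff)
    have "pair (f i) (f k) = pair (e k) (f i) - pair (0, \<gamma> (e k)) (f i)"
      unfolding f_def[of k] using base.pair_diff_left[OF eG[OF ik(2)] \<gamma>G[OF ik(2)] fG[OF ik(1)]]
      by (simp add: pair_commute)
    also have "pair (e k) (f i) = 0" using fE[OF ik(1) eE[OF ik(2)]] by (simp add: pair_commute)
    also have "pair (0, \<gamma> (e k)) (f i) = \<gamma> (e k) (fst (e i)) / 2"
      using pg[OF ik(2) fG[OF ik(1)]] by (simp add: f_def)
    also have "\<gamma> (e k) (fst (e i)) = 2 * pair (e k) (e i)"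
      using t j[OF t] E_inj[of "j (fst (e i))" "e i"] eE[OF ik(1)] by (simp add: \<gamma>_def)
    finally show ?thesis by (simp add: pair_commute)
  qed
  define b where "b k = (if k < 2 * n then e k else f (k - 2 * n))" for k
  show ?thesis
  proof
    show "b k \<in> E q" if "k < 2 * n" for k using that eE by (simp add: b_def)
    show "orthonormal {..<4 * n} bsign q b"
      unfolding orthonormal_def
    proof (intro conjI ballI)
      fix k l assume k: "k \<in> {..<4 * n}" and l: "l \<in> {..<4 * n}"
      have k2: "k - 2 * n < 2 * n" "l - 2 * n < 2 * n" if "\<not> k < 2 * n" "\<not> l < 2 * n" using k l that by auto
      show "pair (b k) (b l) = (if k = l then bsign k else 0)"
      proof (cases "k < 2 * n"; cases "l < 2 * n")
        assume "k < 2 * n" "l < 2 * n" then show ?thesis using on by (simp add: b_def bsign_def)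
      next
        assume "k < 2 * n" "\<not> l < 2 * n"
        moreover from this have "l - 2 * n < 2 * n" using l by auto
        ultimately show ?thesis using fE[of "l - 2 * n" "e k"] eE[of k] by (auto simp: b_def pair_commute)
      next
        assume "\<not> k < 2 * n" "l < 2 * n"
        moreover from this have "k - 2 * n < 2 * n" using k by auto
        ultimately show ?thesis using fE[of "k - 2 * n" "e l"] eE[of l] by (auto simp: b_def)
      next
        assume kl: "\<not> k < 2 * n" "\<not> l < 2 * n"
        have "k - 2 * n < 2 * n" "l - 2 * n < 2 * n" using k l kl by auto
        then have "pair (b k) (b l) = - (if k - 2 * n \<noteq> l - 2 * n then 0 else if k - 2 * n < n then 1 else - 1)"
          using kl ff on by (simp add: b_def)
        then show ?thesis using kl by (auto simp: bsign_def)
      qed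
    next
      fix k assume "k \<in> {..<4 * n}"
      then show "b k \<in> GTM \<A> q" using eG fG by (auto simp: b_def)
    qed
  qed
qed

text \<open>An adapted basis at \<open>p\<close> is extended to sections, within \<open>E\<close> for its first half and with constant
  components for its second half, and orthonormalised in this order. Each new section lies in the span of
  the earlier ones, so the first half stays in \<open>E\<close>, and the second half is orthogonal to it.\<close>

lemma adapted_frame_nat:
  assumes p: "p \<in> U"
  obtains S and e :: "nat \<Rightarrow> 'p \<Rightarrow> 'p gvec"
  where "open S" "p \<in> S" "S \<subseteq> U"
    "\<And>q. q \<in> S \<Longrightarrow> orthonormal {..<4 * n} bsign q (\<lambda>a. e a q)"
    "\<And>q a. q \<in> S \<Longrightarrow> a < 4 * n \<Longrightarrow> gsec q (e a)"
    "\<And>q a. q \<in> S \<Longrightarrow> a < 2 * n \<Longrightarrow> e a q \<in> E q"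
proof -
  obtain b where b: "orthonormal {..<4 * n} bsign p b" "\<And>k. k < 2 * n \<Longrightarrow> b k \<in> E p"
    using adapted_basis[OF p] by blast
  obtain s :: "nat \<Rightarrow> 'p \<Rightarrow> 'p gvec"
    where s0: "(\<forall>i<2 * n. bsection_at \<A> E p (s i)) \<and> span ((\<lambda>i. s i p) ` {..<2 * n}) = E p"
    using E_sections[of p] by (rule exE)
  then have s: "\<And>i. i < 2 * n \<Longrightarrow> bsection_at \<A> E p (s i)" "span ((\<lambda>i. s i p) ` {..<2 * n}) = E p"
    by simp_all
  have "\<exists>c. b k = (\<Sum>i<2 * n. c i *\<^sub>R s i p)" if "k < 2 * n" for k
  proof -
    have "b k \<in> span ((\<lambda>i. s i p) ` {..<2 * n})" using b(2)[OF that] s(2) by simp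
    from span_image_sum[OF finite_lessThan this] show ?thesis by (metis (no_types))
  qed
  then have "\<forall>k. \<exists>c. k < 2 * n \<longrightarrow> b k = (\<Sum>i<2 * n. c i *\<^sub>R s i p)" by simp
  from choice[OF this] obtain c where c: "\<And>k. k < 2 * n \<Longrightarrow> b k = (\<Sum>i<2 * n. c k i *\<^sub>R s i p)"
    by (elim exE) simp
  \<comment> \<open>The second half need not lie in \<open>E\<^sup>\<bottom>\<close> away from \<open>p\<close>; orthonormalisation restores this.\<close>
  define t where "t k q = (if k < 2 * n then (\<Sum>i<2 * n. c k i *\<^sub>R s i q)
    else (\<Sum>a\<in>UNIV. crd p (b k) a *\<^sub>R frame q a))" for k q
  have tE: "t k q \<in> E q" if "k < 2 * n" for k q
    using that s(1) by (auto simp: t_def bsection_at_def intro!: subspace_sum subspace_scale E_subspace)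
  have tg: "gsec p (t k)" if "k < 4 * n" for k
  proof (cases "k < 2 * n")
    case True
    then have "t k = (\<lambda>q. \<Sum>i<2 * n. c k i *\<^sub>R s i q)" by (auto simp: t_def)
    then show ?thesis using s(1) p by (auto simp: bsection_at_def intro!: gsec_sum base.C_const)
  next
    case False
    then have "t k = (\<lambda>q. \<Sum>a\<in>UNIV. crd p (b k) a *\<^sub>R frame q a)" by (auto simp: t_def)
    then show ?thesis using p by (auto intro!: gsec_sum base.C_const gsec_frame)
  qed
  have tp: "t k p = b k" if "k < 4 * n" for k
    using that c GTM_expand[OF p, of "b k"] b(1) by (auto simp: t_def orthonormal_def)
  have "orthonormal {..<4 * n} bsign p (\<lambda>a. t a p)"
    using b(1) tp by (auto simp: orthonormal_def)
  from Gram_Schmidt_sections[OF p tg this bsign_square]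
  obtain e where e: "\<And>a. a < 4 * n \<Longrightarrow> gsec p (e a)"
      "\<And>a q. a < 4 * n \<Longrightarrow> e a q \<in> span ((\<lambda>b. t b q) ` {..a})"
      "base.near p (\<lambda>q. orthonormal {..<4 * n} bsign q (\<lambda>a. e a q))"
    by blast
  have "base.near p (\<lambda>q. \<forall>a\<in>{..<4 * n}. gsec q (e a))"
    using e(1) by (intro base.near_finite near_gsec[OF p]) auto
  from iffD1[OF near_iff[OF p] base.near_conj[OF e(3) this]]
  obtain S where S0: "open S \<and> p \<in> S \<and> S \<subseteq> U \<and>
      (\<forall>q\<in>S. orthonormal {..<4 * n} bsign q (\<lambda>a. e a q) \<and> (\<forall>a\<in>{..<4 * n}. gsec q (e a)))"
    by (rule exE)
  have "e a q \<in> E q" if "a < 2 * n" for a q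
  proof -
    have "(\<lambda>b. t b q) ` {..a} \<subseteq> E q" using tE that by auto
    then have "span ((\<lambda>b. t b q) ` {..a}) \<subseteq> E q" by (rule span_minimal[OF _ E_subspace])
    then show ?thesis using e(2)[of a q] that by auto
  qed
  with S0 show ?thesis by (intro that[of S e]) simp_all
qed

end

section \<open>Charts of the reflector space from orthonormal frames\<close>

lemma bounded_linear_axis: "bounded_linear (axis i :: 'b::euclidean_space \<Rightarrow> 'b ^ 'i)"
  by (subst linear_conv_bounded_linear[symmetric]) (auto intro!: linearI simp: axis_def vec_eq_iff)

lemma smooth_on_vec:
  fixes f :: "'i::finite \<Rightarrow> 'a::real_normed_vector \<Rightarrow> 'b::euclidean_space"
  assumes "open S" "\<And>i. smooth_on S (f i)"
  shows "smooth_on S (\<lambda>x. \<chi> i. f i x)"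
proof -
  have e: "(\<chi> i. f i x) = (\<Sum>i\<in>UNIV. axis i (f i x))" for x
    by (simp add: vec_eq_iff axis_def if_distrib[of "\<lambda>z. z $ _"] cong: if_cong)
  show ?thesis unfolding e
    by (rule smooth_on_sum[OF assms(1) smooth_on_compose_linear[OF assms bounded_linear_axis]])
qed

lemma smooth_on_Pair:
  fixes f :: "'a::real_normed_vector \<Rightarrow> 'b::euclidean_space" and g :: "'a \<Rightarrow> 'c::euclidean_space"
  assumes "open S" "smooth_on S f" "smooth_on S g"
  shows "smooth_on S (\<lambda>x. (f x, g x))"
proof -
  have e: "(f x, g x) = (f x, 0) + (0, g x)" for x by simp
  have l: "bounded_linear (\<lambda>z::'b. (z, 0::'c))" "bounded_linear (\<lambda>z::'c. (0::'b, z))"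
    by (auto intro!: bounded_linear_Pair bounded_linear_ident bounded_linear_zero)
  show ?thesis unfolding e
    by (rule smooth_on_add[OF assms(1) smooth_on_compose_linear[OF assms(1,2) l(1)]
          smooth_on_compose_linear[OF assms(1,3) l(2)]])
qed

lemma (in smooth_chart) common_rep:
  assumes x: "x \<in> N" "x \<in> U" and I: "finite I"
  shows "(\<And>i. i \<in> I \<Longrightarrow> g i \<in> C x) \<Longrightarrow> \<exists>W h. open W \<and> \<phi> x \<in> W \<and>
    (\<forall>i\<in>I. smooth_on W (h i) \<and> (\<forall>y\<in>N \<inter> U. \<phi> y \<in> W \<longrightarrow> g i y = h i (\<phi> y)))"
  using I
proof (induction I rule: finite_induct)
  case empty
  then show ?case by (intro exI[of _ UNIV]) auto
next
  case (insert i F)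
  obtain W h where W: "open W" "\<phi> x \<in> W"
    "\<forall>i\<in>F. smooth_on W (h i) \<and> (\<forall>y\<in>N \<inter> U. \<phi> y \<in> W \<longrightarrow> g i y = h i (\<phi> y))"
    using insert.IH insert.prems by (metis insertCI)
  obtain k V where V: "local_rep x (g i) k V" using insert.prems[of i] mem_C_iff[OF x] by blast
  show ?case
    using W V insert.hyps unfolding local_rep_def
    by (intro exI[of _ "W \<inter> V"] exI[of _ "h(i := k)"]) (auto intro: smooth_on_subset)
qed

text \<open>Coordinates of an endomorphism with respect to an arbitrary frame \<open>f\<close>. The charts of the endomorphism
  bundle are the case of coordinate frames; orthonormal frames give better ones.\<close>

definition bundle_map :: "('p \<Rightarrow> real ^ 'n) \<Rightarrow> ('p \<Rightarrow> 'n + 'n \<Rightarrow> 'p gvec) \<Rightarrow> 'p gpoint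
    \<Rightarrow> (real ^ 'n) \<times> (real ^ ('n + 'n) ^ ('n + 'n))"
  where "bundle_map \<phi> f = (\<lambda>(q, L). (\<phi> q, \<chi> a b. pair (L (f q a)) (f q b)))"

abbreviation over :: "'p set \<Rightarrow> 'p gpoint set" where "over S \<equiv> {(q, L). q \<in> S}"

definition end_bundle :: "('p, real ^ 'n) chart set \<Rightarrow> 'p gpoint set"
  where "end_bundle \<A> = {(q, L). L \<in> endos (GTM \<A> q)}"

lemma (in manifold_chart) endos_sum:
  assumes q: "q \<in> U" and L: "L \<in> endos (GTM \<A> q)" and A: "\<And>i. i \<in> I \<Longrightarrow> A i \<in> GTM \<A> q"
  shows "L (\<Sum>i\<in>I. c i *\<^sub>R A i) = (\<Sum>i\<in>I. c i *\<^sub>R L (A i))"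
proof -
  have lin: "L (a *\<^sub>R u + b *\<^sub>R w) = a *\<^sub>R L u + b *\<^sub>R L w" if "u \<in> GTM \<A> q" "w \<in> GTM \<A> q" for a b u w
    using L that by (auto simp: endos_def linear_upon_def)
  have L0: "L 0 = 0" using lin[of 0 0 0 0] zero_GTM by simp
  show ?thesis using A
  proof (induction I rule: infinite_finite_induct)
    case (insert i F)
    then show ?case
      using lin[of "A i" "\<Sum>i\<in>F. c i *\<^sub>R A i" "c i" 1]
      by (simp add: subspace_sum subspace_scale GTM_any_subspace)
  qed (auto simp: L0)
qed

text \<open>If the frame \<open>f'\<close> is a combination of \<open>f\<close> with smooth coefficients \<open>P\<close>, then the coordinates of \<open>L\<close> with
  respect to \<open>f'\<close> are those with respect to \<open>f\<close>, multiplied by \<open>P\<close> on both sides.\<close>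

lemma (in manifold_chart) bundle_chart_change:
  assumes D: "open D" "D \<subseteq> U" "open D'"
    and f: "\<And>y a. y \<in> D \<Longrightarrow> f y a \<in> GTM \<A> y"
    and f': "\<And>y a. y \<in> D \<Longrightarrow> y \<in> D' \<Longrightarrow> f' y a = (\<Sum>c\<in>UNIV. P a c y *\<^sub>R f y c)"
    and P: "\<And>y a c. y \<in> D \<Longrightarrow> y \<in> D' \<Longrightarrow> P a c \<in> cinf \<A> y"
    and \<psi>: "\<And>y i. y \<in> D \<Longrightarrow> y \<in> D' \<Longrightarrow> (\<lambda>z. \<psi> z $ i) \<in> cinf \<A> y"
    and N: "N \<subseteq> end_bundle \<A>" and x: "x \<in> N" "fst x \<in> D" "fst x \<in> D'"
    and g: "g \<in> smooth_near {(over D', bundle_map \<psi> f')} N x"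
  shows "g \<in> smooth_near {(over D, bundle_map \<phi> f)} N x"
proof -
  let ?q = "fst x"
  have q: "?q \<in> U" using x D by auto
  obtain W1 h where "open W1 \<and> \<phi> ?q \<in> W1 \<and>
    (\<forall>i\<in>UNIV. smooth_on W1 (h i) \<and> (\<forall>y\<in>UNIV \<inter> U. \<phi> y \<in> W1 \<longrightarrow> \<psi> y $ i = h i (\<phi> y)))"
    using base.common_rep[OF UNIV_I q, of UNIV "\<lambda>i z. \<psi> z $ i", OF finite \<psi>[OF x(2,3)]]
    by (elim exE)
  then have W1: "open W1" "\<phi> ?q \<in> W1"
    "\<And>i. smooth_on W1 (h i)" "\<And>i y. y \<in> U \<Longrightarrow> \<phi> y \<in> W1 \<Longrightarrow> \<psi> y $ i = h i (\<phi> y)"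
    by auto
  obtain W2 k where "open W2 \<and> \<phi> ?q \<in> W2 \<and>
    (\<forall>a\<in>UNIV. smooth_on W2 (k a) \<and> (\<forall>y\<in>UNIV \<inter> U. \<phi> y \<in> W2 \<longrightarrow> P (fst a) (snd a) y = k a (\<phi> y)))"
    using base.common_rep[OF UNIV_I q, of UNIV "\<lambda>a. P (fst a) (snd a)", OF finite P[OF x(2,3)]]
    by (elim exE)
  then have W2: "open W2" "\<phi> ?q \<in> W2"
    "\<And>a. smooth_on W2 (k a)" "\<And>a y. y \<in> U \<Longrightarrow> \<phi> y \<in> W2 \<Longrightarrow> P (fst a) (snd a) y = k a (\<phi> y)"
    by auto
  let ?W = "W1 \<inter> W2 \<inter> \<phi> ` (D \<inter> D')"
  have "open (\<phi> ` (D \<inter> D'))"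
    by (rule open_chart_image[OF chart]) (use D in auto)
  then have oW: "open ?W" using W1(1) W2(1) by (intro open_Int)
  let ?T = "\<lambda>z. (\<chi> i. h i (fst z), \<chi> a b. \<Sum>c\<in>UNIV. \<Sum>d\<in>UNIV. k (a, c) (fst z) * (k (b, d) (fst z) * (snd z $ c $ d)))"
  have o: "open (?W \<times> (UNIV :: (real ^ ('n + 'n) ^ ('n + 'n)) set))" using oW by (simp add: open_Times)
  have sm: "smooth_on (?W \<times> (UNIV :: (real ^ ('n + 'n) ^ ('n + 'n)) set)) (\<lambda>z. r (fst z))"
    if "smooth_on W r" "?W \<subseteq> W" for W and r :: "real ^ 'n \<Rightarrow> real"
    by (rule smooth_on_compose[OF o oW _ smooth_on_bounded_linear[OF o bounded_linear_fst]])
      (use that in \<open>auto intro: smooth_on_subset\<close>)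
  have bl: "bounded_linear (\<lambda>z :: (real ^ 'n) \<times> (real ^ ('n + 'n) ^ ('n + 'n)). snd z $ c $ d)" for c d
    by (intro bounded_linear_compose[OF bounded_linear_vec_nth] bounded_linear_snd)
  show ?thesis
  proof (rule smooth_near_chart_change[where W = "?W \<times> UNIV" and \<tau> = ?T, OF o _ _ _ x(1) _ g])
    show "smooth_on (?W \<times> UNIV) ?T"
      by (intro smooth_on_Pair smooth_on_vec smooth_on_sum smooth_on_mult o sm[OF W1(3)] sm[OF W2(3)]
          smooth_on_bounded_linear[OF o bl]) auto
    show "bundle_map \<phi> f x \<in> ?W \<times> UNIV" using W1 W2 x by (auto simp: bundle_map_def split: prod.split)
    show "x \<in> over D" using x by (cases x) auto
    fix y assume y: "y \<in> N" "y \<in> over D" "bundle_map \<phi> f y \<in> ?W \<times> UNIV"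
    obtain r L where yr: "y = (r, L)" by (cases y)
    have r: "r \<in> D" "r \<in> U" "\<phi> r \<in> ?W" using y D by (auto simp: yr bundle_map_def)
    then obtain r' where "r' \<in> D \<inter> D'" "\<phi> r = \<phi> r'" by auto
    then have "r \<in> D'" using chart_inv(1) D r by (metis IntD1 IntD2 subsetD)
    have L: "L \<in> endos (GTM \<A> r)" using y N by (auto simp: yr end_bundle_def)
    then have LG: "L A \<in> GTM \<A> r" if "A \<in> GTM \<A> r" for A using that by (auto simp: endos_def)
    have fG: "(\<Sum>c\<in>UNIV. P a c r *\<^sub>R f r c) \<in> GTM \<A> r" for a
      using f[OF r(1)] by (intro subspace_sum subspace_scale GTM_any_subspace)
    have "pair (L (f' r a)) (f' r b) = (\<Sum>c\<in>UNIV. \<Sum>d\<in>UNIV. P a c r * (P b d r * pair (L (f r c)) (f r d)))" for a b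
      unfolding f'[OF r(1) \<open>r \<in> D'\<close>] endos_sum[OF r(2) L f[OF r(1)]]
        base.pair_sum_left[OF UNIV_I r(2) fG LG[OF f[OF r(1)]]]
        base.pair_sum_right[OF UNIV_I r(2) LG[OF f[OF r(1)]] f[OF r(1)]]
      by (simp add: sum_distrib_left)
    then show "y \<in> over D' \<and> bundle_map \<psi> f' y = ?T (bundle_map \<phi> f y)"
      using \<open>r \<in> D'\<close> r W1(4)[OF r(2)] W2(4)[OF r(2), of "(_, _)"]
      by (auto simp: yr bundle_map_def vec_eq_iff)
  qed
qed

text \<open>The members \<open>Inl\<close> of the frame belong to \<open>E\<close> and the members \<open>Inr\<close> to \<open>E\<^sup>\<bottom>\<close>. The involution \<open>\<sigma>\<close> pairs indices of
  opposite sign in each block; it exists since both signatures are neutral.\<close>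

locale framed_chart = gmetric_chart \<A> U \<phi> n E
  for \<A> :: "('p::{t2_space, second_countable_topology}, real ^ 'n) chart set" and U \<phi> n E +
  fixes S :: "'p set" and e :: "'p \<Rightarrow> 'n + 'n \<Rightarrow> 'p gvec" and \<eta> :: "'n + 'n \<Rightarrow> real" and \<sigma> :: "'n \<Rightarrow> 'n"
  assumes S: "open S" "S \<subseteq> U"
    and on: "\<And>q. q \<in> S \<Longrightarrow> orthonormal UNIV \<eta> q (e q)"
    and \<eta>: "\<And>a. \<eta> a * \<eta> a = 1"
    and sec: "\<And>q a. q \<in> S \<Longrightarrow> gsec q (\<lambda>y. e y a)"
    and e_E: "\<And>q i. q \<in> S \<Longrightarrow> e q (Inl i) \<in> E q"
    and off: "\<And>q a. q \<notin> S \<Longrightarrow> e q a = 0"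
    and \<sigma>: "\<And>i. \<sigma> (\<sigma> i) = i" "\<And>i. \<sigma> i \<noteq> i"
      "\<And>i. \<eta> (Inl (\<sigma> i)) = - \<eta> (Inl i)" "\<And>i. \<eta> (Inr (\<sigma> i)) = - \<eta> (Inr i)"

lemma (in gmetric_chart) framed_chart_exists:
  assumes p: "p \<in> U"
  shows "\<exists>S e \<eta> \<sigma>. framed_chart \<A> U \<phi> n E S e \<eta> \<sigma> \<and> p \<in> S"
proof -
  obtain S and f :: "nat \<Rightarrow> 'p \<Rightarrow> 'p gvec"
  where S: "open S" "p \<in> S" "S \<subseteq> U"
    and f: "\<And>q. q \<in> S \<Longrightarrow> orthonormal {..<4 * n} bsign q (\<lambda>a. f a q)"
    "\<And>q a. q \<in> S \<Longrightarrow> a < 4 * n \<Longrightarrow> gsec q (f a)"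
    "\<And>q a. q \<in> S \<Longrightarrow> a < 2 * n \<Longrightarrow> f a q \<in> E q"
    using adapted_frame_nat[OF p] by blast
  obtain \<beta> :: "'n \<Rightarrow> nat" where \<beta>: "bij_betw \<beta> UNIV {..<2 * n}"
    using dim by (metis bij_betw_iff_card card_lessThan finite finite_lessThan)
  have \<beta>lt: "\<beta> i < 2 * n" for i using \<beta> by (auto simp: bij_betw_def)
  have \<beta>inj: "\<beta> i = \<beta> j \<longleftrightarrow> i = j" for i j using \<beta> by (auto simp: bij_betw_def inj_def)
  define h :: "'n + 'n \<Rightarrow> nat" where "h = case_sum \<beta> (\<lambda>i. 2 * n + \<beta> i)"
  have hlt: "h a < 4 * n" for a 
  proof (cases a)
    case (Inl i) then show ?thesis using \<beta>lt[of i] by (simp add: h_def)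
  next
    case (Inr i) then show ?thesis using \<beta>lt[of i] by (simp add: h_def)
  qed
  have hinj: "h a = h b \<longleftrightarrow> a = b" for a b
    using \<beta>lt \<beta>inj by (cases a; cases b; simp add: h_def) (metis not_add_less1)+
  define e where "e q a = (if q \<in> S then f (h a) q else 0)" for q a
  define flip where "flip k = (if k < n then k + n else k - n)" for k
  define \<sigma> where "\<sigma> i = inv_into UNIV \<beta> (flip (\<beta> i))" for i
  have fl: "flip (\<beta> i) < 2 * n" "flip (flip (\<beta> i)) = \<beta> i" "flip (\<beta> i) \<noteq> \<beta> i"
      "bsign (flip (\<beta> i)) = - bsign (\<beta> i)" "bsign (2 * n + flip (\<beta> i)) = - bsign (2 * n + \<beta> i)" for i
    using \<beta>lt[of i] by (auto simp: flip_def bsign_def)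
  have \<beta>\<sigma>: "\<beta> (\<sigma> i) = flip (\<beta> i)" for i
    using \<beta> fl(1) unfolding \<sigma>_def by (intro f_inv_into_f) (auto simp: bij_betw_def)
  have "framed_chart \<A> U \<phi> n E S e (\<lambda>a. bsign (h a)) \<sigma>"
  proof (unfold_locales)
    show "orthonormal UNIV (\<lambda>a. bsign (h a)) q (e q)" if "q \<in> S" for q
      using f(1)[OF that] hlt hinj that by (auto simp: orthonormal_def e_def)
    show "gsec q (\<lambda>y. e y a)" if q: "q \<in> S" for q a
    proof (rule gsec_cong[OF _ f(2)[OF q hlt]])
      show "q \<in> U" using q S by auto
      show "e y a \<in> GTM \<A> y" for y
        using f(1)[of y] hlt zero_GTM by (auto simp: e_def orthonormal_def)
      show "base.near q (\<lambda>y. f (h a) y = e y a)"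
        using S q by (subst near_iff) (auto simp: e_def intro!: exI[of _ S])
    qed
    show "e q (Inl i) \<in> E q" if "q \<in> S" for q i using that f(3) \<beta>lt by (simp add: e_def h_def)
    show "\<sigma> (\<sigma> i) = i" "\<sigma> i \<noteq> i" for i using \<beta>inj \<beta>\<sigma> fl by metis+
    show "bsign (h (Inl (\<sigma> i))) = - bsign (h (Inl i))" "bsign (h (Inr (\<sigma> i))) = - bsign (h (Inr i))" for i
      by (simp_all add: h_def \<beta>\<sigma> fl)
  qed (use S bsign_square in \<open>auto simp: e_def\<close>)
  then show ?thesis using S(2) by blast
qed

context framed_chart
begin

lemma SU: "q \<in> S \<Longrightarrow> q \<in> U" using S by auto

lemma eG: "e q a \<in> GTM \<A> q"
  using on[of q] off[of q a] zero_GTM by (cases "q \<in> S") (auto simp: orthonormal_def)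

lemma ee: "q \<in> S \<Longrightarrow> pair (e q a) (e q b) = (if a = b then \<eta> a else 0)"
  using on[of q] by (simp add: orthonormal_def)

lemma e_GTM_span: "q \<in> S \<Longrightarrow> span (range (e q)) = GTM \<A> q"
proof (rule orthonormal_spans[OF SU finite on \<eta>])
  assume q: "q \<in> S"
  show "GTM \<A> q \<subseteq> span (range (frame q))" using GTM_span[OF SU[OF q]] by simp
  show "card (range (frame q)) \<le> card (UNIV :: ('n + 'n) set)" by (rule card_image_le) simp
qed (auto intro: GTM_any_subspace eG)

lemma expand: "q \<in> S \<Longrightarrow> A \<in> GTM \<A> q \<Longrightarrow> A = (\<Sum>a\<in>UNIV. (\<eta> a * pair A (e q a)) *\<^sub>R e q a)"
  using orthonormal_expand[OF SU finite on \<eta>] e_GTM_span by blast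

lemma sum_split: "(\<Sum>a\<in>UNIV. g a) = (\<Sum>i\<in>UNIV. g (Inl i)) + (\<Sum>i\<in>UNIV. g (Inr i))"
  for g :: "'n + 'n \<Rightarrow> 'z::comm_monoid_add"
  by (simp add: UNIV_Plus_UNIV[symmetric] sum.Plus del: UNIV_Plus_UNIV)

lemma E_iff: "q \<in> S \<Longrightarrow> A \<in> E q \<longleftrightarrow> A \<in> GTM \<A> q \<and> (\<forall>i. pair A (e q (Inr i)) = 0)"
proof (intro iffI conjI allI)
  assume q: "q \<in> S" and A: "A \<in> E q"
  show AG: "A \<in> GTM \<A> q" using A E_GTM by blast
  obtain T where T: "finite T" "E q \<subseteq> span T" "card T \<le> 2 * n" using E_finite_span by blast
  have ol: "orthonormal (range Inl) \<eta> q (e q)" using on[OF q] by (auto simp: orthonormal_def)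
  have "card (range (Inl :: 'n \<Rightarrow> 'n + 'n)) = CARD('n)" by (rule card_image) simp
  then have sp: "span (e q ` range Inl) = E q"
    using T e_E[OF q] dim by (intro orthonormal_spans[OF SU[OF q] _ ol \<eta> E_subspace T(2,1)]) auto
  have A': "A = (\<Sum>a\<in>range Inl. (\<eta> a * pair A (e q a)) *\<^sub>R e q a)"
    by (rule orthonormal_expand[OF SU[OF q] _ ol \<eta>]) (use A sp in auto)
  fix i
  have "pair (\<Sum>a\<in>range Inl. (\<eta> a * pair A (e q a)) *\<^sub>R e q a) (e q (Inr i))
      = (\<Sum>a\<in>range Inl. (\<eta> a * pair A (e q a)) * pair (e q a) (e q (Inr i)))"
    by (rule base.pair_sum_left[OF UNIV_I SU[OF q] eG eG])
  also have "\<dots> = 0" using ee[OF q] by (auto intro: sum.neutral)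
  finally show "pair A (e q (Inr i)) = 0" by (subst A')
next
  assume q: "q \<in> S" and A: "A \<in> GTM \<A> q \<and> (\<forall>i. pair A (e q (Inr i)) = 0)"
  have "(\<Sum>a\<in>UNIV. (\<eta> a * pair A (e q a)) *\<^sub>R e q a) \<in> E q"
    unfolding sum_split using A e_E[OF q] by (auto intro!: subspace_sum subspace_scale E_subspace)
  then show "A \<in> E q"
    by (rule back_subst[where P = "\<lambda>w. w \<in> E q", OF _ expand[OF q conjunct1[OF A], symmetric]])
qed

lemma pair_expand:
  assumes q: "q \<in> S" and "A \<in> GTM \<A> q" "B \<in> GTM \<A> q"
  shows "pair A B = (\<Sum>a\<in>UNIV. \<eta> a * pair A (e q a) * pair B (e q a))"
proof -
  have "pair (\<Sum>a\<in>UNIV. (\<eta> a * pair A (e q a)) *\<^sub>R e q a) B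
      = (\<Sum>a\<in>UNIV. \<eta> a * pair A (e q a) * pair (e q a) B)"
    by (rule base.pair_sum_left[OF UNIV_I SU[OF q] assms(3) eG])
  also have "\<dots> = (\<Sum>a\<in>UNIV. \<eta> a * pair A (e q a) * pair B (e q a))"
    by (simp add: pair_commute[of B])
  finally show ?thesis
    by (subst expand[OF q assms(2)])
qed

lemma orth_iff: "q \<in> S \<Longrightarrow> A \<in> orth \<A> E q \<longleftrightarrow> A \<in> GTM \<A> q \<and> (\<forall>i. pair A (e q (Inl i)) = 0)"
proof (intro iffI conjI allI)
  assume q: "q \<in> S" and "A \<in> orth \<A> E q"
  then show "A \<in> GTM \<A> q" "pair A (e q (Inl i)) = 0" for i
    using e_E[OF q] by (auto simp: orth_def pair_commute)
next
  assume q: "q \<in> S" and A: "A \<in> GTM \<A> q \<and> (\<forall>i. pair A (e q (Inl i)) = 0)"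
  have "pair B A = 0" if B: "B \<in> E q" for B
    using pair_expand[OF q, of B A] A B E_iff[OF q] by (auto simp: sum_split)
  with A show "A \<in> orth \<A> E q" by (simp add: orth_def)
qed

lemma GTM_eqI: "q \<in> S \<Longrightarrow> A \<in> GTM \<A> q \<Longrightarrow> B \<in> GTM \<A> q \<Longrightarrow> (\<And>a. pair A (e q a) = pair B (e q a)) \<Longrightarrow> A = B"
  using expand[of q A] expand[of q B] by simp

lemma pair_lincomb_e:
  "q \<in> S \<Longrightarrow> pair (\<Sum>a\<in>UNIV. c a *\<^sub>R e q a) (e q b) = \<eta> b * c b"
  using base.pair_sum_left[OF UNIV_I SU, of q "e q b" UNIV "e q" c] eG ee
  by (simp add: if_distrib cong: if_cong)

lemma lincomb_e_GTM: "(\<Sum>a\<in>I. c a *\<^sub>R e q a) \<in> GTM \<A> q"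
  by (intro subspace_sum subspace_scale GTM_any_subspace eG)

lemma proj_E_pair:
  assumes q: "q \<in> S" and A: "A \<in> GTM \<A> q"
  shows "proj_E \<A> E q A \<in> GTM \<A> q" "pair (proj_E \<A> E q A) (e q a) = (case a of Inl i \<Rightarrow> pair A (e q a) | Inr i \<Rightarrow> 0)"
    "proj_E \<A> E q A = (\<Sum>i\<in>UNIV. (\<eta> (Inl i) * pair A (e q (Inl i))) *\<^sub>R e q (Inl i))"
proof -
  let ?B = "\<Sum>a\<in>UNIV. (case a of Inl i \<Rightarrow> \<eta> a * pair A (e q a) | Inr i \<Rightarrow> 0) *\<^sub>R e q a"
  have B: "pair ?B (e q a) = (case a of Inl i \<Rightarrow> pair A (e q a) | Inr i \<Rightarrow> 0)" for a
    unfolding pair_lincomb_e[OF q] using \<eta>[of a] by (cases a) (simp_all flip: mult.assoc)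
  have BE: "?B \<in> E q" unfolding E_iff[OF q] using B lincomb_e_GTM by simp
  have "A - ?B \<in> orth \<A> E q" unfolding orth_iff[OF q]
    using B base.pair_diff_left[OF A lincomb_e_GTM eG] A lincomb_e_GTM subspace_diff[OF GTM_any_subspace]
    by auto
  moreover have "C = ?B" if C: "C \<in> E q" "A - C \<in> orth \<A> E q" for C
  proof (rule GTM_eqI[OF q _ lincomb_e_GTM])
    show CG: "C \<in> GTM \<A> q" using C E_GTM by blast
    show "pair C (e q a) = pair ?B (e q a)" for a
      unfolding B using C base.pair_diff_left[OF A CG eG, of a] E_iff[OF q] orth_iff[OF q]
      by (cases a) auto
  qed
  ultimately have "(THE B. B \<in> E q \<and> A - B \<in> orth \<A> E q) = ?B"
    using BE by (intro the_equality conjI) (assumption | elim conjE)+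
  then have "proj_E \<A> E q A = ?B" using A by (simp only: proj_E_def if_True)
  then show "proj_E \<A> E q A \<in> GTM \<A> q" "pair (proj_E \<A> E q A) (e q a) = (case a of Inl i \<Rightarrow> pair A (e q a) | Inr i \<Rightarrow> 0)"
    "proj_E \<A> E q A = (\<Sum>i\<in>UNIV. (\<eta> (Inl i) * pair A (e q (Inl i))) *\<^sub>R e q (Inl i))"
    using B lincomb_e_GTM[where I = UNIV and c = "\<lambda>a. case a of Inl i \<Rightarrow> \<eta> a * pair A (e q a) | Inr i \<Rightarrow> 0"]
    by (simp_all add: sum_split)
qed

definition endo_mat :: "'p \<Rightarrow> ('p gvec \<Rightarrow> 'p gvec) \<Rightarrow> real ^ ('n + 'n) ^ ('n + 'n)"
  where "endo_mat q L = (\<chi> a b. pair (L (e q a)) (e q b))"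

definition \<Psi> :: "'p gpoint \<Rightarrow> (real ^ 'n) \<times> (real ^ ('n + 'n) ^ ('n + 'n))"
  where "\<Psi> = bundle_map \<phi> e"

lemma \<Psi>_eq: "\<Psi> (q, L) = (\<phi> q, endo_mat q L)"
  by (simp add: \<Psi>_def bundle_map_def endo_mat_def)

text \<open>Orthonormal frames and coordinate frames are smooth combinations of each other.\<close>

lemma frame_chart:
  assumes N: "N \<subseteq> end_bundle \<A>"
  shows "smooth_chart (smooth_near (end_charts \<A>) N) N (over S) \<Psi>"
proof
  fix x :: "'p gpoint" assume x: "x \<in> N" "x \<in> over S"
  have ec: "end_charts \<A> = (\<lambda>(V, \<psi>). (over V, bundle_map \<psi> (coord_frame \<A> (V, \<psi>)))) ` \<A>"
    unfolding end_charts_def bundle_map_def by (intro image_cong) auto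
  have xS: "fst x \<in> S" using x by auto
  have change: "(g \<in> smooth_near {(over V, bundle_map \<psi> (coord_frame \<A> (V, \<psi>)))} N x \<longrightarrow>
        g \<in> smooth_near {(over S, \<Psi>)} N x) \<and>
      (g \<in> smooth_near {(over S, \<Psi>)} N x \<longrightarrow>
        g \<in> smooth_near {(over V, bundle_map \<psi> (coord_frame \<A> (V, \<psi>)))} N x)"
    if V: "(V, \<psi>) \<in> \<A>" "fst x \<in> V" for V \<psi> g
  proof -
    interpret c: manifold_chart \<A> V \<psi> using atlas V(1) by unfold_locales
    have cf: "coord_frame \<A> (V, \<psi>) y a = c.frame y a" if "y \<in> V" for y a
      using that by (simp add: c.frame_def)
    show ?thesis
    proof (intro conjI impI)
      assume "g \<in> smooth_near {(over V, bundle_map \<psi> (coord_frame \<A> (V, \<psi>)))} N x"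
      then show "g \<in> smooth_near {(over S, \<Psi>)} N x" unfolding \<Psi>_def
      proof (rule bundle_chart_change[where P = "\<lambda>a c y. \<eta> c * pair (c.frame y a) (e y c)", rotated -1])
        fix y assume y: "y \<in> S" "y \<in> V"
        show "coord_frame \<A> (V, \<psi>) y a = (\<Sum>c\<in>UNIV. (\<eta> c * pair (c.frame y a) (e y c)) *\<^sub>R e y c)" for a
          unfolding cf[OF y(2)] by (rule expand[OF y(1) c.frame_GTM])
        show "(\<lambda>y. \<eta> c * pair (c.frame y a) (e y c)) \<in> cinf \<A> y" for a c
          using c.gsec_frame[OF y(2)] SU[OF y(1)]
          by (intro base.C_mult base.C_const pair_smooth sec y) auto
        show "(\<lambda>z. \<psi> z $ i) \<in> cinf \<A> y" for i by (rule c.coordf_mem[OF y(2)])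
      qed (use S c.open_U N x xS V eG in auto)
    next
      assume "g \<in> smooth_near {(over S, \<Psi>)} N x"
      then show "g \<in> smooth_near {(over V, bundle_map \<psi> (coord_frame \<A> (V, \<psi>)))} N x" unfolding \<Psi>_def
      proof (rule c.bundle_chart_change[where P = "\<lambda>c a y. c.crd y (e y c) a", rotated -1])
        fix y assume y: "y \<in> V" "y \<in> S"
        show "e y a = (\<Sum>c\<in>UNIV. c.crd y (e y a) c *\<^sub>R coord_frame \<A> (V, \<psi>) y c)" for a
          unfolding cf[OF y(1)] by (rule c.GTM_expand[OF y(1) eG])
        show "(\<lambda>y. c.crd y (e y a) c) \<in> cinf \<A> y" for a c
          using sec[OF y(2), of a] c.gsec_iff[OF y(1), of "\<lambda>y. e y a"] by simp
        show "(\<lambda>z. \<phi> z $ i) \<in> cinf \<A> y" for i by (rule coordf_mem[OF SU[OF y(2)]])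
      qed (use S c.open_U N x xS V cf c.frame_GTM in auto)
    qed
  qed
  show "smooth_near (end_charts \<A>) N x = smooth_near {(over S, \<Psi>)} N x"
  proof (rule smooth_near_eq_single[OF x])
    show "\<exists>(V, \<psi>)\<in>end_charts \<A>. x \<in> V"
      unfolding ec using chart_cover[of "fst x"] by (auto simp: split_beta)
  qed (use change in \<open>auto simp: ec\<close>)
qed

end

section \<open>The tangent spaces of the reflector space\<close>

lemma endosI:
  assumes "\<And>u w a b. u \<in> S \<Longrightarrow> w \<in> S \<Longrightarrow> L (a *\<^sub>R u + b *\<^sub>R w) = a *\<^sub>R L u + b *\<^sub>R L w"
    and "\<And>u. u \<in> S \<Longrightarrow> L u \<in> S" and "\<And>u. u \<notin> S \<Longrightarrow> L u = 0"
  shows "L \<in> endos S"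
  using assms by (auto simp: endos_def linear_upon_def)

lemma endosD:
  assumes "L \<in> endos S"
  shows "u \<in> S \<Longrightarrow> w \<in> S \<Longrightarrow> L (a *\<^sub>R u + b *\<^sub>R w) = a *\<^sub>R L u + b *\<^sub>R L w"
    and "u \<in> S \<Longrightarrow> L u \<in> S" and "u \<notin> S \<Longrightarrow> L u = 0"
  using assms by (auto simp: endos_def linear_upon_def)

context gmetric_chart
begin

lemma skew_fibreI:
  assumes "L \<in> endos (GTM \<A> q)"
    "\<And>A B. A \<in> GTM \<A> q \<Longrightarrow> B \<in> GTM \<A> q \<Longrightarrow> pair (L A) B = - pair A (L B)"
    "\<And>A. A \<in> E q \<Longrightarrow> L A \<in> E q" "\<And>A. A \<in> orth \<A> E q \<Longrightarrow> L A \<in> orth \<A> E q"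
  shows "L \<in> skew_fibre \<A> E q"
  unfolding skew_fibre_def using assms(1,2) image_subsetI[of "E q" L, OF assms(3)] image_subsetI[of "orth \<A> E q" L, OF assms(4)] by simp

lemma skew_end: "skew_bundle \<A> E \<subseteq> end_bundle \<A>"
  by (auto simp: skew_bundle_def end_bundle_def skew_fibre_def)

lemma reflector_iff:
  "(q, K) \<in> reflector_space \<A> E \<longleftrightarrow> K \<in> skew_fibre \<A> E q \<and> (\<forall>A\<in>GTM \<A> q. K (K A) = A)"
proof
  assume K: "(q, K) \<in> reflector_space \<A> E"
  then have sk: "pair (K A) B + pair A (K B) = 0" if "A \<in> GTM \<A> q" "B \<in> GTM \<A> q" for A B
    using that by (auto simp: reflector_space_def paracomplex_def)
  have KG: "K A \<in> GTM \<A> q" if "A \<in> GTM \<A> q" for A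
    using K that by (auto simp: reflector_space_def paracomplex_def endos_def)
  have KE: "K B \<in> E q" if "B \<in> E q" for B using K that by (auto simp: reflector_space_def)
  have "K ` orth \<A> E q \<subseteq> orth \<A> E q"
  proof
    fix C assume "C \<in> K ` orth \<A> E q"
    then obtain A where A: "A \<in> orth \<A> E q" "C = K A" by auto
    then have AG: "A \<in> GTM \<A> q" by (simp add: orth_def)
    have "pair B (K A) = 0" if B: "B \<in> E q" for B
    proof -
      have "pair (K B) A = 0" using A(1) KE[OF B] by (simp add: orth_def)
      moreover have "B \<in> GTM \<A> q" using B E_GTM by blast
      ultimately show ?thesis using sk[OF _ AG, of B] by simp
    qed
    then show "C \<in> orth \<A> E q" using A KG[OF AG] by (simp add: orth_def)
  qed
  then show "K \<in> skew_fibre \<A> E q \<and> (\<forall>A\<in>GTM \<A> q. K (K A) = A)"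
    using K by (auto simp: reflector_space_def paracomplex_def skew_fibre_def)
qed (auto simp: reflector_space_def paracomplex_def skew_fibre_def)

lemma reflector_skew: "reflector_space \<A> E \<subseteq> skew_bundle \<A> E"
  using reflector_iff by (auto simp: skew_bundle_def)

lemma skew_fibreD:
  assumes "L \<in> skew_fibre \<A> E q"
  shows "L \<in> endos (GTM \<A> q)" "A \<in> GTM \<A> q \<Longrightarrow> L A \<in> GTM \<A> q"
    "A \<in> GTM \<A> q \<Longrightarrow> B \<in> GTM \<A> q \<Longrightarrow> pair (L A) B = - pair A (L B)"
    "A \<in> E q \<Longrightarrow> L A \<in> E q" "A \<in> orth \<A> E q \<Longrightarrow> L A \<in> orth \<A> E q" "A \<notin> GTM \<A> q \<Longrightarrow> L A = 0"
    "A \<in> GTM \<A> q \<Longrightarrow> B \<in> GTM \<A> q \<Longrightarrow> L (a *\<^sub>R A + b *\<^sub>R B) = a *\<^sub>R L A + b *\<^sub>R L B"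
proof -
  have L: "L \<in> endos (GTM \<A> q)" "L ` E q \<subseteq> E q" "L ` orth \<A> E q \<subseteq> orth \<A> E q"
    and sk: "\<forall>A\<in>GTM \<A> q. \<forall>B\<in>GTM \<A> q. pair (L A) B + pair A (L B) = 0"
    using assms unfolding skew_fibre_def by blast+
  show "L \<in> endos (GTM \<A> q)" "A \<in> GTM \<A> q \<Longrightarrow> L A \<in> GTM \<A> q" "A \<notin> GTM \<A> q \<Longrightarrow> L A = 0"
    "A \<in> GTM \<A> q \<Longrightarrow> B \<in> GTM \<A> q \<Longrightarrow> L (a *\<^sub>R A + b *\<^sub>R B) = a *\<^sub>R L A + b *\<^sub>R L B"
    using endosD[OF L(1)] L(1) by blast+
  show "A \<in> E q \<Longrightarrow> L A \<in> E q" "A \<in> orth \<A> E q \<Longrightarrow> L A \<in> orth \<A> E q"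
    using L(2,3) by blast+
  show "A \<in> GTM \<A> q \<Longrightarrow> B \<in> GTM \<A> q \<Longrightarrow> pair (L A) B = - pair A (L B)"
    using sk by (simp add: eq_neg_iff_add_eq_0)
qed

lemma orth_subspace: "subspace (orth \<A> E q)"
proof -
  obtain V \<psi> where V: "(V, \<psi>) \<in> \<A>" "q \<in> V" using chart_cover by blast
  then interpret c: manifold_chart \<A> V \<psi> using atlas by unfold_locales
  have EG: "A \<in> GTM \<A> q" if "A \<in> E q" for A using that E_GTM by blast
  show ?thesis
  proof (rule subspaceI)
    show "0 \<in> orth \<A> E q"
      unfolding orth_def using c.base.pair_zero_left[OF UNIV_I V(2) EG] zero_GTM by (simp add: pair_commute)
    fix A B :: "'p gvec" and c assume A: "A \<in> orth \<A> E q"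
    then show "c *\<^sub>R A \<in> orth \<A> E q"
      unfolding orth_def using c.base.pair_scale_left[OF _ EG] subspace_scale[OF GTM_any_subspace]
      by (simp add: pair_commute)
    assume "B \<in> orth \<A> E q"
    with A show "A + B \<in> orth \<A> E q"
      unfolding orth_def using c.base.pair_add_left[OF _ _ EG] subspace_add[OF GTM_any_subspace]
      by (simp add: pair_commute)
  qed
qed

lemma zero_endo: "L \<in> skew_fibre \<A> E q \<Longrightarrow> L 0 = 0"
  using skew_fibreD(7)[of L q 0 0 0 0] zero_GTM by simp

lemma skew_fibre_lincomb:
  assumes L: "L \<in> skew_fibre \<A> E q" and M: "M \<in> skew_fibre \<A> E q"
  shows "(\<lambda>A. a *\<^sub>R L A + b *\<^sub>R M A) \<in> skew_fibre \<A> E q"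
proof -
  note LD = skew_fibreD[OF L] and MD = skew_fibreD[OF M]
  have p: "pair (a *\<^sub>R L A + b *\<^sub>R M A) B = a * pair (L A) B + b * pair (M A) B"
      "pair B (a *\<^sub>R L A + b *\<^sub>R M A) = a * pair B (L A) + b * pair B (M A)"
    if "A \<in> GTM \<A> q" "B \<in> GTM \<A> q" for A B
    using pair_lin_left[OF LD(2)[OF that(1)] MD(2)[OF that(1)] that(2)] by (simp_all add: pair_commute[of B])
  show ?thesis
  proof (intro skew_fibreI endosI)
    fix A B c d assume AB: "A \<in> GTM \<A> q" "B \<in> GTM \<A> q"
    show "a *\<^sub>R L (c *\<^sub>R A + d *\<^sub>R B) + b *\<^sub>R M (c *\<^sub>R A + d *\<^sub>R B)
      = c *\<^sub>R (a *\<^sub>R L A + b *\<^sub>R M A) + d *\<^sub>R (a *\<^sub>R L B + b *\<^sub>R M B)"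
      unfolding LD(7)[OF AB] MD(7)[OF AB] by (simp add: algebra_simps)
  next
    fix A B assume AB: "A \<in> GTM \<A> q" "B \<in> GTM \<A> q"
    show "pair (a *\<^sub>R L A + b *\<^sub>R M A) B = - pair A (a *\<^sub>R L B + b *\<^sub>R M B)"
      unfolding p[OF AB] p(2)[OF AB(2,1)] LD(3)[OF AB] MD(3)[OF AB] by simp
  qed (simp_all add: LD MD subspace_add subspace_scale GTM_any_subspace E_subspace orth_subspace)
qed

lemma skew_fibre_zero: "(\<lambda>A. 0) \<in> skew_fibre \<A> E q"
proof -
  obtain V \<psi> where V: "(V, \<psi>) \<in> \<A>" "q \<in> V" using chart_cover by blast
  then interpret c: manifold_chart \<A> V \<psi> using atlas by unfold_locales
  show ?thesis
    by (intro skew_fibreI endosI)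
      (simp_all add: c.base.pair_zero_left[OF UNIV_I V(2)] pair_commute[of _ 0] zero_GTM
        subspace_0[OF E_subspace] subspace_0[OF orth_subspace])
qed

lemma vert_iff: "V \<in> vert \<A> E (q, K) \<longleftrightarrow> V \<in> skew_fibre \<A> E q \<and> (\<forall>A\<in>GTM \<A> q. V (K A) = - K (V A))"
  by (simp add: vert_def)

lemma vert_lincomb:
  assumes K: "K \<in> skew_fibre \<A> E q" and V: "V \<in> vert \<A> E (q, K)" and W: "W \<in> vert \<A> E (q, K)"
  shows "(\<lambda>A. a *\<^sub>R V A + b *\<^sub>R W A) \<in> vert \<A> E (q, K)"
proof -
  have Vs: "V \<in> skew_fibre \<A> E q" and VK: "\<And>A. A \<in> GTM \<A> q \<Longrightarrow> V (K A) = - K (V A)"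
    using V vert_iff by blast+
  have Ws: "W \<in> skew_fibre \<A> E q" and WK: "\<And>A. A \<in> GTM \<A> q \<Longrightarrow> W (K A) = - K (W A)"
    using W vert_iff by blast+
  show ?thesis unfolding vert_iff
    by (simp add: skew_fibre_lincomb[OF Vs Ws] VK WK skew_fibreD(7)[OF K] skew_fibreD(2)[OF Vs] skew_fibreD(2)[OF Ws])
qed

lemma vert_compose:
  assumes K: "(q, K) \<in> reflector_space \<A> E" and V: "V \<in> vert \<A> E (q, K)"
  shows "(\<lambda>A. K (V A)) \<in> vert \<A> E (q, K)"
proof -
  have Ks: "K \<in> skew_fibre \<A> E q" and KK: "\<And>A. A \<in> GTM \<A> q \<Longrightarrow> K (K A) = A"
    using K reflector_iff by blast+
  have Vs: "V \<in> skew_fibre \<A> E q" and VK: "\<And>A. A \<in> GTM \<A> q \<Longrightarrow> V (K A) = - K (V A)"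
    using V vert_iff by blast+
  note KD = skew_fibreD[OF Ks] and VD = skew_fibreD[OF Vs]
  have mn: "K (- B) = - K B" if "B \<in> GTM \<A> q" for B
    using KD(7)[OF that that, of "-1" 0] by simp
  have mp: "pair A (- B) = - pair A B" if "A \<in> GTM \<A> q" "B \<in> GTM \<A> q" for A B
    using pair_lin_left[OF that(2,2,1), of "-1" 0] by (simp add: pair_commute)
  show ?thesis unfolding vert_iff
  proof (intro conjI ballI skew_fibreI endosI)
    fix A B c d assume AB: "A \<in> GTM \<A> q" "B \<in> GTM \<A> q"
    show "K (V (c *\<^sub>R A + d *\<^sub>R B)) = c *\<^sub>R K (V A) + d *\<^sub>R K (V B)"
      using AB by (simp add: VD(7) KD(7) VD(2))
  next
    fix A B assume AB: "A \<in> GTM \<A> q" "B \<in> GTM \<A> q"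
    have "pair (K (V A)) B = pair A (V (K B))" using AB by (simp add: KD(2,3) VD(2,3))
    then show "pair (K (V A)) B = - pair A (K (V B))"
      using AB by (simp add: VK mp KD(2) VD(2))
  next
    fix A assume A: "A \<in> GTM \<A> q"
    then show "K (V (K A)) = - K (K (V A))" by (simp add: VK mn KD(2) VD(2))
  qed (simp_all add: KD VD zero_endo[OF Ks])
qed

end

context framed_chart
begin

lemma endo_pair_left:
  assumes q: "q \<in> S" and L: "L \<in> endos (GTM \<A> q)" and A: "A \<in> GTM \<A> q" and B: "B \<in> GTM \<A> q"
  shows "pair (L A) B = (\<Sum>a\<in>UNIV. \<eta> a * pair A (e q a) * pair (L (e q a)) B)"
proof -
  have LG: "L A \<in> GTM \<A> q" if "A \<in> GTM \<A> q" for A using endosD(2)[OF L that] .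
  have "pair (L (\<Sum>a\<in>UNIV. (\<eta> a * pair A (e q a)) *\<^sub>R e q a)) B
    = (\<Sum>a\<in>UNIV. \<eta> a * pair A (e q a) * pair (L (e q a)) B)"
    unfolding endos_sum[OF SU[OF q] L eG] by (rule base.pair_sum_left[OF UNIV_I SU[OF q] B LG[OF eG]])
  then show ?thesis by (subst expand[OF q A])
qed

lemma mat_nth: "endo_mat q L $ a $ b = pair (L (e q a)) (e q b)"
  by (simp add: endo_mat_def)

lemma endos_eqI:
  assumes q: "q \<in> S" and L: "L \<in> endos (GTM \<A> q)" "M \<in> endos (GTM \<A> q)" and m: "endo_mat q L = endo_mat q M"
  shows "L = M"
proof
  fix A show "L A = M A"
  proof (cases "A \<in> GTM \<A> q")
    case True
    show ?thesis
    proof (rule GTM_eqI[OF q])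
      show "L A \<in> GTM \<A> q" "M A \<in> GTM \<A> q" using endosD(2)[OF L(1) True] endosD(2)[OF L(2) True] .
      have "pair (L (e q a)) (e q b) = pair (M (e q a)) (e q b)" for a b
        using m mat_nth by metis
      then show "pair (L A) (e q b) = pair (M A) (e q b)" for b
        unfolding endo_pair_left[OF q L(1) True eG] endo_pair_left[OF q L(2) True eG] by simp
    qed
  next
    case False
    then show ?thesis using endosD(3)[OF L(1)] endosD(3)[OF L(2)] by simp
  qed
qed

definition of_mat :: "'p \<Rightarrow> real ^ ('n + 'n) ^ ('n + 'n) \<Rightarrow> 'p gvec \<Rightarrow> 'p gvec"
  where "of_mat q m A = (if A \<in> GTM \<A> q
    then \<Sum>b\<in>UNIV. (\<eta> b * (\<Sum>a\<in>UNIV. \<eta> a * pair A (e q a) * m $ a $ b)) *\<^sub>R e q b else 0)"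

lemma of_mat_pair:
  assumes q: "q \<in> S" and A: "A \<in> GTM \<A> q"
  shows "pair (of_mat q m A) (e q b) = (\<Sum>a\<in>UNIV. \<eta> a * pair A (e q a) * m $ a $ b)"
  using A \<eta>[of b] by (simp add: of_mat_def pair_lincomb_e[OF q] flip: mult.assoc)

lemma of_mat_GTM: "of_mat q m A \<in> GTM \<A> q"
  by (simp add: of_mat_def lincomb_e_GTM zero_GTM)

lemma of_mat_endos: "q \<in> S \<Longrightarrow> of_mat q m \<in> endos (GTM \<A> q)"
proof (intro endosI)
  fix A B a b assume q: "q \<in> S" and AB: "A \<in> GTM \<A> q" "B \<in> GTM \<A> q"
  have G: "a *\<^sub>R A + b *\<^sub>R B \<in> GTM \<A> q" "a *\<^sub>R of_mat q m A + b *\<^sub>R of_mat q m B \<in> GTM \<A> q"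
    by (intro subspace_add subspace_scale GTM_any_subspace of_mat_GTM AB)+
  show "of_mat q m (a *\<^sub>R A + b *\<^sub>R B) = a *\<^sub>R of_mat q m A + b *\<^sub>R of_mat q m B"
  proof (rule GTM_eqI[OF q of_mat_GTM G(2)])
    fix c
    show "pair (of_mat q m (a *\<^sub>R A + b *\<^sub>R B)) (e q c) = pair (a *\<^sub>R of_mat q m A + b *\<^sub>R of_mat q m B) (e q c)"
      unfolding of_mat_pair[OF q G(1)] pair_lin_left[OF AB eG] pair_lin_left[OF of_mat_GTM of_mat_GTM eG]
        of_mat_pair[OF q AB(1)] of_mat_pair[OF q AB(2)]
      by (simp add: sum_distrib_left sum.distrib[symmetric] algebra_simps)
  qed
qed (simp_all add: of_mat_GTM, simp add: of_mat_def)

lemma mat_of_mat: "q \<in> S \<Longrightarrow> endo_mat q (of_mat q m) = m"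
  unfolding vec_eq_iff mat_nth of_mat_pair[OF _ eG]
proof (intro allI)
  fix a b assume q: "q \<in> S"
  have "(\<Sum>c\<in>UNIV. \<eta> c * pair (e q a) (e q c) * m $ c $ b) = (\<Sum>c\<in>UNIV. if c = a then m $ a $ b else 0)"
    using ee[OF q] \<eta> by (intro sum.cong) auto
  then show "(\<Sum>c\<in>UNIV. \<eta> c * pair (e q a) (e q c) * m $ c $ b) = m $ a $ b" by simp
qed

lemma of_mat_mat: "q \<in> S \<Longrightarrow> L \<in> endos (GTM \<A> q) \<Longrightarrow> of_mat q (endo_mat q L) = L"
  by (rule endos_eqI) (auto simp: of_mat_endos mat_of_mat)

text \<open>Matrix multiplication as it appears for \<open>endo_mat\<close>: the signs come from expanding in the frame, and the
  factors are in the order in which the endomorphisms are applied.\<close>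

definition frame_mult :: "real ^ ('n + 'n) ^ ('n + 'n) \<Rightarrow> real ^ ('n + 'n) ^ ('n + 'n) \<Rightarrow> real ^ ('n + 'n) ^ ('n + 'n)"
  where "frame_mult m k = (\<chi> a c. \<Sum>b\<in>UNIV. \<eta> b * m $ a $ b * k $ b $ c)"

lemma mat_compose:
  assumes q: "q \<in> S" and K: "\<And>A. A \<in> GTM \<A> q \<Longrightarrow> K A \<in> GTM \<A> q" and V: "V \<in> endos (GTM \<A> q)"
  shows "endo_mat q (\<lambda>A. V (K A)) = frame_mult (endo_mat q K) (endo_mat q V)"
  by (simp add: vec_eq_iff mat_nth frame_mult_def endo_pair_left[OF q V K[OF eG] eG])

lemma mat_compose_nth:
  assumes q: "q \<in> S" and K: "\<And>A. A \<in> GTM \<A> q \<Longrightarrow> K A \<in> GTM \<A> q" and V: "V \<in> endos (GTM \<A> q)"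
  shows "frame_mult (endo_mat q K) (endo_mat q V) $ a $ c = pair (V (K (e q a))) (e q c)"
  using arg_cong[OF mat_compose[of q K V, OF assms], of "\<lambda>m. m $ a $ c"] by (simp add: mat_nth)

lemma mat_lincomb:
  assumes "\<And>A. A \<in> GTM \<A> q \<Longrightarrow> L A \<in> GTM \<A> q" "\<And>A. A \<in> GTM \<A> q \<Longrightarrow> M A \<in> GTM \<A> q"
  shows "endo_mat q (\<lambda>A. a *\<^sub>R L A + b *\<^sub>R M A) = a *\<^sub>R endo_mat q L + b *\<^sub>R endo_mat q M"
  by (simp add: vec_eq_iff mat_nth pair_lin_left[OF assms(1)[OF eG] assms(2)[OF eG] eG])

definition skew_mat :: "real ^ ('n + 'n) ^ ('n + 'n) \<Rightarrow> bool"
  where "skew_mat m \<longleftrightarrow> (\<forall>a b. m $ a $ b = - m $ b $ a) \<and> (\<forall>i j. m $ Inl i $ Inr j = 0)"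

lemma skew_fibre_iff:
  assumes q: "q \<in> S"
  shows "L \<in> skew_fibre \<A> E q \<longleftrightarrow> L \<in> endos (GTM \<A> q) \<and> skew_mat (endo_mat q L)"
proof (intro iffI conjI)
  assume L: "L \<in> skew_fibre \<A> E q"
  note D = skew_fibreD[OF L]
  show "L \<in> endos (GTM \<A> q)" by (rule D(1))
  show "skew_mat (endo_mat q L)"
    unfolding skew_mat_def mat_nth
  proof (intro conjI allI)
    show "pair (L (e q (Inl i))) (e q (Inr j)) = 0" for i j
      using D(4)[OF e_E[OF q]] E_iff[OF q] by blast
    show "pair (L (e q a)) (e q b) = - pair (L (e q b)) (e q a)" for a b
      using D(3)[OF eG[of q a] eG[of q b]] unfolding pair_commute[of "e q a"] .
  qed
next
  assume "L \<in> endos (GTM \<A> q) \<and> skew_mat (endo_mat q L)"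
  then have L: "L \<in> endos (GTM \<A> q)" and sk: "\<And>a b. pair (L (e q a)) (e q b) = - pair (L (e q b)) (e q a)"
      and bl: "\<And>i j. pair (L (e q (Inl i))) (e q (Inr j)) = 0"
    unfolding skew_mat_def mat_nth by blast+
  have bl': "pair (L (e q (Inr i))) (e q (Inl j)) = 0" for i j using sk bl by (metis neg_equal_0_iff_equal)
  have LG: "L A \<in> GTM \<A> q" if "A \<in> GTM \<A> q" for A using endosD(2)[OF L that] .
  have "pair (L A) B = - pair A (L B)" if AB: "A \<in> GTM \<A> q" "B \<in> GTM \<A> q" for A B
  proof -
    have ex: "pair (L A) B = (\<Sum>a\<in>UNIV. \<Sum>b\<in>UNIV. \<eta> a * pair A (e q a) * (\<eta> b * pair B (e q b) * pair (L (e q a)) (e q b)))"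
      if "A \<in> GTM \<A> q" "B \<in> GTM \<A> q" for A B
      unfolding endo_pair_left[OF q L that] pair_expand[OF q LG[OF eG] that(2)]
      by (simp add: sum_distrib_left algebra_simps)
    have "pair (L A) B = (\<Sum>b\<in>UNIV. \<Sum>a\<in>UNIV. \<eta> a * pair A (e q a) * (\<eta> b * pair B (e q b) * pair (L (e q a)) (e q b)))"
      unfolding ex[OF AB] by (rule sum.swap)
    also have "\<dots> = - (\<Sum>b\<in>UNIV. \<Sum>a\<in>UNIV. \<eta> b * pair B (e q b) * (\<eta> a * pair A (e q a) * pair (L (e q b)) (e q a)))"
      unfolding sum_negf[symmetric] by (intro sum.cong refl) (subst sk, simp)
    finally show ?thesis unfolding pair_commute[of A] ex[OF AB(2,1)] .
  qed
  moreover have "L A \<in> E q" if A: "A \<in> E q" for A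
    unfolding E_iff[OF q]
  proof (intro conjI allI)
    have AG: "A \<in> GTM \<A> q" and z: "\<And>i. pair A (e q (Inr i)) = 0" using A E_iff[OF q] by auto
    show "L A \<in> GTM \<A> q" by (rule LG[OF AG])
    show "pair (L A) (e q (Inr i)) = 0" for i
      unfolding endo_pair_left[OF q L AG eG] sum_split using z bl by simp
  qed
  moreover have "L A \<in> orth \<A> E q" if A: "A \<in> orth \<A> E q" for A
    unfolding orth_iff[OF q]
  proof (intro conjI allI)
    have AG: "A \<in> GTM \<A> q" and z: "\<And>i. pair A (e q (Inl i)) = 0" using A orth_iff[OF q] by auto
    show "L A \<in> GTM \<A> q" by (rule LG[OF AG])
    show "pair (L A) (e q (Inl i)) = 0" for i
      unfolding endo_pair_left[OF q L AG eG] sum_split using z bl' by simp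
  qed
  ultimately show "L \<in> skew_fibre \<A> E q" using L by (auto simp: skew_fibre_def)
qed

lemma of_mat_skew: "q \<in> S \<Longrightarrow> skew_mat m \<Longrightarrow> of_mat q m \<in> skew_fibre \<A> E q"
  by (simp add: skew_fibre_iff of_mat_endos mat_of_mat)

definition unit_mat :: "real ^ ('n + 'n) ^ ('n + 'n)"
  where "unit_mat = (\<chi> a b. if a = b then \<eta> a else 0)"

lemma square_iff:
  assumes q: "q \<in> S" and K: "K \<in> endos (GTM \<A> q)"
  shows "(\<forall>A\<in>GTM \<A> q. K (K A) = A) \<longleftrightarrow> frame_mult (endo_mat q K) (endo_mat q K) = unit_mat"
proof -
  have KG: "K A \<in> GTM \<A> q" if "A \<in> GTM \<A> q" for A using endosD(2)[OF K that] .
  have m: "frame_mult (endo_mat q K) (endo_mat q K) $ a $ b = pair (K (K (e q a))) (e q b)" for a b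
    using mat_compose_nth[of q K K, OF q KG K] by simp
  have K2: "(\<lambda>A. K (K A)) \<in> endos (GTM \<A> q)"
  proof (intro endosI)
    have "K 0 = 0" using endosD(1)[OF K zero_GTM zero_GTM, of 0 0] by simp
    then show "K (K u) = 0" if "u \<notin> GTM \<A> q" for u using endosD(3)[OF K that] by simp
  qed (simp_all add: KG endosD(1)[OF K])
  show ?thesis
  proof
    assume "\<forall>A\<in>GTM \<A> q. K (K A) = A"
    then show "frame_mult (endo_mat q K) (endo_mat q K) = unit_mat"
      using eG ee[OF q] by (simp add: vec_eq_iff m unit_mat_def)
  next
    assume u: "frame_mult (endo_mat q K) (endo_mat q K) = unit_mat"
    have u': "pair (K (K (e q a))) (e q b) = pair (e q a) (e q b)" for a b
      using m[of a b] ee[OF q] unfolding u by (simp add: unit_mat_def)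
    show "\<forall>A\<in>GTM \<A> q. K (K A) = A"
    proof
      fix A assume A: "A \<in> GTM \<A> q"
      show "K (K A) = A"
      proof (rule GTM_eqI[OF q KG[OF KG[OF A]] A])
        fix b
        have "pair (K (K A)) (e q b) = (\<Sum>a\<in>UNIV. \<eta> a * pair A (e q a) * pair (e q b) (e q a))"
          using endo_pair_left[OF q K2 A eG, of b] by (simp add: u' pair_commute[of "e q b"])
        from trans[OF this pair_expand[OF q A eG, symmetric]]
        show "pair (K (K A)) (e q b) = pair A (e q b)" .
      qed
    qed
  qed
qed

sublocale G: smooth_chart "cinf_G \<A> E" "reflector_space \<A> E" "over S" \<Psi>
  by (rule frame_chart) (use skew_end reflector_skew in blast)

sublocale AA: smooth_chart "cinf_A \<A> E" "skew_bundle \<A> E" "over S" \<Psi>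
  by (rule frame_chart) (rule skew_end)

lemma reflector_square_zero_line:
  assumes q: "q \<in> S" and K: "(q, K) \<in> reflector_space \<A> E" and V: "V \<in> vert \<A> E (q, K)"
    and V2: "\<And>A. A \<in> GTM \<A> q \<Longrightarrow> V (V A) = 0"
  shows "(0, endo_mat q V) \<in> G.admissible (q, K)"
proof (rule G.admissible_line, rule always_eventually, rule allI)
  fix t
  have Ks: "K \<in> skew_fibre \<A> E q" and KK: "\<And>A. A \<in> GTM \<A> q \<Longrightarrow> K (K A) = A"
    using K reflector_iff by blast+
  have Vs: "V \<in> skew_fibre \<A> E q" and VK: "\<And>A. A \<in> GTM \<A> q \<Longrightarrow> V (K A) = - K (V A)"
    using V vert_iff by blast+
  note KD = skew_fibreD[OF Ks] and VD = skew_fibreD[OF Vs]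
  let ?K = "\<lambda>A. 1 *\<^sub>R K A + t *\<^sub>R V A"
  have "?K (?K A) = A" if A: "A \<in> GTM \<A> q" for A
    unfolding KD(7)[OF KD(2)[OF A] VD(2)[OF A]] VD(7)[OF KD(2)[OF A] VD(2)[OF A]]
    using A by (simp add: KK VK V2)
  then have "(q, ?K) \<in> reflector_space \<A> E" 
    unfolding reflector_iff using skew_fibre_lincomb[OF Ks Vs] by blast
  moreover have "\<Psi> (q, K) + t *\<^sub>R (0, endo_mat q V) = \<Psi> (q, ?K)"
    using mat_lincomb[of q K V 1 t, OF KD(2) VD(2)] by (simp add: \<Psi>_eq)
  ultimately show "\<Psi> (q, K) + t *\<^sub>R (0, endo_mat q V) \<in> \<Psi> ` (reflector_space \<A> E \<inter> over S)"
    using q by (metis (mono_tags, lifting) IntI case_prodI image_eqI mem_Collect_eq)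
qed

text \<open>A vertical vector is a sum of two vertical vectors with square zero, its parts in the
  eigenspaces of \<open>V \<mapsto> K V\<close>; for those the straight line through \<open>K\<close> stays in the fibre.\<close>

lemma vertical_admissible:
  assumes q: "q \<in> S" and K: "(q, K) \<in> reflector_space \<A> E" and V: "V \<in> vert \<A> E (q, K)"
  shows "(0, endo_mat q V) \<in> G.admissible (q, K)"
proof -
  have x: "(q, K) \<in> reflector_space \<A> E" "(q, K) \<in> over S" using q K by auto
  have Ks: "K \<in> skew_fibre \<A> E q" and KK: "\<And>A. A \<in> GTM \<A> q \<Longrightarrow> K (K A) = A"
    using K reflector_iff by blast+
  have Vs: "V \<in> skew_fibre \<A> E q" and VK: "\<And>A. A \<in> GTM \<A> q \<Longrightarrow> V (K A) = - K (V A)"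
    using V vert_iff by blast+
  note KD = skew_fibreD[OF Ks] and VD = skew_fibreD[OF Vs]
  have KV: "(\<lambda>A. K (V A)) \<in> vert \<A> E (q, K)" by (rule vert_compose[OF K V])
  have mn: "K (- B) = - K B" "V (- B) = - V B" if "B \<in> GTM \<A> q" for B
    using KD(7)[OF that that, of "-1" 0] VD(7)[OF that that, of "-1" 0] by simp_all
  \<comment> \<open>For \<open>s = 1\<close> and \<open>s = -1\<close>, the parts of \<open>V\<close> on which \<open>V \<mapsto> K V\<close> is \<open>1\<close> and \<open>-1\<close>.\<close>
  let ?W = "\<lambda>s A. (1/2) *\<^sub>R V A + (s/2) *\<^sub>R K (V A)"
  have adm: "(0, endo_mat q (?W s)) \<in> G.admissible (q, K)" if s: "s * s = 1" for s
  proof (rule reflector_square_zero_line[OF q K vert_lincomb[OF Ks V KV]])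
    fix A assume A: "A \<in> GTM \<A> q"
    note G = VD(2)[OF A] KD(2)[OF VD(2)[OF A]]
    have "V (K (V A)) = - K (V (V A))" using VK VD(2)[OF A] by simp
    moreover from this have "K (V (K (V A))) = - V (V A)"
      using mn(1)[OF KD(2)[OF VD(2)[OF VD(2)[OF A]]]] KK[OF VD(2)[OF VD(2)[OF A]]] by (simp add: mn KD VD A KK)
    ultimately have "?W s (?W s A) = (1/4 - s * s/4) *\<^sub>R V (V A)"
      unfolding VD(7)[OF G] KD(7)[OF VD(2)[OF G(1)] VD(2)[OF G(2)]] by (simp add: algebra_simps)
    then show "?W s (?W s A) = 0" using s by simp
  qed
  have "endo_mat q V = endo_mat q (?W 1) + endo_mat q (?W (-1))"
    using mat_lincomb[of q V "\<lambda>A. K (V A)" "1/2" "1/2", OF VD(2) KD(2)[OF VD(2)]]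
      mat_lincomb[of q V "\<lambda>A. K (V A)" "1/2" "-1/2", OF VD(2) KD(2)[OF VD(2)]]
    by (simp add: scaleR_add_left[symmetric])
  then have "(0, endo_mat q V) = 1 *\<^sub>R (0, endo_mat q (?W 1)) + 1 *\<^sub>R (0, endo_mat q (?W (-1)))"
    by simp
  then show ?thesis using G.admissible_lincomb[OF x adm adm, of 1 "-1" 1 1] by simp
qed

text \<open>The conditions that cut out \<open>\<G>\<close> have constant coefficients in an orthonormal frame, so the same matrix
  is in \<open>\<G>\<close> over every point of \<open>S\<close>.\<close>

lemma constant_matrix_admissible:
  assumes q: "q \<in> S" and K: "(q, K) \<in> reflector_space \<A> E"
  shows "(u, 0) \<in> G.admissible (q, K)"
proof (rule G.admissible_line)
  have Ks: "K \<in> endos (GTM \<A> q)" "skew_mat (endo_mat q K)" "frame_mult (endo_mat q K) (endo_mat q K) = unit_mat"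
    using K reflector_iff skew_fibre_iff[OF q] square_iff[OF q] by auto
  have op: "open (\<phi> ` S)" using open_chart_image[OF chart S] .
  have "((\<lambda>t. \<phi> q + t *\<^sub>R u) \<longlongrightarrow> \<phi> q + 0 *\<^sub>R u) (at 0)" by (intro tendsto_intros)
  then have "eventually (\<lambda>t. \<phi> q + t *\<^sub>R u \<in> \<phi> ` S) (at 0)"
    using op q by (auto elim!: topological_tendstoD)
  then show "eventually (\<lambda>t. \<Psi> (q, K) + t *\<^sub>R (u, 0) \<in> \<Psi> ` (reflector_space \<A> E \<inter> over S)) (at 0)"
  proof eventually_elim
    case (elim t)
    then obtain r where r: "r \<in> S" "\<phi> q + t *\<^sub>R u = \<phi> r" by auto
    have "(r, of_mat r (endo_mat q K)) \<in> reflector_space \<A> E"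
      unfolding reflector_iff square_iff[OF r(1) of_mat_endos[OF r(1)]] mat_of_mat[OF r(1)]
      using Ks of_mat_skew[OF r(1)] by simp
    moreover have "\<Psi> (q, K) + t *\<^sub>R (u, 0) = \<Psi> (r, of_mat r (endo_mat q K))"
      using r by (simp add: \<Psi>_eq mat_of_mat)
    ultimately show ?case using r(1) by (metis (mono_tags, lifting) IntI case_prodI image_eqI mem_Collect_eq)
  qed
qed

lemma admissible_vert:
  assumes q: "q \<in> S" and K: "(q, K) \<in> reflector_space \<A> E" and V: "V \<in> vert \<A> E (q, K)"
  shows "(u, endo_mat q V) \<in> G.admissible (q, K)"
  using G.admissible_lincomb[OF _ _ constant_matrix_admissible[OF q K, of u] vertical_admissible[OF q K V], of 1 1] q K
  by simp

definition entry :: "'n + 'n \<Rightarrow> 'n + 'n \<Rightarrow> 'p gpoint \<Rightarrow> real"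
  where "entry a b = (\<lambda>y. snd (\<Psi> y) $ a $ b)"

lemma entry_eq: "entry a b (q, L) = pair (L (e q a)) (e q b)"
  by (simp add: entry_def \<Psi>_eq mat_nth)

lemma entry_inner: "entry a b y = \<Psi> y \<bullet> (0, axis a (axis b 1))"
  by (simp add: entry_def inner_prod_def inner_axis)

lemma coord_inner: "coordf i (fst y) = \<Psi> y \<bullet> (axis i 1, 0)"
  by (cases y) (simp add: \<Psi>_eq inner_prod_def inner_axis)

lemma Basis_entry: "(0, axis a (axis b 1)) \<in> (Basis :: ((real ^ 'n) \<times> (real ^ ('n + 'n) ^ ('n + 'n))) set)"
  and Basis_coord: "(axis i 1, 0) \<in> (Basis :: ((real ^ 'n) \<times> (real ^ ('n + 'n) ^ ('n + 'n))) set)"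
proof -
  have "axis a (axis b 1) \<in> (Basis :: (real ^ ('n + 'n) ^ ('n + 'n)) set)"
    by (simp add: axis_in_Basis_iff)
  then show "(0, axis a (axis b 1)) \<in> (Basis :: ((real ^ 'n) \<times> (real ^ ('n + 'n) ^ ('n + 'n))) set)"
    unfolding Basis_prod_def by blast
  have "axis i 1 \<in> (Basis :: (real ^ 'n) set)" by (simp add: axis_in_Basis_iff)
  then show "(axis i 1, 0) \<in> (Basis :: ((real ^ 'n) \<times> (real ^ ('n + 'n) ^ ('n + 'n))) set)"
    unfolding Basis_prod_def by blast
qed

lemma Basis_cases:
  assumes "b \<in> (Basis :: ((real ^ 'n) \<times> (real ^ ('n + 'n) ^ ('n + 'n))) set)"
  obtains i where "b = (axis i 1, 0)" | a c where "b = (0, axis a (axis c 1))"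
  using assms by (auto simp: Basis_prod_def Basis_vec_def)

lemma velocity_entry: "snd (G.velocity v) $ a $ b = v (entry a b)"
  using G.velocity_inner[OF Basis_entry, of v a b]
  by (simp add: entry_inner[abs_def] inner_prod_def inner_axis)

lemma velocity_coord: "fst (G.velocity v) $ i = v (\<lambda>y. coordf i (fst y))"
  using G.velocity_inner[OF Basis_coord, of v i]
  by (simp add: coord_inner inner_prod_def inner_axis)

text \<open>A tangent vector annihilates the constants, so it respects the linearisations of the equations that
  define \<open>\<G>\<close> in the frame: skewness, preservation of the blocks, and \<open>K\<^sup>2 = 1\<close>. These say that its
  matrix part is vertical.\<close>

lemma tangent_G_cases:
  assumes q: "q \<in> S" and K: "(q, K) \<in> reflector_space \<A> E" and v: "v \<in> tangent (cinf_G \<A> E) (q, K)"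
  obtains u V where "V \<in> vert \<A> E (q, K)" "v = G.dvec (q, K) (u, endo_mat q V)" "G.velocity v = (u, endo_mat q V)"
proof -
  have x: "(q, K) \<in> reflector_space \<A> E" "(q, K) \<in> over S" using q K by auto
  have Ks: "K \<in> skew_fibre \<A> E q" and KK: "\<And>A. A \<in> GTM \<A> q \<Longrightarrow> K (K A) = A"
    using K reflector_iff by blast+
  let ?m = "snd (G.velocity v)"
  have eC: "entry a b \<in> cinf_G \<A> E (q, K)" for a b
    using G.C_coord[OF x, of "(0, axis a (axis b 1))"] by (simp add: entry_inner[abs_def])
  have props: "skew_mat (endo_mat r L) \<and> frame_mult (endo_mat r L) (endo_mat r L) = unit_mat"
    if "(r, L) \<in> reflector_space \<A> E" "(r, L) \<in> over S" for r L
    using that reflector_iff skew_fibre_iff square_iff by auto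
  have const: "v f = 0" if "\<And>r L. (r, L) \<in> reflector_space \<A> E \<Longrightarrow> (r, L) \<in> over S \<Longrightarrow> f (r, L) = c" for f c
  proof -
    have "G.near (q, K) (\<lambda>y. f y = (\<lambda>_. c) y)" by (rule G.near_all) (use that in auto)
    from G.tangent_near_cong[OF x v this] show ?thesis using G.tangent_const[OF x v, of c] by simp
  qed
  have "skew_mat ?m" unfolding skew_mat_def velocity_entry
  proof (intro conjI allI)
    fix a b
    have "v (\<lambda>y. entry a b y + entry b a y) = 0"
    proof (rule const[of _ 0])
      fix r L assume "(r, L) \<in> reflector_space \<A> E" "(r, L) \<in> over S"
      then have "endo_mat r L $ a $ b = - endo_mat r L $ b $ a" using props unfolding skew_mat_def by blast
      then show "entry a b (r, L) + entry b a (r, L) = 0" by (simp add: entry_def \<Psi>_eq)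
    qed
    then show "v (entry a b) = - v (entry b a)" using G.tangent_add[OF x v eC eC] by (simp add: eq_neg_iff_add_eq_0)
  next
    fix i j
    show "v (entry (Inl i) (Inr j)) = 0"
    proof (rule const[of _ 0])
      fix r L assume "(r, L) \<in> reflector_space \<A> E" "(r, L) \<in> over S"
      then have "endo_mat r L $ Inl i $ Inr j = 0" using props unfolding skew_mat_def by blast
      then show "entry (Inl i) (Inr j) (r, L) = 0" by (simp add: entry_def \<Psi>_eq)
    qed
  qed
  then have Vs: "of_mat q ?m \<in> skew_fibre \<A> E q" by (rule of_mat_skew[OF q])
  have anti: "frame_mult (endo_mat q K) ?m + frame_mult ?m (endo_mat q K) = 0"
    unfolding vec_eq_iff
  proof (intro allI)
    fix a c
    have "v (\<lambda>y. \<Sum>b\<in>UNIV. \<eta> b * (entry a b y * entry b c y)) = 0"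
    proof (rule const[of _ "unit_mat $ a $ c"])
      fix r L assume "(r, L) \<in> reflector_space \<A> E" "(r, L) \<in> over S"
      then have "frame_mult (endo_mat r L) (endo_mat r L) $ a $ c = unit_mat $ a $ c" using props by simp
      then show "(\<Sum>b\<in>UNIV. \<eta> b * (entry a b (r, L) * entry b c (r, L))) = unit_mat $ a $ c"
        by (simp add: frame_mult_def entry_def \<Psi>_eq mult.assoc)
    qed
    moreover have "v (\<lambda>y. \<Sum>b\<in>UNIV. \<eta> b * (entry a b y * entry b c y))
      = (\<Sum>b\<in>UNIV. \<eta> b * (v (entry a b) * entry b c (q, K) + entry a b (q, K) * v (entry b c)))"
      using eC by (simp add: G.tangent_sum[OF x v] G.tangent_cmult[OF x v] G.tangent_mult[OF x v]
          G.C_mult[OF x] G.C_const[OF x])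
    ultimately show "(frame_mult (endo_mat q K) ?m + frame_mult ?m (endo_mat q K)) $ a $ c = 0 $ a $ c"
      by (simp add: frame_mult_def velocity_entry entry_eq mat_nth sum.distrib algebra_simps)
  qed
  have V: "of_mat q ?m \<in> vert \<A> E (q, K)"
    unfolding vert_iff
  proof (intro conjI ballI Vs)
    fix A assume A: "A \<in> GTM \<A> q"
    note KD = skew_fibreD[OF Ks] and VD = skew_fibreD[OF Vs]
    have sum0: "pair (of_mat q ?m (K (e q a))) (e q c) + pair (K (of_mat q ?m (e q a))) (e q c) = 0" for a c
    proof -
      have "(frame_mult (endo_mat q K) (endo_mat q (of_mat q ?m)) + frame_mult (endo_mat q (of_mat q ?m)) (endo_mat q K)) $ a $ c = 0"
        unfolding mat_of_mat[OF q] anti by simp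
      then show ?thesis
        using mat_compose_nth[of q K "of_mat q ?m", OF q KD(2) VD(1)] mat_compose_nth[of q "of_mat q ?m" K, OF q VD(2) KD(1)]
        by simp
    qed
    let ?L = "\<lambda>A. 1 *\<^sub>R of_mat q ?m (K A) + 1 *\<^sub>R K (of_mat q ?m A)"
    have LG: "?L A \<in> GTM \<A> q" if "A \<in> GTM \<A> q" for A
      by (intro subspace_add[OF GTM_any_subspace] subspace_scale[OF GTM_any_subspace] KD(2)[OF VD(2)] VD(2)[OF KD(2)] that)
    have L: "?L \<in> endos (GTM \<A> q)"
    proof (intro endosI)
      fix A B a b assume AB: "A \<in> GTM \<A> q" "B \<in> GTM \<A> q"
      show "?L (a *\<^sub>R A + b *\<^sub>R B) = a *\<^sub>R ?L A + b *\<^sub>R ?L B"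
        using AB by (simp add: KD(7) VD(7) KD(2) VD(2) algebra_simps)
    next
      fix A assume "A \<notin> GTM \<A> q"
      then show "?L A = 0" using KD(6) VD(6) zero_endo[OF Ks] zero_endo[OF Vs] by simp
    qed (rule LG)
    have "?L A = 0"
    proof (rule GTM_eqI[OF q LG[OF A] zero_GTM])
      fix b
      have "pair (?L (e q a)) (e q b) = 0" for a
        unfolding pair_lin_left[OF VD(2)[OF KD(2)[OF eG]] KD(2)[OF VD(2)[OF eG]] eG] using sum0 by simp
      then show "pair (?L A) (e q b) = pair 0 (e q b)"
        unfolding endo_pair_left[OF q L A eG] base.pair_zero_left[OF UNIV_I SU[OF q] eG] by simp
    qed
    then show "of_mat q ?m (K A) = - K (of_mat q ?m A)" by (simp add: add_eq_0_iff2)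
  qed
  have vel: "G.velocity v = (fst (G.velocity v), endo_mat q (of_mat q ?m))" by (simp add: mat_of_mat[OF q])
  show ?thesis by (rule that[OF V _ vel]) (metis vel G.dvec_velocity[OF x v])
qed

lemma local_rep_G:
  assumes "AA.local_rep x f h W"
  shows "G.local_rep x f h W"
  using assms reflector_skew unfolding AA.local_rep_def G.local_rep_def by blast

lemma tangent_determined_by_cinf_A:
  assumes q: "q \<in> S" and K: "(q, K) \<in> reflector_space \<A> E"
    and v: "v \<in> tangent (cinf_G \<A> E) (q, K)" "w \<in> tangent (cinf_G \<A> E) (q, K)"
    and eq: "\<And>a b. v (entry a b) = w (entry a b)" "\<And>i. v (\<lambda>y. coordf i (fst y)) = w (\<lambda>y. coordf i (fst y))"
  shows "v = w"
proof (rule G.tangent_eqI[OF K _ v])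
  show "(q, K) \<in> over S" using q by simp
  show "G.velocity v = G.velocity w"
    by (intro prod_eqI) (simp_all add: vec_eq_iff velocity_entry velocity_coord eq)
qed

lemma entry_cinf_A: "q \<in> S \<Longrightarrow> (q, K) \<in> skew_bundle \<A> E \<Longrightarrow> entry a b \<in> cinf_A \<A> E (q, K)"
  using AA.C_coord[of "(q, K)" "(0, axis a (axis b 1))"] by (simp add: entry_inner[abs_def])

lemma coord_cinf_A: "q \<in> S \<Longrightarrow> (q, K) \<in> skew_bundle \<A> E \<Longrightarrow> (\<lambda>y. coordf i (fst y)) \<in> cinf_A \<A> E (q, K)"
  using AA.C_coord[of "(q, K)" "(axis i 1, 0)"] by (simp add: coord_inner)

text \<open>Both sides are derivatives along the line \<open>t \<mapsto> K + t V\<close>, which stays in the bundle of skew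
  endomorphisms; and a tangent vector of \<open>\<G>\<close> is determined by the coordinate functions, which live there.\<close>

lemma vert_vec_eq:
  assumes q: "q \<in> S" and K: "(q, K) \<in> reflector_space \<A> E" and V: "V \<in> vert \<A> E (q, K)"
  shows "vert_vec \<A> E (q, K) V = G.dvec (q, K) (0, endo_mat q V)"
proof -
  have x: "(q, K) \<in> reflector_space \<A> E" "(q, K) \<in> over S" using q K by auto
  have sk: "(q, K) \<in> skew_bundle \<A> E" using K reflector_skew by blast
  have Ks: "K \<in> skew_fibre \<A> E q" using K reflector_iff by blast
  have Vs: "V \<in> skew_fibre \<A> E q" using V vert_iff by blast
  note adm = vertical_admissible[OF q K V]
  have d: "G.dvec (q, K) (0, endo_mat q V) f = deriv (\<lambda>t. f (q, K + t *\<^sub>R V)) 0" if f: "f \<in> cinf_A \<A> E (q, K)" for f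
  proof -
    obtain h W where r: "AA.local_rep (q, K) f h W" using AA.mem_C_iff[OF sk x(2)] f by blast
    have W: "open W" "\<Psi> (q, K) \<in> W" "smooth_on W h" using r by (auto simp: AA.local_rep_def)
    have line: "(q, K + t *\<^sub>R V) \<in> skew_bundle \<A> E" "\<Psi> (q, K + t *\<^sub>R V) = \<Psi> (q, K) + t *\<^sub>R (0, endo_mat q V)" for t
    proof -
      have e: "K + t *\<^sub>R V = (\<lambda>A. 1 *\<^sub>R K A + t *\<^sub>R V A)" by (auto simp: plus_fun_def scaleR_fun_def)
      show "(q, K + t *\<^sub>R V) \<in> skew_bundle \<A> E"
        unfolding e using skew_fibre_lincomb[OF Ks Vs, of 1 t] by (simp add: skew_bundle_def)
      show "\<Psi> (q, K + t *\<^sub>R V) = \<Psi> (q, K) + t *\<^sub>R (0, endo_mat q V)"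
        using mat_lincomb[of q K V 1 t, OF skew_fibreD(2)[OF Ks] skew_fibreD(2)[OF Vs]] by (simp add: e \<Psi>_eq)
    qed
    let ?g = "\<lambda>t. h (\<Psi> (q, K) + t *\<^sub>R (0, endo_mat q V))"
    have D: "(h has_derivative frechet_derivative h (at (\<Psi> (q, K) + 0 *\<^sub>R (0, endo_mat q V)))) (at (\<Psi> (q, K) + 0 *\<^sub>R (0, endo_mat q V)))"
      using smooth_on_has_derivative[OF W(3,2)] by (simp add: zero_prod_def[symmetric])
    have "(?g has_derivative (\<lambda>t. frechet_derivative h (at (\<Psi> (q, K) + 0 *\<^sub>R (0, endo_mat q V))) (t *\<^sub>R (0, endo_mat q V)))) (at 0)"
      by (rule has_derivative_compose[where f = "\<lambda>t. \<Psi> (q, K) + t *\<^sub>R (0, endo_mat q V)" and g = h, OF _ D])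
        (auto intro!: derivative_eq_intros)
    moreover have "frechet_derivative h (at (\<Psi> (q, K))) (t *\<^sub>R (0, endo_mat q V)) = frechet_derivative h (at (\<Psi> (q, K))) (0, endo_mat q V) * t" for t
      using linear_cmul[OF smooth_on_linear_derivative[OF W(3,2)], of t "(0, endo_mat q V)"] by simp
    ultimately have "DERIV ?g 0 :> frechet_derivative h (at (\<Psi> (q, K))) (0, endo_mat q V)"
      unfolding has_field_derivative_def by (simp add: zero_prod_def[symmetric])
    moreover have "eventually (\<lambda>t. f (q, K + t *\<^sub>R V) = ?g t) (nhds 0)"
    proof -
      have "((\<lambda>t. \<Psi> (q, K) + t *\<^sub>R (0, endo_mat q V)) \<longlongrightarrow> \<Psi> (q, K) + 0 *\<^sub>R (0, endo_mat q V)) (nhds 0)"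
        by (intro tendsto_intros filterlim_ident)
      then have "eventually (\<lambda>t. \<Psi> (q, K) + t *\<^sub>R (0, endo_mat q V) \<in> W) (nhds 0)"
        by (rule topological_tendstoD[OF _ W(1)]) (use W(2) in \<open>simp add: zero_prod_def[symmetric]\<close>)
      then show ?thesis
        by eventually_elim (use r line q in \<open>auto simp: AA.local_rep_def\<close>)
    qed
    ultimately have "DERIV (\<lambda>t. f (q, K + t *\<^sub>R V)) 0 :> frechet_derivative h (at (\<Psi> (q, K))) (0, endo_mat q V)"
      using DERIV_cong_ev[of 0 0 "\<lambda>t. f (q, K + t *\<^sub>R V)" ?g] by blast
    then show ?thesis using G.dvec_rep[OF x adm local_rep_G[OF r]] DERIV_imp_deriv by metis
  qed
  show ?thesis unfolding vert_vec_def fst_conv snd_conv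
  proof (rule the_equality)
    show "G.dvec (q, K) (0, endo_mat q V) \<in> tangent (cinf_G \<A> E) (q, K) \<and>
      (\<forall>f\<in>cinf_A \<A> E (q, K). G.dvec (q, K) (0, endo_mat q V) f = deriv (\<lambda>t. f (q, K + t *\<^sub>R V)) 0)"
      using d G.dvec_tangent[OF x adm] by blast
    fix v assume v: "v \<in> tangent (cinf_G \<A> E) (q, K) \<and>
      (\<forall>f\<in>cinf_A \<A> E (q, K). v f = deriv (\<lambda>t. f (q, K + t *\<^sub>R V)) 0)"
    show "v = G.dvec (q, K) (0, endo_mat q V)"
      using v d entry_cinf_A[OF q sk] coord_cinf_A[OF q sk]
      by (intro tangent_determined_by_cinf_A[OF q K _ G.dvec_tangent[OF x adm]]) auto
  qed
qed

end

section \<open>Horizontal lifts\<close>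

lemma metric_connectionD:
  assumes "metric_connection \<A> F g D"
  shows "X \<in> TM \<A> p \<Longrightarrow> bsection_at \<A> F p s \<Longrightarrow> D p X s \<in> F p"
    and "bsection_at \<A> F p s \<Longrightarrow> linear_upon (TM \<A> p) (\<lambda>X. D p X s)"
    and "X \<in> TM \<A> p \<Longrightarrow> bsection_at \<A> F p s \<Longrightarrow> bsection_at \<A> F p t \<Longrightarrow>
      D p X (\<lambda>q. s q + t q) = D p X s + D p X t"
    and "vfield_at (cinf \<A>) UNIV p Y \<Longrightarrow> bsection_at \<A> F p s \<Longrightarrow> bsection_at \<A> F p (\<lambda>q. D q (Y q) s)"
    and "X \<in> TM \<A> p \<Longrightarrow> bsection_at \<A> F p s \<Longrightarrow> bsection_at \<A> F p t \<Longrightarrow>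
      X (\<lambda>q. g (s q) (t q)) = g (D p X s) (t p) + g (s p) (D p X t)"
  using assms unfolding metric_connection_def is_connection_def by simp_all

lemma (in framed_chart) proj_E_char:
  assumes q: "q \<in> S" and A: "A \<in> GTM \<A> q"
  shows "proj_E \<A> E q A \<in> E q" "A - proj_E \<A> E q A \<in> orth \<A> E q"
    "B \<in> E q \<Longrightarrow> A - B \<in> orth \<A> E q \<Longrightarrow> proj_E \<A> E q A = B"
proof -
  note P = proj_E_pair[OF q A]
  have d: "pair (A - B) (e q a) = pair A (e q a) - pair B (e q a)" if "B \<in> GTM \<A> q" for B a
    by (rule base.pair_diff_left[OF A that eG])
  show "proj_E \<A> E q A \<in> E q" unfolding E_iff[OF q] using P by simp
  show "A - proj_E \<A> E q A \<in> orth \<A> E q" unfolding orth_iff[OF q]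
    using P A subspace_diff[OF GTM_any_subspace A P(1)] d[OF P(1)] by simp
  assume B: "B \<in> E q" "A - B \<in> orth \<A> E q"
  have BG: "B \<in> GTM \<A> q" using B E_GTM by blast
  show "proj_E \<A> E q A = B"
  proof (rule GTM_eqI[OF q P(1) BG])
    fix a show "pair (proj_E \<A> E q A) (e q a) = pair B (e q a)"
      unfolding P(2) using B d[OF BG, of a] E_iff[OF q] orth_iff[OF q] by (cases a) simp_all
  qed
qed

text \<open>Existence and uniqueness of the projection at points outside the chart, which is needed since sections
  are global: use another adapted frame there.\<close>

lemma (in gmetric_chart) proj_E_any:
  assumes A: "A \<in> GTM \<A> y"
  shows "proj_E \<A> E y A \<in> E y" "A - proj_E \<A> E y A \<in> orth \<A> E y"
    "B \<in> E y \<Longrightarrow> A - B \<in> orth \<A> E y \<Longrightarrow> proj_E \<A> E y A = B"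
proof -
  obtain V \<psi> where V: "(V, \<psi>) \<in> \<A>" "y \<in> V" using chart_cover by blast
  interpret c: gmetric_chart \<A> V \<psi> n E using atlas V(1) dim metric by unfold_locales
  obtain S e \<eta> \<sigma> where f: "framed_chart \<A> V \<psi> n E S e \<eta> \<sigma>" and y: "y \<in> S"
    using c.framed_chart_exists[OF V(2)] by (elim exE conjE) (rule that)
  interpret f: framed_chart \<A> V \<psi> n E S e \<eta> \<sigma> by (rule f)
  show "proj_E \<A> E y A \<in> E y" "A - proj_E \<A> E y A \<in> orth \<A> E y"
    "B \<in> E y \<Longrightarrow> A - B \<in> orth \<A> E y \<Longrightarrow> proj_E \<A> E y A = B"
    using f.proj_E_char[OF y A] by blast+
qed

locale connected_frame = framed_chart \<A> U \<phi> n E S e \<eta> \<sigma>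
  for \<A> :: "('p::{t2_space, second_countable_topology}, real ^ 'n) chart set" and U \<phi> n E S e \<eta> \<sigma> +
  fixes D' D'' :: "'p connection"
  assumes D': "metric_connection \<A> E pair D'"
    and D'': "metric_connection \<A> (orth \<A> E) (\<lambda>A B. - pair A B) D''"
begin

abbreviation D :: "'p connection" where "D \<equiv> sum_connection \<A> E D' D''"

lemma orth_GTM: "A \<in> orth \<A> E q \<Longrightarrow> A \<in> GTM \<A> q" by (simp add: orth_def)

lemma orth_pair: "A \<in> orth \<A> E q \<Longrightarrow> B \<in> E q \<Longrightarrow> pair A B = 0" "A \<in> orth \<A> E q \<Longrightarrow> B \<in> E q \<Longrightarrow> pair B A = 0"
  by (simp_all add: orth_def pair_commute[of A B])

lemma E_in_GTM: "A \<in> E q \<Longrightarrow> A \<in> GTM \<A> q" using E_GTM by blast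

lemma proj_sections:
  assumes q: "q \<in> S" and s: "gsec q s"
  shows "bsection_at \<A> E q (\<lambda>y. proj_E \<A> E y (s y))"
    and "bsection_at \<A> (orth \<A> E) q (\<lambda>y. s y - proj_E \<A> E y (s y))"
proof -
  have sG: "s y \<in> GTM \<A> y" for y by (rule gsec_GTM[OF SU[OF q] s])
  let ?t = "\<lambda>y. \<Sum>i\<in>UNIV. (\<eta> (Inl i) * pair (s y) (e y (Inl i))) *\<^sub>R e y (Inl i)"
  have "gsec q (\<lambda>y. proj_E \<A> E y (s y))"
  proof (rule gsec_cong[OF SU[OF q], of ?t])
    show "gsec q ?t"
      by (intro gsec_sum base.C_mult base.C_const pair_smooth sec q s UNIV_I SU)
    show "proj_E \<A> E y (s y) \<in> GTM \<A> y" for y using proj_E_any(1)[OF sG] E_in_GTM by blast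
    show "base.near q (\<lambda>y. ?t y = proj_E \<A> E y (s y))"
      unfolding near_iff[OF SU[OF q]] using S q proj_E_pair(3)[OF _ sG] by (intro exI[of _ S]) simp
  qed
  then show "bsection_at \<A> E q (\<lambda>y. proj_E \<A> E y (s y))"
      "bsection_at \<A> (orth \<A> E) q (\<lambda>y. s y - proj_E \<A> E y (s y))"
    unfolding bsection_at_def using proj_E_any[OF sG] gsec_diff[OF SU[OF q] s] by simp_all
qed

context fixes q assumes q: "q \<in> S"
begin

lemma D_mem:
  assumes X: "X \<in> TM \<A> q" and s: "gsec q s"
  shows "D' q X (\<lambda>y. proj_E \<A> E y (s y)) \<in> E q"
    and "D'' q X (\<lambda>y. s y - proj_E \<A> E y (s y)) \<in> orth \<A> E q"
    and "D q X s \<in> GTM \<A> q"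
proof -
  show 1: "D' q X (\<lambda>y. proj_E \<A> E y (s y)) \<in> E q"
    by (rule metric_connectionD(1)[OF D' X proj_sections(1)[OF q s]])
  show 2: "D'' q X (\<lambda>y. s y - proj_E \<A> E y (s y)) \<in> orth \<A> E q"
    by (rule metric_connectionD(1)[OF D'' X proj_sections(2)[OF q s]])
  show "D q X s \<in> GTM \<A> q" unfolding sum_connection_def
    by (rule subspace_add[OF GTM_any_subspace E_in_GTM[OF 1] orth_GTM[OF 2]])
qed

lemma D_lin:
  assumes "X \<in> TM \<A> q" "Y \<in> TM \<A> q" "gsec q s"
  shows "D q (a *\<^sub>R X + b *\<^sub>R Y) s = a *\<^sub>R D q X s + b *\<^sub>R D q Y s"
  using metric_connectionD(2)[OF D' proj_sections(1)[OF q assms(3)]]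
    metric_connectionD(2)[OF D'' proj_sections(2)[OF q assms(3)]] assms(1,2)
  unfolding sum_connection_def linear_upon_def by (simp add: algebra_simps)

lemma D_sum:
  assumes s: "gsec q s" and v: "\<And>i. i \<in> I \<Longrightarrow> v i \<in> TM \<A> q" and I: "finite I"
  shows "D q (\<Sum>i\<in>I. c i *\<^sub>R v i) s = (\<Sum>i\<in>I. c i *\<^sub>R D q (v i) s)"
  using I v
proof (induction I rule: finite_induct)
  case empty
  have z: "0 \<in> TM \<A> q" using subspace_0[OF base.subspace_tangent[OF UNIV_I SU[OF q]]] .
  have "D q 0 s = 0" using D_lin[OF z z s, of 0 0] by simp
  then show ?case unfolding sum.empty .
next
  case (insert i F)
  have m: "(\<Sum>i\<in>F. c i *\<^sub>R v i) \<in> TM \<A> q"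
    using insert.prems by (intro subspace_sum subspace_scale base.subspace_tangent UNIV_I SU q) simp
  have d: "D q (c i *\<^sub>R v i + (\<Sum>i\<in>F. c i *\<^sub>R v i)) s = c i *\<^sub>R D q (v i) s + D q (\<Sum>i\<in>F. c i *\<^sub>R v i) s"
    using D_lin[OF insert.prems[OF insertI1] m s, of "c i" 1] unfolding scaleR_one .
  have IH: "D q (\<Sum>i\<in>F. c i *\<^sub>R v i) s = (\<Sum>i\<in>F. c i *\<^sub>R D q (v i) s)"
    using insert.IH insert.prems by simp
  show ?case unfolding sum.insert[OF insert(1,2)] d IH ..
qed

lemma D_expand: "X \<in> TM \<A> q \<Longrightarrow> gsec q s \<Longrightarrow> D q X s = (\<Sum>i\<in>UNIV. X (coordf i) *\<^sub>R D q (coord_vec q i) s)"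
  using D_sum[of s UNIV "coord_vec q" "\<lambda>i. X (coordf i)"] TM_expand[OF SU[OF q], of X] coord_vec_TM[OF SU[OF q]] by simp

lemma D_smooth: "gsec q s \<Longrightarrow> gsec q (\<lambda>y. D y (coord_vec y i) s)"
proof -
  assume s: "gsec q s"
  note b = metric_connectionD(4)[OF D' vfield_coord_vec[OF SU[OF q]] proj_sections(1)[OF q s], of i]
    metric_connectionD(4)[OF D'' vfield_coord_vec[OF SU[OF q]] proj_sections(2)[OF q s], of i]
  have "gsec q (\<lambda>y. D' y (coord_vec y i) (\<lambda>z. proj_E \<A> E z (s z)))"
    "gsec q (\<lambda>y. D'' y (coord_vec y i) (\<lambda>z. s z - proj_E \<A> E z (s z)))"
    using b unfolding bsection_at_def by blast+
  from gsec_lincomb[OF SU[OF q] base.C_const[OF UNIV_I SU[OF q], of 1] base.C_const[OF UNIV_I SU[OF q], of 1] this]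
  show ?thesis unfolding sum_connection_def by simp
qed

lemma D_metric:
  assumes X: "X \<in> TM \<A> q" and s: "gsec q s" and t: "gsec q t"
  shows "X (\<lambda>y. pair (s y) (t y)) = pair (D q X s) (t q) + pair (s q) (D q X t)"
proof -
  let ?s1 = "\<lambda>y. proj_E \<A> E y (s y)" and ?s2 = "\<lambda>y. s y - proj_E \<A> E y (s y)"
  let ?t1 = "\<lambda>y. proj_E \<A> E y (t y)" and ?t2 = "\<lambda>y. t y - proj_E \<A> E y (t y)"
  note U = SU[OF q]
  have sG: "s y \<in> GTM \<A> y" and tG: "t y \<in> GTM \<A> y" for y using gsec_GTM[OF U] s t by auto
  have split: "pair (A1 + A2) (B1 + B2) = pair A1 B1 + pair A2 B2"
    if "A1 \<in> E y" "A2 \<in> orth \<A> E y" "B1 \<in> E y" "B2 \<in> orth \<A> E y" for A1 A2 B1 B2 y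
  proof -
    obtain V \<psi> where V: "(V, \<psi>) \<in> \<A>" "y \<in> V" using chart_cover by blast
    interpret c: manifold_chart \<A> V \<psi> using atlas V(1) by unfold_locales
    have G: "A1 \<in> GTM \<A> y" "A2 \<in> GTM \<A> y" "B1 \<in> GTM \<A> y" "B2 \<in> GTM \<A> y"
      using that by (simp_all add: E_in_GTM orth_GTM)
    have B: "B1 + B2 \<in> GTM \<A> y" by (rule subspace_add[OF GTM_any_subspace G(3,4)])
    have "pair (A1 + A2) (B1 + B2) = pair (B1 + B2) A1 + pair (B1 + B2) A2"
      using c.base.pair_add_left[OF G(1,2) B] by (simp add: pair_commute)
    then show ?thesis
      using c.base.pair_add_left[OF G(3,4,1)] c.base.pair_add_left[OF G(3,4,2)]
        orth_pair[OF that(2,3)] orth_pair[OF that(4,1)]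
      by (simp add: pair_commute)
  qed
  note ps = proj_E_any(1,2)[OF sG] and over_S = proj_E_any(1,2)[OF tG]
  have "pair (s y) (t y) = pair (?s1 y) (?t1 y) + pair (?s2 y) (?t2 y)" for y
    using split[OF ps(1,2) over_S(1,2), of y] by simp
  then have "X (\<lambda>y. pair (s y) (t y)) = X (\<lambda>y. pair (?s1 y) (?t1 y) + pair (?s2 y) (?t2 y))" by simp
  also have "\<dots> = X (\<lambda>y. pair (?s1 y) (?t1 y)) + X (\<lambda>y. pair (?s2 y) (?t2 y))"
    using proj_sections[OF q s] proj_sections[OF q t]
    by (intro base.tangent_add[OF UNIV_I U X] pair_smooth[OF U]) (simp_all add: bsection_at_def)
  also have "X (\<lambda>y. pair (?s1 y) (?t1 y)) = pair (D' q X ?s1) (?t1 q) + pair (?s1 q) (D' q X ?t1)"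
    by (rule metric_connectionD(5)[OF D' X proj_sections(1)[OF q s] proj_sections(1)[OF q t]])
  also have "X (\<lambda>y. pair (?s2 y) (?t2 y)) = pair (D'' q X ?s2) (?t2 q) + pair (?s2 q) (D'' q X ?t2)"
  proof -
    have "X (\<lambda>y. (-1) * pair (?s2 y) (?t2 y)) = (-1) * X (\<lambda>y. pair (?s2 y) (?t2 y))"
      using proj_sections[OF q s] proj_sections[OF q t]
      by (intro base.tangent_cmult[OF UNIV_I U X] pair_smooth[OF U]) (simp_all add: bsection_at_def)
    then show ?thesis
      using metric_connectionD(5)[OF D'' X proj_sections(2)[OF q s] proj_sections(2)[OF q t]] by simp
  qed
  also have "pair (D' q X ?s1) (?t1 q) + pair (?s1 q) (D' q X ?t1) + (pair (D'' q X ?s2) (?t2 q) + pair (?s2 q) (D'' q X ?t2))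
      = (pair (D' q X ?s1) (?t1 q) + pair (D'' q X ?s2) (?t2 q)) + (pair (?s1 q) (D' q X ?t1) + pair (?s2 q) (D'' q X ?t2))"
    by simp
  also have "pair (D' q X ?s1) (?t1 q) + pair (D'' q X ?s2) (?t2 q) = pair (D q X s) (t q)"
    using split[OF D_mem(1,2)[OF X s] over_S(1,2)] by (simp add: sum_connection_def)
  also have "pair (?s1 q) (D' q X ?t1) + pair (?s2 q) (D'' q X ?t2) = pair (s q) (D q X t)"
    using split[OF ps(1,2) D_mem(1,2)[OF X t]] by (simp add: sum_connection_def)
  finally show ?thesis .
qed

text \<open>\<open>D\<close> maps sections of \<open>E\<close> to \<open>E\<close>, because \<open>D''\<close> vanishes on the zero section.\<close>

lemma D_e_Inl: "X \<in> TM \<A> q \<Longrightarrow> D q X (\<lambda>y. e y (Inl i)) \<in> E q"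
proof -
  assume X: "X \<in> TM \<A> q"
  have eE: "e y (Inl i) \<in> E y" for y
    using e_E[of y] off[of y] subspace_0[OF E_subspace] by (cases "y \<in> S") simp_all
  have p: "proj_E \<A> E y (e y (Inl i)) = e y (Inl i)" for y
    using subspace_0[OF orth_subspace] by (intro proj_E_any(3) eG eE) simp
  have z: "bsection_at \<A> (orth \<A> E) q (\<lambda>y. 0)"
    unfolding bsection_at_def using gsec_zero[OF SU[OF q]] subspace_0[OF orth_subspace] by simp
  have "D'' q X (\<lambda>y. 0) = 0" using metric_connectionD(3)[OF D'' X z z] by simp
  then have "D q X (\<lambda>y. e y (Inl i)) = D' q X (\<lambda>y. e y (Inl i))"
    unfolding sum_connection_def p by simp
  then show ?thesis using D_mem(1)[OF X sec[OF q], of "Inl i"] unfolding p by simp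
qed

definition conn_mat :: "'p tvec \<Rightarrow> real ^ ('n + 'n) ^ ('n + 'n)"
  where "conn_mat X = (\<chi> a b. pair (D q X (\<lambda>y. e y a)) (e q b))"

lemma conn_mat_nth: "conn_mat X $ a $ b = pair (D q X (\<lambda>y. e y a)) (e q b)"
  by (simp add: conn_mat_def)

lemma conn_mat_skew: "X \<in> TM \<A> q \<Longrightarrow> skew_mat (conn_mat X)"
  unfolding skew_mat_def conn_mat_nth
proof (intro conjI allI)
  assume X: "X \<in> TM \<A> q"
  fix a b
  have "base.near q (\<lambda>y. pair (e y a) (e y b) = (\<lambda>y. if a = b then \<eta> a else 0) y)"
    unfolding near_iff[OF SU[OF q]] using S q ee by (intro exI[of _ S]) simp
  from base.tangent_near_cong[OF UNIV_I SU[OF q] X this]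
  have "X (\<lambda>y. pair (e y a) (e y b)) = 0" using base.tangent_const[OF UNIV_I SU[OF q] X] by simp
  then show "pair (D q X (\<lambda>y. e y a)) (e q b) = - pair (D q X (\<lambda>y. e y b)) (e q a)"
    unfolding D_metric[OF X sec[OF q] sec[OF q]] pair_commute[of "e q a"] by simp
next
  assume X: "X \<in> TM \<A> q"
  show "pair (D q X (\<lambda>y. e y (Inl i))) (e q (Inr j)) = 0" for i j
    using D_e_Inl[OF X] E_iff[OF q] by blast
qed

definition conn_endo :: "'p tvec \<Rightarrow> 'p gvec \<Rightarrow> 'p gvec" where "conn_endo X = of_mat q (conn_mat X)"

lemma conn_endo_skew: "X \<in> TM \<A> q \<Longrightarrow> conn_endo X \<in> skew_fibre \<A> E q"
  unfolding conn_endo_def by (intro of_mat_skew q conn_mat_skew)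

lemma conn_endo_e: "X \<in> TM \<A> q \<Longrightarrow> conn_endo X (e q a) = D q X (\<lambda>y. e y a)"
proof (rule GTM_eqI[OF q])
  assume X: "X \<in> TM \<A> q"
  show "conn_endo X (e q a) \<in> GTM \<A> q" unfolding conn_endo_def by (rule of_mat_GTM)
  show "D q X (\<lambda>y. e y a) \<in> GTM \<A> q" by (rule D_mem(3)[OF X sec[OF q]])
  fix b
  have "endo_mat q (conn_endo X) $ a $ b = conn_mat X $ a $ b" unfolding conn_endo_def by (simp add: mat_of_mat[OF q])
  then show "pair (conn_endo X (e q a)) (e q b) = pair (D q X (\<lambda>y. e y a)) (e q b)"
    unfolding mat_nth conn_mat_nth .
qed

context fixes K assumes Ks: "K \<in> skew_fibre \<A> E q"
begin

text \<open>The derivative, in direction \<open>X\<close>, of the matrix of a section of endomorphisms that is parallel at the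
  point and takes the value \<open>K\<close> there: the commutator of \<open>K\<close> with the connection form.\<close>

definition hor_mat :: "'p tvec \<Rightarrow> real ^ ('n + 'n) ^ ('n + 'n)"
  where "hor_mat X = frame_mult (conn_mat X) (endo_mat q K) - frame_mult (endo_mat q K) (conn_mat X)"

definition hor_endo :: "'p tvec \<Rightarrow> 'p gvec \<Rightarrow> 'p gvec"
  where "hor_endo X A = K (conn_endo X A) - conn_endo X (K A)"

lemma hor_endo_skew: "X \<in> TM \<A> q \<Longrightarrow> hor_endo X \<in> skew_fibre \<A> E q"
proof -
  assume X: "X \<in> TM \<A> q"
  note KD = skew_fibreD[OF Ks] and WD = skew_fibreD[OF conn_endo_skew[OF X]]
  have pd: "pair (A - A') B = pair A B - pair A' B" "pair B (A - A') = pair B A - pair B A'"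
    if "A \<in> GTM \<A> q" "A' \<in> GTM \<A> q" "B \<in> GTM \<A> q" for A A' B
    using base.pair_diff_left[OF that] by (simp_all add: pair_commute)
  show ?thesis
  proof (intro skew_fibreI endosI)
    fix A B a b assume AB: "A \<in> GTM \<A> q" "B \<in> GTM \<A> q"
    show "hor_endo X (a *\<^sub>R A + b *\<^sub>R B) = a *\<^sub>R hor_endo X A + b *\<^sub>R hor_endo X B"
      unfolding hor_endo_def KD(7)[OF AB] WD(7)[OF AB] KD(7)[OF WD(2)[OF AB(1)] WD(2)[OF AB(2)]]
        WD(7)[OF KD(2)[OF AB(1)] KD(2)[OF AB(2)]]
      by (simp add: algebra_simps)
  next
    fix A assume A: "A \<in> GTM \<A> q"
    show "hor_endo X A \<in> GTM \<A> q" unfolding hor_endo_def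
      by (intro subspace_diff[OF GTM_any_subspace] KD(2)[OF WD(2)[OF A]] WD(2)[OF KD(2)[OF A]])
  next
    fix A assume "A \<notin> GTM \<A> q"
    then show "hor_endo X A = 0"
      using KD(6) WD(6) zero_endo[OF Ks] zero_endo[OF conn_endo_skew[OF X]] by (simp add: hor_endo_def)
  next
    fix A B assume A: "A \<in> GTM \<A> q" and B: "B \<in> GTM \<A> q"
    have "pair (K (conn_endo X A)) B = pair A (conn_endo X (K B))"
      unfolding KD(3)[OF WD(2)[OF A] B] WD(3)[OF A KD(2)[OF B]] by simp
    moreover have "pair (conn_endo X (K A)) B = pair A (K (conn_endo X B))"
      unfolding WD(3)[OF KD(2)[OF A] B] KD(3)[OF A WD(2)[OF B]] by simp
    ultimately show "pair (hor_endo X A) B = - pair A (hor_endo X B)"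
      unfolding hor_endo_def pd[OF KD(2)[OF WD(2)[OF A]] WD(2)[OF KD(2)[OF A]] B]
        pd(2)[OF KD(2)[OF WD(2)[OF B]] WD(2)[OF KD(2)[OF B]] A] by simp
  next
    fix A assume A: "A \<in> E q"
    show "hor_endo X A \<in> E q" unfolding hor_endo_def
      by (intro subspace_diff[OF E_subspace] KD(4)[OF WD(4)[OF A]] WD(4)[OF KD(4)[OF A]])
  next
    fix A assume A: "A \<in> orth \<A> E q"
    show "hor_endo X A \<in> orth \<A> E q" unfolding hor_endo_def
      by (intro subspace_diff[OF orth_subspace] KD(5)[OF WD(5)[OF A]] WD(5)[OF KD(5)[OF A]])
  qed
qed

lemma hor_mat_eq: "X \<in> TM \<A> q \<Longrightarrow> endo_mat q (hor_endo X) = hor_mat X"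
proof -
  assume X: "X \<in> TM \<A> q"
  note KD = skew_fibreD[OF Ks] and WD = skew_fibreD[OF conn_endo_skew[OF X]]
  have w: "endo_mat q (conn_endo X) = conn_mat X" by (simp add: conn_endo_def mat_of_mat[OF q])
  show ?thesis unfolding vec_eq_iff
  proof (intro allI)
    fix a b
    have "endo_mat q (hor_endo X) $ a $ b = pair (K (conn_endo X (e q a))) (e q b) - pair (conn_endo X (K (e q a))) (e q b)"
      unfolding mat_nth hor_endo_def
      by (rule base.pair_diff_left[OF KD(2)[OF WD(2)[OF eG]] WD(2)[OF KD(2)[OF eG]] eG])
    then show "endo_mat q (hor_endo X) $ a $ b = hor_mat X $ a $ b"
      using mat_compose_nth[of q "conn_endo X" K a b, OF q WD(2) KD(1)] mat_compose_nth[of q K "conn_endo X" a b, OF q KD(2) WD(1)]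
      by (simp add: hor_mat_def w)
  qed
qed

lemma hor_mat_skew: "X \<in> TM \<A> q \<Longrightarrow> skew_mat (hor_mat X)"
  using hor_endo_skew[of X] skew_fibre_iff[OF q, of "hor_endo X"] hor_mat_eq by simp

lemma hor_mat_nth:
  assumes X: "X \<in> TM \<A> q"
  shows "hor_mat X $ a $ b = pair (K (D q X (\<lambda>y. e y a))) (e q b) + pair (K (e q a)) (D q X (\<lambda>y. e y b))"
proof -
  note KD = skew_fibreD[OF Ks] and WD = skew_fibreD[OF conn_endo_skew[OF X]]
  have "hor_mat X $ a $ b = pair (K (conn_endo X (e q a))) (e q b) - pair (conn_endo X (K (e q a))) (e q b)"
    unfolding hor_mat_eq[OF X, symmetric] mat_nth hor_endo_def
    by (rule base.pair_diff_left[OF KD(2)[OF WD(2)[OF eG]] WD(2)[OF KD(2)[OF eG]] eG])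
  then show ?thesis unfolding WD(3)[OF KD(2)[OF eG] eG] conn_endo_e[OF X] by simp
qed

lemma conn_mat_expand:
  assumes X: "X \<in> TM \<A> q"
  shows "conn_mat X = (\<Sum>i\<in>UNIV. X (coordf i) *\<^sub>R conn_mat (coord_vec q i))"
  unfolding vec_eq_iff
proof (intro allI)
  fix a b
  have "pair (\<Sum>i\<in>UNIV. X (coordf i) *\<^sub>R D q (coord_vec q i) (\<lambda>y. e y a)) (e q b)
      = (\<Sum>i\<in>UNIV. X (coordf i) * pair (D q (coord_vec q i) (\<lambda>y. e y a)) (e q b))"
    by (rule base.pair_sum_left[OF UNIV_I SU[OF q] eG D_mem(3)[OF coord_vec_TM[OF SU[OF q]] sec[OF q]]])
  then show "conn_mat X $ a $ b = (\<Sum>i\<in>UNIV. X (coordf i) *\<^sub>R conn_mat (coord_vec q i)) $ a $ b"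
    unfolding conn_mat_nth D_expand[OF X sec[OF q]] by (simp add: conn_mat_nth)
qed

lemma hor_mat_expand:
  assumes X: "X \<in> TM \<A> q"
  shows "hor_mat X = (\<Sum>i\<in>UNIV. X (coordf i) *\<^sub>R hor_mat (coord_vec q i))"
proof -
  have ml: "frame_mult (\<Sum>i\<in>UNIV. c i *\<^sub>R w i) k = (\<Sum>i\<in>UNIV. c i *\<^sub>R frame_mult (w i) k)" for c :: "'n \<Rightarrow> real" and w k
    by (simp add: vec_eq_iff frame_mult_def sum_distrib_left sum_distrib_right algebra_simps) (intro allI sum.swap)
  have mr: "frame_mult k (\<Sum>i\<in>UNIV. c i *\<^sub>R w i) = (\<Sum>i\<in>UNIV. c i *\<^sub>R frame_mult k (w i))" for c :: "'n \<Rightarrow> real" and w k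
    by (simp add: vec_eq_iff frame_mult_def sum_distrib_left sum_distrib_right algebra_simps) (intro allI sum.swap)
  show ?thesis unfolding hor_mat_def
    by (subst (1 2) conn_mat_expand[OF X]) (simp add: ml mr sum_subtractf scaleR_diff_right)
qed

text \<open>The matrix of this section is affine in the coordinates, with derivative prescribed by \<open>hor_mat\<close>. It is in
  the bundle of skew endomorphisms but leaves \<open>\<G>\<close> in general.\<close>

definition parallel_section :: "'p \<Rightarrow> 'p gvec \<Rightarrow> 'p gvec"
  where "parallel_section y = (if y \<in> S then of_mat y (endo_mat q K + (\<Sum>i\<in>UNIV. (coordf i y - coordf i q) *\<^sub>R hor_mat (coord_vec q i))) else (\<lambda>A. 0))"

lemma parallel_section_at: "parallel_section q = K"
  using of_mat_mat[OF q skew_fibreD(1)[OF Ks]] q by (simp add: parallel_section_def)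

lemma parallel_section_skew_fibre: "parallel_section y \<in> skew_fibre \<A> E y"
proof (cases "y \<in> S")
  case True
  have K: "skew_mat (endo_mat q K)" using Ks skew_fibre_iff[OF q] by blast
  have H: "skew_mat (hor_mat (coord_vec q i))" for i by (rule hor_mat_skew[OF coord_vec_TM[OF SU[OF q]]])
  have "skew_mat (endo_mat q K + (\<Sum>i\<in>UNIV. (coordf i y - coordf i q) *\<^sub>R hor_mat (coord_vec q i)))"
    unfolding skew_mat_def
  proof (intro conjI allI)
    fix a b
    have "endo_mat q K $ a $ b = - endo_mat q K $ b $ a" "\<And>i. hor_mat (coord_vec q i) $ a $ b = - hor_mat (coord_vec q i) $ b $ a"
      using K H unfolding skew_mat_def by blast+
    then show "(endo_mat q K + (\<Sum>i\<in>UNIV. (coordf i y - coordf i q) *\<^sub>R hor_mat (coord_vec q i))) $ a $ b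
      = - (endo_mat q K + (\<Sum>i\<in>UNIV. (coordf i y - coordf i q) *\<^sub>R hor_mat (coord_vec q i))) $ b $ a"
      by (simp add: sum_negf)
  next
    fix i j
    have "endo_mat q K $ Inl i $ Inr j = 0" "\<And>k. hor_mat (coord_vec q k) $ Inl i $ Inr j = 0"
      using K H unfolding skew_mat_def by blast+
    then show "(endo_mat q K + (\<Sum>i\<in>UNIV. (coordf i y - coordf i q) *\<^sub>R hor_mat (coord_vec q i))) $ Inl i $ Inr j = 0"
      by simp
  qed
  then show ?thesis using of_mat_skew[OF True] True by (simp add: parallel_section_def)
qed (simp add: parallel_section_def skew_fibre_zero)

lemma parallel_section_smooth: "skew_section_at \<A> E q parallel_section"
  unfolding skew_section_at_def
proof (intro conjI allI impI parallel_section_skew_fibre)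
  fix A assume A: "gsec q A"
  have AG: "A y \<in> GTM \<A> y" for y by (rule gsec_GTM[OF SU[OF q] A])
  let ?m = "\<lambda>y. endo_mat q K + (\<Sum>i\<in>UNIV. (coordf i y - coordf i q) *\<^sub>R hor_mat (coord_vec q i))"
  let ?t = "\<lambda>y. \<Sum>b\<in>UNIV. (\<eta> b * (\<Sum>a\<in>UNIV. \<eta> a * pair (A y) (e y a) * ?m y $ a $ b)) *\<^sub>R e y b"
  have m: "(\<lambda>y. ?m y $ a $ b) \<in> cinf \<A> q" for a b
  proof -
    have "(\<lambda>y. endo_mat q K $ a $ b + (\<Sum>i\<in>UNIV. (coordf i y - coordf i q) * hor_mat (coord_vec q i) $ a $ b)) \<in> cinf \<A> q"
      by (intro base.C_add base.C_sum base.C_mult base.C_diff base.C_const coordf_mem UNIV_I SU q)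
    then show ?thesis by simp
  qed
  show "gsec q (\<lambda>y. parallel_section y (A y))"
  proof (rule gsec_cong[OF SU[OF q], of ?t])
    show "gsec q ?t"
      by (intro gsec_sum base.C_mult base.C_sum base.C_const pair_smooth sec A m UNIV_I SU q)
    show "parallel_section y (A y) \<in> GTM \<A> y" for y using skew_fibreD(2)[OF parallel_section_skew_fibre AG] .
    show "base.near q (\<lambda>y. ?t y = parallel_section y (A y))"
      unfolding near_iff[OF SU[OF q]] using S q AG by (intro exI[of _ S]) (simp add: parallel_section_def of_mat_def)
  qed
qed

text \<open>Pair with a frame member and use that \<open>D\<close> is metric. Apart from the terms that give the claim, two
  groups remain: one cancels by the choice of \<open>hor_mat\<close>, the other by skewness of the connection matrix.\<close>

lemma parallel_section_parallel: "parallel_at \<A> D q parallel_section"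
  unfolding parallel_at_def
proof (intro ballI allI impI)
  fix X A assume X: "X \<in> TM \<A> q" and A: "gsec q A"
  note KD = skew_fibreD[OF Ks] and U = SU[OF q]
  have sA: "gsec q (\<lambda>y. parallel_section y (A y))" using parallel_section_smooth A by (simp add: skew_section_at_def)
  have AG: "A y \<in> GTM \<A> y" for y by (rule gsec_GTM[OF U A])
  have De: "D q X (\<lambda>y. e y a) \<in> GTM \<A> q" for a by (rule D_mem(3)[OF X sec[OF q]])
  \<comment> \<open>The matrix of the section in the frame, affine in the base coordinates.\<close>
  let ?m = "\<lambda>a b y. endo_mat q K $ a $ b + (\<Sum>i\<in>UNIV. hor_mat (coord_vec q i) $ a $ b * (coordf i y - coordf i q))"
  let ?c = "\<lambda>a. pair (A q) (e q a)"
  have mC: "?m a b \<in> cinf \<A> q" for a b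
    by (intro base.C_add base.C_sum base.C_mult base.C_diff base.C_const coordf_mem UNIV_I U)
  have Xm: "X (?m a b) = hor_mat X $ a $ b" for a b
  proof -
    have "X (?m a b) = (\<Sum>i\<in>UNIV. hor_mat (coord_vec q i) $ a $ b * X (coordf i))"
      by (simp add: base.tangent_add[OF UNIV_I U X] base.tangent_sum[OF UNIV_I U X] base.tangent_cmult[OF UNIV_I U X]
          base.tangent_diff[OF UNIV_I U X] base.tangent_const[OF UNIV_I U X] base.C_sum[OF UNIV_I U]
          base.C_mult[OF UNIV_I U] base.C_diff[OF UNIV_I U] base.C_const[OF UNIV_I U] coordf_mem[OF U])
    then show ?thesis by (simp add: hor_mat_expand[OF X] mult.commute)
  qed
  have XA: "X (\<lambda>y. pair (A y) (e y a)) = pair (D q X A) (e q a) + pair (A q) (D q X (\<lambda>y. e y a))" for a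
    by (rule D_metric[OF X A sec[OF q]])
  have AC: "(\<lambda>y. pair (A y) (e y a)) \<in> cinf \<A> q" for a by (rule pair_smooth[OF U A sec[OF q]])
  have kw: "K (D q X A) \<in> GTM \<A> q" by (rule KD(2)[OF D_mem(3)[OF X A]])
  have "D q X (\<lambda>y. parallel_section y (A y)) = K (D q X A)"
  proof (rule GTM_eqI[OF q D_mem(3)[OF X sA] kw])
    fix b
    have near: "base.near q (\<lambda>y. pair (parallel_section y (A y)) (e y b) = (\<Sum>a\<in>UNIV. \<eta> a * pair (A y) (e y a) * ?m a b y))"
      unfolding near_iff[OF U] using S q
      by (intro exI[of _ S]) (simp add: parallel_section_def of_mat_pair AG mult.commute)
    have "X (\<lambda>y. pair (parallel_section y (A y)) (e y b))
      = (\<Sum>a\<in>UNIV. \<eta> a * ((pair (D q X A) (e q a) + pair (A q) (D q X (\<lambda>y. e y a))) * endo_mat q K $ a $ b + ?c a * hor_mat X $ a $ b))"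
    proof -
      have "X (\<lambda>y. \<eta> a * pair (A y) (e y a) * ?m a b y)
        = \<eta> a * ((pair (D q X A) (e q a) + pair (A q) (D q X (\<lambda>y. e y a))) * endo_mat q K $ a $ b + ?c a * hor_mat X $ a $ b)" for a
      proof -
        have "X (\<lambda>y. (\<eta> a * pair (A y) (e y a)) * ?m a b y)
          = X (\<lambda>y. \<eta> a * pair (A y) (e y a)) * ?m a b q + (\<eta> a * pair (A q) (e q a)) * X (?m a b)"
          by (rule base.tangent_mult[OF UNIV_I U X base.C_mult[OF UNIV_I U base.C_const[OF UNIV_I U] AC] mC])
        also have "X (\<lambda>y. \<eta> a * pair (A y) (e y a)) = \<eta> a * (pair (D q X A) (e q a) + pair (A q) (D q X (\<lambda>y. e y a)))"
          unfolding base.tangent_cmult[OF UNIV_I U X AC] XA ..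
        also have "?m a b q = endo_mat q K $ a $ b" by simp
        finally show ?thesis unfolding Xm by (simp add: algebra_simps)
      qed
      moreover have "(\<lambda>y. \<eta> a * pair (A y) (e y a) * ?m a b y) \<in> cinf \<A> q" for a
        by (rule base.C_mult[OF UNIV_I U base.C_mult[OF UNIV_I U base.C_const[OF UNIV_I U] AC] mC])
      ultimately show ?thesis
        unfolding base.tangent_near_cong[OF UNIV_I U X near] by (simp add: base.tangent_sum[OF UNIV_I U X])
    qed
    moreover have "X (\<lambda>y. pair (parallel_section y (A y)) (e y b))
        = pair (D q X (\<lambda>y. parallel_section y (A y))) (e q b) + pair (K (A q)) (D q X (\<lambda>y. e y b))"
      using D_metric[OF X sA sec[OF q], of b] by (simp add: parallel_section_at)
    moreover have "pair (K (D q X A)) (e q b) = (\<Sum>a\<in>UNIV. \<eta> a * (pair (D q X A) (e q a) * endo_mat q K $ a $ b))"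
      unfolding endo_pair_left[OF q KD(1) D_mem(3)[OF X A] eG] mat_nth by (simp add: mult.assoc)
    moreover have "pair (K (A q)) (D q X (\<lambda>y. e y b)) = (\<Sum>a\<in>UNIV. \<eta> a * (?c a * pair (K (e q a)) (D q X (\<lambda>y. e y b))))"
      unfolding endo_pair_left[OF q KD(1) AG De] by (simp add: mult.assoc)
    \<comment> \<open>The derivatives of the frame on both sides are exchanged by skewness of the connection matrix.\<close>
    moreover have "(\<Sum>a\<in>UNIV. \<eta> a * (pair (A q) (D q X (\<lambda>y. e y a)) * endo_mat q K $ a $ b))
        = - (\<Sum>a\<in>UNIV. \<eta> a * (?c a * pair (K (D q X (\<lambda>y. e y a))) (e q b)))"
    proof -
      have sk: "conn_mat X $ a $ c = - conn_mat X $ c $ a" for a c using conn_mat_skew[OF X] unfolding skew_mat_def by blast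
      have "(\<Sum>a\<in>UNIV. \<eta> a * (pair (A q) (D q X (\<lambda>y. e y a)) * endo_mat q K $ a $ b))
        = (\<Sum>a\<in>UNIV. \<Sum>c\<in>UNIV. \<eta> a * \<eta> c * ?c c * conn_mat X $ a $ c * endo_mat q K $ a $ b)"
        unfolding pair_expand[OF q AG De] conn_mat_nth by (simp add: sum_distrib_left sum_distrib_right algebra_simps)
      also have "\<dots> = (\<Sum>c\<in>UNIV. \<Sum>a\<in>UNIV. \<eta> a * \<eta> c * ?c c * conn_mat X $ a $ c * endo_mat q K $ a $ b)"
        by (rule sum.swap)
      also have "\<dots> = (\<Sum>c\<in>UNIV. \<Sum>a\<in>UNIV. - (\<eta> a * \<eta> c * ?c c * conn_mat X $ c $ a * endo_mat q K $ a $ b))"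
        by (intro sum.cong refl) (subst sk, simp)
      also have "\<dots> = - (\<Sum>c\<in>UNIV. \<eta> c * (?c c * pair (K (D q X (\<lambda>y. e y c))) (e q b)))"
        unfolding endo_pair_left[OF q KD(1) De eG] conn_mat_nth mat_nth
        by (simp add: sum_negf sum_distrib_left algebra_simps)
      finally show ?thesis .
    qed
    ultimately show "pair (D q X (\<lambda>y. parallel_section y (A y))) (e q b) = pair (K (D q X A)) (e q b)"
      by (simp add: hor_mat_nth[OF X] sum.distrib distrib_left distrib_right)
  qed
  then show "D q X (\<lambda>y. parallel_section y (A y)) - parallel_section q (D q X A) = 0" by (simp add: parallel_section_at)
qed

end

end

end

section \<open>The decomposition into horizontal and vertical parts\<close>

lemma (in smooth_chart) velocity_lincomb:
  "velocity (a *\<^sub>R v + b *\<^sub>R w) = a *\<^sub>R velocity v + b *\<^sub>R velocity w"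
  by (simp add: velocity_def scaleR_fun_def plus_fun_def scaleR_sum_right sum.distrib scaleR_add_left)

lemma cotangent_add:
  assumes \<omega>: "\<omega> \<in> cotangent C x" and vw: "v \<in> tangent C x" "w \<in> tangent C x"
  shows "\<omega> (v + w) = \<omega> v + \<omega> w"
proof -
  have "\<omega> (1 *\<^sub>R v + 1 *\<^sub>R w) = 1 *\<^sub>R \<omega> v + 1 *\<^sub>R \<omega> w"
    using \<omega> vw unfolding cotangent_def linear_upon_def by blast
  then show ?thesis unfolding scaleR_one .
qed

context connected_frame
begin

context fixes q K assumes q: "q \<in> S" and K: "(q, K) \<in> reflector_space \<A> E"
begin

lemma over_S: "(q, K) \<in> reflector_space \<A> E" "(q, K) \<in> over S" "(q, K) \<in> skew_bundle \<A> E"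
  using q K reflector_skew by auto

lemma K_skew: "K \<in> skew_fibre \<A> E q" and K_square: "A \<in> GTM \<A> q \<Longrightarrow> K (K A) = A"
  using K reflector_iff by blast+

lemma hor_endo_vert: "X \<in> TM \<A> q \<Longrightarrow> hor_endo q K X \<in> vert \<A> E (q, K)"
proof -
  assume X: "X \<in> TM \<A> q"
  note KD = skew_fibreD[OF K_skew] and WD = skew_fibreD[OF conn_endo_skew[OF q X]]
  have Kd: "K (A - B) = K A - K B" if "A \<in> GTM \<A> q" "B \<in> GTM \<A> q" for A B
    using KD(7)[OF that, of 1 "-1"] by simp
  show ?thesis unfolding vert_iff
  proof (intro conjI ballI hor_endo_skew[OF q K_skew X])
    fix A assume A: "A \<in> GTM \<A> q"
    have "K (hor_endo q K X A) = conn_endo q X A - K (conn_endo q X (K A))"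
      unfolding hor_endo_def[OF q K_skew] Kd[OF KD(2)[OF WD(2)[OF A]] WD(2)[OF KD(2)[OF A]]]
      by (simp add: K_square WD(2)[OF A])
    then show "hor_endo q K X (K A) = - K (hor_endo q K X A)"
      by (simp add: hor_endo_def[OF q K_skew] K_square A)
  qed
qed

lemma hlift_admissible: "X \<in> TM \<A> q \<Longrightarrow> (u, hor_mat q K X) \<in> G.admissible (q, K)"
  using admissible_vert[OF q K hor_endo_vert, of X u] hor_mat_eq[OF q K_skew] by simp

lemma parallel_section_chain:
  assumes X: "X \<in> TM \<A> q" and f: "f \<in> cinf_A \<A> E (q, K)"
  shows "X (\<lambda>y. f (y, parallel_section q K y)) = G.dvec (q, K) (base.velocity X, hor_mat q K X) f"
proof -
  obtain h W where r: "AA.local_rep (q, K) f h W" using AA.mem_C_iff[OF over_S(3,2)] f by blast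
  have W: "open W" "\<Psi> (q, K) \<in> W" "smooth_on W h" using r by (auto simp: AA.local_rep_def)
  let ?M = "\<lambda>u. endo_mat q K + (\<Sum>i\<in>UNIV. (u $ i - coordf i q) *\<^sub>R hor_mat q K (coord_vec q i))"
  \<comment> \<open>The section in coordinates, so that the chain rule applies to \<open>h \<circ> g\<close>.\<close>
  let ?g = "\<lambda>u. (u, ?M u)"
  have bi: "bounded_linear (\<lambda>u :: real ^ 'n. u $ i)" for i by (rule bounded_linear_vec_nth)
  have sM: "smooth_on T ?g" if "open T" for T
  proof -
    have "smooth_on T (\<lambda>u. endo_mat q K + (\<Sum>i\<in>UNIV. (u $ i + (- coordf i q)) *\<^sub>R hor_mat q K (coord_vec q i)))"
      by (intro smooth_on_add smooth_on_sum smooth_on_scaleR smooth_on_const that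
          smooth_on_bounded_linear[OF that bi])
    then show ?thesis
      using smooth_on_Pair[OF that smooth_on_bounded_linear[OF that bounded_linear_ident]] by simp
  qed
  let ?V = "(?g -` W) \<inter> \<phi> ` S"
  have oV: "open ?V"
    using smooth_on_continuous[OF sM[OF open_UNIV]] W(1) open_chart_image[OF chart S]
    by (intro open_Int) (auto simp: continuous_on_open_vimage)
  have \<Psi>s: "\<Psi> (y, parallel_section q K y) = ?g (\<phi> y)" if "y \<in> S" for y
    using that by (simp add: \<Psi>_eq parallel_section_def[OF q K_skew] mat_of_mat)
  have g0: "?g (\<phi> q) = \<Psi> (q, K)" by (simp add: \<Psi>_eq)
  have V: "\<phi> q \<in> ?V" using W(2) g0 q by simp
  have R: "base.local_rep q (\<lambda>y. f (y, parallel_section q K y)) (\<lambda>u. h (?g u)) ?V"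
    unfolding base.local_rep_def
  proof (intro conjI oV V ballI impI)
    show "smooth_on ?V (\<lambda>u. h (?g u))"
      by (rule smooth_on_compose[OF oV W(1) _ sM[OF oV] W(3)]) auto
    fix y assume y: "y \<in> UNIV \<inter> U" "\<phi> y \<in> ?V"
    from y(2) obtain z where z: "z \<in> S" "\<phi> y = \<phi> z" by auto
    have a: "inv_into U \<phi> (\<phi> y) = y" by (rule chart_inv(1)) (use y in simp)
    have b: "inv_into U \<phi> (\<phi> z) = z" by (rule chart_inv(1)[OF SU[OF z(1)]])
    have "y = z" using trans[OF a[symmetric] b[folded z(2)]] .
    then have yS: "y \<in> S" using z(1) by (rule ssubst)
    have "(y, parallel_section q K y) \<in> skew_bundle \<A> E"
      using parallel_section_skew_fibre[OF q K_skew] by (simp add: skew_bundle_def)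
    then show "f (y, parallel_section q K y) = h (?g (\<phi> y))"
    proof -
      have "\<forall>y\<in>skew_bundle \<A> E \<inter> over S. \<Psi> y \<in> W \<longrightarrow> f y = h (\<Psi> y)"
        using r unfolding AA.local_rep_def by blast
      moreover have "(y, parallel_section q K y) \<in> over S" using yS by simp
      moreover have "\<Psi> (y, parallel_section q K y) \<in> W" unfolding \<Psi>s[OF yS] using y(2) by simp
      ultimately have "f (y, parallel_section q K y) = h (\<Psi> (y, parallel_section q K y))"
        using \<open>(y, parallel_section q K y) \<in> skew_bundle \<A> E\<close> by blast
      then show ?thesis unfolding \<Psi>s[OF yS] .
    qed
  qed
  have 1: "X (\<lambda>y. f (y, parallel_section q K y)) = frechet_derivative (\<lambda>u. h (?g u)) (at (\<phi> q)) (base.velocity X)"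
    by (rule base.tangent_eq_derivative[OF UNIV_I SU[OF q] X R])
  have "(?g has_derivative (\<lambda>u. (u, \<Sum>i\<in>UNIV. (u $ i) *\<^sub>R hor_mat q K (coord_vec q i)))) (at (\<phi> q))"
  proof -
    have d: "((\<lambda>u. u $ i - coordf i q) has_derivative (\<lambda>u. u $ i - 0)) (at (\<phi> q))" for i
      by (intro has_derivative_diff bounded_linear_imp_has_derivative bi has_derivative_const)
    have "((\<lambda>u. endo_mat q K + (\<Sum>i\<in>UNIV. (u $ i - coordf i q) *\<^sub>R hor_mat q K (coord_vec q i))) has_derivative
        (\<lambda>u. 0 + (\<Sum>i\<in>UNIV. (u $ i - 0) *\<^sub>R hor_mat q K (coord_vec q i)))) (at (\<phi> q))"
      by (intro has_derivative_add has_derivative_const has_derivative_sum has_derivative_scaleR_left d)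
    then show ?thesis using has_derivative_Pair[OF has_derivative_ident] by simp
  qed
  moreover have "(h has_derivative frechet_derivative h (at (?g (\<phi> q)))) (at (?g (\<phi> q)))"
    using smooth_on_has_derivative[OF W(3,2)] unfolding g0 .
  ultimately have "((\<lambda>u. h (?g u)) has_derivative
      (\<lambda>u. frechet_derivative h (at (?g (\<phi> q))) (u, \<Sum>i\<in>UNIV. (u $ i) *\<^sub>R hor_mat q K (coord_vec q i)))) (at (\<phi> q))"
    by (rule has_derivative_compose[where f = ?g and g = h])
  from frechet_derivative_at[OF this]
  have "frechet_derivative (\<lambda>u. h (?g u)) (at (\<phi> q)) (base.velocity X)
      = frechet_derivative h (at (\<Psi> (q, K))) (base.velocity X, \<Sum>i\<in>UNIV. (base.velocity X $ i) *\<^sub>R hor_mat q K (coord_vec q i))"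
    unfolding g0 by metis
  also have "(\<Sum>i\<in>UNIV. (base.velocity X $ i) *\<^sub>R hor_mat q K (coord_vec q i)) = hor_mat q K X"
  proof -
    have "base.velocity X $ i = X (coordf i)" for i
      using base.velocity_inner[of "axis i 1" X] by (simp add: inner_axis)
    then show ?thesis using hor_mat_expand[OF q K_skew X] by simp
  qed
  finally show ?thesis using 1 G.dvec_rep[OF over_S(1,2) hlift_admissible[OF X] local_rep_G[OF r]] by simp
qed

text \<open>The section \<open>parallel_section\<close> realises the right hand side. Any other admissible section is parallel at
  the point with the same value, which fixes the derivative of its matrix.\<close>

lemma hlift_eq:
  assumes X: "X \<in> TM \<A> q"
  shows "hlift \<A> E D (q, K) X = G.dvec (q, K) (base.velocity X, hor_mat q K X)"
  unfolding hlift_def fst_conv snd_conv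
proof (rule the_equality)
  let ?v = "G.dvec (q, K) (base.velocity X, hor_mat q K X)"
  note tv = G.dvec_tangent[OF over_S(1,2) hlift_admissible[OF X]]
  show "?v \<in> tangent (cinf_G \<A> E) (q, K) \<and>
    (\<exists>s. skew_section_at \<A> E q s \<and> s q = K \<and> parallel_at \<A> D q s \<and> (\<forall>f\<in>cinf_A \<A> E (q, K). ?v f = X (\<lambda>q. f (q, s q))))"
    using tv parallel_section_smooth[OF q K_skew] parallel_section_at[OF q K_skew] parallel_section_parallel[OF q K_skew] parallel_section_chain[OF X]
    by (intro conjI exI[of _ "parallel_section q K"]) auto
  fix v assume "v \<in> tangent (cinf_G \<A> E) (q, K) \<and>
    (\<exists>s. skew_section_at \<A> E q s \<and> s q = K \<and> parallel_at \<A> D q s \<and> (\<forall>f\<in>cinf_A \<A> E (q, K). v f = X (\<lambda>q. f (q, s q))))"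
  then obtain s where v: "v \<in> tangent (cinf_G \<A> E) (q, K)"
    and s: "skew_section_at \<A> E q s" "s q = K" "parallel_at \<A> D q s"
    and f: "\<And>f. f \<in> cinf_A \<A> E (q, K) \<Longrightarrow> v f = X (\<lambda>q. f (q, s q))"
    by blast
  show "v = ?v"
  proof (rule tangent_determined_by_cinf_A[OF q K v tv])
    fix i
    have "v (\<lambda>y. coordf i (fst y)) = X (coordf i)" using f[OF coord_cinf_A[OF q over_S(3)]] by simp
    moreover have "?v (\<lambda>y. coordf i (fst y)) = base.velocity X $ i"
      using velocity_coord[of ?v i] G.velocity_dvec[OF over_S(1,2) hlift_admissible[OF X]] by simp
    moreover have "base.velocity X $ i = X (coordf i)"
      using base.velocity_inner[of "axis i 1" X] by (simp add: inner_axis)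
    ultimately show "v (\<lambda>y. coordf i (fst y)) = ?v (\<lambda>y. coordf i (fst y))" by simp
  next
    fix a b
    have se: "gsec q (\<lambda>y. s y (e y a))" using s(1) sec[OF q] by (simp add: skew_section_at_def)
    have p: "D q X (\<lambda>y. s y (e y a)) = K (D q X (\<lambda>y. e y a))"
      using s(2,3) X sec[OF q, of a] unfolding parallel_at_def by fastforce
    have "v (entry a b) = X (\<lambda>y. pair (s y (e y a)) (e y b))"
      using f[OF entry_cinf_A[OF q over_S(3)]] by (simp add: entry_eq)
    also have "\<dots> = hor_mat q K X $ a $ b"
      unfolding D_metric[OF q X se sec[OF q]] p hor_mat_nth[OF q K_skew X] s(2) ..
    also have "\<dots> = ?v (entry a b)"
      using velocity_entry[of ?v a b] G.velocity_dvec[OF over_S(1,2) hlift_admissible[OF X]] by simp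
    finally show "v (entry a b) = ?v (entry a b)" .
  qed
qed

lemma hlift_tangent: "X \<in> TM \<A> q \<Longrightarrow> hlift \<A> E D (q, K) X \<in> tangent (cinf_G \<A> E) (q, K)"
  using hlift_eq G.dvec_tangent[OF over_S(1,2) hlift_admissible] by simp

lemma velocity_hlift: "X \<in> TM \<A> q \<Longrightarrow> G.velocity (hlift \<A> E D (q, K) X) = (base.velocity X, hor_mat q K X)"
  using hlift_eq G.velocity_dvec[OF over_S(1,2) hlift_admissible] by simp

lemma vert_vec_tangent: "V \<in> vert \<A> E (q, K) \<Longrightarrow> vert_vec \<A> E (q, K) V \<in> tangent (cinf_G \<A> E) (q, K)"
  using vert_vec_eq[OF q K] G.dvec_tangent[OF over_S(1,2) vertical_admissible[OF q K]] by simp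

lemma velocity_vert_vec: "V \<in> vert \<A> E (q, K) \<Longrightarrow> G.velocity (vert_vec \<A> E (q, K) V) = (0, endo_mat q V)"
  using vert_vec_eq[OF q K] G.velocity_dvec[OF over_S(1,2) vertical_admissible[OF q K]] by simp

text \<open>The differential of the projection \<open>\<G> \<rightarrow> M\<close>, which in coordinates forgets the matrix part of the velocity.\<close>

definition dproj :: "'p gpoint tvec \<Rightarrow> 'p tvec"
  where "dproj v = base.dvec q (fst (G.velocity v))"

lemma dproj_TM: "dproj v \<in> TM \<A> q"
  unfolding dproj_def by (rule base.dvec_tangent[OF UNIV_I SU[OF q] admissible_base[OF SU[OF q]]])

lemma dproj_velocity: "base.velocity (dproj v) = fst (G.velocity v)"
  unfolding dproj_def by (rule base.velocity_dvec[OF UNIV_I SU[OF q] admissible_base[OF SU[OF q]]])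

lemma TM_eqI: "X \<in> TM \<A> q \<Longrightarrow> Y \<in> TM \<A> q \<Longrightarrow> base.velocity X = base.velocity Y \<Longrightarrow> X = Y"
  by (rule base.tangent_eqI[OF UNIV_I SU[OF q]])

lemma dproj_hlift: "X \<in> TM \<A> q \<Longrightarrow> dproj (hlift \<A> E D (q, K) X) = X"
  by (rule TM_eqI[OF dproj_TM]) (simp_all add: dproj_velocity velocity_hlift)

lemma dproj_lincomb: "dproj (a *\<^sub>R v + b *\<^sub>R w) = a *\<^sub>R dproj v + b *\<^sub>R dproj w"
  by (rule TM_eqI[OF dproj_TM base.tangent_lincomb[OF UNIV_I SU[OF q] dproj_TM dproj_TM]])
    (simp add: dproj_velocity G.velocity_lincomb base.velocity_lincomb)

lemma dproj_hlift_vert: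
  assumes "X \<in> TM \<A> q" "V \<in> vert \<A> E (q, K)"
  shows "dproj (hlift \<A> E D (q, K) X + vert_vec \<A> E (q, K) V) = X"
proof (rule TM_eqI[OF dproj_TM assms(1)])
  show "base.velocity (dproj (hlift \<A> E D (q, K) X + vert_vec \<A> E (q, K) V)) = base.velocity X"
    using G.velocity_lincomb[of 1 "hlift \<A> E D (q, K) X" 1 "vert_vec \<A> E (q, K) V"]
    unfolding dproj_velocity scaleR_one velocity_hlift[OF assms(1)] velocity_vert_vec[OF assms(2)] by simp
qed

lemma hlift_zero: "hlift \<A> E D (q, K) 0 = 0"
proof -
  have z: "0 \<in> TM \<A> q" "0 \<in> tangent (cinf_G \<A> E) (q, K)"
    using subspace_0[OF base.subspace_tangent[OF UNIV_I SU[OF q]]] subspace_0[OF G.subspace_tangent[OF over_S(1,2)]] .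
  have v0: "base.velocity 0 = 0" "G.velocity 0 = 0"
    by (simp_all add: base.velocity_def G.velocity_def)
  have "hor_mat q K 0 = 0"
    using hor_mat_expand[OF q K_skew z(1)] by simp
  then show ?thesis
    by (intro G.tangent_eqI[OF over_S(1,2) hlift_tangent[OF z(1)] z(2)])
      (simp only: velocity_hlift[OF z(1)] v0 zero_prod_def)
qed

lemma dproj_vert: "V \<in> vert \<A> E (q, K) \<Longrightarrow> dproj (vert_vec \<A> E (q, K) V) = 0"
  using dproj_hlift_vert[OF subspace_0[OF base.subspace_tangent[OF UNIV_I SU[OF q]]]] hlift_zero by simp

lemma tangent_decomposition:
  assumes v: "v \<in> tangent (cinf_G \<A> E) (q, K)"
  obtains V where "V \<in> vert \<A> E (q, K)" "v = hlift \<A> E D (q, K) (dproj v) + vert_vec \<A> E (q, K) V"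
proof -
  obtain u V0 where V0: "V0 \<in> vert \<A> E (q, K)" "G.velocity v = (u, endo_mat q V0)"
    using tangent_G_cases[OF q K v] by metis
  let ?H = "hor_endo q K (dproj v)"
  let ?V = "\<lambda>A. 1 *\<^sub>R V0 A + (-1) *\<^sub>R ?H A"
  have H: "?H \<in> vert \<A> E (q, K)" by (rule hor_endo_vert[OF dproj_TM])
  have V: "?V \<in> vert \<A> E (q, K)" by (rule vert_lincomb[OF K_skew V0(1) H])
  have "endo_mat q ?V = 1 *\<^sub>R endo_mat q V0 + (-1) *\<^sub>R endo_mat q ?H"
    using V0(1) H by (intro mat_lincomb) (auto simp: vert_iff intro: skew_fibreD(2))
  then have m: "endo_mat q ?V = endo_mat q V0 - hor_mat q K (dproj v)" using hor_mat_eq[OF q K_skew dproj_TM] by simp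
  have "v = hlift \<A> E D (q, K) (dproj v) + vert_vec \<A> E (q, K) ?V"
  proof (rule G.tangent_eqI[OF over_S(1,2) v])
    show "hlift \<A> E D (q, K) (dproj v) + vert_vec \<A> E (q, K) ?V \<in> tangent (cinf_G \<A> E) (q, K)"
      by (rule subspace_add[OF G.subspace_tangent[OF over_S(1,2)] hlift_tangent[OF dproj_TM] vert_vec_tangent[OF V]])
    show "G.velocity v = G.velocity (hlift \<A> E D (q, K) (dproj v) + vert_vec \<A> E (q, K) ?V)"
    proof -
      have add: "G.velocity (a + b) = G.velocity a + G.velocity b" for a b
        using G.velocity_lincomb[of 1 a 1 b] unfolding scaleR_one .
      have eigen_vert: "G.velocity (vert_vec \<A> E (q, K) ?V) = (0, endo_mat q V0 - hor_mat q K (dproj v))"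
        by (rule trans[OF velocity_vert_vec[OF V]]) (rule arg_cong[OF m])
      show ?thesis unfolding add velocity_hlift[OF dproj_TM] eigen_vert dproj_velocity V0(2) by simp
    qed
  qed
  then show ?thesis using V that by blast
qed

lemma pullback_smooth:
  assumes f: "f \<in> cinf \<A> q"
  shows "(\<lambda>y. f (fst y)) \<in> cinf_G \<A> E (q, K)"
    and "v \<in> tangent (cinf_G \<A> E) (q, K) \<Longrightarrow> v (\<lambda>y. f (fst y)) = dproj v f"
proof -
  obtain h W where r: "base.local_rep q f h W" using base.mem_C_iff[OF UNIV_I SU[OF q]] f by blast
  have W: "open W" "\<phi> q \<in> W" "smooth_on W h" "\<And>y. y \<in> U \<Longrightarrow> \<phi> y \<in> W \<Longrightarrow> f y = h (\<phi> y)"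
    using r by (auto simp: base.local_rep_def)
  let ?W = "W \<times> (UNIV :: (real ^ ('n + 'n) ^ ('n + 'n)) set)"
  have o: "open ?W" using W(1) by (simp add: open_Times)
  have s: "smooth_on ?W (\<lambda>z. h (fst z))"
    by (rule smooth_on_compose[OF o W(1) _ smooth_on_bounded_linear[OF o bounded_linear_fst] W(3)]) auto
  have R: "G.local_rep (q, K) (\<lambda>y. f (fst y)) (\<lambda>z. h (fst z)) ?W"
    unfolding G.local_rep_def using o s W S(2) by (auto simp: \<Psi>_eq)
  show "(\<lambda>y. f (fst y)) \<in> cinf_G \<A> E (q, K)" using R G.mem_C_iff[OF over_S(1,2)] by blast
  assume v: "v \<in> tangent (cinf_G \<A> E) (q, K)"
  have fq: "fst (\<Psi> (q, K)) = \<phi> q" by (simp add: \<Psi>_eq)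
  have "((\<lambda>z. h (fst z)) has_derivative (\<lambda>z. frechet_derivative h (at (\<phi> q)) (fst z))) (at (\<Psi> (q, K)))"
    by (rule has_derivative_compose[where f = fst and g = h])
      (auto intro!: derivative_eq_intros simp: fq smooth_on_has_derivative[OF W(3,2)])
  from frechet_derivative_at[OF this]
  have "v (\<lambda>y. f (fst y)) = frechet_derivative h (at (\<phi> q)) (fst (G.velocity v))"
    using G.tangent_eq_derivative[OF over_S(1,2) v R] by metis
  then show "v (\<lambda>y. f (fst y)) = dproj v f"
    using base.dvec_rep[OF UNIV_I SU[OF q] admissible_base[OF SU[OF q]] r] by (simp add: dproj_def)
qed

text \<open>A horizontal form vanishes on vertical vectors, so it is the pullback of a form under the projection.\<close>

lemma hlift_form_eq:
  assumes \<alpha>: "\<alpha> \<in> cotangent (cinf \<A>) q"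
  shows "hlift_form \<A> E D (q, K) \<alpha> = (\<lambda>v. if v \<in> tangent (cinf_G \<A> E) (q, K) then \<alpha> (dproj v) else 0)"
    and "(\<lambda>v. if v \<in> tangent (cinf_G \<A> E) (q, K) then \<alpha> (dproj v) else 0) \<in> cotangent (cinf_G \<A> E) (q, K)"
proof -
  let ?\<omega> = "\<lambda>v. if v \<in> tangent (cinf_G \<A> E) (q, K) then \<alpha> (dproj v) else 0"
  have \<alpha>l: "\<alpha> (a *\<^sub>R u + b *\<^sub>R w) = a * \<alpha> u + b * \<alpha> w" if "u \<in> TM \<A> q" "w \<in> TM \<A> q" for a b u w
    using \<alpha> that by (simp add: cotangent_def linear_upon_def)
  show c: "?\<omega> \<in> cotangent (cinf_G \<A> E) (q, K)"
    unfolding cotangent_def linear_upon_def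
    using G.tangent_lincomb[OF over_S(1,2)] by (simp add: dproj_lincomb \<alpha>l dproj_TM)
  have \<alpha>0: "\<alpha> 0 = 0" by (rule base.cotangent_zero[OF UNIV_I SU[OF q] \<alpha>])
  have h: "?\<omega> \<in> hor_dual \<A> E (q, K)"
    unfolding hor_dual_def vert_space_def using c by (simp add: dproj_vert \<alpha>0)
  show "hlift_form \<A> E D (q, K) \<alpha> = ?\<omega>"
    unfolding hlift_form_def fst_conv
  proof (rule the_equality)
    show "?\<omega> \<in> hor_dual \<A> E (q, K) \<and> (\<forall>Y\<in>TM \<A> q. ?\<omega> (hlift \<A> E D (q, K) Y) = \<alpha> Y)"
      using h by (simp add: hlift_tangent dproj_hlift)
    fix \<omega> assume "\<omega> \<in> hor_dual \<A> E (q, K) \<and> (\<forall>Y\<in>TM \<A> q. \<omega> (hlift \<A> E D (q, K) Y) = \<alpha> Y)"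
    then have \<omega>: "\<omega> \<in> cotangent (cinf_G \<A> E) (q, K)" "\<And>V. V \<in> vert \<A> E (q, K) \<Longrightarrow> \<omega> (vert_vec \<A> E (q, K) V) = 0"
      "\<And>Y. Y \<in> TM \<A> q \<Longrightarrow> \<omega> (hlift \<A> E D (q, K) Y) = \<alpha> Y"
      by (simp_all add: hor_dual_def vert_space_def)
    show "\<omega> = ?\<omega>"
    proof
      fix v show "\<omega> v = ?\<omega> v"
      proof (cases "v \<in> tangent (cinf_G \<A> E) (q, K)")
        case True
        obtain V where V: "V \<in> vert \<A> E (q, K)" "v = hlift \<A> E D (q, K) (dproj v) + vert_vec \<A> E (q, K) V"
          using tangent_decomposition[OF True] .
        have "\<omega> v = \<alpha> (dproj v) + 0"
          using cotangent_add[OF \<omega>(1) hlift_tangent[OF dproj_TM] vert_vec_tangent[OF V(1)], of v]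
          unfolding V(2)[symmetric] \<omega>(2)[OF V(1)] \<omega>(3)[OF dproj_TM] .
        then show ?thesis using True by simp
      next
        case False
        then show ?thesis using \<omega>(1) by (simp add: cotangent_def)
      qed
    qed
  qed
qed

lemma vert_endo: "V \<in> vert \<A> E (q, K) \<Longrightarrow> V \<in> endos (GTM \<A> q)"
  using vert_iff skew_fibreD(1) by blast

lemma vert_vec_inj:
  assumes "V \<in> vert \<A> E (q, K)" "W \<in> vert \<A> E (q, K)" "vert_vec \<A> E (q, K) V = vert_vec \<A> E (q, K) W"
  shows "V = W"
proof (rule endos_eqI[OF q vert_endo[OF assms(1)] vert_endo[OF assms(2)]])
  show "endo_mat q V = endo_mat q W" using velocity_vert_vec[OF assms(1)] velocity_vert_vec[OF assms(2)] assms(3) by simp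
qed

lemma zero_vert: "(\<lambda>A. 0) \<in> vert \<A> E (q, K)"
  unfolding vert_iff using skew_fibre_zero zero_endo[OF K_skew] by simp

lemma vert_form_P_zero: "vert_form_P \<A> E D \<epsilon> (q, K) 0 = 0"
  unfolding vert_form_P_def
proof (rule the_equality)
  have z: "0 \<in> vert_dual \<A> E D (q, K)"
    unfolding vert_dual_def using subspace_0[OF G.subspace_cotangent] by simp
  then show "0 \<in> vert_dual \<A> E D (q, K) \<and>
    (\<forall>V\<in>vert \<A> E (q, K). 0 (vert_vec \<A> E (q, K) V) = 0 (vert_vec \<A> E (q, K) (vert_P \<A> E \<epsilon> (q, K) V)))"
    by simp
  fix \<psi> assume "\<psi> \<in> vert_dual \<A> E D (q, K) \<and>
    (\<forall>V\<in>vert \<A> E (q, K). \<psi> (vert_vec \<A> E (q, K) V) = 0 (vert_vec \<A> E (q, K) (vert_P \<A> E \<epsilon> (q, K) V)))"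
  then have \<psi>: "\<psi> \<in> cotangent (cinf_G \<A> E) (q, K)" "\<And>X. X \<in> TM \<A> q \<Longrightarrow> \<psi> (hlift \<A> E D (q, K) X) = 0"
    "\<And>V. V \<in> vert \<A> E (q, K) \<Longrightarrow> \<psi> (vert_vec \<A> E (q, K) V) = 0"
    by (simp_all add: vert_dual_def hor_space_def)
  show "\<psi> = 0"
  proof
    fix v show "\<psi> v = 0 v"
    proof (cases "v \<in> tangent (cinf_G \<A> E) (q, K)")
      case True
      obtain V where V: "V \<in> vert \<A> E (q, K)" "v = hlift \<A> E D (q, K) (dproj v) + vert_vec \<A> E (q, K) V"
        using tangent_decomposition[OF True] .
      have "\<psi> v = 0 + 0"
        using cotangent_add[OF \<psi>(1) hlift_tangent[OF dproj_TM] vert_vec_tangent[OF V(1)], of v]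
        unfolding V(2)[symmetric] \<psi>(2)[OF dproj_TM] \<psi>(3)[OF V(1)] .
      then show ?thesis by simp
    next
      case False
      then show ?thesis using \<psi>(1) by (simp add: cotangent_def)
    qed
  qed
qed

text \<open>The value of \<open>\<K>\<^sub>\<epsilon>\<close> on \<open>A\<^sup>h + V\<close>; uniqueness of the decomposition is what has to be checked.\<close>

lemma gpc_structure_eq:
  assumes A: "A \<in> GTM \<A> q" and V: "V \<in> vert \<A> E (q, K)"
  shows "gpc_structure \<A> E D \<epsilon> (q, K) (ghlift \<A> E D (q, K) A + (vert_vec \<A> E (q, K) V, 0))
    = ghlift \<A> E D (q, K) (K A) + (vert_vec \<A> E (q, K) (vert_P \<A> E \<epsilon> (q, K) V), 0)"
  unfolding gpc_structure_def fst_conv snd_conv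
proof (rule the_equality)
  have z: "0 \<in> vert_dual \<A> E D (q, K)"
    unfolding vert_dual_def using subspace_0[OF G.subspace_cotangent] by simp
  have m0: "- vert_form_P \<A> E D \<epsilon> (q, K) 0 = 0" unfolding vert_form_P_zero by simp
  show "\<exists>A'\<in>GTM \<A> q. \<exists>V'\<in>vert \<A> E (q, K). \<exists>\<phi>\<in>vert_dual \<A> E D (q, K).
    ghlift \<A> E D (q, K) A + (vert_vec \<A> E (q, K) V, 0) = ghlift \<A> E D (q, K) A' + (vert_vec \<A> E (q, K) V', \<phi>) \<and>
    ghlift \<A> E D (q, K) (K A) + (vert_vec \<A> E (q, K) (vert_P \<A> E \<epsilon> (q, K) V), 0)
    = ghlift \<A> E D (q, K) (K A') + (vert_vec \<A> E (q, K) (vert_P \<A> E \<epsilon> (q, K) V'), - vert_form_P \<A> E D \<epsilon> (q, K) \<phi>)"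
    by (rule bexI[OF _ A], rule bexI[OF _ V], rule bexI[OF _ z]) (simp only: m0)
  fix R assume "\<exists>A'\<in>GTM \<A> q. \<exists>V'\<in>vert \<A> E (q, K). \<exists>\<phi>\<in>vert_dual \<A> E D (q, K).
    ghlift \<A> E D (q, K) A + (vert_vec \<A> E (q, K) V, 0) = ghlift \<A> E D (q, K) A' + (vert_vec \<A> E (q, K) V', \<phi>) \<and>
    R = ghlift \<A> E D (q, K) (K A') + (vert_vec \<A> E (q, K) (vert_P \<A> E \<epsilon> (q, K) V'), - vert_form_P \<A> E D \<epsilon> (q, K) \<phi>)"
  then obtain A' V' \<phi>' where A': "A' \<in> GTM \<A> q" and V': "V' \<in> vert \<A> E (q, K)" and \<phi>': "\<phi>' \<in> vert_dual \<A> E D (q, K)"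
    and eq: "ghlift \<A> E D (q, K) A + (vert_vec \<A> E (q, K) V, 0) = ghlift \<A> E D (q, K) A' + (vert_vec \<A> E (q, K) V', \<phi>')"
    and R: "R = ghlift \<A> E D (q, K) (K A') + (vert_vec \<A> E (q, K) (vert_P \<A> E \<epsilon> (q, K) V'), - vert_form_P \<A> E D \<epsilon> (q, K) \<phi>')"
    by blast
  have t: "fst A \<in> TM \<A> q" "fst A' \<in> TM \<A> q" "snd A \<in> cotangent (cinf \<A>) q" "snd A' \<in> cotangent (cinf \<A>) q"
    using A A' by (simp_all add: gtangent_def mem_Times_iff)
  have 1: "hlift \<A> E D (q, K) (fst A) + vert_vec \<A> E (q, K) V = hlift \<A> E D (q, K) (fst A') + vert_vec \<A> E (q, K) V'"
    using arg_cong[OF eq, of fst] unfolding ghlift_def by (simp only: fst_add fst_conv)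
  have 2: "hlift_form \<A> E D (q, K) (snd A) + 0 = hlift_form \<A> E D (q, K) (snd A') + \<phi>'"
    using arg_cong[OF eq, of snd] unfolding ghlift_def by (simp only: snd_add snd_conv)
  have fA: "fst A = fst A'"
    using arg_cong[OF 1, of dproj] unfolding dproj_hlift_vert[OF t(1) V] dproj_hlift_vert[OF t(2) V'] .
  then have "vert_vec \<A> E (q, K) V = vert_vec \<A> E (q, K) V'" using 1 by (metis add_left_cancel)
  then have VV: "V = V'" by (rule vert_vec_inj[OF V V'])
  have "snd A Y = snd A' Y" for Y
  proof (cases "Y \<in> TM \<A> q")
    case True
    have "(hlift_form \<A> E D (q, K) (snd A) + 0) (hlift \<A> E D (q, K) Y)
        = (hlift_form \<A> E D (q, K) (snd A') + \<phi>') (hlift \<A> E D (q, K) Y)"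
      by (rule fun_cong[OF 2])
    moreover have "\<phi>' (hlift \<A> E D (q, K) Y) = 0"
      using \<phi>' True by (simp add: vert_dual_def hor_space_def)
    ultimately show ?thesis
      using True by (simp add: hlift_form_eq(1)[OF t(3)] hlift_form_eq(1)[OF t(4)] hlift_tangent dproj_hlift)
  next
    case False
    then show ?thesis using t(3,4) by (simp add: cotangent_def)
  qed
  then have sA: "snd A = snd A'" by (rule ext)
  then have z': "\<phi>' = 0" using 2 by (metis add_left_cancel)
  have AA: "A = A'" by (rule prod_eqI[OF fA sA])
  show "R = ghlift \<A> E D (q, K) (K A) + (vert_vec \<A> E (q, K) (vert_P \<A> E \<epsilon> (q, K) V), 0)"
    unfolding R z' m0 AA VV ..
qed

lemma proj_commute:
  assumes L: "L \<in> skew_fibre \<A> E q" and A: "A \<in> GTM \<A> q"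
  shows "proj_E \<A> E q (L A) = L (proj_E \<A> E q A)"
proof (rule proj_E_any(3))
  note LD = skew_fibreD[OF L] and P = proj_E_any(1,2)[OF A]
  show "L A \<in> GTM \<A> q" by (rule LD(2)[OF A])
  show "L (proj_E \<A> E q A) \<in> E q" by (rule LD(4)[OF P(1)])
  have "L A - L (proj_E \<A> E q A) = L (A - proj_E \<A> E q A)"
    using LD(7)[OF A E_in_GTM[OF P(1)], of 1 "-1"] by simp
  then show "L A - L (proj_E \<A> E q A) \<in> orth \<A> E q" using LD(5)[OF P(2)] by simp
qed

text \<open>The projection to \<open>E\<close> is self-adjoint and commutes with everything that preserves \<open>E\<close> and \<open>E\<^sup>\<bottom>\<close>.\<close>

lemma vert_proj:
  assumes V: "V \<in> vert \<A> E (q, K)"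
  shows "(\<lambda>A. V (proj_E \<A> E q A)) \<in> vert \<A> E (q, K)"
proof -
  have Vs: "V \<in> skew_fibre \<A> E q" and VK: "\<And>A. A \<in> GTM \<A> q \<Longrightarrow> V (K A) = - K (V A)"
    using V vert_iff by blast+
  note VD = skew_fibreD[OF Vs] and KD = skew_fibreD[OF K_skew]
  have P: "proj_E \<A> E q A \<in> E q" "A - proj_E \<A> E q A \<in> orth \<A> E q" "proj_E \<A> E q A \<in> GTM \<A> q"
    if "A \<in> GTM \<A> q" for A
    using proj_E_any(1,2)[OF that] E_in_GTM by simp_all
  have Pl: "proj_E \<A> E q (a *\<^sub>R A + b *\<^sub>R B) = a *\<^sub>R proj_E \<A> E q A + b *\<^sub>R proj_E \<A> E q B"
    if "A \<in> GTM \<A> q" "B \<in> GTM \<A> q" for a b A B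
  proof (rule proj_E_any(3))
    show "a *\<^sub>R A + b *\<^sub>R B \<in> GTM \<A> q" using that by (intro subspace_add subspace_scale GTM_any_subspace)
    show "a *\<^sub>R proj_E \<A> E q A + b *\<^sub>R proj_E \<A> E q B \<in> E q"
      using P that by (intro subspace_add subspace_scale E_subspace)
    have "a *\<^sub>R A + b *\<^sub>R B - (a *\<^sub>R proj_E \<A> E q A + b *\<^sub>R proj_E \<A> E q B)
        = a *\<^sub>R (A - proj_E \<A> E q A) + b *\<^sub>R (B - proj_E \<A> E q B)" by (simp add: algebra_simps)
    then show "a *\<^sub>R A + b *\<^sub>R B - (a *\<^sub>R proj_E \<A> E q A + b *\<^sub>R proj_E \<A> E q B) \<in> orth \<A> E q"
      using P(2)[OF that(1)] P(2)[OF that(2)] by (simp add: subspace_add subspace_scale orth_subspace)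
  qed
  have Pp: "pair (proj_E \<A> E q A) B = pair (proj_E \<A> E q A) (proj_E \<A> E q B)" if "A \<in> GTM \<A> q" "B \<in> GTM \<A> q" for A B
    using base.pair_diff_left[OF that(2) P(3)[OF that(2)] P(3)[OF that(1)]] orth_pair(1)[OF P(2)[OF that(2)] P(1)[OF that(1)]]
    by (simp add: pair_commute)
  show ?thesis unfolding vert_iff
  proof (intro conjI ballI skew_fibreI endosI)
    fix A B a b assume AB: "A \<in> GTM \<A> q" "B \<in> GTM \<A> q"
    show "V (proj_E \<A> E q (a *\<^sub>R A + b *\<^sub>R B)) = a *\<^sub>R V (proj_E \<A> E q A) + b *\<^sub>R V (proj_E \<A> E q B)"
      unfolding Pl[OF AB] VD(7)[OF P(3)[OF AB(1)] P(3)[OF AB(2)]] ..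
  next
    fix A B assume A: "A \<in> GTM \<A> q" and B: "B \<in> GTM \<A> q"
    have "pair (V (proj_E \<A> E q A)) B = - pair (proj_E \<A> E q A) (V B)" by (rule VD(3)[OF P(3)[OF A] B])
    also have "pair (proj_E \<A> E q A) (V B) = pair (proj_E \<A> E q A) (proj_E \<A> E q (V B))" by (rule Pp[OF A VD(2)[OF B]])
    also have "\<dots> = pair (proj_E \<A> E q (V B)) A" using Pp[OF VD(2)[OF B] A] by (simp add: pair_commute)
    also have "\<dots> = pair A (V (proj_E \<A> E q B))" by (simp add: proj_commute[OF Vs B] pair_commute)
    finally show "pair (V (proj_E \<A> E q A)) B = - pair A (V (proj_E \<A> E q B))" .
  next
    fix A assume A: "A \<in> orth \<A> E q"
    have "proj_E \<A> E q A = 0"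
      using A subspace_0[OF E_subspace] by (intro proj_E_any(3)[OF orth_GTM]) simp_all
    then show "V (proj_E \<A> E q A) \<in> orth \<A> E q" using zero_endo[OF Vs] subspace_0[OF orth_subspace] by simp
  next
    fix A assume A: "A \<in> GTM \<A> q"
    show "V (proj_E \<A> E q (K A)) = - K (V (proj_E \<A> E q A))"
      unfolding proj_commute[OF K_skew A] VK[OF P(3)[OF A]] ..
  next
    fix A assume "A \<notin> GTM \<A> q"
    then show "V (proj_E \<A> E q A) = 0" using zero_endo[OF Vs] by (simp add: proj_E_def)
  next
    fix A assume "A \<in> E q"
    then show "V (proj_E \<A> E q A) \<in> E q" using VD(4)[OF P(1)[OF E_in_GTM]] by blast
  next
    fix A assume "A \<in> GTM \<A> q"
    then show "V (proj_E \<A> E q A) \<in> GTM \<A> q" using VD(2)[OF P(3)] by blast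
  qed
qed

lemma vert_P_vert:
  assumes V: "V \<in> vert \<A> E (q, K)"
  shows "vert_P \<A> E \<epsilon> (q, K) V \<in> vert \<A> E (q, K)"
proof -
  have Vs: "V \<in> skew_fibre \<A> E q" using V vert_iff by blast
  have d: "V (A - proj_E \<A> E q A) = 1 *\<^sub>R V A + (-1) *\<^sub>R V (proj_E \<A> E q A)" for A
  proof (cases "A \<in> GTM \<A> q")
    case True
    then show ?thesis
      using skew_fibreD(7)[OF Vs True E_in_GTM[OF proj_E_any(1)[OF True]], of 1 "-1"] by simp
  next
    case False
    then show ?thesis using skew_fibreD(6)[OF Vs] zero_endo[OF Vs] by (simp add: proj_E_def)
  qed
  let ?V1 = "\<lambda>A. V (proj_E \<A> E q A)" and ?V2 = "\<lambda>A. V (A - proj_E \<A> E q A)"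
  have V1: "?V1 \<in> vert \<A> E (q, K)" by (rule vert_proj[OF V])
  have V2: "?V2 \<in> vert \<A> E (q, K)" unfolding d by (rule vert_lincomb[OF K_skew V V1])
  have c: "(\<lambda>A. a *\<^sub>R K (?V1 A) + b *\<^sub>R K (?V2 A)) \<in> vert \<A> E (q, K)" for a b
    by (rule vert_lincomb[OF K_skew vert_compose[OF K V1] vert_compose[OF K V2]])
  have e: "vert_P \<A> E \<epsilon> (q, K) V = (\<lambda>A. (if \<epsilon> = 1 \<or> \<epsilon> = 2 then 1 else - 1) *\<^sub>R K (?V1 A)
      + (if \<epsilon> = 1 \<or> \<epsilon> = 3 then 1 else - 1) *\<^sub>R K (?V2 A))"
    unfolding vert_P_def Let_def case_prod_conv
    by (intro ext) (simp add: fun_Compl_def)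
  show ?thesis unfolding e by (rule c)
qed

end

end

section \<open>Cut-offs and extensions of tangent vectors\<close>

text \<open>The support is the preimage of a closed ball, which is closed in \<open>M\<close> because it is compact and \<open>M\<close> is
  Hausdorff.\<close>

lemma (in manifold_chart) bump_function:
  assumes S: "open S" "S \<subseteq> U" and p: "p \<in> S"
  shows "\<exists>\<theta>. \<theta> p \<noteq> 0 \<and> (\<forall>q\<in>S. \<theta> \<in> cinf \<A> q) \<and>
    (\<forall>q. q \<notin> S \<longrightarrow> (\<exists>T. open T \<and> q \<in> T \<and> (\<forall>y\<in>T. \<theta> y = 0)))"
proof -
  obtain r where r: "r > 0" "cball (\<phi> p) r \<subseteq> \<phi> ` S"
    using open_chart_image[OF chart S] p open_contains_cball by (metis imageI)
  let ?\<theta> = "\<lambda>q. if q \<in> S then flat_exp 0 (r\<^sup>2 - (\<phi> q - \<phi> p) \<bullet> (\<phi> q - \<phi> p)) else 0"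
  let ?B = "inv_into U \<phi> ` cball (\<phi> p) r"
  have inU: "cball (\<phi> p) r \<subseteq> \<phi> ` U" using r(2) S(2) by blast
  have "continuous_on (\<phi> ` U) (inv_into U \<phi>)" using homeo by (simp add: homeomorphism_def)
  then have "compact ?B" using inU by (intro compact_continuous_image) (auto intro: continuous_on_subset)
  then have cl: "closed ?B" by (rule compact_imp_closed)
  have BS: "?B \<subseteq> S"
  proof
    fix y assume "y \<in> ?B"
    then obtain u where u: "u \<in> cball (\<phi> p) r" "y = inv_into U \<phi> u" by blast
    then obtain z where "z \<in> S" "u = \<phi> z" using r(2) by blast
    then show "y \<in> S" using u chart_inv(1) S(2) by auto
  qed
  have out: "?\<theta> y = 0" if "y \<notin> ?B" for y
  proof (cases "y \<in> S")
    case True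
    have "\<phi> y \<notin> cball (\<phi> p) r"
    proof
      assume "\<phi> y \<in> cball (\<phi> p) r"
      then have "inv_into U \<phi> (\<phi> y) \<in> ?B" by (rule imageI)
      then show False using that chart_inv(1) S(2) True by auto
    qed
    then have "norm (\<phi> y - \<phi> p) > r" by (simp add: dist_norm norm_minus_commute)
    then have "r\<^sup>2 \<le> (norm (\<phi> y - \<phi> p))\<^sup>2" using r(1) by (intro power_mono) auto
    then show ?thesis by (simp add: flat_exp_def power2_norm_eq_inner)
  qed simp
  show ?thesis
  proof (intro exI[of _ ?\<theta>] conjI ballI allI impI)
    show "?\<theta> p \<noteq> 0" using p r(1) by (simp add: flat_exp_def)
  next
    fix q assume q: "q \<in> S"
    show "?\<theta> \<in> cinf \<A> q"
    proof -
      have qU: "q \<in> U" using q S by auto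
      have sm: "smooth_on UNIV (\<lambda>u. r\<^sup>2 + (- 1) * ((u + (- \<phi> p)) \<bullet> (u + (- \<phi> p))))"
        by (intro smooth_on_add smooth_on_mult smooth_on_inner smooth_on_const open_UNIV
            smooth_on_bounded_linear bounded_linear_ident)
      have "smooth_on UNIV (\<lambda>u. flat_exp 0 (r\<^sup>2 + (- 1) * ((u + (- \<phi> p)) \<bullet> (u + (- \<phi> p)))))"
        by (rule smooth_on_compose[OF open_UNIV open_UNIV _ sm smooth_on_flat_exp]) simp
      from base.C_smooth_coord[OF UNIV_I qU open_UNIV UNIV_I this]
      have "(\<lambda>y. flat_exp 0 (r\<^sup>2 - (\<phi> y - \<phi> p) \<bullet> (\<phi> y - \<phi> p))) \<in> cinf \<A> q" by simp
      moreover have "base.near q (\<lambda>y. flat_exp 0 (r\<^sup>2 - (\<phi> y - \<phi> p) \<bullet> (\<phi> y - \<phi> p)) = ?\<theta> y)"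
        unfolding near_iff[OF qU] using S q by (intro exI[of _ S]) simp
      ultimately show ?thesis by (rule iffD1[OF base.C_cong[OF UNIV_I qU], rotated])
    qed
  next
    fix q assume q: "q \<notin> S"
    show "\<exists>T. open T \<and> q \<in> T \<and> (\<forall>y\<in>T. ?\<theta> y = 0)"
      by (intro exI[of _ "- ?B"]) (use cl BS q out in auto)
  qed
qed

text \<open>Fields cut off near the chart under consideration vanish near every other point, where they are compared
  with the zero section.\<close>

lemma (in gmetric_chart) zero_germ:
  assumes T: "open T" "fst x \<in> T" and x: "x \<in> reflector_space \<A> E"
    and f: "\<And>y. y \<in> reflector_space \<A> E \<Longrightarrow> fst y \<in> T \<Longrightarrow> f y = 0"
  shows "f \<in> cinf_G \<A> E x"
proof -
  obtain V \<psi> where V: "(V, \<psi>) \<in> \<A>" "fst x \<in> V" using chart_cover by blast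
  interpret c: manifold_chart \<A> V \<psi> using atlas V(1) by unfold_locales
  let ?c = "(over V, bundle_map \<psi> (coord_frame \<A> (V, \<psi>)))"
  have ec: "?c \<in> end_charts \<A>"
    unfolding end_charts_def bundle_map_def using V(1) by (intro image_eqI[of _ _ "(V, \<psi>)"]) auto
  let ?W = "(\<psi> ` (V \<inter> T)) \<times> (UNIV :: (real ^ ('n + 'n) ^ ('n + 'n)) set)"
  have o: "open ?W"
    by (intro open_Times open_UNIV open_chart_image[OF V(1)] open_Int c.open_U T(1)) simp
  have "\<forall>y\<in>reflector_space \<A> E \<inter> over V. bundle_map \<psi> (coord_frame \<A> (V, \<psi>)) y \<in> ?W \<longrightarrow> f y = 0"
  proof (intro ballI impI)
    fix y assume y: "y \<in> reflector_space \<A> E \<inter> over V" "bundle_map \<psi> (coord_frame \<A> (V, \<psi>)) y \<in> ?W"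
    obtain r L where yr: "y = (r, L)" by (cases y)
    from y obtain z where z: "z \<in> V" "z \<in> T" "\<psi> r = \<psi> z" by (auto simp: bundle_map_def yr)
    have rV: "r \<in> V" using y(1) yr by simp
    have "r = z" using c.chart_inv(1)[OF rV] c.chart_inv(1)[OF z(1)] z(3) by metis
    then show "f y = 0" using f y(1) z(2) yr by simp
  qed
  note 1 = this
  have 2: "bundle_map \<psi> (coord_frame \<A> (V, \<psi>)) x \<in> ?W"
    using V T by (cases x) (auto simp: bundle_map_def)
  have 3: "x \<in> over V" using V(2) by (cases x) simp
  have "x \<in> over V \<and> (\<exists>W h. open W \<and> bundle_map \<psi> (coord_frame \<A> (V, \<psi>)) x \<in> W \<and> smooth_on W h \<and>
      (\<forall>y\<in>reflector_space \<A> E \<inter> over V. bundle_map \<psi> (coord_frame \<A> (V, \<psi>)) y \<in> W \<longrightarrow>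
        f y = h (bundle_map \<psi> (coord_frame \<A> (V, \<psi>)) y)))"
    by (intro conjI 3 exI[of _ ?W] exI[of _ "\<lambda>_. 0"] o 2 smooth_on_const[OF o]) (rule 1)
  then show ?thesis
    unfolding smooth_near_def by (intro CollectI bexI[OF _ ec]) (simp only: case_prod_conv)
qed

lemma (in framed_chart) crd_sum: "crd q (\<Sum>b\<in>UNIV. c b *\<^sub>R (A b :: 'p gvec)) a = (\<Sum>b\<in>UNIV. c b * crd q (A b) a)"
  for c :: "'n + 'n \<Rightarrow> real"
  by (cases a) (simp_all add: crd_def fst_sum_apply snd_sum_apply scaleR_fun_def)

context connected_frame
begin

abbreviation R :: "'p gpoint set" where "R \<equiv> reflector_space \<A> E"

abbreviation RS :: "'p gpoint set" where "RS \<equiv> R \<inter> over S"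

lemma RS_D: "y \<in> RS \<Longrightarrow> fst y \<in> S" "y \<in> RS \<Longrightarrow> (fst y, snd y) \<in> R" "y \<in> RS \<Longrightarrow> y \<in> R" "y \<in> RS \<Longrightarrow> y \<in> over S"
  by auto

lemma entry_C: "x \<in> RS \<Longrightarrow> entry a b \<in> cinf_G \<A> E x"
  using G.C_coord[of x "(0, axis a (axis b 1))"] by (simp add: entry_inner[abs_def])

lemma pullback_C: "x \<in> RS \<Longrightarrow> f \<in> cinf \<A> (fst x) \<Longrightarrow> (\<lambda>y. f (fst y)) \<in> cinf_G \<A> E x"
  using pullback_smooth(1)[of "fst x" "snd x" f] RS_D by simp

lemma frame_crd_C: "q \<in> S \<Longrightarrow> (\<lambda>q. crd q (e q b) a) \<in> cinf \<A> q"
  using sec[of q b] gsec_iff[OF SU, of q "\<lambda>y. e y b"] by simp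

text \<open>Smooth vector fields on \<open>\<G>\<close> over \<open>S\<close>, given by their coordinates and extended by zero.\<close>

lemma vfield_RS:
  assumes x: "x \<in> RS"
    and X: "\<And>y. y \<in> RS \<Longrightarrow> X y \<in> tangent (cinf_G \<A> E) y" "\<And>y. y \<in> R \<Longrightarrow> y \<notin> over S \<Longrightarrow> X y = 0"
    and u: "\<And>i. u i \<in> cinf_G \<A> E x" "\<And>y i. y \<in> RS \<Longrightarrow> fst (G.velocity (X y)) $ i = u i y"
    and m: "\<And>a b. m a b \<in> cinf_G \<A> E x" "\<And>y a b. y \<in> RS \<Longrightarrow> snd (G.velocity (X y)) $ a $ b = m a b y"
  shows "vfield_at (cinf_G \<A> E) R x X"
proof (rule G.vfield_atI[OF RS_D(3,4)[OF x]])
  show "X y \<in> tangent (cinf_G \<A> E) y" if "y \<in> R" for y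
  proof (cases "y \<in> over S")
    case True then show ?thesis using X(1) that by simp
  next
    case False
    then have "X y = 0" using X(2) that by simp
    then show ?thesis by (simp add: tangent_def linear_upon_def zero_fun_def)
  qed
  fix b :: "(real ^ 'n) \<times> (real ^ ('n + 'n) ^ ('n + 'n))" assume "b \<in> Basis"
  then show "(\<lambda>y. X y (\<lambda>z. \<Psi> z \<bullet> b)) \<in> cinf_G \<A> E x"
  proof (cases rule: Basis_cases)
    case (1 i)
    have "G.near x (\<lambda>y. u i y = X y (\<lambda>z. \<Psi> z \<bullet> b))"
      by (rule G.near_all) (use u(2) velocity_coord in \<open>simp add: 1 coord_inner\<close>)
    from iffD1[OF G.C_cong[OF RS_D(3,4)[OF x] this] u(1)] show ?thesis .
  next
    case (2 a c)
    have "G.near x (\<lambda>y. m a c y = X y (\<lambda>z. \<Psi> z \<bullet> b))"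
      by (rule G.near_all) (use m(2) velocity_entry in \<open>simp add: 2 entry_inner[abs_def]\<close>)
    from iffD1[OF G.C_cong[OF RS_D(3,4)[OF x] this] m(1)] show ?thesis .
  qed
qed

lemma mult_C:
  assumes x: "x \<in> RS"
    and "\<And>a b. (\<lambda>y. m y $ a $ b) \<in> cinf_G \<A> E x" "\<And>a b. (\<lambda>y. k y $ a $ b) \<in> cinf_G \<A> E x"
  shows "(\<lambda>y. frame_mult (m y) (k y) $ a $ b) \<in> cinf_G \<A> E x"
proof -
  have "(\<lambda>y. \<Sum>c\<in>UNIV. \<eta> c * m y $ a $ c * k y $ c $ b) \<in> cinf_G \<A> E x"
    by (intro G.C_sum G.C_mult G.C_const assms(2,3) RS_D(3,4)[OF x])
  then show ?thesis by (simp add: frame_mult_def)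
qed

lemma mat_snd: "endo_mat (fst y) (snd y) $ a $ b = entry a b y"
  by (cases y) (simp add: entry_eq mat_nth)

text \<open>Every tangent vector of \<open>\<G>\<close> at a point over \<open>S\<close> extends to a smooth vector field: a vertical
  \<open>V\<close> extends by \<open>(V - K V K) / 2\<close> with \<open>V\<close> constant in the frame.\<close>

lemma tangent_extends:
  assumes x: "x \<in> RS" and v: "v \<in> tangent (cinf_G \<A> E) x"
  shows "\<exists>Y. vfield_at (cinf_G \<A> E) R x Y \<and> Y x = v"
proof -
  obtain q K where xq: "x = (q, K)" by (cases x)
  have q: "q \<in> S" "(q, K) \<in> R" using x xq by auto
  obtain u V where V: "V \<in> vert \<A> E (q, K)" "v = G.dvec (q, K) (u, endo_mat q V)"
    using tangent_G_cases[OF q] v xq by metis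
  have sk: "skew_mat (endo_mat q V)" using V(1) vert_iff skew_fibre_iff[OF q(1)] by blast
  let ?F = "\<lambda>y. of_mat (fst y) (endo_mat q V)"
  let ?KFK = "\<lambda>y A. snd y (?F y (snd y A))"
  \<comment> \<open>The part anticommuting with \<open>K\<close>, where \<open>K\<close> is the current point of the fibre.\<close>
  let ?V = "\<lambda>y A. (1/2) *\<^sub>R ?F y A + (-1/2) *\<^sub>R ?KFK y A"
  have ex: "?V y \<in> vert \<A> E y \<and> endo_mat (fst y) (?V y) = (1/2) *\<^sub>R endo_mat q V + (-1/2) *\<^sub>R frame_mult (frame_mult (endo_mat (fst y) (snd y)) (endo_mat q V)) (endo_mat (fst y) (snd y))"
    if y: "y \<in> RS" for y
  proof -
    obtain r L where yr: "y = (r, L)" by (cases y)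
    have r: "r \<in> S" "(r, L) \<in> R" using y yr by auto
    have Fs: "of_mat r (endo_mat q V) \<in> skew_fibre \<A> E r" by (rule of_mat_skew[OF r(1) sk])
    have Ls: "L \<in> skew_fibre \<A> E r" and LL: "\<And>A. A \<in> GTM \<A> r \<Longrightarrow> L (L A) = A"
      using r reflector_iff by blast+
    note FD = skew_fibreD[OF Fs] and LD = skew_fibreD[OF Ls]
    let ?f = "of_mat r (endo_mat q V)"
    have cs: "(\<lambda>A. L (?f (L A))) \<in> skew_fibre \<A> E r"
    proof (intro skew_fibreI endosI)
      fix A B assume "A \<in> GTM \<A> r" "B \<in> GTM \<A> r"
      then show "pair (L (?f (L A))) B = - pair A (L (?f (L B)))"
        using LD(3)[OF FD(2)[OF LD(2)], of A B] FD(3)[OF LD(2) LD(2), of A B] LD(3)[OF _ FD(2)[OF LD(2)], of A B] by simp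
    qed (simp_all add: LD FD zero_endo[OF Ls] zero_endo[OF Fs])
    have "?V y \<in> vert \<A> E (r, L)"
      unfolding vert_iff yr fst_conv snd_conv
    proof (intro conjI ballI skew_fibre_lincomb[OF Fs cs])
      fix A assume A: "A \<in> GTM \<A> r"
      have "L ((1/2) *\<^sub>R ?f A + (-1/2) *\<^sub>R L (?f (L A))) = (1/2) *\<^sub>R L (?f A) + (-1/2) *\<^sub>R ?f (L A)"
        unfolding LD(7)[OF FD(2)[OF A] LD(2)[OF FD(2)[OF LD(2)[OF A]]]] LL[OF FD(2)[OF LD(2)[OF A]]] ..
      then show "(1/2) *\<^sub>R ?f (L A) + (-1/2) *\<^sub>R L (?f (L (L A))) = - L ((1/2) *\<^sub>R ?f A + (-1/2) *\<^sub>R L (?f (L A)))"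
        by (simp add: LL[OF A])
    qed
    moreover have "endo_mat r (\<lambda>A. (1/2) *\<^sub>R ?f A + (-1/2) *\<^sub>R L (?f (L A)))
        = (1/2) *\<^sub>R endo_mat r ?f + (-1/2) *\<^sub>R endo_mat r (\<lambda>A. L (?f (L A)))"
      by (rule mat_lincomb) (simp_all add: FD LD)
    moreover have "endo_mat r (\<lambda>A. L (?f (L A))) = frame_mult (frame_mult (endo_mat r L) (endo_mat r ?f)) (endo_mat r L)"
      using mat_compose[of r "\<lambda>A. ?f (L A)" L, OF r(1) FD(2)[OF LD(2)] LD(1)] mat_compose[of r L ?f, OF r(1) LD(2) FD(1)]
      by simp
    ultimately show ?thesis by (simp add: yr mat_of_mat[OF r(1)])
  qed
  let ?Y = "\<lambda>y. if y \<in> RS then G.dvec y (u, endo_mat (fst y) (?V y)) else 0"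
  have adm: "(u, endo_mat (fst y) (?V y)) \<in> G.admissible y" if y: "y \<in> RS" for y
    using admissible_vert[OF RS_D(1,2)[OF y], of "?V y" u] ex[OF y] by simp
  have vel: "G.velocity (?Y y) = (u, endo_mat (fst y) (?V y))" if y: "y \<in> RS" for y
    using G.velocity_dvec[OF RS_D(3,4)[OF y] adm[OF y]] y by simp
  have "vfield_at (cinf_G \<A> E) R x ?Y"
  proof (rule vfield_RS[OF x, where u = "\<lambda>i y. u $ i" and m = "\<lambda>a b y. ((1/2) *\<^sub>R endo_mat q V + (-1/2) *\<^sub>R frame_mult (frame_mult (endo_mat (fst y) (snd y)) (endo_mat q V)) (endo_mat (fst y) (snd y))) $ a $ b"])
    show "?Y y \<in> tangent (cinf_G \<A> E) y" if y: "y \<in> RS" for y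
      using G.dvec_tangent[OF RS_D(3,4)[OF y] adm[OF y]] y by simp
    show "?Y y = 0" if "y \<in> R" "y \<notin> over S" for y using that by simp
    show "(\<lambda>y. u $ i) \<in> cinf_G \<A> E x" for i by (rule G.C_const[OF RS_D(3,4)[OF x]])
    show "fst (G.velocity (?Y y)) $ i = u $ i" if y: "y \<in> RS" for y i unfolding vel[OF y] by simp
    show "snd (G.velocity (?Y y)) $ a $ b = ((1/2) *\<^sub>R endo_mat q V + (-1/2) *\<^sub>R frame_mult (frame_mult (endo_mat (fst y) (snd y)) (endo_mat q V)) (endo_mat (fst y) (snd y))) $ a $ b"
      if y: "y \<in> RS" for y a b
      using arg_cong[OF vel[OF y], of "\<lambda>z. snd z $ a $ b"] unfolding snd_conv conjunct2[OF ex[OF y]] .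
    have ms: "(\<lambda>y. endo_mat (fst y) (snd y) $ a $ b) \<in> cinf_G \<A> E x" for a b
      unfolding mat_snd by (rule entry_C[OF x])
    have "(\<lambda>y. (1/2) * endo_mat q V $ a $ b + (-1/2) * frame_mult (frame_mult (endo_mat (fst y) (snd y)) (endo_mat q V)) (endo_mat (fst y) (snd y)) $ a $ b) \<in> cinf_G \<A> E x" for a b
      by (intro G.C_add G.C_mult G.C_const mult_C[OF x] ms RS_D(3,4)[OF x])
    then show "(\<lambda>y. ((1/2) *\<^sub>R endo_mat q V + (-1/2) *\<^sub>R frame_mult (frame_mult (endo_mat (fst y) (snd y)) (endo_mat q V)) (endo_mat (fst y) (snd y))) $ a $ b) \<in> cinf_G \<A> E x" for a b
      by simp
  qed
  moreover have "?Y x = v"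
  proof -
    have Ks: "K \<in> skew_fibre \<A> E q" and KK: "\<And>A. A \<in> GTM \<A> q \<Longrightarrow> K (K A) = A"
      using q reflector_iff by blast+
    have Vs: "V \<in> skew_fibre \<A> E q" and VK: "\<And>A. A \<in> GTM \<A> q \<Longrightarrow> V (K A) = - K (V A)"
      using V(1) vert_iff by blast+
    have f: "of_mat q (endo_mat q V) = V" by (rule of_mat_mat[OF q(1) skew_fibreD(1)[OF Vs]])
    have "?V (q, K) A = V A" for A
    proof (cases "A \<in> GTM \<A> q")
      case True
      note G = skew_fibreD(2)[OF Vs True]
      have "K (- K (V A)) = - V A"
        using skew_fibreD(7)[OF Ks skew_fibreD(2)[OF Ks G] skew_fibreD(2)[OF Ks G], of "-1" 0] KK[OF G] by simp
      then show ?thesis using True by (simp add: f VK scaleR_add_left[symmetric])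
    next
      case False
      then show ?thesis using skew_fibreD(6)[OF Vs] skew_fibreD(6)[OF Ks] zero_endo[OF Ks] zero_endo[OF Vs] by (simp add: f)
    qed
    then have "?V (q, K) = V" by (rule ext)
    then show ?thesis using x V(2) unfolding xq by simp
  qed
  ultimately show ?thesis by blast
qed

text \<open>A covector orthogonal to \<open>E\<close> vanishes on the projection of \<open>E\<close> to \<open>TM\<close>, which is everything.\<close>

lemma orth_no_forms: "q \<in> S \<Longrightarrow> A \<in> orth \<A> E q \<Longrightarrow> fst A = 0 \<Longrightarrow> A = 0"
proof -
  assume q: "q \<in> S" and A: "A \<in> orth \<A> E q" "fst A = 0"
  have sA: "snd A \<in> cotangent (cinf \<A>) q" using orth_GTM[OF A(1)] by (simp add: gtangent_def mem_Times_iff)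
  have "snd A Y = 0" for Y
  proof (cases "Y \<in> TM \<A> q")
    case True
    obtain B where B: "B \<in> E q" "fst B = Y" using E_onto_TM[OF SU[OF q] True] by blast
    have "snd B \<in> cotangent (cinf \<A>) q" using E_in_GTM[OF B(1)] by (simp add: gtangent_def mem_Times_iff)
    then have "pair B A = snd A Y / 2"
      using base.cotangent_zero[OF UNIV_I SU[OF q]] by (simp add: pair_def A(2) B(2))
    then show ?thesis using orth_pair(2)[OF A(1) B(1)] by simp
  next
    case False then show ?thesis using sA by (simp add: cotangent_def)
  qed
  then show "A = 0" using A(2) by (intro prod_eqI) (auto simp: zero_fun_def)
qed

lemma vert_vec_scale:
  assumes y: "y \<in> RS" and V: "V \<in> vert \<A> E y"
  shows "c *\<^sub>R vert_vec \<A> E y V = vert_vec \<A> E y (\<lambda>A. c *\<^sub>R V A + 0 *\<^sub>R V A)"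
    and "(\<lambda>A. c *\<^sub>R V A + 0 *\<^sub>R V A) \<in> vert \<A> E y"
proof -
  obtain q K where yq: "y = (q, K)" by (cases y)
  have q: "q \<in> S" "(q, K) \<in> R" using y yq by auto
  have Vv: "V \<in> vert \<A> E (q, K)" using V yq by simp
  have Vs: "V \<in> skew_fibre \<A> E q" using Vv vert_iff by blast
  have cV: "(\<lambda>A. c *\<^sub>R V A + 0 *\<^sub>R V A) \<in> vert \<A> E (q, K)"
    by (rule vert_lincomb[OF K_skew[OF q] Vv Vv])
  then show "(\<lambda>A. c *\<^sub>R V A + 0 *\<^sub>R V A) \<in> vert \<A> E y" by (simp add: yq)
  have m: "endo_mat q (\<lambda>A. c *\<^sub>R V A + 0 *\<^sub>R V A) = c *\<^sub>R endo_mat q V + 0 *\<^sub>R endo_mat q V"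
    by (rule mat_lincomb) (simp_all add: skew_fibreD(2)[OF Vs])
  show "c *\<^sub>R vert_vec \<A> E y V = vert_vec \<A> E y (\<lambda>A. c *\<^sub>R V A + 0 *\<^sub>R V A)"
    unfolding yq
  proof (rule G.tangent_eqI[OF over_S(1,2)[OF q] _ vert_vec_tangent[OF q cV]])
    show "c *\<^sub>R vert_vec \<A> E (q, K) V \<in> tangent (cinf_G \<A> E) (q, K)"
      by (rule subspace_scale[OF G.subspace_tangent[OF over_S(1,2)[OF q]] vert_vec_tangent[OF q Vv]])
    show "G.velocity (c *\<^sub>R vert_vec \<A> E (q, K) V) = G.velocity (vert_vec \<A> E (q, K) (\<lambda>A. c *\<^sub>R V A + 0 *\<^sub>R V A))"
      unfolding velocity_vert_vec[OF q cV] m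
      using G.velocity_lincomb[of c "vert_vec \<A> E (q, K) V" 0 "vert_vec \<A> E (q, K) V"]
      by (simp add: velocity_vert_vec[OF q Vv])
  qed
qed

lemma ghlift_scale:
  assumes y: "y \<in> RS" and A: "A \<in> GTM \<A> (fst y)"
  shows "c *\<^sub>R ghlift \<A> E D y A = ghlift \<A> E D y (c *\<^sub>R A)"
proof -
  obtain q K where yq: "y = (q, K)" by (cases y)
  have q: "q \<in> S" "(q, K) \<in> R" using y yq by auto
  have X: "fst A \<in> TM \<A> q" and \<alpha>: "snd A \<in> cotangent (cinf \<A>) q"
    using A yq by (simp_all add: gtangent_def mem_Times_iff)
  have cX: "c *\<^sub>R fst A \<in> TM \<A> q" by (rule subspace_scale[OF base.subspace_tangent[OF UNIV_I SU[OF q(1)]] X])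
  have c\<alpha>: "c *\<^sub>R snd A \<in> cotangent (cinf \<A>) q" by (rule subspace_scale[OF base.subspace_cotangent \<alpha>])
  have h: "hor_mat q K (c *\<^sub>R fst A) = c *\<^sub>R hor_mat q K (fst A)"
    unfolding hor_mat_expand[OF q(1) K_skew[OF q] X] hor_mat_expand[OF q(1) K_skew[OF q] cX]
    by (simp add: scaleR_fun_def scaleR_sum_right)
  have "c *\<^sub>R hlift \<A> E D (q, K) (fst A) = hlift \<A> E D (q, K) (c *\<^sub>R fst A)"
  proof (rule G.tangent_eqI[OF over_S(1,2)[OF q] _ hlift_tangent[OF q cX]])
    show "c *\<^sub>R hlift \<A> E D (q, K) (fst A) \<in> tangent (cinf_G \<A> E) (q, K)"
      by (rule subspace_scale[OF G.subspace_tangent[OF over_S(1,2)[OF q]] hlift_tangent[OF q X]])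
    show "G.velocity (c *\<^sub>R hlift \<A> E D (q, K) (fst A)) = G.velocity (hlift \<A> E D (q, K) (c *\<^sub>R fst A))"
      unfolding velocity_hlift[OF q cX] h
      using G.velocity_lincomb[of c "hlift \<A> E D (q, K) (fst A)" 0 "hlift \<A> E D (q, K) (fst A)"]
        base.velocity_lincomb[of c "fst A" 0 "fst A"]
      by (simp add: velocity_hlift[OF q X])
  qed
  moreover have "c *\<^sub>R hlift_form \<A> E D (q, K) (snd A) = hlift_form \<A> E D (q, K) (c *\<^sub>R snd A)"
    unfolding hlift_form_eq(1)[OF q \<alpha>] hlift_form_eq(1)[OF q c\<alpha>] by (auto simp: scaleR_fun_def)
  ultimately show ?thesis unfolding yq ghlift_def by (intro prod_eqI) simp_all
qed

end

section \<open>Two eigensections whose bracket is not an eigenvector\<close>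

lemma eq_neg_self_imp_zero:
  fixes x :: "'v::real_vector"
  assumes "- x = x"
  shows "x = 0"
proof -
  have "2 *\<^sub>R x = x + x" by (rule scaleR_2)
  also have "\<dots> = x + - x" using assms by simp
  finally show ?thesis by simp
qed

text \<open>The map \<open>J\<close> selects the block in which \<open>\<P>\<^sub>\<epsilon> V = - K V\<close>. The indices \<open>i\<close> and \<open>j\<close> are chosen so that at a
  suitable \<open>K\<close> the vectors \<open>w\<^sub>i\<close>, \<open>w\<^sub>j\<close> are linearly independent.\<close>

locale eigen_fields = connected_frame \<A> U \<phi> n E S e \<eta> \<sigma> D' D''
  for \<A> :: "('p::{t2_space, second_countable_topology}, real ^ 'n) chart set" and U \<phi> n E S e \<eta> \<sigma> D' D'' +
  fixes \<theta> :: "'p \<Rightarrow> real" and p :: 'p and J :: "'n \<Rightarrow> 'n + 'n" and i j :: 'n and \<epsilon> :: nat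
  assumes p: "p \<in> S" and \<theta>p: "\<theta> p \<noteq> 0"
    and \<theta>C: "\<And>q. q \<in> S \<Longrightarrow> \<theta> \<in> cinf \<A> q"
    and \<theta>0: "\<And>q. q \<notin> S \<Longrightarrow> \<exists>T. open T \<and> q \<in> T \<and> (\<forall>y\<in>T. \<theta> y = 0)"
    and J: "J = Inl \<and> (\<epsilon> = 3 \<or> \<epsilon> = 4) \<or> J = Inr \<and> \<epsilon> = 2"
    and ij: "j \<noteq> i" "j \<noteq> \<sigma> i"
begin

definition minus_vec :: "'p gpoint \<Rightarrow> 'n \<Rightarrow> 'p gvec"
  where "minus_vec y k = e (fst y) (J k) - snd y (e (fst y) (J k))"

text \<open>The skew endomorphism \<open>w\<^sub>i \<and> w\<^sub>j\<close> for \<open>w\<^sub>k = minus_vec y k\<close>.\<close>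

definition eigen_vert :: "'p gpoint \<Rightarrow> 'p gvec \<Rightarrow> 'p gvec"
  where "eigen_vert y A = (if A \<in> GTM \<A> (fst y)
    then pair A (minus_vec y i) *\<^sub>R minus_vec y j - pair A (minus_vec y j) *\<^sub>R minus_vec y i else 0)"

definition plus_vec :: "'p gpoint \<Rightarrow> 'p gvec"
  where "plus_vec y = e (fst y) (J i) + snd y (e (fst y) (J i))"

definition vert_section :: "'p gpoint \<Rightarrow> 'p gpoint gvec"
  where "vert_section y = (if y \<in> RS then (\<theta> (fst y) *\<^sub>R vert_vec \<A> E y (eigen_vert y), 0) else 0)"

definition hor_section :: "'p gpoint \<Rightarrow> 'p gpoint gvec"
  where "hor_section y = (if y \<in> RS then \<theta> (fst y) *\<^sub>R ghlift \<A> E D y (plus_vec y) else 0)"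

lemma e_orth: "q \<in> S \<Longrightarrow> e q (Inr k) \<in> orth \<A> E q"
  unfolding orth_iff using eG ee by simp

context fixes q K assumes q: "q \<in> S" and K: "(q, K) \<in> R"
begin

lemma yRS: "(q, K) \<in> RS" using q K by simp

lemma KD: "A \<in> GTM \<A> q \<Longrightarrow> K A \<in> GTM \<A> q"
  "A \<in> GTM \<A> q \<Longrightarrow> B \<in> GTM \<A> q \<Longrightarrow> pair (K A) B = - pair A (K B)"
  "A \<in> GTM \<A> q \<Longrightarrow> B \<in> GTM \<A> q \<Longrightarrow> K (a *\<^sub>R A + b *\<^sub>R B) = a *\<^sub>R K A + b *\<^sub>R K B"
  "A \<in> GTM \<A> q \<Longrightarrow> K (K A) = A" "A \<in> GTM \<A> q \<Longrightarrow> B \<in> GTM \<A> q \<Longrightarrow> K (A - B) = K A - K B"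
  using skew_fibreD(2,3,7)[OF K_skew[OF q K]] K_square[OF q K] skew_fibreD(7)[OF K_skew[OF q K], of A B 1 "-1"]
  by simp_all

lemma minus_vec_GTM: "minus_vec (q, K) k \<in> GTM \<A> q"
  unfolding minus_vec_def fst_conv snd_conv by (intro subspace_diff[OF GTM_any_subspace] eG KD(1))

lemma K_minus_vec: "K (minus_vec (q, K) k) = - minus_vec (q, K) k"
  unfolding minus_vec_def fst_conv snd_conv KD(5)[OF eG KD(1)[OF eG]] KD(4)[OF eG] by simp

lemma minus_vec_block: "J = Inl \<Longrightarrow> minus_vec (q, K) k \<in> E q" "J = Inr \<Longrightarrow> minus_vec (q, K) k \<in> orth \<A> E q"
  unfolding minus_vec_def fst_conv snd_conv using e_E[OF q, of k] e_orth[OF q, of k]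
    skew_fibreD(4,5)[OF K_skew[OF q K]] subspace_diff[OF E_subspace] subspace_diff[OF orth_subspace]
  by simp_all

lemma eigen_vert_eq: "A \<in> GTM \<A> q \<Longrightarrow> eigen_vert (q, K) A = pair A (minus_vec (q, K) i) *\<^sub>R minus_vec (q, K) j - pair A (minus_vec (q, K) j) *\<^sub>R minus_vec (q, K) i"
  by (simp add: eigen_vert_def)

lemma eigen_vert_GTM: "A \<in> GTM \<A> q \<Longrightarrow> eigen_vert (q, K) A \<in> GTM \<A> q"
  unfolding eigen_vert_eq by (intro subspace_diff[OF GTM_any_subspace] subspace_scale[OF GTM_any_subspace] minus_vec_GTM)

lemma pair_eigen_vert:
  assumes "A \<in> GTM \<A> q" "B \<in> GTM \<A> q"
  shows "pair (eigen_vert (q, K) A) B = pair A (minus_vec (q, K) i) * pair (minus_vec (q, K) j) B - pair A (minus_vec (q, K) j) * pair (minus_vec (q, K) i) B"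
  unfolding eigen_vert_eq[OF assms(1)]
  using pair_lin_left[OF minus_vec_GTM minus_vec_GTM assms(2), of "pair A (minus_vec (q, K) i)" j "- pair A (minus_vec (q, K) j)" i] by simp

lemma eigen_vert_linear:
  assumes "A \<in> GTM \<A> q" "B \<in> GTM \<A> q"
  shows "eigen_vert (q, K) (a *\<^sub>R A + b *\<^sub>R B) = a *\<^sub>R eigen_vert (q, K) A + b *\<^sub>R eigen_vert (q, K) B"
proof -
  have "a *\<^sub>R A + b *\<^sub>R B \<in> GTM \<A> q" using assms by (intro subspace_add subspace_scale GTM_any_subspace)
  then show ?thesis
    unfolding eigen_vert_eq[OF assms(1)] eigen_vert_eq[OF assms(2)] by (simp add: eigen_vert_eq pair_lin_left[OF assms minus_vec_GTM] algebra_simps)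
qed

lemma K_eigen_vert: "A \<in> GTM \<A> q \<Longrightarrow> K (eigen_vert (q, K) A) = - eigen_vert (q, K) A"
proof -
  assume A: "A \<in> GTM \<A> q"
  have "K (pair A (minus_vec (q, K) i) *\<^sub>R minus_vec (q, K) j + (- pair A (minus_vec (q, K) j)) *\<^sub>R minus_vec (q, K) i)
      = pair A (minus_vec (q, K) i) *\<^sub>R (- minus_vec (q, K) j) + (- pair A (minus_vec (q, K) j)) *\<^sub>R (- minus_vec (q, K) i)"
    unfolding KD(3)[OF minus_vec_GTM minus_vec_GTM] K_minus_vec ..
  then show ?thesis unfolding eigen_vert_eq[OF A] by simp
qed

lemma eigen_vert_K: "A \<in> GTM \<A> q \<Longrightarrow> eigen_vert (q, K) (K A) = eigen_vert (q, K) A"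
proof -
  assume A: "A \<in> GTM \<A> q"
  have mp: "pair A (- B) = - pair A B" if "B \<in> GTM \<A> q" for B
    using pair_lin_left[OF that that A, of "-1" 0] by (simp add: pair_commute)
  have "pair (K A) (minus_vec (q, K) k) = pair A (minus_vec (q, K) k)" for k
    unfolding KD(2)[OF A minus_vec_GTM] K_minus_vec mp[OF minus_vec_GTM] by simp
  then show ?thesis unfolding eigen_vert_eq[OF A] eigen_vert_eq[OF KD(1)[OF A]] by simp
qed

lemma eigen_vert_orth: "J = Inl \<Longrightarrow> A \<in> orth \<A> E q \<Longrightarrow> eigen_vert (q, K) A = 0" "J = Inr \<Longrightarrow> A \<in> E q \<Longrightarrow> eigen_vert (q, K) A = 0"
proof -
  assume h: "J = Inl" and A: "A \<in> orth \<A> E q"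
  have "pair A (minus_vec (q, K) k) = 0" for k by (rule orth_pair(1)[OF A minus_vec_block(1)[OF h]])
  then show "eigen_vert (q, K) A = 0" unfolding eigen_vert_eq[OF orth_GTM[OF A]] by simp
next
  assume h: "J = Inr" and A: "A \<in> E q"
  have "pair A (minus_vec (q, K) k) = 0" for k by (rule orth_pair(2)[OF minus_vec_block(2)[OF h] A])
  then show "eigen_vert (q, K) A = 0" unfolding eigen_vert_eq[OF E_in_GTM[OF A]] by simp
qed

lemma eigen_vert_vert: "eigen_vert (q, K) \<in> vert \<A> E (q, K)"
  unfolding vert_iff
proof (intro conjI ballI skew_fibreI endosI eigen_vert_linear eigen_vert_GTM)
  fix A B assume AB: "A \<in> GTM \<A> q" "B \<in> GTM \<A> q"
  show "pair (eigen_vert (q, K) A) B = - pair A (eigen_vert (q, K) B)"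
    unfolding pair_eigen_vert[OF AB] pair_commute[of A "eigen_vert (q, K) B"] pair_eigen_vert[OF AB(2,1)] by (simp add: pair_commute)
next
  fix A assume A: "A \<in> E q"
  show "eigen_vert (q, K) A \<in> E q"
  proof (cases "J = Inl")
    case True
    then show ?thesis unfolding eigen_vert_eq[OF E_in_GTM[OF A]]
      by (intro subspace_diff[OF E_subspace] subspace_scale[OF E_subspace] minus_vec_block(1))
  next
    case False
    then have "eigen_vert (q, K) A = 0" using J eigen_vert_orth(2) A by blast
    then show ?thesis using subspace_0[OF E_subspace] by simp
  qed
next
  fix A assume A: "A \<in> orth \<A> E q"
  show "eigen_vert (q, K) A \<in> orth \<A> E q"
  proof (cases "J = Inr")
    case True
    then show ?thesis unfolding eigen_vert_eq[OF orth_GTM[OF A]]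
      by (intro subspace_diff[OF orth_subspace] subspace_scale[OF orth_subspace] minus_vec_block(2))
  next
    case False
    then have "eigen_vert (q, K) A = 0" using J eigen_vert_orth(1) A by blast
    then show ?thesis using subspace_0[OF orth_subspace] by simp
  qed
next
  fix A assume "A \<in> GTM \<A> q"
  then show "eigen_vert (q, K) (K A) = - K (eigen_vert (q, K) A)" using K_eigen_vert eigen_vert_K by simp
qed (simp_all add: eigen_vert_def)

text \<open>On the block selected by \<open>J\<close> both sides are \<open>- K V\<close>, and \<open>V\<close> vanishes on the other block.\<close>

lemma vert_P_eigen_vert: "vert_P \<A> E \<epsilon> (q, K) (eigen_vert (q, K)) = eigen_vert (q, K)"
proof
  fix A
  have v0: "eigen_vert (q, K) 0 = 0" and K0: "K 0 = 0"
    using zero_endo[of "eigen_vert (q, K)" q] eigen_vert_vert vert_iff zero_endo[OF K_skew[OF q K]] by blast+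
  let ?P = "proj_E \<A> E q A"
  show "vert_P \<A> E \<epsilon> (q, K) (eigen_vert (q, K)) A = eigen_vert (q, K) A"
  proof (cases "A \<in> GTM \<A> q")
    case True
    note P = proj_E_any(1,2)[OF True]
    have s: "eigen_vert (q, K) A = eigen_vert (q, K) ?P + eigen_vert (q, K) (A - ?P)"
      using eigen_vert_linear[OF E_in_GTM[OF P(1)] orth_GTM[OF P(2)], of 1 1] by simp
    from J show ?thesis
    proof
      assume h: "J = Inl \<and> (\<epsilon> = 3 \<or> \<epsilon> = 4)"
      then have z: "eigen_vert (q, K) (A - ?P) = 0" using eigen_vert_orth(1) P(2) by blast
      then have "eigen_vert (q, K) ?P = eigen_vert (q, K) A" using s by simp
      then show ?thesis using h z K_eigen_vert[OF True] by (auto simp: vert_P_def Let_def K0)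
    next
      assume h: "J = Inr \<and> \<epsilon> = 2"
      then have z: "eigen_vert (q, K) ?P = 0" using eigen_vert_orth(2) P(1) by blast
      then have "eigen_vert (q, K) (A - ?P) = eigen_vert (q, K) A" using s by simp
      then show ?thesis using h z K_eigen_vert[OF True] by (simp add: vert_P_def Let_def K0)
    qed
  next
    case False
    then have "?P = 0" "eigen_vert (q, K) A = 0" by (simp_all add: proj_E_def eigen_vert_def)
    then show ?thesis by (simp add: vert_P_def Let_def v0 K0)
  qed
qed

lemma plus_vec_GTM: "plus_vec (q, K) \<in> GTM \<A> q"
  unfolding plus_vec_def fst_conv snd_conv by (intro subspace_add[OF GTM_any_subspace] eG KD(1))

lemma K_plus_vec: "K (plus_vec (q, K)) = plus_vec (q, K)"
  unfolding plus_vec_def fst_conv snd_conv using KD(3)[OF eG[of q "J i"] KD(1)[OF eG[of q "J i"]], of 1 1] KD(4)[OF eG] by simp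

lemma plus_vec_parts: "fst (plus_vec (q, K)) \<in> TM \<A> q" "snd (plus_vec (q, K)) \<in> cotangent (cinf \<A>) q"
  using plus_vec_GTM by (simp_all add: gtangent_def mem_Times_iff)

lemma crd_plus_vec: "crd q (plus_vec (q, K)) a = crd q (e q (J i)) a + (\<Sum>b\<in>UNIV. \<eta> b * entry (J i) b (q, K) * crd q (e q b) a)"
proof -
  have "crd q (K (e q (J i))) a = crd q (\<Sum>b\<in>UNIV. (\<eta> b * pair (K (e q (J i))) (e q b)) *\<^sub>R e q b) a"
    by (rule arg_cong[OF expand[OF q KD(1)[OF eG]]])
  then show ?thesis
    using crd_lin[of q 1 "e q (J i)" 1 "K (e q (J i))" a] by (simp add: plus_vec_def crd_sum entry_eq)
qed

lemma vert_section_eq: "vert_section (q, K) = (\<theta> q *\<^sub>R vert_vec \<A> E (q, K) (eigen_vert (q, K)), 0)"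
  using yRS by (simp add: vert_section_def)

lemma hor_section_eq: "hor_section (q, K) = \<theta> q *\<^sub>R ghlift \<A> E D (q, K) (plus_vec (q, K))"
  using yRS by (simp add: hor_section_def)

lemma vert_section_fixed: "gpc_structure \<A> E D \<epsilon> (q, K) (vert_section (q, K)) = vert_section (q, K)"
proof -
  let ?V = "\<lambda>A. \<theta> q *\<^sub>R eigen_vert (q, K) A + 0 *\<^sub>R eigen_vert (q, K) A"
  have V: "\<theta> q *\<^sub>R vert_vec \<A> E (q, K) (eigen_vert (q, K)) = vert_vec \<A> E (q, K) ?V" "?V \<in> vert \<A> E (q, K)"
    by (rule vert_vec_scale[OF yRS eigen_vert_vert])+
  have cot0: "(0 :: 'p covec) \<in> cotangent (cinf \<A>) q" by (rule subspace_0[OF base.subspace_cotangent])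
  have h0: "hlift_form \<A> E D (q, K) 0 = 0"
    unfolding hlift_form_eq(1)[OF q K cot0] by (auto simp: zero_fun_def)
  have g0: "ghlift \<A> E D (q, K) 0 = 0"
    unfolding ghlift_def fst_zero snd_zero hlift_zero[OF q K] h0 by (rule zero_prod_def[symmetric])
  have K0: "K 0 = 0" by (rule zero_endo[OF K_skew[OF q K]])
  have "vert_P \<A> E \<epsilon> (q, K) ?V = ?V"
  proof
    fix A
    have Vl: "K (c *\<^sub>R eigen_vert (q, K) B) = c *\<^sub>R K (eigen_vert (q, K) B)" if "B \<in> GTM \<A> q" for B c
      using KD(3)[OF eigen_vert_GTM[OF that] eigen_vert_GTM[OF that], of c 0] by simp
    have Vl': "K (c *\<^sub>R eigen_vert (q, K) B) = c *\<^sub>R K (eigen_vert (q, K) B)" for B c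
      using Vl K0 by (cases "B \<in> GTM \<A> q") (simp_all add: eigen_vert_def)
    have "vert_P \<A> E \<epsilon> (q, K) ?V A = \<theta> q *\<^sub>R vert_P \<A> E \<epsilon> (q, K) (eigen_vert (q, K)) A"
      by (simp add: vert_P_def Let_def Vl' scaleR_diff_right scaleR_add_right)
    then show "vert_P \<A> E \<epsilon> (q, K) ?V A = ?V A" unfolding vert_P_eigen_vert by simp
  qed
  then show ?thesis
    using gpc_structure_eq[OF q K zero_GTM V(2), of \<epsilon>] unfolding g0 K0 vert_section_eq V(1) by simp
qed

lemma hor_section_fixed: "gpc_structure \<A> E D \<epsilon> (q, K) (hor_section (q, K)) = hor_section (q, K)"
proof -
  have A: "\<theta> q *\<^sub>R plus_vec (q, K) \<in> GTM \<A> q" by (rule subspace_scale[OF GTM_any_subspace plus_vec_GTM])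
  have KA: "K (\<theta> q *\<^sub>R plus_vec (q, K)) = \<theta> q *\<^sub>R plus_vec (q, K)"
    using KD(3)[OF plus_vec_GTM plus_vec_GTM, of "\<theta> q" 0] K_plus_vec by simp
  have F: "hor_section (q, K) = ghlift \<A> E D (q, K) (\<theta> q *\<^sub>R plus_vec (q, K))"
    unfolding hor_section_eq by (rule ghlift_scale[OF yRS]) (simp add: plus_vec_GTM)
  have vz: "vert_vec \<A> E (q, K) (\<lambda>A. 0) = 0"
  proof (rule G.tangent_eqI[OF over_S(1,2)[OF q K] vert_vec_tangent[OF q K zero_vert[OF q K]]])
    show "0 \<in> tangent (cinf_G \<A> E) (q, K)" by (rule subspace_0[OF G.subspace_tangent[OF over_S(1,2)[OF q K]]])
    have m0: "endo_mat q (\<lambda>A. 0) = 0"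
      by (simp add: vec_eq_iff mat_nth base.pair_zero_left[OF UNIV_I SU[OF q] eG])
    have v0: "G.velocity 0 = 0" by (simp add: G.velocity_def)
    show "G.velocity (vert_vec \<A> E (q, K) (\<lambda>A. 0)) = G.velocity 0"
      unfolding velocity_vert_vec[OF q K zero_vert[OF q K]] m0 v0 by (rule zero_prod_def[symmetric])
  qed
  have z: "(vert_vec \<A> E (q, K) (\<lambda>A. 0), 0 :: 'p gpoint covec) = 0"
    unfolding vz by (rule zero_prod_def[symmetric])
  have P0: "vert_P \<A> E \<epsilon> (q, K) (\<lambda>A. 0) = (\<lambda>A. 0)"
    using zero_endo[OF K_skew[OF q K]] by (auto simp: vert_P_def Let_def fun_Compl_def)
  show ?thesis
    using gpc_structure_eq[OF q K A zero_vert[OF q K], of \<epsilon>] unfolding P0 z KA F by simp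
qed

lemma velocity_vert_section: "G.velocity (fst (vert_section (q, K))) = (0, \<theta> q *\<^sub>R endo_mat q (eigen_vert (q, K)))"
  using G.velocity_lincomb[of "\<theta> q" "vert_vec \<A> E (q, K) (eigen_vert (q, K))" 0 "vert_vec \<A> E (q, K) (eigen_vert (q, K))"]
  by (simp add: vert_section_eq velocity_vert_vec[OF q K eigen_vert_vert])

lemma velocity_hor_section: "G.velocity (fst (hor_section (q, K))) = (\<theta> q *\<^sub>R base.velocity (fst (plus_vec (q, K))), \<theta> q *\<^sub>R hor_mat q K (fst (plus_vec (q, K))))"
  using G.velocity_lincomb[of "\<theta> q" "hlift \<A> E D (q, K) (fst (plus_vec (q, K)))" 0 "hlift \<A> E D (q, K) (fst (plus_vec (q, K)))"]
  by (simp add: hor_section_eq ghlift_def velocity_hlift[OF q K plus_vec_parts(1)])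

lemma vert_section_hor_section_tangent:
  "fst (vert_section (q, K)) \<in> tangent (cinf_G \<A> E) (q, K)" "fst (hor_section (q, K)) \<in> tangent (cinf_G \<A> E) (q, K)"
  "snd (hor_section (q, K)) \<in> cotangent (cinf_G \<A> E) (q, K)"
  using subspace_scale[OF G.subspace_tangent[OF over_S(1,2)[OF q K]] vert_vec_tangent[OF q K eigen_vert_vert]]
    subspace_scale[OF G.subspace_tangent[OF over_S(1,2)[OF q K]] hlift_tangent[OF q K plus_vec_parts(1)]]
    subspace_scale[OF G.subspace_cotangent hlift_form_eq(2)[OF q K plus_vec_parts(2)]]
  by (simp_all add: vert_section_eq hor_section_eq ghlift_def hlift_form_eq(1)[OF q K plus_vec_parts(2)])

lemma hor_section_form:
  assumes v: "v \<in> tangent (cinf_G \<A> E) (q, K)"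
  shows "snd (hor_section (q, K)) v = (\<Sum>k\<in>UNIV. \<theta> q * crd q (plus_vec (q, K)) (Inr k) * v (\<lambda>z. coordf k (fst z)))"
proof -
  have "snd (hor_section (q, K)) v = \<theta> q * snd (plus_vec (q, K)) (dproj q v)"
    using v by (simp add: hor_section_eq ghlift_def hlift_form_eq(1)[OF q K plus_vec_parts(2)] scaleR_fun_def)
  also have "snd (plus_vec (q, K)) (dproj q v) = (\<Sum>k\<in>UNIV. dproj q v (coordf k) * snd (plus_vec (q, K)) (coord_vec q k))"
    by (rule cotangent_expand[OF SU[OF q] plus_vec_parts(2) dproj_TM[OF q K]])
  also have "\<theta> q * \<dots> = (\<Sum>k\<in>UNIV. \<theta> q * crd q (plus_vec (q, K)) (Inr k) * v (\<lambda>z. coordf k (fst z)))"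
    by (simp add: sum_distrib_left crd_def pullback_smooth(2)[OF q K coordf_mem[OF SU[OF q]] v] algebra_simps)
  finally show ?thesis .
qed

end

text \<open>The components of \<open>plus_vec\<close> as smooth functions on \<open>\<G>\<close>; the dependence on the point of the fibre is
  through the coordinates \<open>entry\<close>.\<close>

definition plus_coord :: "'n + 'n \<Rightarrow> 'p gpoint \<Rightarrow> real"
  where "plus_coord a y = crd (fst y) (e (fst y) (J i)) a + (\<Sum>b\<in>UNIV. \<eta> b * entry (J i) b y * crd (fst y) (e (fst y) b) a)"

lemma plus_coord_eq: "y \<in> RS \<Longrightarrow> crd (fst y) (plus_vec y) a = plus_coord a y"
  using crd_plus_vec[of "fst y" "snd y" a] RS_D by (simp add: plus_coord_def)

lemma plus_coord_C: "x \<in> RS \<Longrightarrow> plus_coord a \<in> cinf_G \<A> E x"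
  unfolding plus_coord_def[abs_def]
  by (intro G.C_add G.C_sum G.C_mult G.C_const entry_C pullback_C[where f = "\<lambda>q. crd q (e q _) a"] frame_crd_C RS_D(1,3,4))

lemma \<theta>_C: "x \<in> RS \<Longrightarrow> (\<lambda>y. \<theta> (fst y)) \<in> cinf_G \<A> E x"
  by (rule pullback_C[OF _ \<theta>C[OF RS_D(1)]])

lemma vert_section_outside: "y \<notin> RS \<Longrightarrow> vert_section y = 0" and hor_section_outside: "y \<notin> RS \<Longrightarrow> hor_section y = 0"
  by (auto simp: vert_section_def hor_section_def)

lemma vfield_vert_section: "x \<in> RS \<Longrightarrow> vfield_at (cinf_G \<A> E) R x (\<lambda>y. fst (vert_section y))"
proof (rule vfield_RS)
  assume x: "x \<in> RS"
  note xx = RS_D(3,4)[OF x]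
  let ?w = "\<lambda>k b y. (if J k = b then \<eta> b else 0) - entry (J k) b y"
  let ?m = "\<lambda>a b y. \<theta> (fst y) * (?w i a y * ?w j b y - ?w j a y * ?w i b y)"
  show "fst (vert_section y) \<in> tangent (cinf_G \<A> E) y" if "y \<in> RS" for y
    using vert_section_hor_section_tangent(1)[of "fst y" "snd y"] RS_D[OF that] by simp
  show "fst (vert_section y) = 0" if "y \<in> R" "y \<notin> over S" for y using vert_section_outside[of y] that by simp
  show "(\<lambda>y. 0) \<in> cinf_G \<A> E x" by (rule G.C_const[OF xx])
  show "fst (G.velocity (fst (vert_section y))) $ k = 0" if "y \<in> RS" for y k
    using velocity_vert_section[of "fst y" "snd y"] RS_D[OF that] by simp
  show "?m a b \<in> cinf_G \<A> E x" for a b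
    by (intro G.C_mult G.C_diff G.C_const \<theta>_C entry_C x xx)
  show "snd (G.velocity (fst (vert_section y))) $ a $ b = ?m a b y" if y: "y \<in> RS" for y a b
  proof -
    obtain q K where yq: "y = (q, K)" by (cases y)
    have q: "q \<in> S" "(q, K) \<in> R" using y yq by auto
    have w: "pair (minus_vec (q, K) k) (e q c) = ?w k c (q, K)" for k c
      unfolding minus_vec_def fst_conv snd_conv base.pair_diff_left[OF eG KD(1)[OF q eG] eG] entry_eq
      by (simp add: ee[OF q(1)])
    show ?thesis
      using velocity_vert_section[OF q] unfolding yq by (simp add: mat_nth pair_eigen_vert[OF q eG eG] w pair_commute[of "e q _"])
  qed
qed

lemma vfield_hor_section: "x \<in> RS \<Longrightarrow> vfield_at (cinf_G \<A> E) R x (\<lambda>y. fst (hor_section y))"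
proof (rule vfield_RS)
  assume x: "x \<in> RS"
  note xx = RS_D(3,4)[OF x]
  let ?wm = "\<lambda>k y. conn_mat (fst y) (coord_vec (fst y) k)"
  let ?K = "\<lambda>y. endo_mat (fst y) (snd y)"
  let ?m = "\<lambda>a b y. \<theta> (fst y) * (\<Sum>k\<in>UNIV. plus_coord (Inl k) y * (frame_mult (?wm k y) (?K y) $ a $ b - frame_mult (?K y) (?wm k y) $ a $ b))"
  show "fst (hor_section y) \<in> tangent (cinf_G \<A> E) y" if "y \<in> RS" for y
    using vert_section_hor_section_tangent(2)[of "fst y" "snd y"] RS_D[OF that] by simp
  show "fst (hor_section y) = 0" if "y \<in> R" "y \<notin> over S" for y using hor_section_outside[of y] that by simp
  show "(\<lambda>y. \<theta> (fst y) * plus_coord (Inl k) y) \<in> cinf_G \<A> E x" for k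
    by (intro G.C_mult \<theta>_C plus_coord_C x xx)
  have bv: "base.velocity X $ k = X (coordf k)" for X k
    using base.velocity_inner[of "axis k 1" X] by (simp add: inner_axis)
  show "fst (G.velocity (fst (hor_section y))) $ k = \<theta> (fst y) * plus_coord (Inl k) y" if y: "y \<in> RS" for y k
    using velocity_hor_section[of "fst y" "snd y"] RS_D[OF y] plus_coord_eq[OF y, of "Inl k"] by (simp add: bv crd_def)
  have wC: "(\<lambda>y. ?wm k y $ a $ b) \<in> cinf_G \<A> E x" for k a b
  proof -
    have "(\<lambda>q. pair (D q (coord_vec q k) (\<lambda>z. e z a)) (e q b)) \<in> cinf \<A> (fst x)"
      by (intro pair_smooth SU RS_D(1)[OF x] D_smooth sec)
    from pullback_C[OF x this]
    have "(\<lambda>y. pair (D (fst y) (coord_vec (fst y) k) (\<lambda>z. e z a)) (e (fst y) b)) \<in> cinf_G \<A> E x" .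
    moreover have "G.near x (\<lambda>y. pair (D (fst y) (coord_vec (fst y) k) (\<lambda>z. e z a)) (e (fst y) b) = ?wm k y $ a $ b)"
      by (rule G.near_all) (auto simp: conn_mat_nth)
    ultimately show ?thesis by (rule iffD1[OF G.C_cong[OF xx], rotated])
  qed
  have KC: "(\<lambda>y. ?K y $ a $ b) \<in> cinf_G \<A> E x" for a b unfolding mat_snd by (rule entry_C[OF x])
  show "?m a b \<in> cinf_G \<A> E x" for a b
    by (intro G.C_mult G.C_sum G.C_diff \<theta>_C plus_coord_C mult_C wC KC x xx)
  show "snd (G.velocity (fst (hor_section y))) $ a $ b = ?m a b y" if y: "y \<in> RS" for y a b
  proof -
    obtain q K where yq: "y = (q, K)" by (cases y)
    have q: "q \<in> S" "(q, K) \<in> R" using y yq by auto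
    have c: "fst (plus_vec (q, K)) (coordf k) = plus_coord (Inl k) (q, K)" for k
      using plus_coord_eq[OF y, of "Inl k"] by (simp add: crd_def yq)
    have "hor_mat q K (fst (plus_vec (q, K))) $ a $ b = (\<Sum>k\<in>UNIV. plus_coord (Inl k) (q, K) * hor_mat q K (coord_vec q k) $ a $ b)"
      unfolding hor_mat_expand[OF q(1) K_skew[OF q] plus_vec_parts(1)[OF q]] by (simp add: c)
    then show ?thesis
      using velocity_hor_section[OF q] by (simp add: yq hor_mat_def[OF q(1) K_skew[OF q]])
  qed
qed

lemma oneform_hor_section: "x \<in> RS \<Longrightarrow> X_field \<in> {X. vfield_at (cinf_G \<A> E) R x X} \<Longrightarrow> (\<lambda>y. snd (hor_section y) (X_field y)) \<in> cinf_G \<A> E x"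
proof -
  assume x: "x \<in> RS" and "X_field \<in> {X. vfield_at (cinf_G \<A> E) R x X}"
  then have Y: "vfield_at (cinf_G \<A> E) R x X_field" by simp
  note xx = RS_D(3,4)[OF x]
  let ?F = "\<lambda>y. \<Sum>k\<in>UNIV. \<theta> (fst y) * plus_coord (Inr k) y * X_field y (\<lambda>z. coordf k (fst z))"
  have gC: "(\<lambda>z. coordf k (fst z)) \<in> cinf_G \<A> E x" for k by (rule pullback_C[OF x coordf_mem[OF SU[OF RS_D(1)[OF x]]]])
  have "?F \<in> cinf_G \<A> E x"
    by (intro G.C_sum G.C_mult \<theta>_C plus_coord_C x xx) (use Y gC in \<open>auto simp: vfield_at_def\<close>)
  moreover have "G.near x (\<lambda>y. ?F y = snd (hor_section y) (X_field y))"
  proof (rule G.near_all)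
    fix y assume "y \<in> R" "y \<in> over S"
    then have y: "y \<in> RS" by simp
    have "X_field y \<in> tangent (cinf_G \<A> E) (fst y, snd y)" using Y RS_D(3)[OF y] by (simp add: vfield_at_def)
    from hor_section_form[OF RS_D(1,2)[OF y] this] show "?F y = snd (hor_section y) (X_field y)"
      using plus_coord_eq[OF y] by simp
  qed
  ultimately show ?thesis by (rule iffD1[OF G.C_cong[OF xx], rotated])
qed

lemma zero_tangent: "0 \<in> tangent C y" "0 \<in> cotangent C y"
  by (simp_all add: tangent_def cotangent_def linear_upon_def zero_fun_def)

lemma gsection_fields: "gsection (cinf_G \<A> E) R vert_section" "gsection (cinf_G \<A> E) R hor_section"
proof -
  have t: "fst (vert_section y) \<in> tangent (cinf_G \<A> E) y" "snd (vert_section y) \<in> cotangent (cinf_G \<A> E) y"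
      "fst (hor_section y) \<in> tangent (cinf_G \<A> E) y" "snd (hor_section y) \<in> cotangent (cinf_G \<A> E) y" for y
  proof -
    have a: "fst (vert_section y) \<in> tangent (cinf_G \<A> E) y \<and> snd (vert_section y) \<in> cotangent (cinf_G \<A> E) y \<and>
      fst (hor_section y) \<in> tangent (cinf_G \<A> E) y \<and> snd (hor_section y) \<in> cotangent (cinf_G \<A> E) y"
    proof (cases "y \<in> RS")
      case True
      obtain q K where yq: "y = (q, K)" by (cases y)
      have q: "q \<in> S" "(q, K) \<in> R" using True yq by auto
      show ?thesis unfolding yq using vert_section_hor_section_tangent[OF q] vert_section_eq[OF q] zero_tangent(2) by simp
    next
      case False
      then show ?thesis unfolding vert_section_outside[OF False] hor_section_outside[OF False] by (simp add: zero_tangent)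
    qed
    then show "fst (vert_section y) \<in> tangent (cinf_G \<A> E) y" "snd (vert_section y) \<in> cotangent (cinf_G \<A> E) y"
      "fst (hor_section y) \<in> tangent (cinf_G \<A> E) y" "snd (hor_section y) \<in> cotangent (cinf_G \<A> E) y" by blast+
  qed
  have z: "gsection_at (cinf_G \<A> E) R x s"
    if x: "x \<in> R" "x \<notin> over S" and s: "s = vert_section \<or> s = hor_section" for x s
  proof -
    have "fst x \<notin> S" using x by (cases x) simp
    from \<theta>0[OF this] obtain T where "open T \<and> fst x \<in> T \<and> (\<forall>y\<in>T. \<theta> y = 0)" by (rule exE)
    then have T: "open T" "fst x \<in> T" "\<And>y. y \<in> T \<Longrightarrow> \<theta> y = 0" by simp_all
    have zz: "(0 :: 'p gpoint tvec, 0 :: 'p gpoint covec) = 0" by (rule zero_prod_def[symmetric])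
    have "vert_section y = 0" "hor_section y = 0" if "fst y \<in> T" for y
      unfolding vert_section_def hor_section_def T(3)[OF that] scaleR_zero_left zz by (rule if_cancel)+
    then have s0: "s y = 0" if "fst y \<in> T" for y using s that by (elim disjE) simp_all
    have "(\<lambda>y. fst (s y) f) \<in> cinf_G \<A> E x" for f
      by (rule zero_germ[OF T(1,2) x(1)]) (simp add: s0)
    moreover have "(\<lambda>y. snd (s y) (X y)) \<in> cinf_G \<A> E x" for X
      by (rule zero_germ[OF T(1,2) x(1)]) (simp add: s0)
    ultimately show ?thesis
      unfolding gsection_at_def vfield_at_def oneform_at_def using s
      by (elim disjE) (simp_all add: t)
  qed
  have c: "(\<lambda>y. snd (vert_section y) (X y)) \<in> cinf_G \<A> E x" if x: "x \<in> RS" for x X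
  proof -
    have "(\<lambda>y. snd (vert_section y) (X y)) = (\<lambda>y. 0)" by (auto simp: vert_section_def)
    then show ?thesis using G.C_const[OF RS_D(3,4)[OF x], of 0] by simp
  qed
  have "gsection_at (cinf_G \<A> E) R x vert_section" if "x \<in> RS" for x
    unfolding gsection_at_def oneform_at_def using vfield_vert_section[OF that] by (simp add: t c[OF that])
  moreover have "gsection_at (cinf_G \<A> E) R x hor_section" if "x \<in> RS" for x
    unfolding gsection_at_def oneform_at_def using vfield_hor_section[OF that] by (simp add: t oneform_hor_section[OF that])
  ultimately show "gsection (cinf_G \<A> E) R vert_section" "gsection (cinf_G \<A> E) R hor_section"
    unfolding gsection_def using z by blast+
qed


text \<open>A vertical vector annihilates functions pulled back from \<open>M\<close>, in particular the cut-off, so only the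
  factors \<open>entry\<close> are differentiated. Their derivatives along \<open>V\<close> are the components of \<open>V e\<^sub>i\<close>.\<close>

lemma scaled_bracket_coordinate:
  assumes q: "p = q" and K: "(q, K) \<in> R"
  shows "fst (vert_section (q, K)) (\<lambda>y. \<theta> (fst y) * plus_coord a y) = \<theta> q * \<theta> q * crd q (eigen_vert (q, K) (e q (J i))) a"
proof -
  have qS: "q \<in> S" using p q by simp
  note x = over_S(1,2)[OF qS K] and xx = yRS[OF qS K]
  let ?v = "vert_vec \<A> E (q, K) (eigen_vert (q, K))"
  have v: "?v \<in> tangent (cinf_G \<A> E) (q, K)" by (rule vert_vec_tangent[OF qS K eigen_vert_vert[OF qS K]])
  have pull: "?v (\<lambda>y. f (fst y)) = 0" if f: "f \<in> cinf \<A> q" for f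
  proof -
    have "?v (\<lambda>y. f (fst y)) = dproj q ?v f" by (rule pullback_smooth(2)[OF qS K f v])
    then show ?thesis unfolding dproj_vert[OF qS K eigen_vert_vert[OF qS K]] by simp
  qed
  have ent: "?v (entry c b) = pair (eigen_vert (q, K) (e q c)) (e q b)" for c b
    using velocity_entry[of ?v c b] by (simp add: velocity_vert_vec[OF qS K eigen_vert_vert[OF qS K]] mat_nth)
  let ?g = "\<lambda>b q. crd q (e q b) a"
  have gC: "?g b \<in> cinf \<A> q" for b by (rule frame_crd_C[OF qS])
  have tgC: "(\<lambda>q. \<theta> q * ?g b q) \<in> cinf \<A> q" for b by (rule base.C_mult[OF UNIV_I SU[OF qS] \<theta>C[OF qS] gC])
  have TC: "(\<lambda>y. \<theta> (fst y) * ?g b (fst y)) \<in> cinf_G \<A> E (q, K)" for b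
    using pullback_C[OF xx, of "\<lambda>q. \<theta> q * ?g b q"] tgC by simp
  have EC: "entry c b \<in> cinf_G \<A> E (q, K)" for c b by (rule entry_C[OF xx])
  have C0: "(\<lambda>y. \<eta> b) \<in> cinf_G \<A> E (q, K)" for b by (rule G.C_const[OF x])
  have EC': "(\<lambda>y. \<eta> b * entry (J i) b y) \<in> cinf_G \<A> E (q, K)" for b by (rule G.C_mult[OF x C0 EC])
  have eq: "(\<lambda>y. \<theta> (fst y) * plus_coord a y) = (\<lambda>y. \<theta> (fst y) * ?g (J i) (fst y)
      + (\<Sum>b\<in>UNIV. (\<eta> b * entry (J i) b y) * (\<theta> (fst y) * ?g b (fst y))))"
    by (rule ext) (simp add: plus_coord_def distrib_left sum_distrib_left algebra_simps)
  have t1: "?v (\<lambda>y. \<theta> (fst y) * plus_coord a y) = ?v (\<lambda>y. \<theta> (fst y) * ?g (J i) (fst y))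
      + (\<Sum>b\<in>UNIV. ?v (\<lambda>y. (\<eta> b * entry (J i) b y) * (\<theta> (fst y) * ?g b (fst y))))"
    unfolding eq
    by (subst G.tangent_add[OF x v TC G.C_sum[OF x G.C_mult[OF x EC' TC]]])
      (simp only: G.tangent_sum[OF x v G.C_mult[OF x EC' TC]])
  have t2: "?v (\<lambda>y. \<theta> (fst y) * ?g b (fst y)) = 0" for b by (rule pull[OF tgC])
  have t3: "?v (\<lambda>y. (\<eta> b * entry (J i) b y) * (\<theta> (fst y) * ?g b (fst y)))
      = \<theta> q * ((\<eta> b * pair (eigen_vert (q, K) (e q (J i))) (e q b)) * ?g b q)" for b
    unfolding G.tangent_mult[OF x v EC' TC] G.tangent_cmult[OF x v EC] ent t2 by simp
  have "?v (\<lambda>y. \<theta> (fst y) * plus_coord a y)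
      = \<theta> q * crd q (\<Sum>b\<in>UNIV. (\<eta> b * pair (eigen_vert (q, K) (e q (J i))) (e q b)) *\<^sub>R e q b) a"
    unfolding t1 t2 t3 crd_sum by (simp only: sum_distrib_left add_0)
  also have "(\<Sum>b\<in>UNIV. (\<eta> b * pair (eigen_vert (q, K) (e q (J i))) (e q b)) *\<^sub>R e q b) = eigen_vert (q, K) (e q (J i))"
    by (rule expand[OF qS eigen_vert_GTM[OF qS K eG], symmetric])
  finally show ?thesis by (simp add: vert_section_eq[OF qS K] scaleR_fun_def)
qed

context fixes K assumes K: "(p, K) \<in> R"
begin

definition hor_part :: "'p gvec" where "hor_part = (\<theta> p * \<theta> p) *\<^sub>R eigen_vert (p, K) (e p (J i))"

lemma hor_part_GTM: "hor_part \<in> GTM \<A> p"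
  unfolding hor_part_def by (rule subspace_scale[OF GTM_any_subspace eigen_vert_GTM[OF p K eG]])

lemma hor_part_parts: "fst hor_part \<in> TM \<A> p" "snd hor_part \<in> cotangent (cinf \<A>) p"
  using hor_part_GTM by (simp_all add: gtangent_def mem_Times_iff)

lemma K_hor_part: "K hor_part = - hor_part"
proof -
  have "K ((\<theta> p * \<theta> p) *\<^sub>R eigen_vert (p, K) (e p (J i))) = (\<theta> p * \<theta> p) *\<^sub>R K (eigen_vert (p, K) (e p (J i)))"
    using KD(3)[OF p K eigen_vert_GTM[OF p K eG] eigen_vert_GTM[OF p K eG], of "\<theta> p * \<theta> p" "J i" 0] by simp
  then show ?thesis unfolding hor_part_def K_eigen_vert[OF p K eG] by simp
qed

lemma crd_hor_part: "crd p hor_part a = \<theta> p * \<theta> p * crd p (eigen_vert (p, K) (e p (J i))) a"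
  using crd_lin[of p "\<theta> p * \<theta> p" "eigen_vert (p, K) (e p (J i))" 0 "eigen_vert (p, K) (e p (J i))" a] by (simp add: hor_part_def)

lemma vert_section_plus_coord: "fst (vert_section (p, K)) (\<lambda>y. \<theta> (fst y) * plus_coord a y) = crd p hor_part a"
  unfolding scaled_bracket_coordinate[OF refl K] crd_hor_part ..

lemma vert_section_coord: "y \<in> RS \<Longrightarrow> fst (vert_section y) (\<lambda>z. coordf k (fst z)) = 0"
  using velocity_coord[of "fst (vert_section y)" k] velocity_vert_section[of "fst y" "snd y"] RS_D[of y] by simp

lemma hor_section_coord: "y \<in> RS \<Longrightarrow> fst (hor_section y) (\<lambda>z. coordf k (fst z)) = \<theta> (fst y) * plus_coord (Inl k) y"
proof -
  assume y: "y \<in> RS"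
  have bv: "base.velocity X $ k = X (coordf k)" for X
    using base.velocity_inner[of "axis k 1" X] by (simp add: inner_axis)
  show ?thesis
    using velocity_coord[of "fst (hor_section y)" k] velocity_hor_section[of "fst y" "snd y"] RS_D[OF y] plus_coord_eq[OF y, of "Inl k"]
    by (simp add: bv crd_def)
qed

text \<open>Tangent part: \<open>vert_section\<close> annihilates the base coordinates, so the projected bracket is its derivative
  of the components of \<open>plus_vec\<close>. Form part: the form of \<open>hor_section\<close> is \<open>\<Sum> a\<^sub>k d(x\<^sub>k \<circ> \<pi>)\<close>, and its Lie
  derivative along a vertical field is obtained by differentiating the \<open>a\<^sub>k\<close> only; the remaining terms of
  the Courant bracket contain the pairing of this form with a vertical vector.\<close>

lemma bracket_eq:
  obtains W where "W \<in> vert \<A> E (p, K)"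
    "courant (cinf_G \<A> E) R vert_section hor_section (p, K) = ghlift \<A> E D (p, K) hor_part + (vert_vec \<A> E (p, K) W, 0)"
proof -
  note x = over_S(1,2)[OF p K] and xx = yRS[OF p K]
  let ?B = "lie_bracket (cinf_G \<A> E) (\<lambda>y. fst (vert_section y)) (\<lambda>y. fst (hor_section y)) (p, K)"
  have vE: "vfield_at (cinf_G \<A> E) R (p, K) (\<lambda>y. fst (vert_section y))" by (rule vfield_vert_section[OF xx])
  have vF: "vfield_at (cinf_G \<A> E) R (p, K) (\<lambda>y. fst (hor_section y))" by (rule vfield_hor_section[OF xx])
  note tE = vert_section_hor_section_tangent(1)[OF p K] and tF = vert_section_hor_section_tangent(2)[OF p K]
  have B: "?B \<in> tangent (cinf_G \<A> E) (p, K)" by (rule G.lie_bracket_tangent[OF x vE vF])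
  have crdC: "(\<lambda>z. coordf k (fst z)) \<in> cinf_G \<A> E (p, K)" for k
    by (rule pullback_C[OF xx]) (simp add: coordf_mem[OF SU[OF p]])
  have nE: "G.near (p, K) (\<lambda>y. fst (vert_section y) (\<lambda>z. coordf k (fst z)) = 0)" for k
    by (rule G.near_all) (rule vert_section_coord, simp)
  have nF: "G.near (p, K) (\<lambda>y. fst (hor_section y) (\<lambda>z. coordf k (fst z)) = \<theta> (fst y) * plus_coord (Inl k) y)" for k
    by (rule G.near_all) (rule hor_section_coord, simp)
  have dE: "v (\<lambda>y. fst (vert_section y) (\<lambda>z. coordf k (fst z))) = 0" if "v \<in> tangent (cinf_G \<A> E) (p, K)" for v k
    using G.tangent_near_cong[OF x that nE] G.tangent_const[OF x that, of 0] by simp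
  \<comment> \<open>Base coordinates of the bracket: \<open>[V, A\<^sup>h] x\<^sub>k = V (A\<^sup>h x\<^sub>k)\<close>, since \<open>V x\<^sub>k = 0\<close>.\<close>
  have "fst (G.velocity ?B) $ k = fst hor_part (coordf k)" for k
  proof -
    have "fst (G.velocity ?B) $ k = ?B (\<lambda>z. coordf k (fst z))" by (rule velocity_coord)
    also have "\<dots> = fst (vert_section (p, K)) (\<lambda>y. fst (hor_section y) (\<lambda>z. coordf k (fst z)))"
      using crdC dE[OF tF] by (simp add: lie_bracket_def)
    also have "\<dots> = crd p hor_part (Inl k)"
      unfolding G.tangent_near_cong[OF x tE nF] by (rule vert_section_plus_coord)
    finally show ?thesis by (simp add: crd_def)
  qed
  moreover have "base.velocity (fst hor_part) $ k = fst hor_part (coordf k)" for k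
    using base.velocity_inner[of "axis k 1" "fst hor_part"] by (simp add: inner_axis)
  ultimately have "base.velocity (dproj p ?B) = base.velocity (fst hor_part)"
    unfolding dproj_velocity[OF p K] by (simp add: vec_eq_iff)
  then have pB: "dproj p ?B = fst hor_part" by (rule TM_eqI[OF p K dproj_TM[OF p K] hor_part_parts(1)])
  obtain W where W: "W \<in> vert \<A> E (p, K)" "?B = hlift \<A> E D (p, K) (dproj p ?B) + vert_vec \<A> E (p, K) W"
    using tangent_decomposition[OF p K B] .
  \<comment> \<open>Needed to evaluate Lie derivatives of forms on a single vector.\<close>
  have ext: "\<exists>Y. vfield_at (cinf_G \<A> E) R (p, K) Y \<and> Y (p, K) = v" if "v \<in> tangent (cinf_G \<A> E) (p, K)" for v
    by (rule tangent_extends[OF xx that])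
  have L1: "lie_form (cinf_G \<A> E) R (\<lambda>y. fst (vert_section y)) (\<lambda>y. snd (hor_section y)) (p, K) = hlift_form \<A> E D (p, K) (snd hor_part)"
    unfolding hlift_form_eq(1)[OF p K hor_part_parts(2)]
  proof
    fix v
    show "lie_form (cinf_G \<A> E) R (\<lambda>y. fst (vert_section y)) (\<lambda>y. snd (hor_section y)) (p, K) v
        = (if v \<in> tangent (cinf_G \<A> E) (p, K) then snd hor_part (dproj p v) else 0)"
    proof (cases "v \<in> tangent (cinf_G \<A> E) (p, K)")
      case True
      have aC: "(\<lambda>y. \<theta> (fst y) * plus_coord (Inr k) y) \<in> cinf_G \<A> E (p, K)" for k
        by (rule G.C_mult[OF x \<theta>_C[OF xx] plus_coord_C[OF xx]])
      have form: "G.near (p, K) (\<lambda>y. \<forall>v\<in>tangent (cinf_G \<A> E) y.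
          snd (hor_section y) v = (\<Sum>k\<in>UNIV. \<theta> (fst y) * plus_coord (Inr k) y * v (\<lambda>z. coordf k (fst z))))"
      proof (rule G.near_all, rule ballI)
        fix y v assume "y \<in> R" "y \<in> over S" and v: "v \<in> tangent (cinf_G \<A> E) y"
        then have y: "y \<in> RS" by simp
        from hor_section_form[OF RS_D(1,2)[OF y], of v] v
        show "snd (hor_section y) v = (\<Sum>k\<in>UNIV. \<theta> (fst y) * plus_coord (Inr k) y * v (\<lambda>z. coordf k (fst z)))"
          using plus_coord_eq[OF y] by simp
      qed
      have "lie_form (cinf_G \<A> E) R (\<lambda>y. fst (vert_section y)) (\<lambda>y. snd (hor_section y)) (p, K) v
          = (\<Sum>k\<in>UNIV. fst (vert_section (p, K)) (\<lambda>y. \<theta> (fst y) * plus_coord (Inr k) y) * v (\<lambda>z. coordf k (fst z))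
            + \<theta> (fst (p, K)) * plus_coord (Inr k) (p, K) * v (\<lambda>y. fst (vert_section y) (\<lambda>z. coordf k (fst z))))"
        by (rule G.lie_form_eq[OF x vE form aC crdC True ext[OF True]])
      also have "\<dots> = (\<Sum>k\<in>UNIV. crd p hor_part (Inr k) * dproj p v (coordf k))"
        unfolding vert_section_plus_coord dE[OF True] pullback_smooth(2)[OF p K coordf_mem[OF SU[OF p]] True] by simp
      also have "\<dots> = snd hor_part (dproj p v)"
        unfolding cotangent_expand[OF SU[OF p] hor_part_parts(2) dproj_TM[OF p K, of v]] by (simp add: crd_def mult.commute)
      finally show ?thesis using True by simp
    qed (simp add: lie_form_def)
  qed
  have L2: "lie_form (cinf_G \<A> E) R (\<lambda>y. fst (hor_section y)) (\<lambda>y. snd (vert_section y)) (p, K) = 0"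
  proof
    fix v
    show "lie_form (cinf_G \<A> E) R (\<lambda>y. fst (hor_section y)) (\<lambda>y. snd (vert_section y)) (p, K) v = 0 v"
    proof (cases "v \<in> tangent (cinf_G \<A> E) (p, K)")
      case True
      have "lie_form (cinf_G \<A> E) R (\<lambda>y. fst (hor_section y)) (\<lambda>y. snd (vert_section y)) (p, K) v
          = (\<Sum>k\<in>({} :: 'n set). fst (hor_section (p, K)) (\<lambda>y. 0) * v (\<lambda>y. 0) + 0 * v (\<lambda>y. fst (hor_section y) (\<lambda>y. 0)))"
        by (rule G.lie_form_eq[OF x vF _ _ _ True ext[OF True]]) (auto intro: G.near_all simp: vert_section_def)
      then show ?thesis by simp
    qed (simp add: lie_form_def)
  qed
  \<comment> \<open>The pairing of a vertical vector with a horizontal form is zero.\<close>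
  have L3: "diff_fun (cinf_G \<A> E) (\<lambda>y. snd (hor_section y) (fst (vert_section y)) - snd (vert_section y) (fst (hor_section y))) (p, K) = 0"
  proof
    fix v
    have n0: "G.near (p, K) (\<lambda>y. snd (hor_section y) (fst (vert_section y)) - snd (vert_section y) (fst (hor_section y)) = 0)"
    proof (rule G.near_all)
      fix y assume "y \<in> R" "y \<in> over S"
      then have y: "y \<in> RS" by simp
      have tE: "fst (vert_section y) \<in> tangent (cinf_G \<A> E) (fst y, snd y)"
        using vert_section_hor_section_tangent(1)[OF RS_D(1,2)[OF y]] by simp
      have "snd (hor_section y) (fst (vert_section y)) = 0"
        using hor_section_form[OF RS_D(1,2)[OF y] tE] vert_section_coord[OF y] by simp
      then show "snd (hor_section y) (fst (vert_section y)) - snd (vert_section y) (fst (hor_section y)) = 0" by (simp add: vert_section_def)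
    qed
    show "diff_fun (cinf_G \<A> E) (\<lambda>y. snd (hor_section y) (fst (vert_section y)) - snd (vert_section y) (fst (hor_section y))) (p, K) v = 0 v"
      using G.tangent_near_cong[OF x _ n0, of v] G.tangent_const[OF x, of v 0] by (simp add: diff_fun_def)
  qed
  have "courant (cinf_G \<A> E) R vert_section hor_section (p, K) = ghlift \<A> E D (p, K) hor_part + (vert_vec \<A> E (p, K) W, 0)"
  proof (rule prod_eqI)
    show "fst (courant (cinf_G \<A> E) R vert_section hor_section (p, K)) = fst (ghlift \<A> E D (p, K) hor_part + (vert_vec \<A> E (p, K) W, 0))"
      unfolding courant_def Let_def ghlift_def fst_add fst_conv using W(2) unfolding pB .
    have "snd (courant (cinf_G \<A> E) R vert_section hor_section (p, K)) = hlift_form \<A> E D (p, K) (snd hor_part) - 0 - (1/2) *\<^sub>R 0"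
      unfolding courant_def Let_def snd_conv L1 L2 L3 ..
    also have "\<dots> = hlift_form \<A> E D (p, K) (snd hor_part) + 0" by simp
    finally show "snd (courant (cinf_G \<A> E) R vert_section hor_section (p, K)) = snd (ghlift \<A> E D (p, K) hor_part + (vert_vec \<A> E (p, K) W, 0))"
      unfolding ghlift_def snd_add snd_conv .
  qed
  then show ?thesis using W(1) that by blast
qed

text \<open>If \<open>\<K>\<^sub>\<epsilon>\<close> were integrable, the bracket would be fixed by \<open>\<K>\<^sub>\<epsilon>\<close>, so its horizontal part \<open>hor_part\<close> would
  have the same tangent part as \<open>K hor_part = - hor_part\<close>.\<close>

lemma integrable_imp_fst_hor_part:
  assumes int: "integrable_gpc (cinf_G \<A> E) R (gpc_structure \<A> E D \<epsilon>)"
  shows "fst hor_part = 0"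
proof -
  note x = over_S(1,2)[OF p K]
  let ?C = "cinf_G \<A> E" and ?K = "gpc_structure \<A> E D \<epsilon>"
  let ?KE = "\<lambda>y. ?K y (vert_section y)" and ?KF = "\<lambda>y. ?K y (hor_section y)"
  let ?Z = "courant ?C R vert_section hor_section (p, K)"
  have fixE: "?KE y = vert_section y" and fixF: "?KF y = hor_section y" if "y \<in> R" "y \<in> over S" for y
    using vert_section_fixed[of "fst y" "snd y"] hor_section_fixed[of "fst y" "snd y"] that by (cases y, simp)+
  have nE: "G.near (p, K) (\<lambda>y. ?KE y = vert_section y)" "G.near (p, K) (\<lambda>y. vert_section y = vert_section y)"
    and nF: "G.near (p, K) (\<lambda>y. ?KF y = hor_section y)" "G.near (p, K) (\<lambda>y. hor_section y = hor_section y)"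
    by (rule G.near_all; simp add: fixE fixF)+
  note tE = vert_section_hor_section_tangent(1)[OF p K] and tF = vert_section_hor_section_tangent(2)[OF p K]
  have tE': "fst (?KE (p, K)) \<in> tangent ?C (p, K)" and tF': "fst (?KF (p, K)) \<in> tangent ?C (p, K)"
    unfolding fixE[OF x] fixF[OF x] by (rule tE, rule tF)
  have c: "courant ?C R ?KE ?KF (p, K) = ?Z" "courant ?C R ?KE hor_section (p, K) = ?Z" "courant ?C R vert_section ?KF (p, K) = ?Z"
    by (rule G.courant_near_cong[OF x nE(1) nF(1) tE' tF'], rule G.courant_near_cong[OF x nE(1) nF(2) tE' tF],
        rule G.courant_near_cong[OF x nE(2) nF(1) tE tF'])
  have "courant ?C R vert_section hor_section (p, K) + courant ?C R ?KE ?KF (p, K)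
      - ?K (p, K) (courant ?C R ?KE hor_section (p, K)) - ?K (p, K) (courant ?C R vert_section ?KF (p, K)) = 0"
    using int gsection_fields x(1) unfolding integrable_gpc_def by blast
  \<comment> \<open>Both sections are fixed near \<open>(p, K)\<close>, so all four brackets coincide.\<close>
  then have "2 *\<^sub>R ?Z = 2 *\<^sub>R ?K (p, K) ?Z"
    unfolding c scaleR_2 by (simp only: diff_diff_eq right_minus_eq)
  then have KZ: "?K (p, K) ?Z = ?Z" by simp
  obtain W where W: "W \<in> vert \<A> E (p, K)" "?Z = ghlift \<A> E D (p, K) hor_part + (vert_vec \<A> E (p, K) W, 0)"
    by (rule bracket_eq)
  have mc: "- hor_part \<in> GTM \<A> p" by (rule subspace_neg[OF GTM_any_subspace hor_part_GTM])
  then have mt: "fst (- hor_part) \<in> TM \<A> p" by (simp add: gtangent_def mem_Times_iff)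
  have "ghlift \<A> E D (p, K) (- hor_part) + (vert_vec \<A> E (p, K) (vert_P \<A> E \<epsilon> (p, K) W), 0)
      = ghlift \<A> E D (p, K) hor_part + (vert_vec \<A> E (p, K) W, 0)"
    using KZ gpc_structure_eq[OF p K hor_part_GTM W(1), of \<epsilon>] unfolding W(2) K_hor_part by simp
  from arg_cong[OF this, of fst]
  have "hlift \<A> E D (p, K) (fst (- hor_part)) + vert_vec \<A> E (p, K) (vert_P \<A> E \<epsilon> (p, K) W)
      = hlift \<A> E D (p, K) (fst hor_part) + vert_vec \<A> E (p, K) W"
    unfolding ghlift_def fst_add fst_conv .
  \<comment> \<open>Projecting to \<open>M\<close> removes the vertical vectors, whatever they are.\<close>
  from arg_cong[OF this, of "dproj p"] have "fst (- hor_part) = fst hor_part"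
    unfolding dproj_hlift_vert[OF p K mt vert_P_vert[OF p K W(1)]] dproj_hlift_vert[OF p K hor_part_parts(1) W(1)] .
  then have "- fst hor_part = fst hor_part" unfolding fst_uminus .
  then show ?thesis by (rule eq_neg_self_imp_zero)
qed

lemma hor_part_block_no_forms: "fst hor_part = 0 \<Longrightarrow> eigen_vert (p, K) (e p (J i)) = 0"
proof -
  assume z: "fst hor_part = 0"
  have b: "hor_part \<in> E p \<or> hor_part \<in> orth \<A> E p"
    using J minus_vec_block[OF p K, of i] minus_vec_block[OF p K, of j]
    unfolding hor_part_def eigen_vert_eq[OF p K eG]
    by (auto intro!: subspace_scale[OF E_subspace] subspace_diff[OF E_subspace]
        subspace_scale[OF orth_subspace] subspace_diff[OF orth_subspace])
  have "hor_part = 0" using b E_no_forms[OF _ z] orth_no_forms[OF p _ z] by blast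
  then show ?thesis using \<theta>p by (simp add: hor_part_def)
qed

end

end

text \<open>The point \<open>K\<close> exchanges \<open>e\<^sub>k\<close> and \<open>e\<^sub>\<sigma>\<^sub>k\<close>, which have opposite signs.\<close>

context framed_chart
begin

definition swap_mat :: "real ^ ('n + 'n) ^ ('n + 'n)"
  where "swap_mat = (\<chi> a b. if b = map_sum \<sigma> \<sigma> a then \<eta> b else 0)"

lemma swap_swap: "map_sum \<sigma> \<sigma> (map_sum \<sigma> \<sigma> a) = a" and eta_swap: "\<eta> (map_sum \<sigma> \<sigma> a) = - \<eta> a"
  by (cases a; simp add: \<sigma>)+

lemma swap_reflector: "q \<in> S \<Longrightarrow> (q, of_mat q swap_mat) \<in> reflector_space \<A> E"
proof -
  assume q: "q \<in> S"
  have sk: "skew_mat swap_mat"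
    unfolding skew_mat_def swap_mat_def using swap_swap eta_swap
    by (auto simp: map_sum_def)
  have "frame_mult swap_mat swap_mat = unit_mat"
    unfolding vec_eq_iff
  proof (intro allI)
    fix a c
    have "frame_mult swap_mat swap_mat $ a $ c
      = (\<Sum>b\<in>UNIV. if b = map_sum \<sigma> \<sigma> a then (if c = map_sum \<sigma> \<sigma> b then \<eta> b * \<eta> b * \<eta> c else 0) else 0)"
      unfolding frame_mult_def swap_mat_def vec_lambda_beta by (intro sum.cong refl) simp
    then show "frame_mult swap_mat swap_mat $ a $ c = unit_mat $ a $ c"
      by (simp add: swap_swap \<eta> unit_mat_def)
  qed
  then show ?thesis
    unfolding reflector_iff square_iff[OF q of_mat_endos[OF q]] mat_of_mat[OF q]
    using of_mat_skew[OF q sk] by simp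
qed

end

lemma (in eigen_fields) not_integrable:
  "\<not> integrable_gpc (cinf_G \<A> E) R (gpc_structure \<A> E D \<epsilon>)"
proof
  assume int: "integrable_gpc (cinf_G \<A> E) R (gpc_structure \<A> E D \<epsilon>)"
  let ?K = "of_mat p swap_mat"
  have K: "(p, ?K) \<in> R" by (rule swap_reflector[OF p])
  have z: "eigen_vert (p, ?K) (e p (J i)) = 0"
    by (rule hor_part_block_no_forms[OF K integrable_imp_fst_hor_part[OF K int]])
  have Ke: "pair (?K (e p a)) (e p b) = (if b = map_sum \<sigma> \<sigma> a then \<eta> b else 0)" for a b
    using arg_cong[OF mat_of_mat[OF p, of swap_mat], of "\<lambda>m. m $ a $ b"] by (simp add: mat_nth swap_mat_def)
  have Jk: "J k = J l \<longleftrightarrow> k = l" "map_sum \<sigma> \<sigma> (J k) = J (\<sigma> k)" for k l using J by auto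
  have w: "pair (minus_vec (p, ?K) k) (e p (J l)) = (if k = l then \<eta> (J l) else 0) - (if l = \<sigma> k then \<eta> (J l) else 0)" for k l
    unfolding minus_vec_def fst_conv snd_conv base.pair_diff_left[OF eG KD(1)[OF p K eG] eG] Ke
    by (simp add: ee[OF p] Jk)
  have 1: "\<sigma> i \<noteq> i" "\<sigma> j \<noteq> j" "i \<noteq> \<sigma> j" using \<sigma>(1)[of j] \<sigma>(2) ij by auto
  \<comment> \<open>At this \<open>K\<close>, \<open>w\<^sub>i\<close> and \<open>w\<^sub>j\<close> are combinations of disjoint pairs of frame members, so one component shows
    that \<open>V e\<^sub>i \<noteq> 0\<close>.\<close>
  have "pair (eigen_vert (p, ?K) (e p (J i))) (e p (J j)) = \<eta> (J i) * \<eta> (J j)"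
    unfolding pair_eigen_vert[OF p K eG eG] pair_commute[of "e p (J i)"] w using ij 1 by auto
  then have "\<eta> (J i) * \<eta> (J j) = 0" unfolding z base.pair_zero_left[OF UNIV_I SU[OF p] eG] by simp
  then show False using \<eta>[of "J i"] \<eta>[of "J j"] by auto
qed

theorem corollary1:
  fixes \<A> :: "('p::{t2_space, second_countable_topology}, real ^ 'n) chart set"
    and n :: nat
    and E :: "'p \<Rightarrow> 'p gvec set"
    and D' D'' :: "'p connection"
  assumes "smooth_atlas \<A>"
    and "CARD('n) = 2 * n"
    and "n \<ge> 2"
    and "gen_metric \<A> n E"
    and "metric_connection \<A> E pair D'"
    and "metric_connection \<A> (orth \<A> E) (\<lambda>A B. - pair A B) D''"
  shows "\<forall>\<epsilon>\<in>{2, 3, 4}. \<not> integrable_gpc (cinf_G \<A> E) (reflector_space \<A> E)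
           (gpc_structure \<A> E (sum_connection \<A> E D' D'') \<epsilon>)"
proof
  fix \<epsilon> :: nat assume \<epsilon>: "\<epsilon> \<in> {2, 3, 4}"
  \<comment> \<open>Any point of \<open>M\<close>; types are inhabited, so \<open>M\<close> is not empty.\<close>
  define p where "p = (undefined :: 'p)"
  have "p \<in> (\<Union>(U, \<phi>)\<in>\<A>. U)" using assms(1) by (simp add: smooth_atlas_def)
  then obtain U \<phi> where U: "(U, \<phi>) \<in> \<A>" "p \<in> U" by blast
  interpret c: gmetric_chart \<A> U \<phi> n E using assms U by unfold_locales
  obtain S e \<eta> \<sigma> where f: "framed_chart \<A> U \<phi> n E S e \<eta> \<sigma>" and p: "p \<in> S"
    using c.framed_chart_exists[OF U(2)] by (elim exE conjE) (rule that)
  interpret f: framed_chart \<A> U \<phi> n E S e \<eta> \<sigma> by (rule f)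
  obtain \<theta> :: "'p \<Rightarrow> real" where "\<theta> p \<noteq> 0 \<and> (\<forall>q\<in>S. \<theta> \<in> cinf \<A> q) \<and>
    (\<forall>q. q \<notin> S \<longrightarrow> (\<exists>T. open T \<and> q \<in> T \<and> (\<forall>y\<in>T. \<theta> y = 0)))"
    using c.bump_function[OF f.S p] by (rule exE)
  then have \<theta>: "\<theta> p \<noteq> 0" "\<And>q. q \<in> S \<Longrightarrow> \<theta> \<in> cinf \<A> q"
    "\<And>q. q \<notin> S \<Longrightarrow> \<exists>T. open T \<and> q \<in> T \<and> (\<forall>y\<in>T. \<theta> y = 0)"
    by simp_all
  \<comment> \<open>Any index; a \<open>j\<close> outside \<open>{i, \<sigma> i}\<close> exists because \<open>2 n \<ge> 4\<close>.\<close>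
  define i where "i = (undefined :: 'n)"
  have "card {i, \<sigma> i} \<le> 2" by (simp add: card_insert_if)
  then have "card {i, \<sigma> i} \<noteq> CARD('n)" using assms(2,3) by simp
  then have "{i, \<sigma> i} \<noteq> UNIV" by (rule contrapos_nn) simp
  then obtain j where j: "j \<noteq> i" "j \<noteq> \<sigma> i" by blast
  interpret w: eigen_fields \<A> U \<phi> n E S e \<eta> \<sigma> D' D'' \<theta> p "if \<epsilon> = 2 then Inr else Inl" i j \<epsilon>
    using assms \<epsilon> p \<theta> j by unfold_locales auto
  show "\<not> integrable_gpc (cinf_G \<A> E) (reflector_space \<A> E)
           (gpc_structure \<A> E (sum_connection \<A> E D' D'') \<epsilon>)"
    by (rule w.not_integrable)
qed

end
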